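(* Let $k$ be a commutative ring and let $V$ be a $\mathscr{C}$-module over $k$ with $\mathrm{gd}(V)<\infty$. Then the following statements are equivalent: (1) $V$ is relative projective; (2) $H_s(V)=0$ for all $s\geq 1$; (3) $H_1(V)=0$; (4) $H_s(V)=0$ for some $s\geq 1$.
   Context: Let $m\geq 1$ be an integer and $\mathbb{N}$ the set of nonnegative integers; write $[n]=\{1,\ldots,n\}$, $[0]=\emptyset$. The category $\mathscr{C}$ (skeleton of $\mathrm{FI}^m$) has objects $\mathbf{n}=(n_1,\ldots,n_m)\in\mathbb{N}^m$; a morphism $\mathbf{f}:\mathbf{n}\to\mathbf{t}$ is a tuple $(f_1,\ldots,f_m)$ of injections $f_i:[n_i]\to[t_i]$, composed componentwise. Objects are partially ordered componentwise, and $\deg(\mathbf{n})=n_1+\cdots+n_m$. $k$ is unital. A $\mathscr{C}$-module is a covariant functor $V$ from $\mathscr{C}$ to $k$-modules, with values $V_{\mathbf{n}}$; $M(\mathbf{n})$ is the $k$-linearization of $\mathscr{C}(\mathbf{n},-)$, and $S_{\mathbf{n}}=\mathscr{C}(\mathbf{n},\mathbf{n})\cong S_{n_1}\times\cdots\times S_{n_m}$, so that $M(\mathbf{n})$ has a right $kS_{\mathbf{n}}$-action. Homology: $k\mathscr{C}$ is the category algebra (free $k$-module on all morphisms, product given by composition when defined and $0$ otherwise); $\mathscr{C}$-modules are regarded as $k\mathscr{C}$-modules $\bigoplus_{\mathbf{n}}V_{\mathbf{n}}$. $\mathfrak{m}\subset k\mathscr{C}$ is the two-sided ideal spanned by all morphisms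 $\mathbf{i}\to\mathbf{j}$ with $\mathbf{i}<\mathbf{j}$ (i.e. $\mathbf i\leq\mathbf j$, $\mathbf i\neq\mathbf j$). $H_s(V)=\mathrm{Tor}_s^{k\mathscr{C}}(k\mathscr{C}/\mathfrak{m},V)$. The generating degree is $\mathrm{gd}(V)=\sup\{\deg(\mathbf{n})\mid (H_0(V))_{\mathbf{n}}\neq 0\}$, set to $-1$ if this set is empty. A basic relative projective module is a $\mathscr{C}$-module of the form $M(\mathbf{n})\otimes_{kS_{\mathbf{n}}}U$ for an object $\mathbf{n}$ and a $kS_{\mathbf{n}}$-module $U$. A $\mathscr{C}$-module is relative projective if it has a finite filtration by submodules, starting at $0$ and ending at the whole module, all of whose successive quotients are isomorphic to basic relative projective modules. *)

theory Defs
  imports "HOL-Library.FSet" "HOL-Library.Extended_Real"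
    "HOL-Algebra.QuotRing" "HOL-Algebra.Free_Abelian_Groups" "HOL-Algebra.Module"
begin

section \<open>The category\<close>

text \<open>
  The index set of the tuples is the finite type \<^typ>\<open>'m\<close>, so that \<open>m\<close> is its
  cardinality (which is at least 1).  The order on objects is the library's
  pointwise order on functions.
\<close>

type_synonym 'm obj = "'m \<Rightarrow> nat"

datatype 'm mor = Mor (src: "'m obj") (maps: "'m \<Rightarrow> nat \<Rightarrow> nat") (tgt: "'m obj")

definition deg :: "'m::finite obj \<Rightarrow> nat" where
  "deg n = (\<Sum>i\<in>UNIV. n i)"

text \<open>
  The components of a morphism are extensional, so that distinct terms are
  distinct morphisms.
\<close>

definition Hom :: "'m obj \<Rightarrow> 'm obj \<Rightarrow> 'm mor set" where
  "Hom n t = {Mor n f t | f. \<forall>i. f i \<in> {1..n i} \<rightarrow>\<^sub>E {1..t i} \<and> inj_on (f i) {1..n i}}"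

definition Mors :: "'m mor set" where
  "Mors = (\<Union>n t. Hom n t)"

definition id_mor :: "'m obj \<Rightarrow> 'm mor" where
  "id_mor n = Mor n (\<lambda>i. \<lambda>x\<in>{1..n i}. x) n"

definition comp_mor :: "'m mor \<Rightarrow> 'm mor \<Rightarrow> 'm mor" where
  "comp_mor g f = Mor (src f) (\<lambda>i. compose {1..src f i} (maps g i) (maps f i)) (tgt g)"


section \<open>Modules over commutative and noncommutative rings\<close>

text \<open>
  The record \<^typ>\<open>('a, 'x) module\<close> of HOL-Algebra is used for all modules.  The
  multiplicative part of the record is irrelevant unless the module is an algebra.
\<close>

definition module_iso :: "('a, 'c) ring_scheme \<Rightarrow> ('a, 'x) module \<Rightarrow> ('a, 'y) module \<Rightarrow> ('x \<Rightarrow> 'y) set" where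
  "module_iso A M N = {h. bij_betw h (carrier M) (carrier N) \<and>
     (\<forall>x\<in>carrier M. \<forall>y\<in>carrier M. h (x \<oplus>\<^bsub>M\<^esub> y) = h x \<oplus>\<^bsub>N\<^esub> h y) \<and>
     (\<forall>a\<in>carrier A. \<forall>x\<in>carrier M. h (a \<odot>\<^bsub>M\<^esub> x) = a \<odot>\<^bsub>N\<^esub> h x)}"

definition quotient_module :: "('a, 'x) module \<Rightarrow> 'x set \<Rightarrow> ('a, 'x set) module" where
  "quotient_module M N = \<lparr>carrier = a_rcosets\<^bsub>M\<^esub> N, mult = undefined, one = undefined,
     ring.zero = N, ring.add = set_add M, smult = (\<lambda>a X. \<Union>x\<in>X. N +>\<^bsub>M\<^esub> (a \<odot>\<^bsub>M\<^esub> x))\<rparr>"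

definition free_module :: "'k ring \<Rightarrow> 's set \<Rightarrow> ('k, 's \<Rightarrow> 'k) module" where
  "free_module R S = \<lparr>carrier = {p. (\<forall>s\<in>S. p s \<in> carrier R) \<and> (\<forall>s. s \<notin> S \<longrightarrow> p s = \<zero>\<^bsub>R\<^esub>)
                                    \<and> finite {s. p s \<noteq> \<zero>\<^bsub>R\<^esub>}},
     mult = undefined, one = undefined,
     ring.zero = (\<lambda>s. \<zero>\<^bsub>R\<^esub>), ring.add = (\<lambda>p q s. p s \<oplus>\<^bsub>R\<^esub> q s), smult = (\<lambda>a p s. a \<otimes>\<^bsub>R\<^esub> p s)\<rparr>"

text \<open>Unital left modules over a unital, not necessarily commutative, ring.\<close>

locale left_module = A: ring A + M: abelian_group M
  for A :: "('a, 'c) ring_scheme" and M :: "('a, 'x) module" +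
  assumes smult_closed: "\<lbrakk>a \<in> carrier A; x \<in> carrier M\<rbrakk> \<Longrightarrow> a \<odot>\<^bsub>M\<^esub> x \<in> carrier M"
    and smult_l_distr: "\<lbrakk>a \<in> carrier A; b \<in> carrier A; x \<in> carrier M\<rbrakk>
      \<Longrightarrow> (a \<oplus>\<^bsub>A\<^esub> b) \<odot>\<^bsub>M\<^esub> x = a \<odot>\<^bsub>M\<^esub> x \<oplus>\<^bsub>M\<^esub> b \<odot>\<^bsub>M\<^esub> x"
    and smult_r_distr: "\<lbrakk>a \<in> carrier A; x \<in> carrier M; y \<in> carrier M\<rbrakk>
      \<Longrightarrow> a \<odot>\<^bsub>M\<^esub> (x \<oplus>\<^bsub>M\<^esub> y) = a \<odot>\<^bsub>M\<^esub> x \<oplus>\<^bsub>M\<^esub> a \<odot>\<^bsub>M\<^esub> y"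
    and smult_assoc: "\<lbrakk>a \<in> carrier A; b \<in> carrier A; x \<in> carrier M\<rbrakk>
      \<Longrightarrow> (a \<otimes>\<^bsub>A\<^esub> b) \<odot>\<^bsub>M\<^esub> x = a \<odot>\<^bsub>M\<^esub> (b \<odot>\<^bsub>M\<^esub> x)"
    and smult_one: "x \<in> carrier M \<Longrightarrow> \<one>\<^bsub>A\<^esub> \<odot>\<^bsub>M\<^esub> x = x"


section \<open>Tensor products\<close>

text \<open>
  A \<open>B\<close>-\<open>A\<close>-bimodule is a left \<open>B\<close>-module record with a right \<open>A\<close>-action.  Its tensor
  product with a left \<open>A\<close>-module is the usual quotient of the free abelian group on
  pairs, a left \<open>B\<close>-module via the first factor.  The ring \<open>A\<close> need not be unital.
\<close>

record ('b, 'a, 'x) bimodule = "('b, 'x) module" +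
  rsmult :: "'x \<Rightarrow> 'a \<Rightarrow> 'x"

definition pairs_group :: "('b, 'a, 'x) bimodule \<Rightarrow> ('a, 'y) module \<Rightarrow> ('x \<times> 'y \<Rightarrow>\<^sub>0 int) monoid" where
  "pairs_group X Y = free_Abelian_group (carrier X \<times> carrier Y)"

definition tensor_relations ::
  "('a, 'c) ring_scheme \<Rightarrow> ('b, 'a, 'x) bimodule \<Rightarrow> ('a, 'y) module \<Rightarrow> ('x \<times> 'y \<Rightarrow>\<^sub>0 int) set" where
  "tensor_relations A X Y = generate (pairs_group X Y)
     ({frag_of (x \<oplus>\<^bsub>X\<^esub> x', y) - frag_of (x, y) - frag_of (x', y) | x x' y.
         x \<in> carrier X \<and> x' \<in> carrier X \<and> y \<in> carrier Y}
    \<union> {frag_of (x, y \<oplus>\<^bsub>Y\<^esub> y') - frag_of (x, y) - frag_of (x, y') | x y y'.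
         x \<in> carrier X \<and> y \<in> carrier Y \<and> y' \<in> carrier Y}
    \<union> {frag_of (rsmult X x a, y) - frag_of (x, a \<odot>\<^bsub>Y\<^esub> y) | x a y.
         x \<in> carrier X \<and> a \<in> carrier A \<and> y \<in> carrier Y})"

text \<open>The map induced by \<open>\<phi> \<otimes> \<psi>\<close> on cosets; \<open>X\<close> and \<open>Y\<close> are the factors of the codomain.\<close>

definition tensor_map ::
  "('a, 'c) ring_scheme \<Rightarrow> ('b, 'a, 'x) bimodule \<Rightarrow> ('a, 'y) module \<Rightarrow> ('u \<Rightarrow> 'x) \<Rightarrow> ('v \<Rightarrow> 'y)
     \<Rightarrow> ('u \<times> 'v \<Rightarrow>\<^sub>0 int) set \<Rightarrow> ('x \<times> 'y \<Rightarrow>\<^sub>0 int) set" where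
  "tensor_map A X Y \<phi> \<psi> C =
     (\<Union>c\<in>C. tensor_relations A X Y #>\<^bsub>pairs_group X Y\<^esub>
        frag_extend (\<lambda>(u, v). frag_of (\<phi> u, \<psi> v)) c)"

definition tensor ::
  "('a, 'c) ring_scheme \<Rightarrow> ('b, 'a, 'x) bimodule \<Rightarrow> ('a, 'y) module
     \<Rightarrow> ('b, ('x \<times> 'y \<Rightarrow>\<^sub>0 int) set) module" where
  "tensor A X Y =
     (let Q = pairs_group X Y Mod tensor_relations A X Y
      in \<lparr>carrier = carrier Q, mult = undefined, one = undefined,
          ring.zero = \<one>\<^bsub>Q\<^esub>, ring.add = monoid.mult Q,
          smult = (\<lambda>b. tensor_map A X Y (\<lambda>x. b \<odot>\<^bsub>X\<^esub> x) id)\<rparr>)"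


section \<open>Modules over the category\<close>

record ('m, 'k, 'v) cmod =
  val :: "'m obj \<Rightarrow> ('k, 'v) module"
  act :: "'m mor \<Rightarrow> 'v \<Rightarrow> 'v"

locale cmodule =
  fixes R :: "'k ring" and V :: "('m, 'k, 'v) cmod"
  assumes module: "Module.module R (val V n)"
    and act_closed: "\<lbrakk>f \<in> Hom n t; x \<in> carrier (val V n)\<rbrakk> \<Longrightarrow> act V f x \<in> carrier (val V t)"
    and act_add: "\<lbrakk>f \<in> Hom n t; x \<in> carrier (val V n); y \<in> carrier (val V n)\<rbrakk>
      \<Longrightarrow> act V f (x \<oplus>\<^bsub>val V n\<^esub> y) = act V f x \<oplus>\<^bsub>val V t\<^esub> act V f y"
    and act_smult: "\<lbrakk>f \<in> Hom n t; a \<in> carrier R; x \<in> carrier (val V n)\<rbrakk>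
      \<Longrightarrow> act V f (a \<odot>\<^bsub>val V n\<^esub> x) = a \<odot>\<^bsub>val V t\<^esub> act V f x"
    and act_id: "x \<in> carrier (val V n) \<Longrightarrow> act V (id_mor n) x = x"
    and act_comp: "\<lbrakk>f \<in> Hom l n; g \<in> Hom n t; x \<in> carrier (val V l)\<rbrakk>
      \<Longrightarrow> act V (comp_mor g f) x = act V g (act V f x)"

definition cmod_isomorphic :: "'k ring \<Rightarrow> ('m, 'k, 'v) cmod \<Rightarrow> ('m, 'k, 'w) cmod \<Rightarrow> bool" where
  "cmod_isomorphic R V W \<longleftrightarrow>
     (\<exists>\<phi>. (\<forall>n. \<phi> n \<in> module_iso R (val V n) (val W n)) \<and>
          (\<forall>n t. \<forall>f\<in>Hom n t. \<forall>x\<in>carrier (val V n). \<phi> t (act V f x) = act W f (\<phi> n x)))"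

definition subcmod :: "'k ring \<Rightarrow> ('m, 'k, 'v) cmod \<Rightarrow> ('m obj \<Rightarrow> 'v set) \<Rightarrow> bool" where
  "subcmod R V W \<longleftrightarrow> (\<forall>n. submodule (W n) R (val V n)) \<and>
     (\<forall>n t. \<forall>f\<in>Hom n t. \<forall>x\<in>W n. act V f x \<in> W t)"

definition restrict_cmod :: "('m, 'k, 'v) cmod \<Rightarrow> ('m obj \<Rightarrow> 'v set) \<Rightarrow> ('m, 'k, 'v) cmod" where
  "restrict_cmod V W = \<lparr>val = (\<lambda>n. (val V n)\<lparr>carrier := W n\<rparr>), act = act V\<rparr>"

definition quotient_cmod :: "('m, 'k, 'v) cmod \<Rightarrow> ('m obj \<Rightarrow> 'v set) \<Rightarrow> ('m, 'k, 'v set) cmod" where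
  "quotient_cmod V W = \<lparr>val = (\<lambda>n. quotient_module (val V n) (W n)),
     act = (\<lambda>f X. \<Union>x\<in>X. W (tgt f) +>\<^bsub>val V (tgt f)\<^esub> act V f x)\<rparr>"


section \<open>The category algebra\<close>

definition delta :: "'k ring \<Rightarrow> 'm mor \<Rightarrow> 'm mor \<Rightarrow> 'k" where
  "delta R f = (\<lambda>g. if g = f then \<one>\<^bsub>R\<^esub> else \<zero>\<^bsub>R\<^esub>)"

definition convolution :: "'k ring \<Rightarrow> ('m mor \<Rightarrow> 'k) \<Rightarrow> ('m mor \<Rightarrow> 'k) \<Rightarrow> 'm mor \<Rightarrow> 'k" where
  "convolution R p q = (\<lambda>h. finsum R (\<lambda>(g, f). p g \<otimes>\<^bsub>R\<^esub> q f)
     {(g, f). p g \<noteq> \<zero>\<^bsub>R\<^esub> \<and> q f \<noteq> \<zero>\<^bsub>R\<^esub> \<and> src g = tgt f \<and> comp_mor g f = h})"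

text \<open>The category algebra has no unit; its unit field is left unspecified.\<close>

definition cat_algebra :: "'k ring \<Rightarrow> ('k, 'm mor \<Rightarrow> 'k) module" where
  "cat_algebra R = (free_module R Mors)\<lparr>mult := convolution R\<rparr>"

definition group_algebra :: "'k ring \<Rightarrow> 'm obj \<Rightarrow> ('k, 'm mor \<Rightarrow> 'k) module" where
  "group_algebra R n =
     (free_module R (Hom n n))\<lparr>mult := convolution R, one := delta R (id_mor n)\<rparr>"

definition up_ideal :: "'k ring \<Rightarrow> ('m mor \<Rightarrow> 'k) set" where
  "up_ideal R = {p \<in> carrier (cat_algebra R). \<forall>f. p f \<noteq> \<zero>\<^bsub>R\<^esub> \<longrightarrow> src f < tgt f}"

definition cat_algebra_mod_up ::
  "'k ring \<Rightarrow> ('m mor \<Rightarrow> 'k, 'm mor \<Rightarrow> 'k, ('m mor \<Rightarrow> 'k) set) bimodule" where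
  "cat_algebra_mod_up R =
     (let A = cat_algebra R; I = up_ideal R; Q = A Quot I
      in \<lparr>carrier = carrier Q, mult = undefined, one = undefined, ring.zero = \<zero>\<^bsub>Q\<^esub>, ring.add = ring.add Q,
          smult = (\<lambda>p X. (I +>\<^bsub>A\<^esub> p) \<otimes>\<^bsub>Q\<^esub> X), rsmult = (\<lambda>X p. X \<otimes>\<^bsub>Q\<^esub> (I +>\<^bsub>A\<^esub> p))\<rparr>)"

text \<open>The module over the category algebra \<open>\<Oplus>\<^sub>n V\<^sub>n\<close> associated with \<open>V\<close>.\<close>

definition total :: "'k ring \<Rightarrow> ('m, 'k, 'v) cmod \<Rightarrow> ('m mor \<Rightarrow> 'k, 'm obj \<Rightarrow> 'v) module" where
  "total R V =
     \<lparr>carrier = {x. (\<forall>n. x n \<in> carrier (val V n)) \<and> finite {n. x n \<noteq> \<zero>\<^bsub>val V n\<^esub>}},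
      mult = undefined, one = undefined,
      ring.zero = (\<lambda>n. \<zero>\<^bsub>val V n\<^esub>), ring.add = (\<lambda>x y n. x n \<oplus>\<^bsub>val V n\<^esub> y n),
      smult = (\<lambda>p x t. \<Oplus>\<^bsub>val V t\<^esub>f\<in>{f. p f \<noteq> \<zero>\<^bsub>R\<^esub> \<and> tgt f = t}.
                 p f \<odot>\<^bsub>val V t\<^esub> act V f (x (src f)))\<rparr>"

text \<open>The value \<open>e\<^sub>n N\<close> at the object \<open>n\<close> of a module \<open>N\<close> over the category algebra.\<close>

definition component :: "'k ring \<Rightarrow> ('m mor \<Rightarrow> 'k, 'x) module \<Rightarrow> 'm obj \<Rightarrow> 'x set" where
  "component R N n = (\<lambda>x. delta R (id_mor n) \<odot>\<^bsub>N\<^esub> x) ` carrier N"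


section \<open>Relative projective modules\<close>

text \<open>
  \<open>M(n)\<^sub>t\<close>, as a bimodule over the ground ring and the group algebra of \<open>n\<close>.  A morphism
  \<open>f\<close> acts on \<open>M(n)\<close> by left multiplication with \<open>f\<close> in the category algebra.
\<close>

definition M_bimodule :: "'k ring \<Rightarrow> 'm obj \<Rightarrow> 'm obj \<Rightarrow> ('k, 'm mor \<Rightarrow> 'k, 'm mor \<Rightarrow> 'k) bimodule" where
  "M_bimodule R n t = module.extend (free_module R (Hom n t)) (bimodule.fields (convolution R))"

definition M_tensor ::
  "'k ring \<Rightarrow> 'm obj \<Rightarrow> ('m mor \<Rightarrow> 'k, 'u) module
     \<Rightarrow> ('m, 'k, (('m mor \<Rightarrow> 'k) \<times> 'u \<Rightarrow>\<^sub>0 int) set) cmod" where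
  "M_tensor R n U =
     \<lparr>val = (\<lambda>t. tensor (group_algebra R n) (M_bimodule R n t) U),
      act = (\<lambda>f. tensor_map (group_algebra R n) (M_bimodule R n (tgt f)) U
                   (convolution R (delta R f)) id)\<rparr>"

text \<open>
  \<open>U\<close> is sought in the element type of \<open>W\<close>.  This is no restriction:
  the value of \<open>M(n) \<otimes> U\<close> at \<open>n\<close> is isomorphic to \<open>U\<close>, so that \<open>U\<close> can always be
  transported to the carrier of the value of \<open>W\<close> at \<open>n\<close>.
\<close>

definition basic_relative_projective :: "'k ring \<Rightarrow> ('m, 'k, 'w) cmod \<Rightarrow> bool" where
  "basic_relative_projective R W \<longleftrightarrow>
     (\<exists>n (U :: ('m mor \<Rightarrow> 'k, 'w) module).
        left_module (group_algebra R n) U \<and> cmod_isomorphic R (M_tensor R n U) W)"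

definition relative_projective :: "'k ring \<Rightarrow> ('m, 'k, 'v) cmod \<Rightarrow> bool" where
  "relative_projective R V \<longleftrightarrow>
     (\<exists>(l::nat) (W :: nat \<Rightarrow> 'm obj \<Rightarrow> 'v set).
        (\<forall>j\<le>l. subcmod R V (W j)) \<and>
        (\<forall>n. W 0 n = {\<zero>\<^bsub>val V n\<^esub>}) \<and> (\<forall>n. W l n = carrier (val V n)) \<and>
        (\<forall>j<l. (\<forall>n. W j n \<subseteq> W (Suc j) n) \<and>
               basic_relative_projective R (quotient_cmod (restrict_cmod V (W (Suc j))) (W j))))"


section \<open>The standard free resolution\<close>

text \<open>
  \<open>X n\<close> is a set of free generators in degree \<open>n\<close>; the value at \<open>t\<close> is the free module
  on the symbols \<open>(f, x)\<close>, standing for \<open>f x\<close>, with \<open>x \<in> X n\<close> and \<open>f : n \<rightarrow> t\<close>.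
\<close>

definition free_cmod :: "'k ring \<Rightarrow> ('m obj \<Rightarrow> 'x set) \<Rightarrow> ('m, 'k, 'm mor \<times> 'x \<Rightarrow> 'k) cmod" where
  "free_cmod R X =
     \<lparr>val = (\<lambda>t. free_module R {(f, x). \<exists>n. f \<in> Hom n t \<and> x \<in> X n}),
      act = (\<lambda>g p (h, x). \<Oplus>\<^bsub>R\<^esub>f\<in>{f. p (f, x) \<noteq> \<zero>\<^bsub>R\<^esub> \<and> src g = tgt f \<and> comp_mor g f = h}. p (f, x))\<rparr>"

text \<open>
  The free module with one generator for every element of every value of \<open>W\<close>, and
  the epimorphism onto \<open>W\<close> sending each generator to the element it belongs to.
  Elements are turned into generators by a function \<open>c\<close>, injective on the values of \<open>W\<close>.
\<close>

definition free_cover :: "'k ring \<Rightarrow> ('v \<Rightarrow> 'x) \<Rightarrow> ('m, 'k, 'v) cmod \<Rightarrow> ('m, 'k, 'm mor \<times> 'x \<Rightarrow> 'k) cmod" where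
  "free_cover R c W = free_cmod R (\<lambda>n. c ` carrier (val W n))"

definition cover_map ::
  "'k ring \<Rightarrow> ('v \<Rightarrow> 'x) \<Rightarrow> ('m, 'k, 'v) cmod \<Rightarrow> 'm obj \<Rightarrow> ('m mor \<times> 'x \<Rightarrow> 'k) \<Rightarrow> 'v" where
  "cover_map R c W t p = finsum (val W t)
     (\<lambda>(f, x). p (f, x) \<odot>\<^bsub>val W t\<^esub> act W f (inv_into (carrier (val W (src f))) c x))
     {z. p z \<noteq> \<zero>\<^bsub>R\<^esub>}"

definition cover_kernel :: "'k ring \<Rightarrow> ('v \<Rightarrow> 'x) \<Rightarrow> ('m, 'k, 'v) cmod \<Rightarrow> ('m, 'k, 'm mor \<times> 'x \<Rightarrow> 'k) cmod" where
  "cover_kernel R c W = restrict_cmod (free_cover R c W)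
     (\<lambda>t. {p \<in> carrier (val (free_cover R c W) t). cover_map R c W t p = \<zero>\<^bsub>val W t\<^esub>})"

text \<open>
  Labels for the generators of all terms of the resolution in a single type:
  \<open>Elem v\<close> belongs to the element \<open>v\<close> of \<open>V\<close>, and \<open>Syz S\<close> to the element of
  the previous term with graph \<open>S\<close>.
\<close>

datatype ('k, 'm, 'v) label = Elem 'v | Syz "('k \<times> 'm mor \<times> ('k, 'm, 'v) label) fset"

definition syz_label :: "'k ring \<Rightarrow> ('m mor \<times> ('k, 'm, 'v) label \<Rightarrow> 'k) \<Rightarrow> ('k, 'm, 'v) label" where
  "syz_label R p = Syz (Abs_fset {(p (f, x), f, x) | f x. p (f, x) \<noteq> \<zero>\<^bsub>R\<^esub>})"

primrec syzygy ::
  "'k ring \<Rightarrow> ('m, 'k, 'v) cmod \<Rightarrow> nat \<Rightarrow> ('m, 'k, 'm mor \<times> ('k, 'm, 'v) label \<Rightarrow> 'k) cmod" where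
  "syzygy R V 0 = cover_kernel R Elem V"
| "syzygy R V (Suc s) = cover_kernel R (syz_label R) (syzygy R V s)"

text \<open>
  A resolution by projective modules, as \<open>M(n)\<close> is generated over the category algebra
  by the idempotent \<open>e\<^sub>n\<close>: \<open>\<dots> \<rightarrow> F\<^sub>1 \<rightarrow> F\<^sub>0 \<rightarrow> V \<rightarrow> 0\<close>.  Its differential
  \<open>F\<^sub>s\<^sub>+\<^sub>1 \<rightarrow> F\<^sub>s\<close> covers the kernel of the map out of \<open>F\<^sub>s\<close>.
\<close>

primrec resolution ::
  "'k ring \<Rightarrow> ('m, 'k, 'v) cmod \<Rightarrow> nat \<Rightarrow> ('m, 'k, 'm mor \<times> ('k, 'm, 'v) label \<Rightarrow> 'k) cmod" where
  "resolution R V 0 = free_cover R Elem V"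
| "resolution R V (Suc s) = free_cover R (syz_label R) (syzygy R V s)"

definition differential ::
  "'k ring \<Rightarrow> ('m, 'k, 'v) cmod \<Rightarrow> nat \<Rightarrow> 'm obj
     \<Rightarrow> ('m mor \<times> ('k, 'm, 'v) label \<Rightarrow> 'k) \<Rightarrow> ('m mor \<times> ('k, 'm, 'v) label \<Rightarrow> 'k)" where
  "differential R V s = cover_map R (syz_label R) (syzygy R V s)"


section \<open>Tor and homology\<close>

text \<open>
  \<open>Tor\<^sub>s(X, V)\<close> over the category algebra is the homology at \<open>s\<close> of the complex
  \<open>X \<otimes> F\<^sub>0 \<leftarrow> X \<otimes> F\<^sub>1 \<leftarrow> \<dots>\<close>, a left module over whatever acts on \<open>X\<close> from the left.
\<close>

definition tor_chains ::
  "'k ring \<Rightarrow> ('b, 'm mor \<Rightarrow> 'k, 'x) bimodule \<Rightarrow> ('m, 'k, 'v) cmod \<Rightarrow> nat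
     \<Rightarrow> ('b, ('x \<times> ('m obj \<Rightarrow> 'm mor \<times> ('k, 'm, 'v) label \<Rightarrow> 'k) \<Rightarrow>\<^sub>0 int) set) module" where
  "tor_chains R X V s = tensor (cat_algebra R) X (total R (resolution R V s))"

definition tor_boundary ::
  "'k ring \<Rightarrow> ('b, 'm mor \<Rightarrow> 'k, 'x) bimodule \<Rightarrow> ('m, 'k, 'v) cmod \<Rightarrow> nat
     \<Rightarrow> ('x \<times> ('m obj \<Rightarrow> 'm mor \<times> ('k, 'm, 'v) label \<Rightarrow> 'k) \<Rightarrow>\<^sub>0 int) set
     \<Rightarrow> ('x \<times> ('m obj \<Rightarrow> 'm mor \<times> ('k, 'm, 'v) label \<Rightarrow> 'k) \<Rightarrow>\<^sub>0 int) set" where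
  "tor_boundary R X V s = tensor_map (cat_algebra R) X (total R (resolution R V s))
     id (\<lambda>x n. differential R V s n (x n))"

definition tor_cycles ::
  "'k ring \<Rightarrow> ('b, 'm mor \<Rightarrow> 'k, 'x) bimodule \<Rightarrow> ('m, 'k, 'v) cmod \<Rightarrow> nat
     \<Rightarrow> ('x \<times> ('m obj \<Rightarrow> 'm mor \<times> ('k, 'm, 'v) label \<Rightarrow> 'k) \<Rightarrow>\<^sub>0 int) set set" where
  "tor_cycles R X V s = (case s of
       0 \<Rightarrow> carrier (tor_chains R X V 0)
     | Suc r \<Rightarrow> a_kernel (tor_chains R X V (Suc r)) (tor_chains R X V r) (tor_boundary R X V r))"

definition tor ::
  "'k ring \<Rightarrow> ('b, 'm mor \<Rightarrow> 'k, 'x) bimodule \<Rightarrow> ('m, 'k, 'v) cmod \<Rightarrow> nat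
     \<Rightarrow> ('b, ('x \<times> ('m obj \<Rightarrow> 'm mor \<times> ('k, 'm, 'v) label \<Rightarrow> 'k) \<Rightarrow>\<^sub>0 int) set set) module" where
  "tor R X V s = quotient_module
     ((tor_chains R X V s)\<lparr>carrier := tor_cycles R X V s\<rparr>)
     (tor_boundary R X V s ` carrier (tor_chains R X V (Suc s)))"

abbreviation "homology R V s \<equiv> tor R (cat_algebra_mod_up R) V s"

definition is_zero :: "('a, 'x) module \<Rightarrow> bool" where
  "is_zero M \<longleftrightarrow> carrier M = {\<zero>\<^bsub>M\<^esub>}"

definition generating_degree :: "'k ring \<Rightarrow> ('m::finite, 'k, 'v) cmod \<Rightarrow> ereal" where
  "generating_degree R V =
     (let D = {n. component R (homology R V 0) n \<noteq> {\<zero>\<^bsub>homology R V 0\<^esub>}}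
      in if D = {} then -1 else (SUP n\<in>D. ereal (real (deg n))))"

end

theory Submission
  imports Defs
begin

text \<open>
  Why the four conditions are equivalent.  For a module \<open>V\<close>, an object \<open>t\<close> and a set \<open>A\<close> of
  points of \<open>t\<close> (an object is regarded as the finite set of its coloured points), let
  \<open>miss V A t\<close> be the subgroup of \<open>V\<^sub>t\<close> spanned by the images of all morphisms into \<open>t\<close> whose
  range does not contain \<open>A\<close>.  For \<open>A = {}\<close> it is zero, and if \<open>A\<close> consists of all points of \<open>t\<close>,
  it is \<open>(\<mm>V)\<^sub>t\<close>.  Call \<open>V\<close> saturated if \<open>h v \<in> miss V (h A) t\<close> implies \<open>v \<in> miss V A n\<close> for
  all morphisms \<open>h : n \<rightarrow> t\<close>.  The quotient \<open>V\<^sub>t / miss V A t\<close> is a value of an iterated derivative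
  of \<open>V\<close>, that is of an iterated cokernel of maps from \<open>V\<close> to its shifts; saturation says
  that all iterated derivatives are torsion free.  Each of the four conditions is
  equivalent to saturation.

  Homology.  Let \<open>0 \<rightarrow> K \<rightarrow> F \<rightarrow> V \<rightarrow> 0\<close> be exact with \<open>F\<close> saturated.  Then \<open>V\<close> is saturated
  if and only if \<open>K \<inter> miss F A t = miss K A t\<close> for all \<open>A\<close> and \<open>t\<close>, and the case where \<open>A\<close> is
  everything implies the others (\<open>saturated_iff_pure\<close>).  This case says that
  \<open>K / \<mm>K \<rightarrow> F / \<mm>F\<close> is injective, which for free \<open>F\<close> means \<open>H\<^sub>1(V) = 0\<close>.  Moreover \<open>K\<close> is
  saturated if and only if \<open>V\<close> is (\<open>saturated_K\<close>, \<open>saturated_quotient\<close>): saturation can be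
  read off from any syzygy of \<open>V\<close>.  Free modules are saturated (\<open>saturated_free\<close>), so that for
  every \<open>s \<ge> 1\<close> the vanishing of \<open>H\<^sub>s(V)\<close>, which is \<open>H\<^sub>1\<close> of a syzygy, is equivalent to
  saturation of \<open>V\<close> (\<open>homology_Suc_zero_iff\<close>).

  Relative projective modules.  A module \<open>M(n) \<otimes> U\<close> is saturated, as every morphism \<open>h\<close>
  acts on it by a split injection whose retraction is compatible with ranges
  (\<open>saturated_MU\<close>), and extensions of saturated modules are saturated
  (\<open>saturated_extension\<close>).  Conversely let \<open>V\<close> be saturated of finite generating degree \<open>d\<close>.  List
  the objects of degree at most \<open>d\<close> by increasing degree and filter \<open>V\<close> by the submodules
  generated by the values at the first \<open>j\<close> objects.  If the next object is \<open>m\<close>, the quotient is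
  generated by \<open>U = V\<^sub>m / (\<mm>V)\<^sub>m\<close>, and \<open>M(m) \<otimes> U\<close> maps onto it.  An element of the kernel has the form
  \<open>\<Sum> f \<otimes> u\<^sub>f\<close> with \<open>f\<close> running over morphisms with pairwise different ranges; modulo the range
  of one \<open>f\<close> all other terms vanish, and saturation forces \<open>u\<^sub>f = 0\<close> (\<open>comparison_inj\<close>).
\<close>

section \<open>Injections as subsets\<close>

text \<open>
  An object is the finite set of its points, each of which remembers its colour; a
  morphism is a colour-preserving injection, determined by its range up to a permutation of its
  source.
\<close>

definition full :: "'m obj \<Rightarrow> ('m \<times> nat) set" where
  "full n = {(i, x). x \<in> {1..n i}}"

definition app :: "'m mor \<Rightarrow> 'm \<times> nat \<Rightarrow> 'm \<times> nat" where
  "app f = (\<lambda>(i, x). (i, maps f i x))"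

definition img :: "'m mor \<Rightarrow> ('m \<times> nat) set" where
  "img f = app f ` full (src f)"

lemma Hom_src [simp]: "f \<in> Hom n t \<Longrightarrow> src f = n"
  and Hom_tgt [simp]: "f \<in> Hom n t \<Longrightarrow> tgt f = t"
  by (auto simp: Hom_def)

lemma mem_Mors: "f \<in> Mors \<longleftrightarrow> f \<in> Hom (src f) (tgt f)"
  unfolding Mors_def by (auto)

lemma fst_app [simp]: "fst (app f z) = fst z"
  by (cases z) (simp add: app_def)

lemma img_Hom: "f \<in> Hom n t \<Longrightarrow> img f = app f ` full n"
  by (simp add: img_def)

lemma app_in_full: "\<lbrakk>f \<in> Hom n t; z \<in> full n\<rbrakk> \<Longrightarrow> app f z \<in> full t"
  by (cases z) (auto simp: Hom_def full_def app_def PiE_iff)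

lemma inj_on_app:
  assumes "f \<in> Hom n t" shows "inj_on (app f) (full n)"
proof (rule inj_onI)
  fix z w assume "z \<in> full n" "w \<in> full n" "app f z = app f w"
  moreover have "inj_on (maps f i) {1..n i}" for i using assms by (auto simp: Hom_def)
  ultimately show "z = w" by (cases z, cases w) (auto simp: full_def app_def inj_on_def)
qed

lemma img_subset_full: "f \<in> Hom n t \<Longrightarrow> img f \<subseteq> full t"
  by (auto simp: img_Hom app_in_full)

lemma finite_full [simp]: "finite (full (n :: 'm::finite obj))"
proof -
  have "full n \<subseteq> (\<Union>i\<in>UNIV. {i} \<times> {1..n i})" by (auto simp: full_def)
  thus ?thesis by (rule finite_subset) simp
qed

lemma card_full: "card (full (n :: 'm::finite obj)) = deg n"
proof -
  have "full n = Sigma UNIV (\<lambda>i. {1..n i})" by (auto simp: full_def)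
  thus ?thesis by (simp add: deg_def)
qed

lemma Hom_eqI:
  assumes "f \<in> Hom n t" "f' \<in> Hom n t" "\<And>z. z \<in> full n \<Longrightarrow> app f z = app f' z"
  shows "f = f'"
proof -
  obtain a b where f: "f = Mor n a t" "f' = Mor n b t"
    and a: "\<forall>i. a i \<in> {1..n i} \<rightarrow>\<^sub>E {1..t i}" "\<forall>i. b i \<in> {1..n i} \<rightarrow>\<^sub>E {1..t i}"
    using assms(1,2) by (auto simp: Hom_def)
  have "a i x = b i x" for i x
  proof (cases "x \<in> {1..n i}")
    case True
    hence "(i, x) \<in> full n" by (auto simp: full_def)
    from assms(3)[OF this] show ?thesis by (simp add: app_def f)
  next
    case False
    thus ?thesis using a PiE_arb[of "a i" _ _ x] PiE_arb[of "b i" _ _ x] by metis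
  qed
  hence "a = b" by blast
  thus ?thesis by (simp add: f)
qed

lemma Hom_of_map:
  assumes "F ` full n \<subseteq> full t" "inj_on F (full n)" "\<And>z. z \<in> full n \<Longrightarrow> fst (F z) = fst z"
  obtains f where "f \<in> Hom n t" "\<And>z. z \<in> full n \<Longrightarrow> app f z = F z"
proof -
  define f where "f = Mor n (\<lambda>i. \<lambda>x\<in>{1..n i}. snd (F (i, x))) t"
  have Fz: "F (i, x) = (i, snd (F (i, x)))" if "x \<in> {1..n i}" for i x
    using assms(3)[of "(i, x)"] that by (auto simp: full_def prod_eq_iff)
  have "f \<in> Hom n t"
  proof -
    have "(\<lambda>x\<in>{1..n i}. snd (F (i, x))) \<in> {1..n i} \<rightarrow>\<^sub>E {1..t i}" for i
    proof (rule restrict_PiE_iff[THEN iffD2], rule ballI)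
      fix x assume x: "x \<in> {1..n i}"
      hence "(i, x) \<in> full n" by (simp add: full_def)
      hence "F (i, x) \<in> full t" using assms(1) by blast
      with Fz[OF x] show "snd (F (i, x)) \<in> {1..t i}" by (auto simp: full_def)
    qed
    moreover have "inj_on (\<lambda>x\<in>{1..n i}. snd (F (i, x))) {1..n i}" for i
    proof (rule inj_onI)
      fix x y assume xy: "x \<in> {1..n i}" "y \<in> {1..n i}"
        and "(\<lambda>x\<in>{1..n i}. snd (F (i, x))) x = (\<lambda>x\<in>{1..n i}. snd (F (i, x))) y"
      hence "snd (F (i, x)) = snd (F (i, y))" by simp
      hence "F (i, x) = F (i, y)" using Fz[OF xy(1)] Fz[OF xy(2)] by simp
      hence "(i, x) = (i, y)" by (rule inj_onD[OF assms(2)]) (use xy in \<open>auto simp: full_def\<close>)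
      thus "x = y" by simp
    qed
    ultimately show ?thesis by (auto simp: Hom_def f_def)
  qed
  moreover have "app f z = F z" if "z \<in> full n" for z
    using that Fz by (cases z) (auto simp: app_def f_def full_def)
  ultimately show ?thesis using that by blast
qed

lemma id_in_Hom [simp]: "id_mor n \<in> Hom n n"
  by (auto simp: Hom_def id_mor_def inj_on_def)

lemma app_id: "z \<in> full n \<Longrightarrow> app (id_mor n) z = z"
  by (cases z) (auto simp: app_def id_mor_def full_def)

lemma comp_in_Hom [simp]:
  assumes "f \<in> Hom l n" "g \<in> Hom n t" shows "comp_mor g f \<in> Hom l t"
proof -
  obtain a b where f: "f = Mor l a n" "g = Mor n b t"
    and a: "\<And>i. a i \<in> {1..l i} \<rightarrow>\<^sub>E {1..n i}" "\<And>i. b i \<in> {1..n i} \<rightarrow>\<^sub>E {1..t i}"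
      "\<And>i. inj_on (a i) {1..l i}" "\<And>i. inj_on (b i) {1..n i}"
    using assms by (auto simp: Hom_def)
  have "compose {1..l i} (b i) (a i) \<in> {1..l i} \<rightarrow>\<^sub>E {1..t i}" for i
    using a(1)[of i] a(2)[of i] by (auto simp: compose_def PiE_iff)
  moreover have "inj_on (compose {1..l i} (b i) (a i)) {1..l i}" for i
  proof (rule inj_onI)
    fix x y assume xy: "x \<in> {1..l i}" "y \<in> {1..l i}" 
      and "compose {1..l i} (b i) (a i) x = compose {1..l i} (b i) (a i) y"
    hence "b i (a i x) = b i (a i y)" by (simp add: compose_eq)
    hence "a i x = a i y" using inj_onD[OF a(4)[of i]] PiE_mem[OF a(1)[of i]] xy by blast
    thus "x = y" using inj_onD[OF a(3)[of i]] xy by blast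
  qed
  ultimately show ?thesis by (auto simp: comp_mor_def f Hom_def)
qed

lemma app_comp:
  assumes "f \<in> Hom l n" "z \<in> full l" shows "app (comp_mor g f) z = app g (app f z)"
  using assms by (cases z) (auto simp: app_def comp_mor_def full_def compose_eq)

lemma src_comp [simp]: "src (comp_mor g f) = src f"
  and tgt_comp [simp]: "tgt (comp_mor g f) = tgt g"
  by (simp_all add: comp_mor_def)

lemma app_comp_image:
  assumes "f \<in> Hom l n" "A \<subseteq> full l" shows "app (comp_mor g f) ` A = app g ` app f ` A"
  unfolding image_image by (rule image_cong) (use assms app_comp[OF assms(1)] in blast)+

lemma img_comp: "f \<in> Hom l n \<Longrightarrow> img (comp_mor g f) = app g ` img f"
  by (simp add: img_def app_comp_image)

lemma comp_id_left [simp]: "f \<in> Hom n t \<Longrightarrow> comp_mor (id_mor t) f = f"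
  by (rule Hom_eqI[of _ n t]) (auto simp: app_comp app_id app_in_full)

lemma comp_id_right [simp]: "f \<in> Hom n t \<Longrightarrow> comp_mor f (id_mor n) = f"
  by (rule Hom_eqI[of _ n t]) (auto simp: app_comp[OF id_in_Hom] app_id app_in_full intro: comp_in_Hom[OF id_in_Hom])

lemma comp_assoc:
  assumes "f \<in> Hom l n" "g \<in> Hom n t" "h \<in> Hom t u"
  shows "comp_mor h (comp_mor g f) = comp_mor (comp_mor h g) f"
  by (rule Hom_eqI[of _ l u])
    (use assms in \<open>auto simp: app_comp app_comp[OF comp_in_Hom[OF assms(1,2)]] app_in_full intro: comp_in_Hom\<close>)

lemma comp_left_cancel:
  assumes "f \<in> Hom l n" "f' \<in> Hom l n" "g \<in> Hom n t" "comp_mor g f = comp_mor g f'"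
  shows "f = f'"
proof (rule Hom_eqI[OF assms(1,2)])
  fix z assume z: "z \<in> full l"
  have "app g (app f z) = app g (app f' z)" using assms z by (metis app_comp)
  thus "app f z = app f' z" using inj_onD[OF inj_on_app[OF assms(3)]] app_in_full assms(1,2) z by blast
qed

lemma factor_through:
  assumes g: "g \<in> Hom p t" and h: "h \<in> Hom n t" and sub: "img g \<subseteq> img h"
  obtains k where "k \<in> Hom p n" "g = comp_mor h k"
proof -
  define F where "F z = inv_into (full n) (app h) (app g z)" for z
  have F: "F z \<in> full n" "app h (F z) = app g z" if "z \<in> full p" for z
  proof -
    have "app g z \<in> app h ` full n" using sub that g h by (auto simp: img_Hom)
    thus "F z \<in> full n" "app h (F z) = app g z" unfolding F_def by (auto intro: inv_into_into f_inv_into_f)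
  qed
  have 1: "F ` full p \<subseteq> full n" using F by auto
  have 2: "inj_on F (full p)"
    by (rule inj_onI) (metis F(2) inj_onD[OF inj_on_app[OF g]])
  have 3: "fst (F z) = fst z" if "z \<in> full p" for z using F(2)[OF that] by (metis fst_app)
  obtain k where k: "k \<in> Hom p n" "\<And>z. z \<in> full p \<Longrightarrow> app k z = F z" using Hom_of_map[OF 1 2 3] by blast
  have "g = comp_mor h k"
    by (rule Hom_eqI[of _ p t]) (use g h k F in \<open>auto simp: app_comp\<close>)
  with k(1) show ?thesis using that by blast
qed

lemma Hom_with_img:
  fixes t :: "'m::finite obj"
  assumes "S \<subseteq> full t"
  obtains n h where "h \<in> Hom n t" "img h = S"
proof -
  define Si where "Si i = {x. (i, x) \<in> S}" for i
  have "finite S" using assms finite_subset finite_full by blast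
  hence fin: "finite (Si i)" for i
    unfolding Si_def by (rule finite_surj[of _ _ snd]) force
  define n where "n i = card (Si i)" for i
  have "\<exists>b. bij_betw b {1..n i} (Si i)" for i
    by (rule finite_same_card_bij) (use fin in \<open>auto simp: n_def\<close>)
  then obtain b where b: "\<And>i. bij_betw (b i) {1..n i} (Si i)" by metis
  define F where "F = (\<lambda>(i, x). (i, b i x))"
  have im: "F ` full n = S"
  proof
    show "F ` full n \<subseteq> S" using bij_betwE[OF b] by (auto simp: F_def full_def Si_def)
    show "S \<subseteq> F ` full n"
    proof
      fix z assume z: "z \<in> S"
      obtain i y where iy: "z = (i, y)" by (cases z)
      hence "y \<in> b i ` {1..n i}" using b[of i] z by (auto simp: bij_betw_def Si_def)
      then obtain x where "x \<in> {1..n i}" "y = b i x" by auto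
      thus "z \<in> F ` full n" by (intro image_eqI[of _ _ "(i, x)"]) (auto simp: F_def full_def iy)
    qed
  qed
  have "inj_on F (full n)"
    using b by (auto simp: inj_on_def F_def full_def bij_betw_def)
  moreover have "fst (F z) = fst z" for z by (cases z) (simp add: F_def)
  ultimately obtain h where h: "h \<in> Hom n t" "\<And>z. z \<in> full n \<Longrightarrow> app h z = F z"
    using Hom_of_map[of F n t] im assms by metis
  have "img h = S" using h im by (auto simp: img_Hom)
  with h(1) show ?thesis using that by blast
qed

lemma Hom_le:
  assumes "f \<in> Hom n t" shows "n \<le> t"
proof (rule le_funI)
  fix i
  have "maps f i ` {1..n i} \<subseteq> {1..t i}" "inj_on (maps f i) {1..n i}"
    using assms by (fastforce simp: Hom_def PiE_iff)+
  thus "n i \<le> t i" using card_inj_on_le[of "maps f i" "{1..n i}" "{1..t i}"] by simp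
qed

lemma deg_img: "f \<in> Hom n t \<Longrightarrow> card (img f) = deg (n :: 'm::finite obj)"
  by (simp add: img_Hom card_image inj_on_app card_full)

lemma Hom_full_img:
  assumes "f \<in> Hom n (t :: 'm::finite obj)" shows "full t \<subseteq> img f \<longleftrightarrow> n = t"
proof
  assume "full t \<subseteq> img f"
  hence "deg n = deg t" using img_subset_full[OF assms] deg_img[OF assms] card_full by (metis subset_antisym)
  hence "(\<Sum>i\<in>UNIV. t i - n i) = 0" using Hom_le[OF assms]
    by (simp add: deg_def sum_subtractf_nat le_fun_def)
  hence "t i \<le> n i" for i by simp
  thus "n = t" using Hom_le[OF assms] by (auto simp: le_fun_def intro!: antisym)
next
  assume nt: "n = t"
  have "card (img f) = card (full t)" using deg_img[OF assms] nt by (simp add: card_full)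
  thus "full t \<subseteq> img f" using img_subset_full[OF assms] by (metis card_subset_eq finite_full subset_refl)
qed

lemma Hom_less_iff:
  assumes "f \<in> Hom n (t :: 'm::finite obj)" shows "n < t \<longleftrightarrow> \<not> full t \<subseteq> img f"
  using Hom_full_img[OF assms] Hom_le[OF assms] by auto

lemma Hom_same_img:
  assumes f: "f \<in> Hom n t" and g: "g \<in> Hom p t" and "img f = img g"
  shows "n = p"
  using factor_through[OF f g] factor_through[OF g f] assms(3) Hom_le by (metis order_antisym order_refl)

text \<open>
  All endomorphisms are permutations of finite sets.
\<close>

lemma Hom_inverse:
  assumes s: "s \<in> Hom n n"
  obtains s' where "s' \<in> Hom n (n :: 'm::finite obj)" "comp_mor s' s = id_mor n" "comp_mor s s' = id_mor n"
proof -
  have "img (id_mor n) \<subseteq> img s"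
    using Hom_full_img[OF s] img_subset_full[OF id_in_Hom[of n]] by blast
  then obtain s' where s': "s' \<in> Hom n n" "id_mor n = comp_mor s s'"
    using factor_through[OF id_in_Hom s] by blast
  have "comp_mor s (comp_mor s' s) = comp_mor s (id_mor n)"
    using s s' by (metis comp_assoc comp_id_left comp_id_right)
  hence "comp_mor s' s = id_mor n"
    using comp_left_cancel[of "comp_mor s' s" n n "id_mor n" s n] s s'(1) by simp
  with s' show ?thesis using that by metis
qed

lemma finite_Hom [simp]: "finite (Hom n (t :: 'm::finite obj))"
proof -
  have "Hom n t \<subseteq> (\<lambda>f. Mor n f t) ` (PiE UNIV (\<lambda>i. {1..n i} \<rightarrow>\<^sub>E {1..t i}))"
    by (auto simp: Hom_def PiE_iff)
  thus ?thesis by (rule finite_subset) (auto intro!: finite_PiE)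
qed

text \<open>
  A point \<open>b\<close> of \<open>t\<close> can be placed in two independent ways in a larger object, without moving the
  other points.  Used in \<open>saturated_quotient\<close> to see that an obstruction that lives at \<open>b\<close> is torsion.
\<close>

lemma two_new_points:
  assumes b: "b \<in> full t"
  obtains t' g g' where "g \<in> Hom t t'" "g' \<in> Hom t t'"
    "\<And>z. z \<in> full t \<Longrightarrow> z \<noteq> b \<Longrightarrow> app g z = app g' z" "app g b \<notin> img g'"
proof -
  obtain i b0 where b0: "b = (i, b0)" by (cases b)
  define t' where "t' = t(i := Suc (t i))"
  define G where "G z = (if z = b then (i, Suc (t i)) else z)" for z
  have sub: "full t \<subseteq> full t'" by (auto simp: full_def t'_def)
  have new: "(i, Suc (t i)) \<notin> full t" "(i, Suc (t i)) \<in> full t'" by (auto simp: full_def t'_def)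
  obtain g where g: "g \<in> Hom t t'" "\<And>z. z \<in> full t \<Longrightarrow> app g z = z"
    using Hom_of_map[of "\<lambda>z. z" t t'] sub by auto
  \<comment> \<open>\<open>g\<close> is the standard inclusion, and \<open>g'\<close> moves \<open>b\<close> to the new point.\<close>
  have "G ` full t \<subseteq> full t'" "inj_on G (full t)" "\<And>z. fst (G z) = fst z"
    using sub new b0 by (auto simp: G_def inj_on_def)
  then obtain g' where g': "g' \<in> Hom t t'" "\<And>z. z \<in> full t \<Longrightarrow> app g' z = G z"
    using Hom_of_map[of G t t'] by metis
  have "app g b \<notin> img g'" using g g' b new by (auto simp: img_Hom G_def)
  moreover have "app g z = app g' z" if "z \<in> full t" "z \<noteq> b" for z using that g g' by (simp add: G_def)
  ultimately show ?thesis using that g(1) g'(1) by blast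
qed

section \<open>Saturated functors\<close>

text \<open>
  Saturation and purity only concern the additive structure of the values.
\<close>

locale afun =
  fixes V :: "('m::finite, 'k, 'v) cmod"
  assumes grp: "abelian_group (val V n)"
    and act_closed: "\<lbrakk>f \<in> Hom n t; x \<in> carrier (val V n)\<rbrakk> \<Longrightarrow> act V f x \<in> carrier (val V t)"
    and act_add: "\<lbrakk>f \<in> Hom n t; x \<in> carrier (val V n); y \<in> carrier (val V n)\<rbrakk>
      \<Longrightarrow> act V f (x \<oplus>\<^bsub>val V n\<^esub> y) = act V f x \<oplus>\<^bsub>val V t\<^esub> act V f y"
    and act_id: "x \<in> carrier (val V n) \<Longrightarrow> act V (id_mor n) x = x"
    and act_comp: "\<lbrakk>f \<in> Hom l n; g \<in> Hom n t; x \<in> carrier (val V l)\<rbrakk>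
      \<Longrightarrow> act V (comp_mor g f) x = act V g (act V f x)"

text \<open>
  The span of the images of the morphisms that miss a point of \<open>A\<close>: zero for \<open>A = {}\<close>, and \<open>(\<mm>V)\<^sub>t\<close> for
  \<open>A = full t\<close>.
\<close>

inductive_set miss :: "('m, 'k, 'v) cmod \<Rightarrow> ('m \<times> nat) set \<Rightarrow> 'm obj \<Rightarrow> 'v set"
  for V A t where
  zero: "\<zero>\<^bsub>val V t\<^esub> \<in> miss V A t"
| step: "\<lbrakk>g \<in> Hom p t; \<not> A \<subseteq> img g; y \<in> carrier (val V p); w \<in> miss V A t\<rbrakk>
    \<Longrightarrow> act V g y \<oplus>\<^bsub>val V t\<^esub> w \<in> miss V A t"

definition saturated_at :: "('m, 'k, 'v) cmod \<Rightarrow> 'm obj \<Rightarrow> ('m \<times> nat) set \<Rightarrow> bool" where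
  "saturated_at V n A \<longleftrightarrow> (\<forall>t. \<forall>h\<in>Hom n t. \<forall>v\<in>carrier (val V n).
     act V h v \<in> miss V (app h ` A) t \<longrightarrow> v \<in> miss V A n)"

text \<open>
  In terms of the quotients \<open>V\<^sub>n / miss V A n\<close>, the values of the iterated derivatives of \<open>V\<close>, this
  is injectivity of all maps induced by morphisms.
\<close>

definition saturated :: "('m, 'k, 'v) cmod \<Rightarrow> bool" where
  "saturated V \<longleftrightarrow> (\<forall>n. \<forall>A\<subseteq>full n. saturated_at V n A)"

context abelian_group
begin

lemma eq_minus_of_sum_zero: "\<lbrakk>x \<in> carrier G; y \<in> carrier G; x \<oplus> y = \<zero>\<rbrakk> \<Longrightarrow> y = \<ominus> x"
  using minus_equality minus_minus a_comm by metis

lemma split_summand: "\<lbrakk>x \<in> carrier G; y \<in> carrier G\<rbrakk> \<Longrightarrow> x = (x \<ominus> y) \<oplus> y"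
  by (simp add: minus_eq a_assoc l_neg)

lemma sum_diff_left: "\<lbrakk>u \<in> carrier G; v \<in> carrier G\<rbrakk> \<Longrightarrow> (u \<oplus> v) \<ominus> u = v"
  by (simp add: minus_eq a_comm[of u v] a_assoc r_neg)

lemma sum_diff_right: "\<lbrakk>u \<in> carrier G; v \<in> carrier G\<rbrakk> \<Longrightarrow> (u \<oplus> v) \<ominus> v = u"
  by (simp add: minus_eq a_assoc r_neg)

lemma diff_self: "u \<in> carrier G \<Longrightarrow> u \<ominus> u = \<zero>"
  by (simp add: minus_eq r_neg)

lemma diff_zero: "u \<in> carrier G \<Longrightarrow> u \<ominus> \<zero> = u"
  using sum_diff_right[of u \<zero>] by simp

lemma sum_diff_middle:
  assumes "u \<in> carrier G" "v \<in> carrier G" "w \<in> carrier G" shows "(u \<oplus> v \<oplus> w) \<ominus> v = u \<oplus> w"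
proof -
  have "u \<oplus> v \<oplus> w = (u \<oplus> w) \<oplus> v" using assms by (simp add: a_ac)
  thus ?thesis using assms by (simp add: sum_diff_right)
qed

lemma diff_eq_of_sum_eq:
  assumes "a \<in> carrier G" "b \<in> carrier G" "c \<in> carrier G" "d \<in> carrier G" "a \<oplus> b = c \<oplus> d"
  shows "a \<ominus> c = d \<ominus> b"
proof -
  have "a \<ominus> c \<oplus> b = (a \<oplus> b) \<ominus> c" using assms(1-4) by (simp add: minus_eq a_ac)
  also have "\<dots> = d" using assms by (simp add: sum_diff_left)
  finally have "d \<ominus> b = (a \<ominus> c \<oplus> b) \<ominus> b" by simp
  also have "\<dots> = a \<ominus> c" using assms(1-4) by (intro sum_diff_right) auto
  finally show ?thesis by simp
qed

end

context afun
begin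

sublocale grp: abelian_group "val V n" for n by (rule grp)

lemma act_hom: "f \<in> Hom n t \<Longrightarrow> abelian_group_hom (val V n) (val V t) (act V f)"
  by (rule abelian_group_homI) (auto simp: grp group_hom_def group_hom_axioms_def hom_def act_closed act_add
      intro: grp.a_group)

lemma act_zero: "f \<in> Hom n t \<Longrightarrow> act V f \<zero>\<^bsub>val V n\<^esub> = \<zero>\<^bsub>val V t\<^esub>"
  by (rule abelian_group_hom.hom_zero[OF act_hom])

lemma act_minus: "\<lbrakk>f \<in> Hom n t; x \<in> carrier (val V n)\<rbrakk>
    \<Longrightarrow> act V f (\<ominus>\<^bsub>val V n\<^esub> x) = \<ominus>\<^bsub>val V t\<^esub> act V f x"
  by (rule abelian_group_hom.hom_a_inv[OF act_hom])

lemma miss_closed: "w \<in> miss V A t \<Longrightarrow> w \<in> carrier (val V t)"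
  by (induction rule: miss.induct) (auto intro: act_closed)

lemma act_in_miss: "\<lbrakk>g \<in> Hom p t; \<not> A \<subseteq> img g; y \<in> carrier (val V p)\<rbrakk> \<Longrightarrow> act V g y \<in> miss V A t"
  using miss.step[of g p t A y V "\<zero>\<^bsub>val V t\<^esub>"] miss.zero[of V t A] by (simp add: act_closed)

lemma miss_add: "w \<in> miss V A t \<Longrightarrow> u \<in> miss V A t \<Longrightarrow> w \<oplus>\<^bsub>val V t\<^esub> u \<in> miss V A t"
proof (induction rule: miss.induct)
  case zero thus ?case by (simp add: miss_closed)
next
  case (step g p y w)
  have "act V g y \<oplus>\<^bsub>val V t\<^esub> w \<oplus>\<^bsub>val V t\<^esub> u = act V g y \<oplus>\<^bsub>val V t\<^esub> (w \<oplus>\<^bsub>val V t\<^esub> u)"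
    using step by (simp add: grp.a_assoc act_closed miss_closed)
  with step show ?case by (simp add: miss.step)
qed

lemma miss_minus: "w \<in> miss V A t \<Longrightarrow> \<ominus>\<^bsub>val V t\<^esub> w \<in> miss V A t"
proof (induction rule: miss.induct)
  case zero
  have "\<ominus>\<^bsub>val V t\<^esub> \<zero>\<^bsub>val V t\<^esub> = \<zero>\<^bsub>val V t\<^esub>" by (rule grp.minus_equality) auto
  thus ?case by (metis miss.zero)
next
  case (step g p y w)
  have "\<ominus>\<^bsub>val V t\<^esub> (act V g y \<oplus>\<^bsub>val V t\<^esub> w) = act V g (\<ominus>\<^bsub>val V p\<^esub> y) \<oplus>\<^bsub>val V t\<^esub> \<ominus>\<^bsub>val V t\<^esub> w"
    using step by (simp add: grp.minus_add act_closed miss_closed act_minus)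
  with step show ?case by (simp add: miss.step)
qed

lemma miss_diff: "\<lbrakk>w \<in> miss V A t; u \<in> miss V A t\<rbrakk> \<Longrightarrow> w \<ominus>\<^bsub>val V t\<^esub> u \<in> miss V A t"
  by (simp add: a_minus_def miss_add miss_minus)

lemma miss_mono: "w \<in> miss V A t \<Longrightarrow> A \<subseteq> B \<Longrightarrow> w \<in> miss V B t"
  by (induction rule: miss.induct) (auto intro: miss.intros)

lemma miss_empty: "miss V {} t = {\<zero>\<^bsub>val V t\<^esub>}"
  by (auto elim: miss.cases intro: miss.zero)

lemma act_miss:
  assumes "w \<in> miss V A n" "f \<in> Hom n t" "A \<subseteq> full n"
  shows "act V f w \<in> miss V (app f ` A) t"
  using assms(1)
proof (induction rule: miss.induct)
  case zero show ?case using assms by (simp add: act_zero miss.zero)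
next
  case (step g p y w)
  obtain a where a: "a \<in> A" "a \<notin> img g" using step by auto
  have "app f a \<notin> img (comp_mor f g)"
  proof
    assume "app f a \<in> img (comp_mor f g)"
    then obtain c where c: "c \<in> img g" "app f a = app f c" by (auto simp: img_comp[OF step(1)])
    hence "a = c" using inj_onD[OF inj_on_app[OF assms(2)] c(2)] a assms(3) img_subset_full[OF step(1)] by blast
    thus False using a c by simp
  qed
  hence "\<not> app f ` A \<subseteq> img (comp_mor f g)" using a by blast
  hence "act V (comp_mor f g) y \<in> miss V (app f ` A) t" by (rule act_in_miss[rotated]) (use step assms in auto)
  moreover have "act V f (act V g y \<oplus>\<^bsub>val V n\<^esub> w) = act V (comp_mor f g) y \<oplus>\<^bsub>val V t\<^esub> act V f w"
    using step assms by (simp add: act_add act_closed miss_closed act_comp)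
  ultimately show ?case using step.IH by (simp add: miss_add)
qed

text \<open>
  A morphism that misses a point of \<open>insert b A\<close> misses a point of \<open>A\<close>, or it misses \<open>b\<close> and then factors
  through the inclusion \<open>h\<close> of the complement of \<open>b\<close>.
\<close>

lemma miss_insert:
  assumes "w \<in> miss V (insert b A) t" and h: "h \<in> Hom n t" and "img h = full t - {b}"
  shows "\<exists>u\<in>miss V A t. \<exists>y\<in>carrier (val V n). w = u \<oplus>\<^bsub>val V t\<^esub> act V h y"
  using assms(1)
proof (induction rule: miss.induct)
  case zero show ?case using act_zero[OF h]
    by (intro bexI[of _ "\<zero>\<^bsub>val V t\<^esub>"] bexI[of _ "\<zero>\<^bsub>val V n\<^esub>"]) (auto intro: miss.zero)
next
  case (step g p x w)
  then obtain u y where uy: "u \<in> miss V A t" "y \<in> carrier (val V n)" "w = u \<oplus>\<^bsub>val V t\<^esub> act V h y"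
    by blast
  note cl = miss_closed[OF uy(1)] act_closed[OF h uy(2)] act_closed[OF step(1) step(3)]
  show ?case
  proof (cases "A \<subseteq> img g")
    case False
    have "act V g x \<oplus>\<^bsub>val V t\<^esub> w = (act V g x \<oplus>\<^bsub>val V t\<^esub> u) \<oplus>\<^bsub>val V t\<^esub> act V h y"
      using cl uy by (simp add: grp.a_assoc)
    with False step uy show ?thesis using miss.step by metis
  next
    case True
    hence "img g \<subseteq> img h" using step assms(3) img_subset_full[OF step(1)] by auto
    then obtain k where k: "k \<in> Hom p n" "g = comp_mor h k" using factor_through[OF step(1) h] by blast
    have "act V g x \<oplus>\<^bsub>val V t\<^esub> w = u \<oplus>\<^bsub>val V t\<^esub> (act V h (act V k x) \<oplus>\<^bsub>val V t\<^esub> act V h y)"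
      using cl uy k step h by (simp add: grp.a_ac act_comp)
    also have "\<dots> = u \<oplus>\<^bsub>val V t\<^esub> act V h (act V k x \<oplus>\<^bsub>val V n\<^esub> y)"
      using act_add[OF h act_closed[OF k(1) step(3)] uy(2)] by simp
    finally show ?thesis using uy k step act_closed by blast
  qed
qed

text \<open>
  Every morphism is a composite of morphisms that miss exactly one point and an isomorphism.
\<close>

lemma saturated_at_of_one_point:
  assumes one: "\<And>n t A h v b. \<lbrakk>A \<subseteq> full n; card A = c; h \<in> Hom n t; b \<in> full t; img h = full t - {b};
      v \<in> carrier (val V n); act V h v \<in> miss V (app h ` A) t\<rbrakk> \<Longrightarrow> v \<in> miss V A n"
    and "A \<subseteq> full n" "card A = c"
  shows "saturated_at V n A"
proof -
  have "v \<in> miss V A n" if "A \<subseteq> full n" "card A = c" "h \<in> Hom n t" "v \<in> carrier (val V n)"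
    "act V h v \<in> miss V (app h ` A) t" for t n A h v
    using that
  proof (induction "deg t" arbitrary: t n A h v rule: less_induct)
    case less
    note h = less.prems(3) and v = less.prems(4)
    show ?case
    proof (cases "full t \<subseteq> img h")
      case True
      hence "n = t" using Hom_full_img[OF h] by simp
      with h obtain s where s: "s \<in> Hom t n" "comp_mor s h = id_mor n" using Hom_inverse[of h n] by blast
      have "act V s (act V h v) \<in> miss V (app s ` app h ` A) n"
        by (rule act_miss[OF less.prems(5) s(1)]) (use h less.prems(1) in \<open>auto simp: app_in_full\<close>)
      moreover have "act V s (act V h v) = v" using act_comp[OF h s(1) v] s act_id v by simp
      moreover have "app s ` app h ` A = A"
      proof -
        have "app s ` app h ` A = app (id_mor n) ` A"
          unfolding app_comp_image[OF h less.prems(1), symmetric] s ..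
        also have "\<dots> = (\<lambda>z. z) ` A" by (rule image_cong) (use app_id less.prems(1) in blast)+
        finally show ?thesis by simp
      qed
      ultimately show ?thesis by simp
    next
      case False
      then obtain b where b: "b \<in> full t" "b \<notin> img h" by blast
      obtain p h0 where h0: "h0 \<in> Hom p t" "img h0 = full t - {b}"
        using Hom_with_img[of "full t - {b}" t] by blast
      have "img h \<subseteq> img h0" using h0 b img_subset_full[OF h] by blast
      then obtain k where k: "k \<in> Hom n p" "h = comp_mor h0 k" using factor_through h h0 by metis
      have A: "app k ` A \<subseteq> full p" "card (app k ` A) = c"
        using less.prems app_in_full[OF k(1)] inj_on_subset[OF inj_on_app[OF k(1)]] by (blast, metis card_image)
      have "act V h0 (act V k v) \<in> miss V (app h0 ` app k ` A) t"
        using less.prems(5) act_comp[OF k(1) h0(1) v] app_comp_image[OF k(1) less.prems(1)] k(2) by simp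
      hence "act V k v \<in> miss V (app k ` A) p"
        using one[OF A h0(1) b(1) h0(2)] act_closed[OF k(1) v] by blast
      moreover have "deg p < deg t"
        using deg_img[OF h0(1)] h0(2) b(1) card_full[of t] by (metis card_Diff1_less finite_full)
      ultimately show ?thesis using less.hyps[OF _ less.prems(1,2) k(1) v] by blast
    qed
  qed
  with assms show ?thesis unfolding saturated_at_def by blast
qed

end

lemma saturated_atD: "\<lbrakk>saturated_at V n A; h \<in> Hom n t; v \<in> carrier (val V n); act V h v \<in> miss V (app h ` A) t\<rbrakk> \<Longrightarrow> v \<in> miss V A n"
  unfolding saturated_at_def by blast

lemma saturatedD:
  "\<lbrakk>saturated V; A \<subseteq> full n; h \<in> Hom n t; v \<in> carrier (val V n); act V h v \<in> miss V (app h ` A) t\<rbrakk> \<Longrightarrow> v \<in> miss V A n"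
  unfolding saturated_def saturated_at_def by blast

locale epi = F: afun F + V: afun V
  for F :: "('m::finite, 'k, 'a) cmod" and V :: "('m, 'k, 'b) cmod" +
  fixes \<pi> :: "'m obj \<Rightarrow> 'a \<Rightarrow> 'b"
  assumes pi_closed: "x \<in> carrier (val F n) \<Longrightarrow> \<pi> n x \<in> carrier (val V n)"
    and pi_add: "\<lbrakk>x \<in> carrier (val F n); y \<in> carrier (val F n)\<rbrakk>
      \<Longrightarrow> \<pi> n (x \<oplus>\<^bsub>val F n\<^esub> y) = \<pi> n x \<oplus>\<^bsub>val V n\<^esub> \<pi> n y"
    and pi_surj: "w \<in> carrier (val V n) \<Longrightarrow> \<exists>x\<in>carrier (val F n). \<pi> n x = w"
    and pi_act: "\<lbrakk>f \<in> Hom n t; x \<in> carrier (val F n)\<rbrakk> \<Longrightarrow> \<pi> t (act F f x) = act V f (\<pi> n x)"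
begin

definition ker :: "'m obj \<Rightarrow> 'a set" where
  "ker n = {x \<in> carrier (val F n). \<pi> n x = \<zero>\<^bsub>val V n\<^esub>}"

abbreviation K where "K \<equiv> restrict_cmod F ker"

lemma pi_hom: "abelian_group_hom (val F n) (val V n) (\<pi> n)"
  by (rule abelian_group_homI) (auto simp: F.grp V.grp group_hom_def group_hom_axioms_def hom_def pi_closed pi_add
      intro: F.grp.a_group V.grp.a_group)

lemma pi_zero: "\<pi> n \<zero>\<^bsub>val F n\<^esub> = \<zero>\<^bsub>val V n\<^esub>"
  by (rule abelian_group_hom.hom_zero[OF pi_hom])

lemma pi_minus: "x \<in> carrier (val F n) \<Longrightarrow> \<pi> n (\<ominus>\<^bsub>val F n\<^esub> x) = \<ominus>\<^bsub>val V n\<^esub> \<pi> n x"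
  by (rule abelian_group_hom.hom_a_inv[OF pi_hom])

lemma pi_diff: "\<lbrakk>x \<in> carrier (val F n); y \<in> carrier (val F n)\<rbrakk>
    \<Longrightarrow> \<pi> n (x \<ominus>\<^bsub>val F n\<^esub> y) = \<pi> n x \<ominus>\<^bsub>val V n\<^esub> \<pi> n y"
  by (simp add: a_minus_def pi_add pi_minus)

lemma val_K: "val K n = (val F n)\<lparr>carrier := ker n\<rparr>" and act_K: "act K = act F"
  by (simp_all add: restrict_cmod_def)

lemma K_simps [simp]: "carrier (val K n) = ker n" "\<zero>\<^bsub>val K n\<^esub> = \<zero>\<^bsub>val F n\<^esub>"
  "x \<oplus>\<^bsub>val K n\<^esub> y = x \<oplus>\<^bsub>val F n\<^esub> y" "act K = act F"
  by (simp_all add: restrict_cmod_def)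

lemma ker_closed: "x \<in> ker n \<Longrightarrow> x \<in> carrier (val F n)" by (simp add: ker_def)

lemma ker_zero: "\<zero>\<^bsub>val F n\<^esub> \<in> ker n" by (simp add: ker_def pi_zero)

lemma ker_add: "x \<in> ker n \<Longrightarrow> y \<in> ker n \<Longrightarrow> x \<oplus>\<^bsub>val F n\<^esub> y \<in> ker n"
  by (simp add: ker_def pi_add)

lemma ker_minus: "x \<in> ker n \<Longrightarrow> \<ominus>\<^bsub>val F n\<^esub> x \<in> ker n"
  by (simp add: ker_def pi_minus)

lemma ker_diff: "x \<in> ker n \<Longrightarrow> y \<in> ker n \<Longrightarrow> x \<ominus>\<^bsub>val F n\<^esub> y \<in> ker n"
  by (simp add: a_minus_def ker_add ker_minus)

lemma ker_act: "f \<in> Hom n t \<Longrightarrow> x \<in> ker n \<Longrightarrow> act F f x \<in> ker t"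
  by (simp add: ker_def F.act_closed pi_act V.act_zero)

lemma afun_K: "afun K"
proof (rule afun.intro)
  show "abelian_group (val K n)" for n
  proof (rule abelian_groupI)
    fix x assume "x \<in> carrier (val K n)"
    thus "\<exists>y\<in>carrier (val K n). y \<oplus>\<^bsub>val K n\<^esub> x = \<zero>\<^bsub>val K n\<^esub>"
      by (auto intro!: bexI[of _ "\<ominus>\<^bsub>val F n\<^esub> x"] ker_minus simp: F.grp.l_neg ker_closed)
  qed (auto intro: ker_add ker_zero simp: ker_closed F.grp.a_ac)
qed (auto intro: ker_act simp: ker_closed F.act_add F.act_id F.act_comp)

sublocale K: afun K by (rule afun_K)

lemma miss_K_sub: "w \<in> miss K A t \<Longrightarrow> w \<in> miss F A t"
  by (induction rule: miss.induct) (auto intro: miss.intros ker_closed)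

lemma pi_miss: "w \<in> miss F A t \<Longrightarrow> \<pi> t w \<in> miss V A t"
proof (induction rule: miss.induct)
  case (step g p y w)
  thus ?case by (simp add: pi_add F.act_closed F.miss_closed pi_act pi_closed miss.step)
qed (simp add: pi_zero miss.zero)

lemma miss_lift: "w \<in> miss V A t \<Longrightarrow> \<exists>u\<in>miss F A t. \<pi> t u = w"
proof (induction rule: miss.induct)
  case zero show ?case using miss.zero pi_zero by metis
next
  case (step g p y w)
  then obtain u x where "u \<in> miss F A t" "\<pi> t u = w" "x \<in> carrier (val F p)" "\<pi> p x = y"
    using pi_surj by blast
  moreover from this have "\<pi> t (act F g x \<oplus>\<^bsub>val F t\<^esub> u) = act V g y \<oplus>\<^bsub>val V t\<^esub> w"
    using step by (simp add: pi_add F.act_closed F.miss_closed pi_act)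
  ultimately show ?case using step miss.step by metis
qed

text \<open>
  The sequence \<open>K\<^sub>n \<rightarrow> F\<^sub>n / miss F A n \<rightarrow> V\<^sub>n / miss V A n \<rightarrow> 0\<close> is exact.
\<close>

lemma lift_mod_ker:
  assumes "x \<in> carrier (val F n)" "\<pi> n x \<in> miss V A n"
  obtains k u where "k \<in> ker n" "u \<in> miss F A n" "x = k \<oplus>\<^bsub>val F n\<^esub> u"
proof -
  obtain u where u: "u \<in> miss F A n" "\<pi> n u = \<pi> n x" using miss_lift assms(2) by metis
  have "x \<ominus>\<^bsub>val F n\<^esub> u \<in> ker n"
    using assms(1) u F.miss_closed[OF u(1)]
    by (simp add: ker_def pi_diff pi_closed V.grp.diff_self)
  thus ?thesis using that u F.grp.split_summand F.miss_closed assms(1) by metis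
qed

text \<open>
  Injectivity of \<open>K\<^sub>t / miss K A t \<rightarrow> F\<^sub>t / miss F A t\<close>.
\<close>

definition pure :: "('m \<times> nat) set \<Rightarrow> 'm obj \<Rightarrow> bool" where
  "pure A t \<longleftrightarrow> (\<forall>z\<in>ker t. z \<in> miss F A t \<longrightarrow> z \<in> miss K A t)"

text \<open>
  Induction on \<open>A\<close>: if \<open>z \<in> K\<^sub>t\<close> is the sum of \<open>s \<in> miss F A t\<close> and of \<open>h y\<close> with \<open>h\<close> missing only \<open>b\<close>,
  then \<open>h\<close> maps the class of \<open>y\<close> in \<open>V\<close> into \<open>miss V A t\<close>.  By saturation of \<open>V\<close> one can
  replace \<open>y\<close> by an element of \<open>K\<close>, at the cost of changing \<open>s\<close>.  The bound on the cardinality in the second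
  assumption is what makes the lemma available inside the induction of \<open>saturated_quotient\<close>.
\<close>

lemma pure_of_saturated_at:
  assumes "A \<subseteq> full t" "\<And>n B. B \<subseteq> full n \<Longrightarrow> card B < card A \<Longrightarrow> saturated_at V n B"
  shows "pure A t"
proof -
  have "finite A" using assms(1) finite_subset finite_full by blast
  thus ?thesis using assms
  proof (induction A rule: finite_induct)
    case empty
    thus ?case by (simp add: pure_def F.miss_empty K.miss_empty)
  next
    case (insert b A)
    have IH: "pure A t" by (rule insert.IH) (use insert in \<open>auto\<close>)
    obtain n h where h: "h \<in> Hom n t" "img h = full t - {b}" using Hom_with_img[of "full t - {b}" t] by blast
    have "A \<subseteq> img h" using insert h by auto
    then obtain A' where A': "A' \<subseteq> full n" "A = app h ` A'"
      using h(1) by (auto simp: img_Hom subset_image_iff)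
    have cA: "card A' < card (insert b A)"
      using A' insert inj_on_subset[OF inj_on_app[OF h(1)]] by (simp add: card_image)
    show ?case unfolding pure_def
    proof (intro ballI impI)
      fix z assume z: "z \<in> ker t" "z \<in> miss F (insert b A) t"
      obtain s y where sy: "s \<in> miss F A t" "y \<in> carrier (val F n)" "z = s \<oplus>\<^bsub>val F t\<^esub> act F h y"
        using F.miss_insert[OF z(2) h] by blast
      have "\<pi> t s \<oplus>\<^bsub>val V t\<^esub> act V h (\<pi> n y) = \<zero>\<^bsub>val V t\<^esub>"
        using z(1) sy h by (simp add: ker_def pi_add F.miss_closed F.act_closed pi_act)
      hence "act V h (\<pi> n y) = \<ominus>\<^bsub>val V t\<^esub> \<pi> t s"
        by (intro V.grp.eq_minus_of_sum_zero) (use sy h in \<open>auto simp: pi_closed F.miss_closed V.act_closed\<close>)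
      hence "act V h (\<pi> n y) \<in> miss V (app h ` A') t"
        using V.miss_minus[OF pi_miss[OF sy(1)]] A' by simp
      hence "\<pi> n y \<in> miss V A' n"
        by (intro saturated_atD[OF insert.prems(2)[OF A'(1) cA] h(1)] pi_closed sy)
      then obtain k u where ku: "k \<in> ker n" "u \<in> miss F A' n" "y = k \<oplus>\<^bsub>val F n\<^esub> u"
        using lift_mod_ker sy by metis
      have hu: "act F h u \<in> miss F A t" using F.act_miss[OF ku(2) h(1) A'(1)] A' by simp
      define s' where "s' = s \<oplus>\<^bsub>val F t\<^esub> act F h u"
      have s': "s' \<in> miss F A t" using sy hu F.miss_add by (simp add: s'_def)
      have cl: "s \<in> carrier (val F t)" "act F h u \<in> carrier (val F t)" "act F h k \<in> carrier (val F t)"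
        "s' \<in> carrier (val F t)"
        using F.miss_closed[OF sy(1)] F.miss_closed[OF hu] F.miss_closed[OF s'] F.act_closed[OF h(1)] ker_closed[OF ku(1)] by auto
      have z': "z = act F h k \<oplus>\<^bsub>val F t\<^esub> s'"
        using sy(3) ku cl F.act_add[OF h(1) ker_closed[OF ku(1)] F.miss_closed[OF ku(2)]] by (simp add: s'_def F.grp.a_ac)
      have "s' = z \<ominus>\<^bsub>val F t\<^esub> act F h k"
        using cl unfolding z' by (simp add: F.grp.sum_diff_left)
      hence "s' \<in> ker t" using z(1) ker_act[OF h(1) ku(1)] ker_diff by simp
      hence "s' \<in> miss K A t" using IH s' by (simp add: pure_def)
      hence "s' \<in> miss K (insert b A) t" using K.miss_mono by blast
      moreover have "act K h k \<in> miss K (insert b A) t"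
        by (rule K.act_in_miss[OF h(1)]) (use ku h in auto)
      ultimately show "z \<in> miss K (insert b A) t" using K.miss_add[of "act K h k" "insert b A" t s'] z' by simp
    qed
  qed
qed

lemma pure_of_saturated: "saturated V \<Longrightarrow> A \<subseteq> full t \<Longrightarrow> pure A t"
  by (rule pure_of_saturated_at) (auto simp: saturated_def)

lemma saturated_K:
  assumes "saturated F" "saturated V"
  shows "saturated K"
  unfolding saturated_def saturated_at_def
proof (intro allI impI ballI)
  fix n A t h v assume A: "A \<subseteq> full n" and h: "h \<in> Hom n t" and v: "v \<in> carrier (val K n)"
    and "act K h v \<in> miss K (app h ` A) t"
  hence "act F h v \<in> miss F (app h ` A) t" using miss_K_sub by simp
  hence "v \<in> miss F A n" using saturatedD[OF assms(1) A h] v ker_closed by simp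
  thus "v \<in> miss K A n" using pure_of_saturated[OF assms(2) A] v by (simp add: pure_def)
qed

lemma saturated_extension:
  assumes "saturated K" "saturated V"
  shows "saturated F"
  unfolding saturated_def saturated_at_def
proof (intro allI impI ballI)
  fix n A t h v assume A: "A \<subseteq> full n" and h: "h \<in> Hom n t" and v: "v \<in> carrier (val F n)"
    and hv: "act F h v \<in> miss F (app h ` A) t"
  have A': "app h ` A \<subseteq> full t" using A h app_in_full by blast
  have "act V h (\<pi> n v) \<in> miss V (app h ` A) t" using pi_miss[OF hv] pi_act[OF h v] by simp
  hence "\<pi> n v \<in> miss V A n" using saturatedD[OF assms(2) A h pi_closed[OF v]] by blast
  then obtain k u where ku: "k \<in> ker n" "u \<in> miss F A n" "v = k \<oplus>\<^bsub>val F n\<^esub> u"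
    using lift_mod_ker v by metis
  have hu: "act F h u \<in> miss F (app h ` A) t" by (rule F.act_miss[OF ku(2) h A])
  have cl: "act F h k \<in> carrier (val F t)" "act F h u \<in> carrier (val F t)"
    using F.miss_closed[OF hu] F.act_closed[OF h ker_closed[OF ku(1)]] by auto
  have "act F h k = act F h v \<ominus>\<^bsub>val F t\<^esub> act F h u"
    using F.act_add[OF h ker_closed[OF ku(1)] F.miss_closed[OF ku(2)]] ku(3) cl
    by (simp add: F.grp.sum_diff_right)
  hence "act F h k \<in> miss F (app h ` A) t" using F.miss_diff[OF hv hu] by simp
  hence "act K h k \<in> miss K (app h ` A) t"
    using pure_of_saturated[OF assms(2) A'] ker_act[OF h ku(1)] by (simp add: pure_def)
  hence "k \<in> miss K A n" using saturatedD[OF assms(1) A h, of k] ku(1) by simp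
  thus "v \<in> miss F A n" using F.miss_add miss_K_sub ku by blast
qed

text \<open>
  Downward induction on \<open>A\<close>: write \<open>z = s + h y\<close> according to purity for \<open>insert b A\<close>, with \<open>y \<in> K\<close>.
  Then \<open>h y = z - s\<close> lies in \<open>miss F A t\<close>, saturation of \<open>F\<close> moves this to the source of \<open>h\<close>, where
  one point less remains outside \<open>A\<close>, and purity there finishes.
\<close>

lemma pure_all:
  assumes sF: "saturated F" and full: "\<And>t. pure (full t) t" and "A \<subseteq> full t"
  shows "pure A t"
  using assms(3)
proof (induction "card (full t - A)" arbitrary: A t)
  case 0
  hence "A = full t" by auto
  thus ?case using full by simp
next
  case (Suc c)
  then obtain b where b: "b \<in> full t" "b \<notin> A" by (metis Diff_eq_empty_iff card.empty nat.distinct(1) subsetI)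
  obtain n h where h: "h \<in> Hom n t" "img h = full t - {b}" using Hom_with_img[of "full t - {b}" t] by blast
  have "A \<subseteq> img h" using Suc b h by auto
  then obtain A' where A': "A' \<subseteq> full n" "A = app h ` A'"
    using h(1) by (auto simp: img_Hom subset_image_iff)
  have "full t - insert b A = (full t - A) - {b}" by blast
  hence c1: "card (full t - insert b A) = c" using Suc b by simp
  have "app h ` (full n - A') = full t - insert b A"
    using h(2) A' b inj_on_image_set_diff[OF inj_on_app[OF h(1)], of "full n" A'] by (auto simp: img_Hom[OF h(1)])
  hence c2: "card (full n - A') = c"
    using c1 inj_on_subset[OF inj_on_app[OF h(1)], of "full n - A'"] by (metis Diff_subset card_image)
  have p1: "pure (insert b A) t" using Suc.hyps(1)[OF c1[symmetric]] Suc b by simp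
  have p2: "pure A' n" using Suc.hyps(1)[OF c2[symmetric]] A' by simp
  show ?case unfolding pure_def
  proof (intro ballI impI)
    fix z assume z: "z \<in> ker t" "z \<in> miss F A t"
    have "z \<in> miss K (insert b A) t" using p1 z F.miss_mono[OF z(2), of "insert b A"] by (auto simp: pure_def)
    from K.miss_insert[OF this h]
    obtain s y where sy: "s \<in> miss K A t" "y \<in> ker n" "z = s \<oplus>\<^bsub>val F t\<^esub> act F h y"
      by auto
    have cl: "s \<in> carrier (val F t)" "act F h y \<in> carrier (val F t)"
      using K.miss_closed[OF sy(1)] ker_closed F.act_closed[OF h(1)] sy(2) by auto
    have "act F h y = z \<ominus>\<^bsub>val F t\<^esub> s"
      using cl sy(3) by (simp add: F.grp.sum_diff_left)
    hence "act F h y \<in> miss F (app h ` A') t" using F.miss_diff[OF z(2) miss_K_sub[OF sy(1)]] A' by simp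
    hence "y \<in> miss F A' n" using saturatedD[OF sF A'(1) h(1)] ker_closed[OF sy(2)] by blast
    hence "y \<in> miss K A' n" using p2 sy(2) by (simp add: pure_def)
    hence "act K h y \<in> miss K A t" using K.act_miss[OF _ h(1) A'(1)] A'(2) by blast
    thus "z \<in> miss K A t" using K.miss_add[OF sy(1), of "act K h y"] sy(3) by simp
  qed
qed

text \<open>
  If the part \<open>z\<close> of \<open>h p\<close> lying in the kernel may be chosen to come from objects missing \<open>b\<close> or a point of \<open>h A\<close>,
  then subtracting from \<open>p\<close> an element of the kernel makes \<open>h p\<close> an element of \<open>miss F (h A) t\<close>.
\<close>

lemma descend_saturation:
  assumes sF: "saturated_at F n A" and h: "h \<in> Hom n t" "img h = full t - {b}"
    and p: "p \<in> carrier (val F n)" and z: "z \<in> miss K (insert b (app h ` A)) t"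
    and u: "u \<in> miss F (app h ` A) t" and hp: "act F h p = z \<oplus>\<^bsub>val F t\<^esub> u"
  shows "\<pi> n p \<in> miss V A n"
proof -
  obtain s y where sy: "s \<in> miss K (app h ` A) t" "y \<in> ker n" "z = s \<oplus>\<^bsub>val F t\<^esub> act F h y"
    using K.miss_insert[OF z h] by auto
  have cl: "u \<in> carrier (val F t)" "act F h y \<in> carrier (val F t)" "s \<in> carrier (val F t)"
    using F.act_closed[OF h(1)] ker_closed sy(2) F.miss_closed[OF u] F.miss_closed[OF miss_K_sub[OF sy(1)]] by auto
  have "act F h (p \<ominus>\<^bsub>val F n\<^esub> y) = act F h p \<ominus>\<^bsub>val F t\<^esub> act F h y"
    using h(1) p ker_closed[OF sy(2)] by (simp add: a_minus_def F.act_add F.act_minus)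
  also have "\<dots> = s \<oplus>\<^bsub>val F t\<^esub> u" unfolding hp sy(3) using cl by (simp add: F.grp.sum_diff_middle)
  finally have "act F h (p \<ominus>\<^bsub>val F n\<^esub> y) \<in> miss F (app h ` A) t"
    using F.miss_add[OF miss_K_sub[OF sy(1)] u] by simp
  hence "p \<ominus>\<^bsub>val F n\<^esub> y \<in> miss F A n" using saturated_atD[OF sF h(1)] p ker_closed[OF sy(2)] by simp
  hence "\<pi> n (p \<ominus>\<^bsub>val F n\<^esub> y) \<in> miss V A n" by (rule pi_miss)
  moreover have "\<pi> n (p \<ominus>\<^bsub>val F n\<^esub> y) = \<pi> n p"
    using p sy(2) ker_closed[OF sy(2)] pi_closed[OF p] by (simp add: pi_diff ker_def V.grp.diff_zero)
  ultimately show ?thesis by simp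
qed

lemma saturated_of_pure:
  assumes sF: "saturated F" and full: "\<And>t. pure (full t) t"
  shows "saturated V"
proof -
  have "saturated_at V n A" if "A \<subseteq> full n" for n A
  proof (rule V.saturated_at_of_one_point[OF _ that refl])
    fix n t A h v b
    assume A: "A \<subseteq> full n" and h: "h \<in> Hom n t" "b \<in> full t" "img h = full t - {b}"
      and v: "v \<in> carrier (val V n)" and hv: "act V h v \<in> miss V (app h ` A) t"
    obtain p where p: "p \<in> carrier (val F n)" "\<pi> n p = v" using pi_surj v by blast
    have "\<pi> t (act F h p) \<in> miss V (app h ` A) t" using hv pi_act[OF h(1) p(1)] p by simp
    then obtain z u where zu: "z \<in> ker t" "u \<in> miss F (app h ` A) t" "act F h p = z \<oplus>\<^bsub>val F t\<^esub> u"
      using lift_mod_ker F.act_closed[OF h(1) p(1)] by metis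
    have A': "insert b (app h ` A) \<subseteq> full t" using A h app_in_full by blast
    have cl: "z \<in> carrier (val F t)" "u \<in> carrier (val F t)" using zu ker_closed F.miss_closed by blast+
    have "z = act F h p \<ominus>\<^bsub>val F t\<^esub> u" using zu(3) cl by (simp add: F.grp.sum_diff_right)
    moreover have "act F h p \<in> miss F (insert b (app h ` A)) t" by (rule F.act_in_miss[OF h(1)]) (use h p in auto)
    moreover have "u \<in> miss F (insert b (app h ` A)) t" using F.miss_mono[OF zu(2)] by blast
    ultimately have "z \<in> miss F (insert b (app h ` A)) t" using F.miss_diff by simp
    hence zK: "z \<in> miss K (insert b (app h ` A)) t" using pure_all[OF sF full A'] zu by (simp add: pure_def)
    have "\<pi> n p \<in> miss V A n"
      by (rule descend_saturation[OF _ h(1,3) p(1) zK zu(2,3)]) (use sF A in \<open>simp add: saturated_def\<close>)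
    thus "v \<in> miss V A n" by (simp add: p(2))
  qed
  thus ?thesis by (simp add: saturated_def)
qed

lemma saturated_iff_pure:
  assumes "saturated F"
  shows "saturated V \<longleftrightarrow> (\<forall>t. pure (full t) t)"
  using saturated_of_pure[OF assms] pure_of_saturated by blast

text \<open>
  Induction on the cardinality of \<open>A\<close>, so that purity is available for sets of the size of \<open>A\<close>.  Let
  \<open>h\<close> miss only \<open>b\<close>, and suppose that \<open>h v\<close> lies in \<open>miss V (h A) t\<close>.  A lift \<open>p\<close> of \<open>v\<close> satisfies
  \<open>h p = z + u\<close> with \<open>z \<in> K\<close> and \<open>u \<in> miss F (h A) t\<close>; the class of \<open>z\<close> is the image of \<open>v\<close> under the connecting
  map from the kernel of the map induced by \<open>h\<close>.  The two placements \<open>g\<close> and \<open>g'\<close> of \<open>b\<close> agree on the range of \<open>h\<close>,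
  so \<open>g z\<close> and \<open>g' z\<close> agree modulo \<open>miss F (g h A)\<close> and hence, by purity, modulo \<open>miss K (g h A)\<close>.  As \<open>g'\<close>
  misses \<open>g b\<close>, the element \<open>g z\<close> comes from objects missing \<open>g b\<close> or a point of \<open>g h A\<close>, and
  saturation of \<open>K\<close> removes \<open>g\<close>.
\<close>

lemma saturated_quotient:
  assumes sK: "saturated K" and sF: "saturated F"
  shows "saturated V"
proof -
  have "saturated_at V n A" if "A \<subseteq> full n" for n A
    using that
  proof (induction "card A" arbitrary: n A rule: less_induct)
    case less
    have IH: "saturated_at V n B" if "B \<subseteq> full n" "card B < card A" for n B using less.hyps that by blast
    show ?case
    proof (rule V.saturated_at_of_one_point[OF _ less.prems refl])
      fix n t A' h v b
      assume A: "A' \<subseteq> full n" and cA: "card A' = card A" and h: "h \<in> Hom n t" "b \<in> full t" "img h = full t - {b}"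
        and v: "v \<in> carrier (val V n)" and hv: "act V h v \<in> miss V (app h ` A') t"
      obtain p where p: "p \<in> carrier (val F n)" "\<pi> n p = v" using pi_surj v by blast
      have "\<pi> t (act F h p) \<in> miss V (app h ` A') t" using hv pi_act[OF h(1) p(1)] p by simp
      then obtain z u where zu: "z \<in> ker t" "u \<in> miss F (app h ` A') t" "act F h p = z \<oplus>\<^bsub>val F t\<^esub> u"
        using lift_mod_ker F.act_closed[OF h(1) p(1)] by metis
      have cl: "z \<in> carrier (val F t)" "u \<in> carrier (val F t)" using zu ker_closed F.miss_closed by blast+
      have hA: "app h ` A' \<subseteq> full t" "b \<notin> app h ` A'" using A h app_in_full by (auto simp: img_Hom[OF h(1)])
      obtain t' g g' where g: "g \<in> Hom t t'" "g' \<in> Hom t t'"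
        "\<And>z. z \<in> full t \<Longrightarrow> z \<noteq> b \<Longrightarrow> app g z = app g' z" "app g b \<notin> img g'"
        using two_new_points[OF h(2)] by metis
      have "comp_mor g h = comp_mor g' h"
      proof (rule Hom_eqI[of _ n t'])
        fix x assume x: "x \<in> full n"
        hence "app h x \<noteq> b" using h by (auto simp: img_Hom[OF h(1)])
        thus "app (comp_mor g h) x = app (comp_mor g' h) x"
          using x h g(3) app_in_full[OF h(1)] by (simp add: app_comp)
      qed (use g h in auto)
      hence gg: "act F g (act F h p) = act F g' (act F h p)"
        using F.act_comp[OF h(1) g(1) p(1)] F.act_comp[OF h(1) g(2) p(1)] by simp
      have gA: "app g' ` app h ` A' = app g ` app h ` A'"
        by (rule image_cong[OF refl]) (metis g(3) hA subsetD)
      have gzu: "act F g z \<oplus>\<^bsub>val F t'\<^esub> act F g u = act F g' z \<oplus>\<^bsub>val F t'\<^esub> act F g' u"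
        using gg F.act_add[OF g(1) cl] F.act_add[OF g(2) cl] zu(3) by simp
      have cl': "act F g z \<in> carrier (val F t')" "act F g u \<in> carrier (val F t')"
        "act F g' z \<in> carrier (val F t')" "act F g' u \<in> carrier (val F t')"
        using F.act_closed g cl by auto
      have d: "act F g z \<ominus>\<^bsub>val F t'\<^esub> act F g' z = act F g' u \<ominus>\<^bsub>val F t'\<^esub> act F g u"
        using F.grp.diff_eq_of_sum_eq cl' gzu by blast
      let ?A = "app g ` app h ` A'"
      have "act F g' u \<ominus>\<^bsub>val F t'\<^esub> act F g u \<in> miss F ?A t'"
        using F.miss_diff[OF F.act_miss[OF zu(2) g(2) hA(1), unfolded gA] F.act_miss[OF zu(2) g(1) hA(1)]] .
      moreover have "act F g z \<ominus>\<^bsub>val F t'\<^esub> act F g' z \<in> ker t'" by (intro ker_diff ker_act[OF g(1)] ker_act[OF g(2)] zu)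
      moreover have "pure ?A t'"
      proof (rule pure_of_saturated_at)
        show "?A \<subseteq> full t'" using hA g(1) app_in_full by blast
        have "card ?A \<le> card A" using cA card_image_le[of A' "app h"] card_image_le[of "app h ` A'" "app g"]
          finite_subset[OF A finite_full] by simp
        thus "\<And>n B. B \<subseteq> full n \<Longrightarrow> card B < card ?A \<Longrightarrow> saturated_at V n B" using IH by fastforce
      qed
      ultimately have "act F g z \<ominus>\<^bsub>val F t'\<^esub> act F g' z \<in> miss K ?A t'"
        using d unfolding pure_def by metis
      hence 1: "act F g z \<ominus>\<^bsub>val F t'\<^esub> act F g' z \<in> miss K (app g ` insert b (app h ` A')) t'"
        by (rule K.miss_mono) auto
      have 2: "act F g' z \<in> miss K (app g ` insert b (app h ` A')) t'"
        using K.act_in_miss[OF g(2), of "app g ` insert b (app h ` A')" z] g(4) zu(1) by auto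
      have "act F g z \<in> miss K (app g ` insert b (app h ` A')) t'"
        using K.miss_add[OF 1 2] F.grp.split_summand[OF cl'(1,3)] by simp
      hence zK: "z \<in> miss K (insert b (app h ` A')) t"
        using saturatedD[OF sK _ g(1), of "insert b (app h ` A')" z] zu(1) hA h(2) by simp
      have "\<pi> n p \<in> miss V A' n"
        by (rule descend_saturation[OF _ h(1,3) p(1) zK zu(2,3)]) (use sF A in \<open>simp add: saturated_def\<close>)
      thus "v \<in> miss V A' n" by (simp add: p(2))
    qed
  qed
  thus ?thesis by (simp add: saturated_def)
qed

end

text \<open>
  A retraction of the action of \<open>h\<close> that turns the image of a morphism missing a point of \<open>h A\<close> into a combination
  of images of morphisms missing a point of \<open>A\<close> maps \<open>miss V (h A) t\<close> to \<open>miss V A n\<close>.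
\<close>

lemma (in afun) saturated_of_retractions:
  assumes r_zero: "\<And>n t h. h \<in> Hom n t \<Longrightarrow> r h \<zero>\<^bsub>val V t\<^esub> = \<zero>\<^bsub>val V n\<^esub>"
    and r_add: "\<And>n t h x y. \<lbrakk>h \<in> Hom n t; x \<in> carrier (val V t); y \<in> carrier (val V t)\<rbrakk>
      \<Longrightarrow> r h (x \<oplus>\<^bsub>val V t\<^esub> y) = r h x \<oplus>\<^bsub>val V n\<^esub> r h y"
    and r_act: "\<And>n t h v. \<lbrakk>h \<in> Hom n t; v \<in> carrier (val V n)\<rbrakk> \<Longrightarrow> r h (act V h v) = v"
    and r_miss: "\<And>n t h A p g y. \<lbrakk>h \<in> Hom n t; A \<subseteq> full n; g \<in> Hom p t; \<not> app h ` A \<subseteq> img g;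
      y \<in> carrier (val V p)\<rbrakk> \<Longrightarrow> r h (act V g y) \<in> miss V A n"
  shows "saturated V"
  unfolding saturated_def saturated_at_def
proof (intro allI impI ballI)
  fix n A t h v assume A: "A \<subseteq> full n" and h: "h \<in> Hom n t" and v: "v \<in> carrier (val V n)"
    and hv: "act V h v \<in> miss V (app h ` A) t"
  have "r h w \<in> miss V A n" if "w \<in> miss V (app h ` A) t" for w
    using that
  proof (induction rule: miss.induct)
    case zero show ?case using r_zero[OF h] miss.zero by metis
  next
    case (step g p y w)
    have "r h (act V g y \<oplus>\<^bsub>val V t\<^esub> w) = r h (act V g y) \<oplus>\<^bsub>val V n\<^esub> r h w"
      by (rule r_add[OF h]) (use step in \<open>auto intro: act_closed miss_closed\<close>)
    thus ?case using miss_add[OF r_miss[OF h A step(1,2,3)] step.IH] by simp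
  qed
  from this[OF hv] show "v \<in> miss V A n" by (simp add: r_act[OF h v])
qed

section \<open>Free modules over the category\<close>

text \<open>
  As a rewrite rule, \<open>Hom_src\<close> loops on assumptions of the form \<open>f \<in> Hom (src f) t\<close>.
\<close>

declare Hom_src [simp del]

locale coeff_ring = cring R for R :: "'k ring" (structure)

definition sing :: "'k ring \<Rightarrow> 's \<Rightarrow> 'k \<Rightarrow> 's \<Rightarrow> 'k" where
  "sing R s a = (\<lambda>x. if x = s then a else \<zero>\<^bsub>R\<^esub>)"

lemma free_module_simps [simp]:
  "\<zero>\<^bsub>free_module R S\<^esub> = (\<lambda>s. \<zero>\<^bsub>R\<^esub>)"
  "p \<oplus>\<^bsub>free_module R S\<^esub> q = (\<lambda>s. p s \<oplus>\<^bsub>R\<^esub> q s)"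
  "a \<odot>\<^bsub>free_module R S\<^esub> p = (\<lambda>s. a \<otimes>\<^bsub>R\<^esub> p s)"
  by (simp_all add: free_module_def)

lemma free_module_carrier: "p \<in> carrier (free_module R S) \<longleftrightarrow>
    (\<forall>s\<in>S. p s \<in> carrier R) \<and> (\<forall>s. s \<notin> S \<longrightarrow> p s = \<zero>\<^bsub>R\<^esub>) \<and> finite {s. p s \<noteq> \<zero>\<^bsub>R\<^esub>}"
  by (simp add: free_module_def)

context coeff_ring
begin

lemma free_coeff_closed: "p \<in> carrier (free_module R S) \<Longrightarrow> p s \<in> carrier R"
  by (cases "s \<in> S") (auto simp: free_module_carrier)

lemma free_supp: "p \<in> carrier (free_module R S) \<Longrightarrow> p s \<noteq> \<zero> \<Longrightarrow> s \<in> S"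
  by (auto simp: free_module_carrier)

lemma free_finite: "p \<in> carrier (free_module R S) \<Longrightarrow> finite {s. p s \<noteq> \<zero>}"
  by (auto simp: free_module_carrier)

lemma free_moduleI:
  "\<lbrakk>\<And>s. p s \<in> carrier R; \<And>s. p s \<noteq> \<zero> \<Longrightarrow> s \<in> S; finite {s. p s \<noteq> \<zero>}\<rbrakk> \<Longrightarrow> p \<in> carrier (free_module R S)"
  by (auto simp: free_module_carrier)

lemma sing_in_free: "\<lbrakk>s \<in> S; a \<in> carrier R\<rbrakk> \<Longrightarrow> sing R s a \<in> carrier (free_module R S)"
  by (rule free_moduleI) (auto simp: sing_def split: if_splits intro: finite_subset[of _ "{s}"])

lemma free_add_closed:
  assumes "p \<in> carrier (free_module R S)" "q \<in> carrier (free_module R S)"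
  shows "(\<lambda>s. p s \<oplus> q s) \<in> carrier (free_module R S)"
proof (rule free_moduleI)
  show "s \<in> S" if "p s \<oplus> q s \<noteq> \<zero>" for s
    using that free_supp[OF assms(1), of s] free_supp[OF assms(2), of s] by (metis r_zero zero_closed)
  have "{s. p s \<oplus> q s \<noteq> \<zero>} \<subseteq> {s. p s \<noteq> \<zero>} \<union> {s. q s \<noteq> \<zero>}" by auto
  thus "finite {s. p s \<oplus> q s \<noteq> \<zero>}" using free_finite[OF assms(1)] free_finite[OF assms(2)]
    by (meson finite_UnI finite_subset)
qed (use assms in \<open>auto intro: free_coeff_closed\<close>)

lemma free_smult_closed:
  assumes "p \<in> carrier (free_module R S)" "a \<in> carrier R"
  shows "(\<lambda>s. a \<otimes> p s) \<in> carrier (free_module R S)"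
proof (rule free_moduleI)
  show "s \<in> S" if "a \<otimes> p s \<noteq> \<zero>" for s
    using that free_supp[OF assms(1), of s] assms(2) by (metis r_null)
  have "{s. a \<otimes> p s \<noteq> \<zero>} \<subseteq> {s. p s \<noteq> \<zero>}" using assms by auto
  thus "finite {s. a \<otimes> p s \<noteq> \<zero>}" using free_finite[OF assms(1)] finite_subset by blast
qed (use assms in \<open>auto intro: free_coeff_closed\<close>)

lemma free_minus_closed:
  assumes "p \<in> carrier (free_module R S)"
  shows "(\<lambda>s. \<ominus> p s) \<in> carrier (free_module R S)"
proof -
  have "(\<lambda>s. (\<ominus> \<one>) \<otimes> p s) = (\<lambda>s. \<ominus> p s)"
    using assms by (intro ext) (simp add: l_minus free_coeff_closed)
  thus ?thesis using free_smult_closed[OF assms, of "\<ominus> \<one>"] by simp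
qed

lemma free_zero_closed: "(\<lambda>s. \<zero>) \<in> carrier (free_module R S)"
  by (rule free_moduleI) auto

lemma free_abelian_group: "abelian_group (free_module R S)"
proof (rule abelian_groupI)
  fix p assume p: "p \<in> carrier (free_module R S)"
  show "\<exists>q\<in>carrier (free_module R S). q \<oplus>\<^bsub>free_module R S\<^esub> p = \<zero>\<^bsub>free_module R S\<^esub>"
    using p by (intro bexI[OF _ free_minus_closed[OF p]]) (auto simp: l_neg free_coeff_closed)
qed (auto simp: free_add_closed free_zero_closed free_coeff_closed a_ac)

lemma free_is_module: "Module.module R (free_module R S)"
  by (rule moduleI)
    (auto simp: is_cring free_abelian_group free_smult_closed free_coeff_closed l_distr r_distr m_assoc)

lemma free_induct [consumes 1, case_names zero add]:
  assumes p: "p \<in> carrier (free_module R S)" and zero: "P (\<lambda>s. \<zero>)"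
    and add: "\<And>s a p. \<lbrakk>s \<in> S; a \<in> carrier R; p \<in> carrier (free_module R S); P p\<rbrakk>
      \<Longrightarrow> P (\<lambda>x. sing R s a x \<oplus> p x)"
  shows "P p"
  using p
proof (induction "card {s. p s \<noteq> \<zero>}" arbitrary: p)
  case 0
  hence "p = (\<lambda>s. \<zero>)" using free_finite[OF 0(2)] by (auto simp: card_eq_0_iff)
  thus ?case using zero by simp
next
  case (Suc n)
  have fin: "finite {s. p s \<noteq> \<zero>}" by (rule free_finite[OF Suc.prems])
  obtain s where s: "p s \<noteq> \<zero>" using Suc.hyps(2) by (metis (mono_tags, lifting) card.empty empty_Collect_eq nat.distinct(1))
  define q where "q = (\<lambda>x. if x = s then \<zero> else p x)"
  have supp: "{x. q x \<noteq> \<zero>} = {x. p x \<noteq> \<zero>} - {s}" by (auto simp: q_def)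
  have q: "q \<in> carrier (free_module R S)"
  proof (rule free_moduleI)
    show "finite {x. q x \<noteq> \<zero>}" using supp fin by simp
    show "q x \<in> carrier R" for x using free_coeff_closed[OF Suc.prems] by (simp add: q_def)
    show "x \<in> S" if "q x \<noteq> \<zero>" for x using that free_supp[OF Suc.prems, of x] by (auto simp: q_def split: if_splits)
  qed
  have "n = card {x. q x \<noteq> \<zero>}" using supp fin s Suc.hyps(2) by simp
  hence "P q" using Suc.hyps(1) q by blast
  hence "P (\<lambda>x. sing R s (p s) x \<oplus> q x)"
    using add[OF free_supp[OF Suc.prems s] free_coeff_closed[OF Suc.prems] q] by blast
  moreover have "(\<lambda>x. sing R s (p s) x \<oplus> q x) = p"
    using free_coeff_closed[OF Suc.prems] by (auto simp: sing_def q_def)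
  ultimately show ?case by simp
qed

end

locale fcmodule = cmodule R V for R :: "'k ring" and V :: "('m::finite, 'k, 'v) cmod"

sublocale fcmodule \<subseteq> afun V
proof (rule afun.intro)
  show "abelian_group (val V n)" for n using module[of n] by (simp add: module_def)
qed (rule act_closed act_add act_id act_comp; assumption)+

sublocale fcmodule \<subseteq> val: Module.module R "val V n" for n
  by (rule module)

sublocale fcmodule \<subseteq> coeff: coeff_ring R
  by (rule coeff_ring.intro) (rule val.is_cring)


definition symb :: "('m obj \<Rightarrow> 'x set) \<Rightarrow> 'm obj \<Rightarrow> ('m mor \<times> 'x) set" where
  "symb X t = {(f, x). \<exists>n. f \<in> Hom n t \<and> x \<in> X n}"

lemma symb_iff: "(f, x) \<in> symb X t \<longleftrightarrow> f \<in> Hom (src f) t \<and> x \<in> X (src f)"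
  unfolding symb_def using Hom_src by fastforce

lemma symbI: "f \<in> Hom n t \<Longrightarrow> x \<in> X n \<Longrightarrow> (f, x) \<in> symb X t"
  unfolding symb_def by blast

lemma val_free: "val (free_cmod R X) t = free_module R (symb X t)"
  by (simp add: free_cmod_def symb_def)

context coeff_ring
begin

text \<open>
  As \<open>g\<close> is injective, it moves the coefficient of \<open>(f, x)\<close> to \<open>(g f, x)\<close>; the defining sum of the action has at most one
  term.
\<close>

lemma free_act_comp:
  assumes g: "g \<in> Hom t u" and p: "p \<in> carrier (free_module R (symb X t))" and f: "f \<in> Hom n t"
  shows "act (free_cmod R X) g p (comp_mor g f, x) = p (f, x)"
proof -
  let ?S = "{f'. p (f', x) \<noteq> \<zero> \<and> src g = tgt f' \<and> comp_mor g f' = comp_mor g f}"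
  have unique: "f' = f" if "p (f', x) \<noteq> \<zero>" "comp_mor g f' = comp_mor g f" for f'
  proof -
    have f': "f' \<in> Hom (src f') t" using free_supp[OF p that(1)] by (simp add: symb_iff)
    have "src f' = n" using arg_cong[OF that(2), of src] Hom_src[OF f] by simp
    thus ?thesis using comp_left_cancel[OF _ f g that(2)] f' by simp
  qed
  have S: "?S = (if p (f, x) = \<zero> then {} else {f})"
  proof (cases "p (f, x) = \<zero>")
    case True
    hence "f' \<notin> ?S" for f' using unique[of f'] by blast
    thus ?thesis using True by auto
  next
    case False
    have "f \<in> ?S" using False Hom_src[OF g] f by simp
    moreover have "?S \<subseteq> {f}"
    proof
      fix f' assume "f' \<in> ?S"
      hence "f' = f" by (intro unique) simp_all
      thus "f' \<in> {f}" by simp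
    qed
    ultimately have "?S = {f}" by (intro equalityI) simp_all
    thus ?thesis using False by simp
  qed
  have "act (free_cmod R X) g p (comp_mor g f, x) = (\<Oplus>f\<in>?S. p (f, x))" by (simp add: free_cmod_def)
  also have "\<dots> = p (f, x)" unfolding S using free_coeff_closed[OF p, of "(f, x)"] by simp
  finally show ?thesis .
qed

lemma free_act_nonzero:
  assumes g: "g \<in> Hom t u" and p: "p \<in> carrier (free_module R (symb X t))"
    and "act (free_cmod R X) g p (h, x) \<noteq> \<zero>"
  obtains f where "f \<in> Hom (src f) t" "h = comp_mor g f" "x \<in> X (src f)" "p (f, x) \<noteq> \<zero>"
proof -
  let ?S = "{f'. p (f', x) \<noteq> \<zero> \<and> src g = tgt f' \<and> comp_mor g f' = h}"
  have "?S \<noteq> {}"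
  proof
    assume e: "?S = {}"
    have "act (free_cmod R X) g p (h, x) = (\<Oplus>f\<in>?S. p (f, x))" by (simp add: free_cmod_def)
    thus False using assms(3) unfolding e by simp
  qed
  then obtain f where "p (f, x) \<noteq> \<zero>" "comp_mor g f = h" by blast
  with free_supp[OF p this(1)] show ?thesis using that by (auto simp: symb_iff)
qed

lemma free_act_eqI:
  assumes g: "g \<in> Hom t u" and p: "p \<in> carrier (free_module R (symb X t))"
    and 1: "\<And>f x. f \<in> Hom (src f) t \<Longrightarrow> q (comp_mor g f, x) = p (f, x)"
    and 2: "\<And>h x. (\<And>f. f \<in> Hom (src f) t \<Longrightarrow> h \<noteq> comp_mor g f) \<Longrightarrow> q (h, x) = \<zero>"
  shows "act (free_cmod R X) g p = q"
proof (rule ext, unfold split_paired_all)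
  fix h x
  show "act (free_cmod R X) g p (h, x) = q (h, x)"
  proof (cases "\<exists>f. f \<in> Hom (src f) t \<and> h = comp_mor g f")
    case True
    then obtain f where f: "f \<in> Hom (src f) t" "h = comp_mor g f" by blast
    show ?thesis unfolding f(2) free_act_comp[OF g p f(1)] 1[OF f(1)] ..
  next
    case False
    hence "q (h, x) = \<zero>" using 2 by blast
    moreover have "act (free_cmod R X) g p (h, x) = \<zero>"
    proof (rule ccontr)
      assume "act (free_cmod R X) g p (h, x) \<noteq> \<zero>"
      then obtain f where "f \<in> Hom (src f) t" "h = comp_mor g f" by (rule free_act_nonzero[OF g p])
      thus False using False by blast
    qed
    ultimately show ?thesis by simp
  qed
qed

lemma free_act_other:
  assumes g: "g \<in> Hom t u" and p: "p \<in> carrier (free_module R (symb X t))"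
    and "\<And>f. f \<in> Hom (src f) t \<Longrightarrow> h \<noteq> comp_mor g f"
  shows "act (free_cmod R X) g p (h, x) = \<zero>"
proof (rule ccontr)
  assume "act (free_cmod R X) g p (h, x) \<noteq> \<zero>"
  then obtain f where "f \<in> Hom (src f) t" "h = comp_mor g f" by (rule free_act_nonzero[OF g p])
  thus False using assms(3) by blast
qed

lemma free_act_closed:
  assumes g: "g \<in> Hom t u" and p: "p \<in> carrier (free_module R (symb X t))"
  shows "act (free_cmod R X) g p \<in> carrier (free_module R (symb X u))"
proof (rule free_moduleI)
  let ?q = "act (free_cmod R X) g p"
  show "?q s \<in> carrier R" for s
  proof -
    obtain h x where s: "s = (h, x)" by (cases s)
    show ?thesis
    proof (cases "?q s = \<zero>")
      case False
      hence "?q (h, x) \<noteq> \<zero>" by (simp add: s)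
      then obtain f where f: "f \<in> Hom (src f) t" "h = comp_mor g f" by (rule free_act_nonzero[OF g p])
      show ?thesis unfolding s f(2) free_act_comp[OF g p f(1)] by (rule free_coeff_closed[OF p])
    qed simp
  qed
  show "s \<in> symb X u" if nz: "?q s \<noteq> \<zero>" for s
  proof -
    obtain h x where s: "s = (h, x)" by (cases s)
    have "?q (h, x) \<noteq> \<zero>" using nz by (simp add: s)
    then obtain f where f: "f \<in> Hom (src f) t" "h = comp_mor g f" "x \<in> X (src f)"
      by (rule free_act_nonzero[OF g p])
    have "h \<in> Hom (src f) u" unfolding f(2) by (rule comp_in_Hom[OF f(1) g])
    thus ?thesis using f(3) unfolding s symb_def by blast
  qed
  have "{s. ?q s \<noteq> \<zero>} \<subseteq> (\<lambda>(f, x). (comp_mor g f, x)) ` {z. p z \<noteq> \<zero>}"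
  proof
    fix s assume nz: "s \<in> {s. ?q s \<noteq> \<zero>}"
    obtain h x where s: "s = (h, x)" by (cases s)
    have "?q (h, x) \<noteq> \<zero>" using nz by (simp add: s)
    then obtain f where "h = comp_mor g f" "p (f, x) \<noteq> \<zero>" by (rule free_act_nonzero[OF g p])
    thus "s \<in> (\<lambda>(f, x). (comp_mor g f, x)) ` {z. p z \<noteq> \<zero>}"
      using s by (intro image_eqI[of _ _ "(f, x)"]) auto
  qed
  thus "finite {s. ?q s \<noteq> \<zero>}" using free_finite[OF p] by (meson finite_imageI finite_subset)
qed

lemma free_act_sing:
  assumes g: "g \<in> Hom t u" and f: "f \<in> Hom n t" "x \<in> X n" "a \<in> carrier R"
  shows "act (free_cmod R X) g (sing R (f, x) a) = sing R (comp_mor g f, x) a"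
proof (rule free_act_eqI[OF g sing_in_free])
  show "(f, x) \<in> symb X t" using f by (intro symbI)
  show "sing R (comp_mor g f, x) a (comp_mor g f', x') = sing R (f, x) a (f', x')"
    if f': "f' \<in> Hom (src f') t" for f' x'
  proof -
    have "f' = f" if e: "comp_mor g f' = comp_mor g f"
    proof -
      have "src f' = n" using arg_cong[OF e, of src] Hom_src[OF f(1)] by simp
      thus ?thesis using comp_left_cancel[OF _ f(1) g e] f' by simp
    qed
    thus ?thesis by (auto simp: sing_def)
  qed
  show "sing R (comp_mor g f, x) a (h, x') = \<zero>"
    if "\<And>f. f \<in> Hom (src f) t \<Longrightarrow> h \<noteq> comp_mor g f" for h x'
    using that[of f] f(1) Hom_src[OF f(1)] by (auto simp: sing_def)
qed (use f in auto)

lemma free_cmod_cmodule: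
  fixes X :: "'m obj \<Rightarrow> 'x set"
  shows "cmodule R (free_cmod R X)"
proof (rule cmodule.intro)
  show "Module.module R (val (free_cmod R X) n)" for n by (simp add: val_free free_is_module)
  show "act (free_cmod R X) f x \<in> carrier (val (free_cmod R X) t)"
    if "f \<in> Hom n t" "x \<in> carrier (val (free_cmod R X) n)" for f n t x
    using that free_act_closed by (simp add: val_free)
  fix f :: "'m mor" and n t p
  assume f: "f \<in> Hom n t" and "p \<in> carrier (val (free_cmod R X) n)"
  hence p: "p \<in> carrier (free_module R (symb X n))" by (simp add: val_free)
  show "act (free_cmod R X) f (p \<oplus>\<^bsub>val (free_cmod R X) n\<^esub> q)
      = act (free_cmod R X) f p \<oplus>\<^bsub>val (free_cmod R X) t\<^esub> act (free_cmod R X) f q"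
    if "q \<in> carrier (val (free_cmod R X) n)" for q
  proof -
    have q: "q \<in> carrier (free_module R (symb X n))" using that by (simp add: val_free)
    show ?thesis unfolding val_free free_module_simps
      by (rule free_act_eqI[OF f free_add_closed[OF p q]])
        (auto simp: free_act_comp[OF f p] free_act_comp[OF f q] free_act_other[OF f p] free_act_other[OF f q])
  qed
  show "act (free_cmod R X) f (a \<odot>\<^bsub>val (free_cmod R X) n\<^esub> p)
      = a \<odot>\<^bsub>val (free_cmod R X) t\<^esub> act (free_cmod R X) f p" if a: "a \<in> carrier R" for a
    unfolding val_free free_module_simps
    by (rule free_act_eqI[OF f free_smult_closed[OF p a]])
      (use a in \<open>auto simp: free_act_comp[OF f p] free_act_other[OF f p]\<close>)
next
  fix n p assume "p \<in> carrier (val (free_cmod R X) n)"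
  hence p: "p \<in> carrier (free_module R (symb X n))" by (simp add: val_free)
  show "act (free_cmod R X) (id_mor n) p = p"
  proof (rule free_act_eqI[OF id_in_Hom p])
    fix h x assume "\<And>f. f \<in> Hom (src f) n \<Longrightarrow> h \<noteq> comp_mor (id_mor n) f"
    hence "h \<notin> Hom (src h) n" using comp_id_left[of h "src h" n] by auto
    thus "p (h, x) = \<zero>" using free_supp[OF p, of "(h, x)"] unfolding symb_iff by blast
  qed simp
next
  fix f g :: "'m mor" and l n t p
  assume f: "f \<in> Hom l n" and g: "g \<in> Hom n t" and "p \<in> carrier (val (free_cmod R X) l)"
  hence p: "p \<in> carrier (free_module R (symb X l))" by (simp add: val_free)
  have fp: "act (free_cmod R X) f p \<in> carrier (free_module R (symb X n))" by (rule free_act_closed[OF f p])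
  show "act (free_cmod R X) (comp_mor g f) p = act (free_cmod R X) g (act (free_cmod R X) f p)"
  proof (rule free_act_eqI[OF comp_in_Hom[OF f g] p])
    fix k x assume k: "k \<in> Hom (src k) l"
    have "comp_mor (comp_mor g f) k = comp_mor g (comp_mor f k)" by (rule comp_assoc[OF k f g, symmetric])
    thus "act (free_cmod R X) g (act (free_cmod R X) f p) (comp_mor (comp_mor g f) k, x) = p (k, x)"
      using free_act_comp[OF g fp comp_in_Hom[OF k f]] free_act_comp[OF f p k] by simp
  next
    fix h x assume h: "\<And>k. k \<in> Hom (src k) l \<Longrightarrow> h \<noteq> comp_mor (comp_mor g f) k"
    show "act (free_cmod R X) g (act (free_cmod R X) f p) (h, x) = \<zero>"
    proof (rule ccontr)
      assume "act (free_cmod R X) g (act (free_cmod R X) f p) (h, x) \<noteq> \<zero>"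
      then obtain f' where f': "f' \<in> Hom (src f') n" "h = comp_mor g f'" "act (free_cmod R X) f p (f', x) \<noteq> \<zero>"
        by (rule free_act_nonzero[OF g fp])
      from f'(3) obtain k where k: "k \<in> Hom (src k) l" "f' = comp_mor f k" by (rule free_act_nonzero[OF f p])
      hence "h = comp_mor (comp_mor g f) k" using f' comp_assoc[OF k(1) f g] by simp
      thus False using h k by blast
    qed
  qed
qed

lemma free_cmod_fcmodule: "fcmodule R (free_cmod R (X :: 'm::finite obj \<Rightarrow> 'x set))"
  by (rule fcmodule.intro[OF free_cmod_cmodule])

text \<open>
  For free modules, \<open>miss\<close> is a condition on the support, which the action of a morphism preserves and reflects.
\<close>

lemma miss_free:
  fixes X :: "'m::finite obj \<Rightarrow> 'x set"
  shows "p \<in> miss (free_cmod R X) A t \<longleftrightarrow>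
    p \<in> carrier (free_module R (symb X t)) \<and> (\<forall>f x. p (f, x) \<noteq> \<zero> \<longrightarrow> \<not> A \<subseteq> img f)"
proof (intro iffI conjI; (elim conjE)?)
  interpret F: fcmodule R "free_cmod R X" by (rule free_cmod_fcmodule)
  show "p \<in> carrier (free_module R (symb X t))" if "p \<in> miss (free_cmod R X) A t"
    using F.miss_closed[OF that] by (simp add: val_free)
  show "\<forall>f x. p (f, x) \<noteq> \<zero> \<longrightarrow> \<not> A \<subseteq> img f" if "p \<in> miss (free_cmod R X) A t"
    using that
  proof (induction rule: miss.induct)
    case zero thus ?case by (simp add: val_free)
  next
    case (step g n y w)
    hence y: "y \<in> carrier (free_module R (symb X n))" by (simp add: val_free)
    show ?case
    proof (intro allI impI)
      fix f x assume "(act (free_cmod R X) g y \<oplus>\<^bsub>val (free_cmod R X) t\<^esub> w) (f, x) \<noteq> \<zero>"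
      hence "act (free_cmod R X) g y (f, x) \<noteq> \<zero> \<or> w (f, x) \<noteq> \<zero>" by (auto simp: val_free)
      thus "\<not> A \<subseteq> img f"
      proof
        assume "act (free_cmod R X) g y (f, x) \<noteq> \<zero>"
        then obtain f' where f': "f' \<in> Hom (src f') n" "f = comp_mor g f'" by (rule free_act_nonzero[OF step(1) y])
        hence "img f \<subseteq> img g" using img_subset_full[OF f'(1)] img_Hom[OF step(1)] by (auto simp: img_comp)
        thus ?thesis using step by blast
      qed (use step in blast)
    qed
  qed
  show "p \<in> miss (free_cmod R X) A t"
    if "p \<in> carrier (free_module R (symb X t))" "\<forall>f x. p (f, x) \<noteq> \<zero> \<longrightarrow> \<not> A \<subseteq> img f"
  proof -
    let ?S = "{(f, x) \<in> symb X t. \<not> A \<subseteq> img f}"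
    have "p \<in> carrier (free_module R ?S)" using that
      by (intro free_moduleI) (auto intro: free_coeff_closed free_supp simp: free_finite)
    thus ?thesis
    proof (induction rule: free_induct)
      case zero show ?case using miss.zero[of "free_cmod R X" t A] by (simp add: val_free)
    next
      case (add s a p)
      obtain f x where s: "s = (f, x)" "f \<in> Hom (src f) t" "x \<in> X (src f)" "\<not> A \<subseteq> img f"
        using add(1) by (auto simp: symb_iff)
      have i: "sing R (id_mor (src f), x) a \<in> carrier (val (free_cmod R X) (src f))"
        unfolding val_free by (rule sing_in_free[OF symbI]) (use s add in auto)
      have "act (free_cmod R X) f (sing R (id_mor (src f), x) a) = sing R s a"
        using free_act_sing[where X = X, OF s(2) id_in_Hom s(3) add(2)] s by simp
      thus ?case using miss.step[OF s(2) s(4) i add.IH] by (simp add: val_free)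
    qed
  qed
qed

lemma saturated_free:
  fixes X :: "'m::finite obj \<Rightarrow> 'x set"
  shows "saturated (free_cmod R X)"
  unfolding saturated_def saturated_at_def
proof (intro allI impI ballI)
  fix n A t h v assume A: "A \<subseteq> full n" and h: "h \<in> Hom n t" and "v \<in> carrier (val (free_cmod R X) n)"
    and hv: "act (free_cmod R X) h v \<in> miss (free_cmod R X) (app h ` A) t"
  hence v: "v \<in> carrier (free_module R (symb X n))" by (simp add: val_free)
  show "v \<in> miss (free_cmod R X) A n" unfolding miss_free
  proof (intro conjI allI impI v notI)
    fix f x assume f: "v (f, x) \<noteq> \<zero>" "A \<subseteq> img f"
    have fH: "f \<in> Hom (src f) n" using free_supp[OF v f(1)] by (simp add: symb_iff)
    have "act (free_cmod R X) h v (comp_mor h f, x) \<noteq> \<zero>" using free_act_comp[OF h v fH] f by simp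
    moreover have "app h ` A \<subseteq> img (comp_mor h f)" using f by (auto simp: img_comp[OF fH])
    ultimately show False using hv unfolding miss_free by blast
  qed
qed

end

text \<open>
  One step of the standard resolution.
\<close>

locale covered = fcmodule R W for R :: "'k ring" and W :: "('m::finite, 'k, 'v) cmod" +
  fixes c :: "'v \<Rightarrow> 'x"
  assumes inj: "inj_on c (carrier (val W n))"
begin

abbreviation "lab \<equiv> (\<lambda>n. c ` carrier (val W n))"

abbreviation "FC \<equiv> free_cover R c W"

abbreviation "\<pi> \<equiv> cover_map R c W"

definition term_of :: "'m obj \<Rightarrow> 'm mor \<times> 'x \<Rightarrow> 'v" where
  "term_of t = (\<lambda>(f, x). act W f (inv_into (carrier (val W (src f))) c x))"

lemma val_FC: "val FC t = free_module R (symb lab t)"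
  by (simp add: free_cover_def val_free)

lemma term_closed: "z \<in> symb lab t \<Longrightarrow> term_of t z \<in> carrier (val W t)"
  by (cases z) (auto simp: symb_iff term_of_def intro!: act_closed inv_into_into)

lemma term_elem: "\<lbrakk>f \<in> Hom n t; y \<in> carrier (val W n)\<rbrakk> \<Longrightarrow> term_of t (f, c y) = act W f y"
  by (simp add: term_of_def Hom_src inv_into_f_f[OF inj])

lemma cover_map_eq:
  assumes p: "p \<in> carrier (val FC t)" and S: "finite S" "{z. p z \<noteq> \<zero>\<^bsub>R\<^esub>} \<subseteq> S" "S \<subseteq> symb lab t"
  shows "\<pi> t p = finsum (val W t) (\<lambda>z. p z \<odot>\<^bsub>val W t\<^esub> term_of t z) S"
proof -
  have p': "p \<in> carrier (free_module R (symb lab t))" using p by (simp add: val_FC)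
  have cl: "p z \<odot>\<^bsub>val W t\<^esub> term_of t z \<in> carrier (val W t)" if "z \<in> S" for z
    using that S term_closed coeff.free_coeff_closed[OF p'] by blast
  have "\<pi> t p = finsum (val W t) (\<lambda>z. p z \<odot>\<^bsub>val W t\<^esub> term_of t z) {z. p z \<noteq> \<zero>\<^bsub>R\<^esub>}"
    unfolding cover_map_def by (rule arg_cong[of _ _ "\<lambda>f. finsum (val W t) f _"]) (auto simp: term_of_def)
  also have "\<dots> = finsum (val W t) (\<lambda>z. p z \<odot>\<^bsub>val W t\<^esub> term_of t z) S"
    by (rule grp.add.finprod_mono_neutral_cong_left) (use S cl term_closed in auto)
  finally show ?thesis .
qed

lemma cover_closed: "p \<in> carrier (val FC t) \<Longrightarrow> \<pi> t p \<in> carrier (val W t)"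
  by (subst cover_map_eq[of p t "{z. p z \<noteq> \<zero>\<^bsub>R\<^esub>}"])
    (auto simp: val_FC coeff.free_finite coeff.free_supp coeff.free_coeff_closed intro!: grp.finsum_closed term_closed)

lemma cover_add:
  assumes p: "p \<in> carrier (val FC t)" and q: "q \<in> carrier (val FC t)"
  shows "\<pi> t (p \<oplus>\<^bsub>val FC t\<^esub> q) = \<pi> t p \<oplus>\<^bsub>val W t\<^esub> \<pi> t q"
proof -
  have p': "p \<in> carrier (free_module R (symb lab t))" and q': "q \<in> carrier (free_module R (symb lab t))"
    using p q by (simp_all add: val_FC)
  define S where "S = {z. p z \<noteq> \<zero>\<^bsub>R\<^esub>} \<union> {z. q z \<noteq> \<zero>\<^bsub>R\<^esub>}"
  have S: "finite S" "S \<subseteq> symb lab t"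
    using coeff.free_finite[OF p'] coeff.free_finite[OF q'] coeff.free_supp[OF p'] coeff.free_supp[OF q'] by (auto simp: S_def)
  have pq: "(\<lambda>z. p z \<oplus>\<^bsub>R\<^esub> q z) \<in> carrier (val FC t)"
    using coeff.free_add_closed[OF p' q'] by (simp add: val_FC)
  have supp: "{z. p z \<oplus>\<^bsub>R\<^esub> q z \<noteq> \<zero>\<^bsub>R\<^esub>} \<subseteq> S" by (auto simp: S_def)
  have tc: "\<And>z. z \<in> S \<Longrightarrow> term_of t z \<in> carrier (val W t)" using S term_closed by blast
  have "\<pi> t (\<lambda>z. p z \<oplus>\<^bsub>R\<^esub> q z) = finsum (val W t) (\<lambda>z. (p z \<oplus>\<^bsub>R\<^esub> q z) \<odot>\<^bsub>val W t\<^esub> term_of t z) S"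
    by (rule cover_map_eq[OF pq S(1) supp S(2)])
  also have "\<dots> = finsum (val W t) (\<lambda>z. p z \<odot>\<^bsub>val W t\<^esub> term_of t z \<oplus>\<^bsub>val W t\<^esub> q z \<odot>\<^bsub>val W t\<^esub> term_of t z) S"
    by (rule grp.finsum_cong') (use tc coeff.free_coeff_closed[OF p'] coeff.free_coeff_closed[OF q']
        in \<open>auto simp: val.smult_l_distr\<close>)
  also have "\<dots> = finsum (val W t) (\<lambda>z. p z \<odot>\<^bsub>val W t\<^esub> term_of t z) S
      \<oplus>\<^bsub>val W t\<^esub> finsum (val W t) (\<lambda>z. q z \<odot>\<^bsub>val W t\<^esub> term_of t z) S"
    by (rule grp.finsum_addf) (use tc coeff.free_coeff_closed[OF p'] coeff.free_coeff_closed[OF q'] in auto)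
  also have "\<dots> = \<pi> t p \<oplus>\<^bsub>val W t\<^esub> \<pi> t q"
    using cover_map_eq[OF p S(1) _ S(2)] cover_map_eq[OF q S(1) _ S(2)] by (simp add: S_def)
  finally show ?thesis by (simp add: val_FC)
qed

lemma cover_sing:
  assumes "f \<in> Hom n t" "y \<in> carrier (val W n)" "a \<in> carrier R"
  shows "\<pi> t (sing R (f, c y) a) = a \<odot>\<^bsub>val W t\<^esub> act W f y"
proof -
  have s: "(f, c y) \<in> symb lab t" using assms by (intro symbI) auto
  have "\<pi> t (sing R (f, c y) a)
      = finsum (val W t) (\<lambda>z. sing R (f, c y) a z \<odot>\<^bsub>val W t\<^esub> term_of t z) {(f, c y)}"
    by (rule cover_map_eq) (use s coeff.sing_in_free[OF s assms(3)] in \<open>auto simp: val_FC sing_def\<close>)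
  also have "\<dots> = a \<odot>\<^bsub>val W t\<^esub> act W f y"
    using assms by (simp add: term_elem sing_def act_closed)
  finally show ?thesis .
qed

lemma cover_zero: "\<pi> t (\<lambda>z. \<zero>\<^bsub>R\<^esub>) = \<zero>\<^bsub>val W t\<^esub>"
proof -
  have "(\<lambda>z. \<zero>\<^bsub>R\<^esub>) \<in> carrier (val FC t)" unfolding val_FC by (rule coeff.free_zero_closed)
  from cover_map_eq[OF this, of "{}"] show ?thesis by simp
qed

sublocale FC: fcmodule R FC
  unfolding free_cover_def by (rule coeff.free_cmod_fcmodule)

lemma FC_induct [consumes 1, case_names zero add]:
  assumes "p \<in> carrier (val FC t)" "P (\<lambda>z. \<zero>\<^bsub>R\<^esub>)"
    and "\<And>n f y a p. \<lbrakk>f \<in> Hom n t; y \<in> carrier (val W n); a \<in> carrier R; p \<in> carrier (val FC t);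
        sing R (f, c y) a \<in> carrier (val FC t); P p\<rbrakk>
      \<Longrightarrow> P (sing R (f, c y) a \<oplus>\<^bsub>val FC t\<^esub> p)"
  shows "P p"
  using assms(1) unfolding val_FC
proof (induction rule: coeff.free_induct)
  case zero show ?case by (rule assms)
next
  case (add s a p)
  obtain f x where s: "s = (f, x)" by (cases s)
  then obtain n y where "f \<in> Hom n t" "y \<in> carrier (val W n)" "x = c y"
    using add(1) by (auto simp: symb_def)
  thus ?case using assms(3)[of f n y a p] add coeff.sing_in_free[OF add(1,2)] by (simp add: s val_FC)
qed

lemma cover_act:
  assumes g: "g \<in> Hom t u" and p: "p \<in> carrier (val FC t)"
  shows "\<pi> u (act FC g p) = act W g (\<pi> t p)"
  using p
proof (induction rule: FC_induct)
  case zero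
  have "act FC g (\<lambda>z. \<zero>\<^bsub>R\<^esub>) = (\<lambda>z. \<zero>\<^bsub>R\<^esub>)" using FC.act_zero[OF g] by (simp add: val_FC)
  thus ?case by (simp add: cover_zero act_zero[OF g])
next
  case (add n f y a p)
  have "act FC g (sing R (f, c y) a) = sing R (comp_mor g f, c y) a"
    unfolding free_cover_def by (rule coeff.free_act_sing[OF g add(1)]) (use add in auto)
  hence "\<pi> u (act FC g (sing R (f, c y) a)) = a \<odot>\<^bsub>val W u\<^esub> act W g (act W f y)"
    using add g by (simp add: cover_sing[OF comp_in_Hom[OF add(1) g]] act_comp)
  also have "\<dots> = act W g (\<pi> t (sing R (f, c y) a))"
    using add g by (simp add: cover_sing act_smult act_closed)
  finally have 1: "\<pi> u (act FC g (sing R (f, c y) a)) = act W g (\<pi> t (sing R (f, c y) a))" .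
  have "\<pi> u (act FC g (sing R (f, c y) a \<oplus>\<^bsub>val FC t\<^esub> p))
      = \<pi> u (act FC g (sing R (f, c y) a)) \<oplus>\<^bsub>val W u\<^esub> \<pi> u (act FC g p)"
    using add g by (simp add: FC.act_add cover_add FC.act_closed)
  also have "\<dots> = act W g (\<pi> t (sing R (f, c y) a) \<oplus>\<^bsub>val W t\<^esub> \<pi> t p)"
    using add g by (simp add: 1 act_add cover_closed)
  also have "\<dots> = act W g (\<pi> t (sing R (f, c y) a \<oplus>\<^bsub>val FC t\<^esub> p))"
    using add by (simp add: cover_add)
  finally show ?case .
qed

lemma cover_smult:
  assumes b: "b \<in> carrier R" and p: "p \<in> carrier (val FC t)"
  shows "\<pi> t (b \<odot>\<^bsub>val FC t\<^esub> p) = b \<odot>\<^bsub>val W t\<^esub> \<pi> t p"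
  using p
proof (induction rule: FC_induct)
  case zero
  thus ?case using b by (simp add: cover_zero val_FC)
next
  case (add n f y a p)
  have "b \<odot>\<^bsub>val FC t\<^esub> sing R (f, c y) a = sing R (f, c y) (b \<otimes>\<^bsub>R\<^esub> a)"
    using b by (auto simp: val_FC sing_def)
  hence 1: "\<pi> t (b \<odot>\<^bsub>val FC t\<^esub> sing R (f, c y) a) = b \<odot>\<^bsub>val W t\<^esub> \<pi> t (sing R (f, c y) a)"
    using add b by (simp add: cover_sing act_closed val.smult_assoc1)
  have "\<pi> t (b \<odot>\<^bsub>val FC t\<^esub> (sing R (f, c y) a \<oplus>\<^bsub>val FC t\<^esub> p))
      = \<pi> t (b \<odot>\<^bsub>val FC t\<^esub> sing R (f, c y) a \<oplus>\<^bsub>val FC t\<^esub> b \<odot>\<^bsub>val FC t\<^esub> p)"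
    by (subst FC.val.smult_r_distr[OF b add(5,4)]) (rule refl)
  also have "\<dots> = \<pi> t (b \<odot>\<^bsub>val FC t\<^esub> sing R (f, c y) a) \<oplus>\<^bsub>val W t\<^esub> \<pi> t (b \<odot>\<^bsub>val FC t\<^esub> p)"
    by (rule cover_add) (use add b FC.val.smult_closed in auto)
  also have "\<dots> = b \<odot>\<^bsub>val W t\<^esub> (\<pi> t (sing R (f, c y) a) \<oplus>\<^bsub>val W t\<^esub> \<pi> t p)"
    unfolding 1 add.IH by (subst val.smult_r_distr) (use add b cover_closed in auto)
  also have "\<dots> = b \<odot>\<^bsub>val W t\<^esub> \<pi> t (sing R (f, c y) a \<oplus>\<^bsub>val FC t\<^esub> p)"
    by (subst cover_add[OF add(5,4)]) (rule refl)
  finally show ?case .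
qed

sublocale epi FC W \<pi>
proof unfold_locales
  show "\<pi> n x \<in> carrier (val W n)" if "x \<in> carrier (val FC n)" for x n by (rule cover_closed[OF that])
  show "\<exists>x\<in>carrier (val FC n). \<pi> n x = w" if "w \<in> carrier (val W n)" for w n
  proof (rule bexI)
    show "\<pi> n (sing R (id_mor n, c w) \<one>\<^bsub>R\<^esub>) = w"
      using that cover_sing[OF id_in_Hom that, of "\<one>\<^bsub>R\<^esub>"] by (simp add: act_id)
    show "sing R (id_mor n, c w) \<one>\<^bsub>R\<^esub> \<in> carrier (val FC n)"
      unfolding val_FC by (rule coeff.sing_in_free[OF symbI]) (use that in auto)
  qed
qed (use cover_add cover_act in auto)

lemma cover_kernel_eq: "cover_kernel R c W = K"
  by (simp add: cover_kernel_def ker_def[abs_def])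

lemma saturated_FC: "saturated FC"
  unfolding free_cover_def by (rule coeff.saturated_free)

lemma cover_kernel_fcmodule: "fcmodule R (cover_kernel R c W)"
  unfolding cover_kernel_eq
proof (rule fcmodule.intro, rule cmodule.intro)
  fix n
  have m: "Module.module R (val FC n)" by (rule FC.module)
  have "submodule (ker n) R (val FC n)"
  proof (rule FC.val.module_incl_imp_submodule)
    show "ker n \<subseteq> carrier (val FC n)" by (auto simp: ker_def)
    show "Module.module R ((val FC n)\<lparr>carrier := ker n\<rparr>)"
    proof (rule moduleI)
      show "cring R" by (rule val.is_cring)
      show "abelian_group ((val FC n)\<lparr>carrier := ker n\<rparr>)" using K.grp[of n] by (simp add: val_K)
      show "a \<odot>\<^bsub>(val FC n)\<lparr>carrier := ker n\<rparr>\<^esub> x \<in> carrier ((val FC n)\<lparr>carrier := ker n\<rparr>)"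
        if "a \<in> carrier R" "x \<in> carrier ((val FC n)\<lparr>carrier := ker n\<rparr>)" for a x
      proof -
        have "x \<in> ker n" using that by simp
        hence "\<pi> n (a \<odot>\<^bsub>val FC n\<^esub> x) = \<zero>\<^bsub>val W n\<^esub>" "a \<odot>\<^bsub>val FC n\<^esub> x \<in> carrier (val FC n)"
          using that(1) cover_smult[OF that(1), of x n] by (auto simp: ker_def FC.val.smult_closed)
        thus ?thesis by (simp add: ker_def)
      qed
    qed (auto simp: ker_def FC.val.smult_l_distr FC.val.smult_r_distr FC.val.smult_assoc1)
  qed
  thus "Module.module R (val K n)" using submodule.submodule_is_module[OF _ m] by (simp add: val_K)
next
  fix f :: "'m mor" and n t a x
  assume "f \<in> Hom n t" "a \<in> carrier R" "x \<in> carrier (val K n)"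
  thus "act K f (a \<odot>\<^bsub>val K n\<^esub> x) = a \<odot>\<^bsub>val K t\<^esub> act K f x"
    using FC.act_smult[of f n t a x] by (simp add: val_K act_K ker_closed)
qed (use K.act_closed K.act_add K.act_id K.act_comp in auto)

lemma saturated_iff_pure_cover: "saturated W \<longleftrightarrow> (\<forall>t. pure (full t) t)"
  by (rule saturated_iff_pure[OF saturated_FC])

text \<open>
  The step that carries saturation through the whole resolution, in both directions.
\<close>

lemma saturated_cover_kernel: "saturated (cover_kernel R c W) \<longleftrightarrow> saturated W"
  unfolding cover_kernel_eq using saturated_K[OF saturated_FC] saturated_quotient[OF _ saturated_FC] by blast

end

lemma syz_label_inj:
  assumes "\<And>p. p \<in> P \<Longrightarrow> finite {z. p z \<noteq> \<zero>\<^bsub>R\<^esub>}"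
  shows "inj_on (syz_label R) P"
proof (rule inj_onI)
  fix p q assume pq: "p \<in> P" "q \<in> P" and eq: "syz_label R p = syz_label R q"
  let ?G = "\<lambda>p. {(p (f, x), f, x) | f x. p (f, x) \<noteq> \<zero>\<^bsub>R\<^esub>}"
  have fin: "finite (?G p)" if "p \<in> P" for p
  proof -
    have "?G p = (\<lambda>z. (p z, z)) ` {z. p z \<noteq> \<zero>\<^bsub>R\<^esub>}" by (auto simp: image_iff)
    thus ?thesis using assms[OF that] by simp
  qed
  have "Abs_fset (?G p) = Abs_fset (?G q)" using eq by (simp add: syz_label_def)
  hence G: "?G p = ?G q" using fin pq by (subst (asm) Abs_fset_inject) auto
  have "p (f, x) = q (f, x)" for f x
  proof -
    have "(p (f, x), f, x) \<in> ?G p \<longleftrightarrow> (p (f, x), f, x) \<in> ?G q"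
      "(q (f, x), f, x) \<in> ?G p \<longleftrightarrow> (q (f, x), f, x) \<in> ?G q" using G by blast+
    thus ?thesis by auto
  qed
  thus "p = q" by auto
qed

context fcmodule
begin

lemma covered_Elem: "covered R V Elem"
  by (rule covered.intro[OF fcmodule_axioms]) (auto simp: covered_axioms_def inj_on_def)

lemma covered_syzygy: "covered R (syzygy R V s) (syz_label R)"
proof (induction s)
  case 0
  interpret C: covered R V Elem by (rule covered_Elem)
  show ?case unfolding syzygy.simps
  proof (rule covered.intro[OF C.cover_kernel_fcmodule], unfold covered_axioms_def, intro allI syz_label_inj)
    fix n p assume "p \<in> carrier (val (cover_kernel R Elem V) n)"
    hence "p \<in> carrier (val C.FC n)" unfolding C.cover_kernel_eq by (simp add: C.ker_closed)
    thus "finite {z. p z \<noteq> \<zero>\<^bsub>R\<^esub>}" unfolding C.val_FC by (rule coeff.free_finite)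
  qed
next
  case (Suc s)
  interpret C: covered R "syzygy R V s" "syz_label R" by (rule Suc)
  show ?case unfolding syzygy.simps
  proof (rule covered.intro[OF C.cover_kernel_fcmodule], unfold covered_axioms_def, intro allI syz_label_inj)
    fix n p assume "p \<in> carrier (val (cover_kernel R (syz_label R) (syzygy R V s)) n)"
    hence "p \<in> carrier (val C.FC n)" unfolding C.cover_kernel_eq by (simp add: C.ker_closed)
    thus "finite {z. p z \<noteq> \<zero>\<^bsub>R\<^esub>}" unfolding C.val_FC by (rule coeff.free_finite)
  qed
qed

lemma saturated_syzygy: "saturated (syzygy R V s) \<longleftrightarrow> saturated V"
proof (induction s)
  case 0
  interpret C: covered R V Elem by (rule covered_Elem)
  show ?case by (simp add: C.saturated_cover_kernel)
next
  case (Suc s)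
  interpret C: covered R "syzygy R V s" "syz_label R" by (rule covered_syzygy)
  show ?case using Suc by (simp add: C.saturated_cover_kernel)
qed

end

section \<open>Tensor products\<close>

text \<open>
  The scalars \<open>A\<close> are not assumed to form a ring, in order to cover the category algebra, which has no unit.
\<close>

locale tensor_pair =
  fixes A :: "('a, 'c) ring_scheme" and X :: "('b, 'a, 'x) bimodule" and Y :: "('a, 'y) module"
  assumes grpX: "abelian_group X" and grpY: "abelian_group Y"
    and rsmult_closed: "\<lbrakk>x \<in> carrier X; a \<in> carrier A\<rbrakk> \<Longrightarrow> rsmult X x a \<in> carrier X"
    and lsmult_closed: "\<lbrakk>a \<in> carrier A; y \<in> carrier Y\<rbrakk> \<Longrightarrow> a \<odot>\<^bsub>Y\<^esub> y \<in> carrier Y"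
begin

sublocale X: abelian_group X by (rule grpX)
sublocale Y: abelian_group Y by (rule grpY)

abbreviation "G \<equiv> pairs_group X Y"
abbreviation "N \<equiv> tensor_relations A X Y"
abbreviation "T \<equiv> tensor A X Y"

lemma G_simps [simp]: "c \<in> carrier G \<longleftrightarrow> Poly_Mapping.keys c \<subseteq> carrier X \<times> carrier Y"
  "c \<otimes>\<^bsub>G\<^esub> d = c + d" "\<one>\<^bsub>G\<^esub> = 0"
  by (simp_all add: pairs_group_def)

lemma G_inv [simp]: "Poly_Mapping.keys c \<subseteq> carrier X \<times> carrier Y \<Longrightarrow> inv\<^bsub>G\<^esub> c = - c"
  by (simp add: pairs_group_def)

sublocale G: comm_group G
  unfolding pairs_group_def by (rule abelian_free_Abelian_group)

definition rels :: "('x \<times> 'y \<Rightarrow>\<^sub>0 int) set" where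
  "rels = {frag_of (x \<oplus>\<^bsub>X\<^esub> x', y) - frag_of (x, y) - frag_of (x', y) | x x' y.
         x \<in> carrier X \<and> x' \<in> carrier X \<and> y \<in> carrier Y}
    \<union> {frag_of (x, y \<oplus>\<^bsub>Y\<^esub> y') - frag_of (x, y) - frag_of (x, y') | x y y'.
         x \<in> carrier X \<and> y \<in> carrier Y \<and> y' \<in> carrier Y}
    \<union> {frag_of (rsmult X x a, y) - frag_of (x, a \<odot>\<^bsub>Y\<^esub> y) | x a y.
         x \<in> carrier X \<and> a \<in> carrier A \<and> y \<in> carrier Y}"

lemma N_eq: "N = generate G rels"
  by (simp add: tensor_relations_def rels_def)

lemma keys_diff3: "Poly_Mapping.keys (frag_of a - frag_of b - frag_of c) \<subseteq> {a, b, c}"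
  using keys_diff[of "frag_of a - frag_of b" "frag_of c"] keys_diff[of "frag_of a" "frag_of b"] by auto

lemma keys_diff2: "Poly_Mapping.keys (frag_of a - frag_of b) \<subseteq> {a, b}"
  using keys_diff[of "frag_of a" "frag_of b"] by auto

lemma rels_sub: "rels \<subseteq> carrier G"
proof
  fix r assume "r \<in> rels"
  then consider (1) x x' y where "r = frag_of (x \<oplus>\<^bsub>X\<^esub> x', y) - frag_of (x, y) - frag_of (x', y)"
      "x \<in> carrier X" "x' \<in> carrier X" "y \<in> carrier Y"
    | (2) x y y' where "r = frag_of (x, y \<oplus>\<^bsub>Y\<^esub> y') - frag_of (x, y) - frag_of (x, y')"
      "x \<in> carrier X" "y \<in> carrier Y" "y' \<in> carrier Y"
    | (3) x a y where "r = frag_of (rsmult X x a, y) - frag_of (x, a \<odot>\<^bsub>Y\<^esub> y)"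
      "x \<in> carrier X" "a \<in> carrier A" "y \<in> carrier Y"
    unfolding rels_def by blast
  thus "r \<in> carrier G"
  proof cases
    case 1 thus ?thesis using keys_diff3[of "(x \<oplus>\<^bsub>X\<^esub> x', y)" "(x, y)" "(x', y)"] by auto
  next
    case 2 thus ?thesis using keys_diff3[of "(x, y \<oplus>\<^bsub>Y\<^esub> y')" "(x, y)" "(x, y')"] by auto
  next
    case 3 thus ?thesis using keys_diff2[of "(rsmult X x a, y)" "(x, a \<odot>\<^bsub>Y\<^esub> y)"] rsmult_closed lsmult_closed by auto
  qed
qed

lemma N_subgroup: "subgroup N G"
  unfolding N_eq by (rule G.generate_is_subgroup[OF rels_sub])

lemma N_normal: "N \<lhd> G"
  by (rule G.normal_iff_subgroup[THEN iffD2, OF N_subgroup])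

sublocale Q: comm_group "G Mod N"
  by (rule G.abelian_FactGroup[OF N_subgroup])

lemma T_simps: "carrier T = carrier (G Mod N)" "\<zero>\<^bsub>T\<^esub> = N"
  "s \<oplus>\<^bsub>T\<^esub> t = s \<otimes>\<^bsub>G Mod N\<^esub> t"
  by (simp_all add: tensor_def Let_def FactGroup_def)

lemma smult_T: "b \<odot>\<^bsub>T\<^esub> t = tensor_map A X Y (\<lambda>x. b \<odot>\<^bsub>X\<^esub> x) id t"
  by (simp add: tensor_def Let_def)

lemma grpT: "abelian_group T"
proof (rule abelian_groupI)
  show "\<exists>s\<in>carrier T. s \<oplus>\<^bsub>T\<^esub> t = \<zero>\<^bsub>T\<^esub>" if "t \<in> carrier T" for t
    using Q.l_inv_ex[of t] that by (auto simp: T_simps FactGroup_def)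
  have one: "\<one>\<^bsub>G Mod N\<^esub> = N" by (simp add: FactGroup_def)
  show "\<zero>\<^bsub>T\<^esub> \<oplus>\<^bsub>T\<^esub> t = t" if "t \<in> carrier T" for t
    using Q.l_one[of t] that one by (simp add: T_simps)
  show "\<zero>\<^bsub>T\<^esub> \<in> carrier T" using Q.one_closed one by (simp add: T_simps)
qed (use Q.m_assoc Q.m_comm Q.m_closed in \<open>auto simp only: T_simps\<close>)

sublocale T: abelian_group T by (rule grpT)

definition cl :: "('x \<times> 'y \<Rightarrow>\<^sub>0 int) \<Rightarrow> ('x \<times> 'y \<Rightarrow>\<^sub>0 int) set" where
  "cl c = N #>\<^bsub>G\<^esub> c"

definition cls :: "'x \<Rightarrow> 'y \<Rightarrow> ('x \<times> 'y \<Rightarrow>\<^sub>0 int) set" where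
  "cls x y = cl (frag_of (x, y))"

lemma cl_closed: "c \<in> carrier G \<Longrightarrow> cl c \<in> carrier T"
  by (auto simp: T_simps cl_def FactGroup_def RCOSETS_def)

lemma cl_cases: assumes "t \<in> carrier T" obtains c where "c \<in> carrier G" "t = cl c"
  using assms by (auto simp: T_simps cl_def FactGroup_def RCOSETS_def)

lemma cl_add: "c \<in> carrier G \<Longrightarrow> d \<in> carrier G \<Longrightarrow> cl (c + d) = cl c \<oplus>\<^bsub>T\<^esub> cl d"
  using normal.rcos_sum[OF N_normal, of c d] by (simp add: T_simps cl_def FactGroup_def)

lemma cl_zero_iff: "c \<in> carrier G \<Longrightarrow> cl c = \<zero>\<^bsub>T\<^esub> \<longleftrightarrow> c \<in> N"
  using G.coset_join1[of N c] G.coset_join2[of c N] subgroup.subset[OF N_subgroup] N_subgroup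
  by (auto simp: cl_def T_simps)

lemma cl_0: "cl 0 = \<zero>\<^bsub>T\<^esub>"
  using subgroup.one_closed[OF N_subgroup] cl_zero_iff[of 0] by simp

lemma cl_uminus: "c \<in> carrier G \<Longrightarrow> cl (- c) = \<ominus>\<^bsub>T\<^esub> cl c"
  by (rule T.eq_minus_of_sum_zero) (use cl_add[of c "- c"] cl_0 cl_closed in \<open>auto\<close>)

lemma cl_diff: "c \<in> carrier G \<Longrightarrow> d \<in> carrier G \<Longrightarrow> cl (c - d) = cl c \<ominus>\<^bsub>T\<^esub> cl d"
  using cl_add[of c "- d"] by (simp add: cl_uminus a_minus_def)

lemma cls_closed [simp]: "\<lbrakk>x \<in> carrier X; y \<in> carrier Y\<rbrakk> \<Longrightarrow> cls x y \<in> carrier T"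
  unfolding cls_def by (rule cl_closed) simp

lemma cl_rel: "r \<in> rels \<Longrightarrow> cl r = \<zero>\<^bsub>T\<^esub>"
  using cl_zero_iff[of r] rels_sub generate.incl[of r rels G] by (auto simp: N_eq)

lemma eq_of_diff3: "\<lbrakk>a \<in> carrier T; b \<in> carrier T; c \<in> carrier T; a \<ominus>\<^bsub>T\<^esub> b \<ominus>\<^bsub>T\<^esub> c = \<zero>\<^bsub>T\<^esub>\<rbrakk> \<Longrightarrow> a = b \<oplus>\<^bsub>T\<^esub> c"
proof -
  assume a: "a \<in> carrier T" "b \<in> carrier T" "c \<in> carrier T" and "a \<ominus>\<^bsub>T\<^esub> b \<ominus>\<^bsub>T\<^esub> c = \<zero>\<^bsub>T\<^esub>"
  hence "a \<ominus>\<^bsub>T\<^esub> b = \<zero>\<^bsub>T\<^esub> \<oplus>\<^bsub>T\<^esub> c" using T.split_summand[of "a \<ominus>\<^bsub>T\<^esub> b" c] T.minus_closed by metis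
  hence "a = c \<oplus>\<^bsub>T\<^esub> b" using a T.split_summand[of a b] T.l_zero by metis
  thus ?thesis using a T.a_comm by metis
qed

lemma cls_add_left:
  assumes "x \<in> carrier X" "x' \<in> carrier X" "y \<in> carrier Y"
  shows "cls (x \<oplus>\<^bsub>X\<^esub> x') y = cls x y \<oplus>\<^bsub>T\<^esub> cls x' y"
proof -
  have "frag_of (x \<oplus>\<^bsub>X\<^esub> x', y) - frag_of (x, y) - frag_of (x', y) \<in> rels"
    using assms by (auto simp: rels_def)
  hence "cl (frag_of (x \<oplus>\<^bsub>X\<^esub> x', y) - frag_of (x, y) - frag_of (x', y)) = \<zero>\<^bsub>T\<^esub>" by (rule cl_rel)
  moreover have "frag_of (x \<oplus>\<^bsub>X\<^esub> x', y) - frag_of (x, y) \<in> carrier G"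
    using keys_diff2[of "(x \<oplus>\<^bsub>X\<^esub> x', y)" "(x, y)"] assms by auto
  ultimately have "cls (x \<oplus>\<^bsub>X\<^esub> x') y \<ominus>\<^bsub>T\<^esub> cls x y \<ominus>\<^bsub>T\<^esub> cls x' y = \<zero>\<^bsub>T\<^esub>"
    using assms by (simp only: cls_def) (subst (asm) cl_diff; simp add: cl_diff)
  thus ?thesis using assms by (intro eq_of_diff3) (auto)
qed

lemma cls_add_right:
  assumes "x \<in> carrier X" "y \<in> carrier Y" "y' \<in> carrier Y"
  shows "cls x (y \<oplus>\<^bsub>Y\<^esub> y') = cls x y \<oplus>\<^bsub>T\<^esub> cls x y'"
proof -
  have "frag_of (x, y \<oplus>\<^bsub>Y\<^esub> y') - frag_of (x, y) - frag_of (x, y') \<in> rels"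
    using assms by (auto simp: rels_def)
  hence "cl (frag_of (x, y \<oplus>\<^bsub>Y\<^esub> y') - frag_of (x, y) - frag_of (x, y')) = \<zero>\<^bsub>T\<^esub>" by (rule cl_rel)
  moreover have "frag_of (x, y \<oplus>\<^bsub>Y\<^esub> y') - frag_of (x, y) \<in> carrier G"
    using keys_diff2[of "(x, y \<oplus>\<^bsub>Y\<^esub> y')" "(x, y)"] assms by auto
  ultimately have "cls x (y \<oplus>\<^bsub>Y\<^esub> y') \<ominus>\<^bsub>T\<^esub> cls x y \<ominus>\<^bsub>T\<^esub> cls x y' = \<zero>\<^bsub>T\<^esub>"
    using assms by (simp only: cls_def) (subst (asm) cl_diff; simp add: cl_diff)
  thus ?thesis using assms by (intro eq_of_diff3) (auto)
qed

lemma cls_balanced: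
  assumes "x \<in> carrier X" "a \<in> carrier A" "y \<in> carrier Y"
  shows "cls (rsmult X x a) y = cls x (a \<odot>\<^bsub>Y\<^esub> y)"
proof -
  have "frag_of (rsmult X x a, y) - frag_of (x, a \<odot>\<^bsub>Y\<^esub> y) \<in> rels"
    using assms by (auto simp: rels_def)
  hence "cl (frag_of (rsmult X x a, y) - frag_of (x, a \<odot>\<^bsub>Y\<^esub> y)) = \<zero>\<^bsub>T\<^esub>" by (rule cl_rel)
  hence "cls (rsmult X x a) y \<ominus>\<^bsub>T\<^esub> cls x (a \<odot>\<^bsub>Y\<^esub> y) = \<zero>\<^bsub>T\<^esub>"
    using assms by (simp add: cls_def cl_diff rsmult_closed lsmult_closed)
  moreover have "cls (rsmult X x a) y \<in> carrier T" "cls x (a \<odot>\<^bsub>Y\<^esub> y) \<in> carrier T"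
    using assms by (auto simp: rsmult_closed lsmult_closed)
  ultimately show ?thesis using T.split_summand T.l_zero by metis
qed

lemma cls_zero_left: "y \<in> carrier Y \<Longrightarrow> cls \<zero>\<^bsub>X\<^esub> y = \<zero>\<^bsub>T\<^esub>"
  using cls_add_left[of "\<zero>\<^bsub>X\<^esub>" "\<zero>\<^bsub>X\<^esub>" y] cls_closed[of "\<zero>\<^bsub>X\<^esub>" y] T.add.r_cancel_one' X.l_zero X.zero_closed by metis

lemma cls_zero_right: "x \<in> carrier X \<Longrightarrow> cls x \<zero>\<^bsub>Y\<^esub> = \<zero>\<^bsub>T\<^esub>"
  using cls_add_right[of x "\<zero>\<^bsub>Y\<^esub>" "\<zero>\<^bsub>Y\<^esub>"] cls_closed[of x "\<zero>\<^bsub>Y\<^esub>"] T.add.r_cancel_one' Y.l_zero Y.zero_closed by metis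

lemma cls_minus_left: "x \<in> carrier X \<Longrightarrow> y \<in> carrier Y \<Longrightarrow> cls (\<ominus>\<^bsub>X\<^esub> x) y = \<ominus>\<^bsub>T\<^esub> cls x y"
  using cls_add_left[of x "\<ominus>\<^bsub>X\<^esub> x" y] cls_zero_left[of y] X.r_neg[of x]
    T.eq_minus_of_sum_zero[OF cls_closed[of x y] cls_closed[of "\<ominus>\<^bsub>X\<^esub> x" y]] X.a_inv_closed by metis

text \<open>
  Sums of pure tensors; negatives are covered by additivity in the first factor, and \<open>all_tsums\<close> yields the induction
  principle \<open>tensor_induct\<close>.
\<close>

inductive_set tsums :: "('x \<times> 'y \<Rightarrow>\<^sub>0 int) set set" where
  zero: "\<zero>\<^bsub>T\<^esub> \<in> tsums"
| add: "\<lbrakk>x \<in> carrier X; y \<in> carrier Y; t \<in> tsums\<rbrakk> \<Longrightarrow> cls x y \<oplus>\<^bsub>T\<^esub> t \<in> tsums"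

lemma tsums_closed: "t \<in> tsums \<Longrightarrow> t \<in> carrier T"
  by (induction rule: tsums.induct) (auto)

lemma tsums_add: "s \<in> tsums \<Longrightarrow> t \<in> tsums \<Longrightarrow> s \<oplus>\<^bsub>T\<^esub> t \<in> tsums"
proof (induction rule: tsums.induct)
  case zero thus ?case by (simp add: tsums_closed)
next
  case (add x y s)
  have "cls x y \<oplus>\<^bsub>T\<^esub> s \<oplus>\<^bsub>T\<^esub> t = cls x y \<oplus>\<^bsub>T\<^esub> (s \<oplus>\<^bsub>T\<^esub> t)"
    using add by (intro T.a_assoc) (auto simp: tsums_closed)
  thus ?case using tsums.add[OF add(1,2) add.IH] add by metis
qed

lemma tsums_minus: "s \<in> tsums \<Longrightarrow> \<ominus>\<^bsub>T\<^esub> s \<in> tsums"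
proof (induction rule: tsums.induct)
  case zero
  have "\<ominus>\<^bsub>T\<^esub> \<zero>\<^bsub>T\<^esub> = \<zero>\<^bsub>T\<^esub>" by (rule T.minus_equality) (auto)
  thus ?case using tsums.zero by metis
next
  case (add x y s)
  have "\<ominus>\<^bsub>T\<^esub> (cls x y \<oplus>\<^bsub>T\<^esub> s) = cls (\<ominus>\<^bsub>X\<^esub> x) y \<oplus>\<^bsub>T\<^esub> \<ominus>\<^bsub>T\<^esub> s"
    using add by (simp add: cls_minus_left T.minus_add tsums_closed)
  thus ?case using tsums.add[OF X.a_inv_closed[OF add(1)] add(2) add.IH] by metis
qed

lemma all_tsums: "t \<in> carrier T \<Longrightarrow> t \<in> tsums"
proof (elim cl_cases)
  fix c assume "c \<in> carrier G" and t: "t = cl c"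
  have "cl c \<in> tsums"
  proof (rule free_Abelian_group_induct[of c "carrier X \<times> carrier Y" "\<lambda>c. cl c \<in> tsums"])
    show "Poly_Mapping.keys c \<subseteq> carrier X \<times> carrier Y" using \<open>c \<in> carrier G\<close> by simp
    show "cl 0 \<in> tsums" using tsums.zero cl_0 by metis
    show "cl (c - d) \<in> tsums" if "Poly_Mapping.keys c \<subseteq> carrier X \<times> carrier Y"
      "Poly_Mapping.keys d \<subseteq> carrier X \<times> carrier Y" "cl c \<in> tsums" "cl d \<in> tsums" for c d
      using that tsums_add[OF _ tsums_minus, of "cl c" "cl d"] by (simp add: cl_diff a_minus_def)
    show "cl (frag_of a) \<in> tsums" if aXY: "a \<in> carrier X \<times> carrier Y" for a
    proof -
      obtain x y where a: "a = (x, y)" "x \<in> carrier X" "y \<in> carrier Y" using aXY by auto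
      have "cls x y \<oplus>\<^bsub>T\<^esub> \<zero>\<^bsub>T\<^esub> \<in> tsums" by (rule tsums.add[OF a(2,3) tsums.zero])
      thus ?thesis using a by (simp add: cls_def[symmetric])
    qed
  qed
  thus "t \<in> tsums" by (simp add: t)
qed

lemma tensor_induct [consumes 1, case_names zero add]:
  assumes "t \<in> carrier T" "P \<zero>\<^bsub>T\<^esub>"
    and "\<And>x y t. \<lbrakk>x \<in> carrier X; y \<in> carrier Y; t \<in> carrier T; P t\<rbrakk> \<Longrightarrow> P (cls x y \<oplus>\<^bsub>T\<^esub> t)"
  shows "P t"
  using all_tsums[OF assms(1)] by (induction rule: tsums.induct) (use assms tsums_closed in blast)+

text \<open>
  The universal property with respect to balanced biadditive maps.
\<close>

lemma tensor_universal:
  fixes H :: "('h, 'q) ring_scheme" and \<beta> :: "'x \<Rightarrow> 'y \<Rightarrow> 'h"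
  assumes H: "abelian_group H"
    and closed: "\<And>x y. x \<in> carrier X \<Longrightarrow> y \<in> carrier Y \<Longrightarrow> \<beta> x y \<in> carrier H"
    and addl: "\<And>x x' y. \<lbrakk>x \<in> carrier X; x' \<in> carrier X; y \<in> carrier Y\<rbrakk> \<Longrightarrow> \<beta> (x \<oplus>\<^bsub>X\<^esub> x') y = \<beta> x y \<oplus>\<^bsub>H\<^esub> \<beta> x' y"
    and addr: "\<And>x y y'. \<lbrakk>x \<in> carrier X; y \<in> carrier Y; y' \<in> carrier Y\<rbrakk> \<Longrightarrow> \<beta> x (y \<oplus>\<^bsub>Y\<^esub> y') = \<beta> x y \<oplus>\<^bsub>H\<^esub> \<beta> x y'"
    and bal: "\<And>x a y. \<lbrakk>x \<in> carrier X; a \<in> carrier A; y \<in> carrier Y\<rbrakk> \<Longrightarrow> \<beta> (rsmult X x a) y = \<beta> x (a \<odot>\<^bsub>Y\<^esub> y)"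
  obtains h where "\<And>t. t \<in> carrier T \<Longrightarrow> h t \<in> carrier H"
    "\<And>s t. s \<in> carrier T \<Longrightarrow> t \<in> carrier T \<Longrightarrow> h (s \<oplus>\<^bsub>T\<^esub> t) = h s \<oplus>\<^bsub>H\<^esub> h t"
    "\<And>x y. x \<in> carrier X \<Longrightarrow> y \<in> carrier Y \<Longrightarrow> h (cls x y) = \<beta> x y"
proof -
  interpret H: abelian_group H by (rule H)
  have im: "(\<lambda>(x, y). \<beta> x y) ` (carrier X \<times> carrier Y) \<subseteq> carrier H" using closed by auto
  obtain k where "k \<in> hom (free_Abelian_group (carrier X \<times> carrier Y)) (add_monoid H)"
    "\<And>z. z \<in> carrier X \<times> carrier Y \<Longrightarrow> k (frag_of z) = (case z of (x, y) \<Rightarrow> \<beta> x y)"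
    by (rule H.add.free_Abelian_group_universal[OF im]) (rule that)
  hence k: "k \<in> hom G (add_monoid H)"
    "\<And>z. z \<in> carrier X \<times> carrier Y \<Longrightarrow> k (frag_of z) = (case z of (x, y) \<Rightarrow> \<beta> x y)"
    by (simp_all add: pairs_group_def)
  have kb: "k (frag_of (x, y)) = \<beta> x y" if "x \<in> carrier X" "y \<in> carrier Y" for x y using that k(2) by simp
  interpret k: group_hom G "add_monoid H" k
    by (unfold_locales) (rule k(1))
  have kdiff: "k (c - d) = k c \<ominus>\<^bsub>H\<^esub> k d" if "c \<in> carrier G" "d \<in> carrier G" for c d
  proof -
    have "k (c \<otimes>\<^bsub>G\<^esub> inv\<^bsub>G\<^esub> d) = k c \<otimes>\<^bsub>add_monoid H\<^esub> inv\<^bsub>add_monoid H\<^esub> k d"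
      using that by (simp only: k.hom_mult G.inv_closed k.hom_inv)
    thus ?thesis using that by (simp add: a_minus_def a_inv_def)
  qed
  have sub0: "subgroup (kernel G (add_monoid H) k) G" by (rule k.subgroup_kernel)
  have "rels \<subseteq> kernel G (add_monoid H) k"
  proof
    fix r assume r: "r \<in> rels"
    have rG: "r \<in> carrier G" using r rels_sub by blast
    from r consider (1) x x' y where "r = frag_of (x \<oplus>\<^bsub>X\<^esub> x', y) - frag_of (x, y) - frag_of (x', y)"
        "x \<in> carrier X" "x' \<in> carrier X" "y \<in> carrier Y"
      | (2) x y y' where "r = frag_of (x, y \<oplus>\<^bsub>Y\<^esub> y') - frag_of (x, y) - frag_of (x, y')"
        "x \<in> carrier X" "y \<in> carrier Y" "y' \<in> carrier Y"
      | (3) x a y where "r = frag_of (rsmult X x a, y) - frag_of (x, a \<odot>\<^bsub>Y\<^esub> y)"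
        "x \<in> carrier X" "a \<in> carrier A" "y \<in> carrier Y"
      unfolding rels_def by blast
    hence "k r = \<zero>\<^bsub>H\<^esub>"
    proof cases
      case 1
      have "frag_of (x \<oplus>\<^bsub>X\<^esub> x', y) - frag_of (x, y) \<in> carrier G"
        using keys_diff2[of "(x \<oplus>\<^bsub>X\<^esub> x', y)" "(x, y)"] 1 by auto
      hence "k r = k (frag_of (x \<oplus>\<^bsub>X\<^esub> x', y)) \<ominus>\<^bsub>H\<^esub> k (frag_of (x, y)) \<ominus>\<^bsub>H\<^esub> k (frag_of (x', y))"
        using 1 by (simp only: 1(1)) (subst kdiff; simp add: kdiff)
      also have "\<dots> = \<beta> x y \<oplus>\<^bsub>H\<^esub> \<beta> x' y \<ominus>\<^bsub>H\<^esub> \<beta> x y \<ominus>\<^bsub>H\<^esub> \<beta> x' y" using 1 by (simp add: kb addl)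
      also have "\<dots> = \<zero>\<^bsub>H\<^esub>" using 1 closed by (simp add: H.sum_diff_left H.diff_self)
      finally show ?thesis .
    next
      case 2
      have "frag_of (x, y \<oplus>\<^bsub>Y\<^esub> y') - frag_of (x, y) \<in> carrier G"
        using keys_diff2[of "(x, y \<oplus>\<^bsub>Y\<^esub> y')" "(x, y)"] 2 by auto
      hence "k r = k (frag_of (x, y \<oplus>\<^bsub>Y\<^esub> y')) \<ominus>\<^bsub>H\<^esub> k (frag_of (x, y)) \<ominus>\<^bsub>H\<^esub> k (frag_of (x, y'))"
        using 2 by (simp only: 2(1)) (subst kdiff; simp add: kdiff)
      also have "\<dots> = \<beta> x y \<oplus>\<^bsub>H\<^esub> \<beta> x y' \<ominus>\<^bsub>H\<^esub> \<beta> x y \<ominus>\<^bsub>H\<^esub> \<beta> x y'" using 2 by (simp add: kb addr)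
      also have "\<dots> = \<zero>\<^bsub>H\<^esub>" using 2 closed by (simp add: H.sum_diff_left H.diff_self)
      finally show ?thesis .
    next
      case 3
      thus ?thesis by (simp add: kdiff kb bal rsmult_closed lsmult_closed closed H.diff_self)
    qed
    thus "r \<in> kernel G (add_monoid H) k" using rG by (simp add: kernel_def)
  qed
  hence "N \<subseteq> kernel G (add_monoid H) k" unfolding N_eq by (rule G.generate_subgroup_incl[OF _ sub0])
  then obtain h where h: "h \<in> hom (G Mod N) (add_monoid H)" "\<And>c. c \<in> carrier G \<Longrightarrow> h (N #>\<^bsub>G\<^esub> c) = k c"
    by (rule k.FactGroup_universal_kernel[OF N_normal]) (rule that)
  show ?thesis
  proof (rule that)
    show "h t \<in> carrier H" if "t \<in> carrier T" for t using h(1) that by (auto simp: hom_def T_simps)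
    show "h (s \<oplus>\<^bsub>T\<^esub> t) = h s \<oplus>\<^bsub>H\<^esub> h t" if "s \<in> carrier T" "t \<in> carrier T" for s t
      using h(1) that by (auto simp: hom_def T_simps)
    show "h (cls x y) = \<beta> x y" if "x \<in> carrier X" "y \<in> carrier Y" for x y
      using h(2)[of "frag_of (x, y)"] kb that by (simp add: cls_def cl_def)
  qed
qed

end

text \<open>
  Functoriality of the tensor product in both factors.
\<close>

locale tensor_pair_map = P: tensor_pair A X Y + P': tensor_pair A X' Y'
  for A :: "('a, 'c) ring_scheme" and X :: "('b, 'a, 'x) bimodule" and Y :: "('a, 'y) module"
    and X' :: "('b, 'a, 'u) bimodule" and Y' :: "('a, 'v) module" +
  fixes \<phi> :: "'x \<Rightarrow> 'u" and \<psi> :: "'y \<Rightarrow> 'v"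
  assumes phi_closed: "x \<in> carrier X \<Longrightarrow> \<phi> x \<in> carrier X'"
    and psi_closed: "y \<in> carrier Y \<Longrightarrow> \<psi> y \<in> carrier Y'"
    and phi_add: "\<lbrakk>x \<in> carrier X; x' \<in> carrier X\<rbrakk> \<Longrightarrow> \<phi> (x \<oplus>\<^bsub>X\<^esub> x') = \<phi> x \<oplus>\<^bsub>X'\<^esub> \<phi> x'"
    and psi_add: "\<lbrakk>y \<in> carrier Y; y' \<in> carrier Y\<rbrakk> \<Longrightarrow> \<psi> (y \<oplus>\<^bsub>Y\<^esub> y') = \<psi> y \<oplus>\<^bsub>Y'\<^esub> \<psi> y'"
    and phi_smult: "\<lbrakk>x \<in> carrier X; a \<in> carrier A\<rbrakk> \<Longrightarrow> \<phi> (rsmult X x a) = rsmult X' (\<phi> x) a"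
    and psi_smult: "\<lbrakk>a \<in> carrier A; y \<in> carrier Y\<rbrakk> \<Longrightarrow> \<psi> (a \<odot>\<^bsub>Y\<^esub> y) = a \<odot>\<^bsub>Y'\<^esub> \<psi> y"
begin

abbreviation "F \<equiv> frag_extend (\<lambda>(u, v). frag_of (\<phi> u, \<psi> v))"
abbreviation "tmap \<equiv> tensor_map A X' Y' \<phi> \<psi>"

lemma F_closed: assumes "c \<in> carrier P.G" shows "F c \<in> carrier P'.G"
proof -
  have "(\<Union>x\<in>Poly_Mapping.keys c. Poly_Mapping.keys (case x of (u, v) \<Rightarrow> frag_of (\<phi> u, \<psi> v)))
      \<subseteq> carrier X' \<times> carrier Y'"
    using assms phi_closed psi_closed by auto
  thus ?thesis using keys_frag_extend[of "\<lambda>(u, v). frag_of (\<phi> u, \<psi> v)" c] by simp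
qed

lemma F_rels: assumes "r \<in> P.rels" shows "F r \<in> P'.rels"
proof -
  from assms consider (1) x x' y where "r = frag_of (x \<oplus>\<^bsub>X\<^esub> x', y) - frag_of (x, y) - frag_of (x', y)"
      "x \<in> carrier X" "x' \<in> carrier X" "y \<in> carrier Y"
    | (2) x y y' where "r = frag_of (x, y \<oplus>\<^bsub>Y\<^esub> y') - frag_of (x, y) - frag_of (x, y')"
      "x \<in> carrier X" "y \<in> carrier Y" "y' \<in> carrier Y"
    | (3) x a y where "r = frag_of (rsmult X x a, y) - frag_of (x, a \<odot>\<^bsub>Y\<^esub> y)"
      "x \<in> carrier X" "a \<in> carrier A" "y \<in> carrier Y"
    unfolding P.rels_def by blast
  thus ?thesis
  proof cases
    case 1
    hence "F r = frag_of (\<phi> x \<oplus>\<^bsub>X'\<^esub> \<phi> x', \<psi> y) - frag_of (\<phi> x, \<psi> y) - frag_of (\<phi> x', \<psi> y)"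
      by (simp add: frag_extend_diff phi_add)
    thus ?thesis unfolding P'.rels_def using 1 phi_closed psi_closed by blast
  next
    case 2
    hence "F r = frag_of (\<phi> x, \<psi> y \<oplus>\<^bsub>Y'\<^esub> \<psi> y') - frag_of (\<phi> x, \<psi> y) - frag_of (\<phi> x, \<psi> y')"
      by (simp add: frag_extend_diff psi_add)
    thus ?thesis unfolding P'.rels_def using 2 phi_closed psi_closed by blast
  next
    case 3
    hence "F r = frag_of (rsmult X' (\<phi> x) a, \<psi> y) - frag_of (\<phi> x, a \<odot>\<^bsub>Y'\<^esub> \<psi> y)"
      by (simp add: frag_extend_diff phi_smult psi_smult)
    thus ?thesis unfolding P'.rels_def using 3 phi_closed psi_closed by blast
  qed
qed

lemma F_N: assumes "r \<in> P.N" shows "F r \<in> P'.N"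
proof -
  have "subgroup {c \<in> carrier P.G. F c \<in> P'.N} P.G"
  proof (rule P.G.subgroupI)
    show "{c \<in> carrier P.G. F c \<in> P'.N} \<noteq> {}"
      using subgroup.one_closed[OF P'.N_subgroup] by (auto intro!: exI[of _ 0])
    show "inv\<^bsub>P.G\<^esub> c \<in> {c \<in> carrier P.G. F c \<in> P'.N}" if c: "c \<in> {c \<in> carrier P.G. F c \<in> P'.N}" for c
    proof -
      have "F (- c) = inv\<^bsub>P'.G\<^esub> (F c)" using F_closed[of c] c by (simp add: frag_extend_minus)
      thus ?thesis using c subgroup.m_inv_closed[OF P'.N_subgroup] by simp
    qed
    show "c \<otimes>\<^bsub>P.G\<^esub> d \<in> {c \<in> carrier P.G. F c \<in> P'.N}"
      if c: "c \<in> {c \<in> carrier P.G. F c \<in> P'.N}" and d: "d \<in> {c \<in> carrier P.G. F c \<in> P'.N}" for c d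
      using c d subgroup.m_closed[OF P'.N_subgroup, of "F c" "F d"] P.G.m_closed[of c d] by (simp add: frag_extend_add)
  qed blast
  moreover have "P.rels \<subseteq> {c \<in> carrier P.G. F c \<in> P'.N}"
    using P.rels_sub F_rels generate.incl[of _ P'.rels P'.G] unfolding P'.N_eq by blast
  ultimately have "P.N \<subseteq> {c \<in> carrier P.G. F c \<in> P'.N}"
    unfolding P.N_eq by (rule P.G.generate_subgroup_incl[rotated])
  thus ?thesis using assms by blast
qed

lemma tmap_cl:
  assumes c: "c \<in> carrier P.G" shows "tmap (P.cl c) = P'.cl (F c)"
proof -
  have sub: "P'.N \<subseteq> carrier P'.G" by (rule subgroup.subset[OF P'.N_subgroup])
  have *: "P'.N #>\<^bsub>P'.G\<^esub> F d = P'.cl (F c)" if "d \<in> P.cl c" for d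
  proof -
    obtain n where n: "n \<in> P.N" "d = n + c" using \<open>d \<in> P.cl c\<close> by (auto simp: P.cl_def r_coset_def)
    have nG: "n \<in> carrier P.G" using subgroup.subset[OF P.N_subgroup] n by blast
    have "P'.cl (F n) = \<zero>\<^bsub>P'.T\<^esub>" using P'.cl_zero_iff[OF F_closed[OF nG]] F_N[OF n(1)] by blast
    moreover have "P'.cl (F n + F c) = P'.cl (F n) \<oplus>\<^bsub>P'.T\<^esub> P'.cl (F c)"
      by (rule P'.cl_add[OF F_closed[OF nG] F_closed[OF c]])
    ultimately have "P'.cl (F n + F c) = P'.cl (F c)"
      using P'.T.l_zero[OF P'.cl_closed[OF F_closed[OF c]]] by metis
    thus ?thesis by (simp add: n(2) frag_extend_add P'.cl_def)
  qed
  have "c \<in> P.cl c" using P.G.rcos_self[OF c P.N_subgroup] by (simp add: P.cl_def)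
  hence ne: "P.cl c \<noteq> {}" by blast
  have "tmap (P.cl c) = (\<Union>d\<in>P.cl c. P'.N #>\<^bsub>P'.G\<^esub> F d)" by (simp add: tensor_map_def)
  also have "\<dots> = (\<Union>d\<in>P.cl c. P'.cl (F c))" by (rule SUP_cong[OF refl]) (rule *)
  also have "\<dots> = P'.cl (F c)" using ne by simp
  finally show ?thesis .
qed

lemma tmap_cls: "\<lbrakk>x \<in> carrier X; y \<in> carrier Y\<rbrakk> \<Longrightarrow> tmap (P.cls x y) = P'.cls (\<phi> x) (\<psi> y)"
  using tmap_cl[of "frag_of (x, y)"] by (simp add: P.cls_def P'.cls_def)

lemma tmap_closed: "t \<in> carrier P.T \<Longrightarrow> tmap t \<in> carrier P'.T"
  by (elim P.cl_cases) (simp only: tmap_cl P'.cl_closed F_closed)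

lemma tmap_add:
  assumes s: "s \<in> carrier P.T" and t: "t \<in> carrier P.T"
  shows "tmap (s \<oplus>\<^bsub>P.T\<^esub> t) = tmap s \<oplus>\<^bsub>P'.T\<^esub> tmap t"
proof -
  obtain c where c: "c \<in> carrier P.G" "s = P.cl c" using P.cl_cases[OF s] .
  obtain d where d: "d \<in> carrier P.G" "t = P.cl d" using P.cl_cases[OF t] .
  have "c + d \<in> carrier P.G" using P.G.m_closed[OF c(1) d(1)] by simp
  hence "tmap (P.cl (c + d)) = P'.cl (F c + F d)" by (simp add: tmap_cl frag_extend_add)
  also have "\<dots> = P'.cl (F c) \<oplus>\<^bsub>P'.T\<^esub> P'.cl (F d)" by (rule P'.cl_add[OF F_closed[OF c(1)] F_closed[OF d(1)]])
  finally show ?thesis using P.cl_add[OF c(1) d(1)] c d tmap_cl by metis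
qed

lemma tmap_zero: "tmap \<zero>\<^bsub>P.T\<^esub> = \<zero>\<^bsub>P'.T\<^esub>"
  using tmap_cl[of 0] P.cl_0 P'.cl_0 by simp

end

section \<open>Convolution and the linear extension of the action\<close>

lemma Hom_Mors: "f \<in> Hom n t \<Longrightarrow> f \<in> Mors"
  unfolding Mors_def by blast

lemma comp_in_Mors: "\<lbrakk>g \<in> Mors; f \<in> Mors; src g = tgt f\<rbrakk> \<Longrightarrow> comp_mor g f \<in> Mors"
  unfolding mem_Mors by (metis comp_in_Hom src_comp tgt_comp)

lemma comp_assoc_Mors:
  assumes "g \<in> Mors" "f \<in> Mors" "e \<in> Mors" "src g = tgt f" "src f = tgt e"
  shows "comp_mor g (comp_mor f e) = comp_mor (comp_mor g f) e"
proof (rule comp_assoc)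
  show "e \<in> Hom (src e) (tgt e)" using assms by (simp only: mem_Mors)
  show "f \<in> Hom (tgt e) (tgt f)" using assms by (metis mem_Mors)
  show "g \<in> Hom (tgt f) (tgt g)" using assms by (metis mem_Mors)
qed

lemma delta_sing: "delta R f = sing R f \<one>\<^bsub>R\<^esub>"
  by (simp add: delta_def sing_def)

context coeff_ring
begin

lemma free_mono: "\<lbrakk>p \<in> carrier (free_module R S); S \<subseteq> S'\<rbrakk> \<Longrightarrow> p \<in> carrier (free_module R S')"
  by (rule free_moduleI) (auto intro: free_coeff_closed free_finite dest: free_supp)

text \<open>
  Summing over fixed finite sets containing the supports makes the sums of two convolutions comparable, whence
  additivity in both arguments.
\<close>

lemma convolution_eq:
  assumes p: "p \<in> carrier (free_module R S)" and q: "q \<in> carrier (free_module R S')"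
    and P: "finite P" "{x. p x \<noteq> \<zero>} \<subseteq> P" and Q: "finite Q" "{x. q x \<noteq> \<zero>} \<subseteq> Q"
  shows "convolution R p q h
    = (\<Oplus>z\<in>{(g, f) \<in> P \<times> Q. src g = tgt f \<and> comp_mor g f = h}. case z of (g, f) \<Rightarrow> p g \<otimes> q f)"
  unfolding convolution_def
proof (rule add.finprod_mono_neutral_cong_left)
  show "finite {(g, f) \<in> P \<times> Q. src g = tgt f \<and> comp_mor g f = h}"
    by (rule finite_subset[of _ "P \<times> Q"]) (use P Q in auto)
  show "{(g, f). p g \<noteq> \<zero> \<and> q f \<noteq> \<zero> \<and> src g = tgt f \<and> comp_mor g f = h}
      \<subseteq> {(g, f) \<in> P \<times> Q. src g = tgt f \<and> comp_mor g f = h}"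
    using P Q by auto
  show "(case z of (g, f) \<Rightarrow> p g \<otimes> q f) = \<zero>"
    if "z \<in> {(g, f) \<in> P \<times> Q. src g = tgt f \<and> comp_mor g f = h}
      - {(g, f). p g \<noteq> \<zero> \<and> q f \<noteq> \<zero> \<and> src g = tgt f \<and> comp_mor g f = h}" for z
  proof -
    have "p (fst z) = \<zero> \<or> q (snd z) = \<zero>" using that by (cases z) auto
    thus ?thesis using free_coeff_closed[OF p] free_coeff_closed[OF q] by (cases z) auto
  qed
qed (use free_coeff_closed[OF p] free_coeff_closed[OF q] in auto)

lemma convolution_coeff_closed:
  assumes p: "p \<in> carrier (free_module R S)" and q: "q \<in> carrier (free_module R S')"
  shows "convolution R p q h \<in> carrier R"
  unfolding convolution_def
  by (rule finsum_closed) (use free_coeff_closed[OF p] free_coeff_closed[OF q] in auto)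

lemma convolution_zero_left: "convolution R (\<lambda>x. \<zero>) q = (\<lambda>h. \<zero>)"
  by (simp add: convolution_def)

lemma convolution_zero_right: "convolution R p (\<lambda>x. \<zero>) = (\<lambda>h. \<zero>)"
  by (simp add: convolution_def)

lemma convolution_add_left:
  assumes p: "p \<in> carrier (free_module R S)" and p': "p' \<in> carrier (free_module R S)"
    and q: "q \<in> carrier (free_module R S')"
  shows "convolution R (\<lambda>x. p x \<oplus> p' x) q = (\<lambda>h. convolution R p q h \<oplus> convolution R p' q h)"
proof
  fix h
  let ?P = "{x. p x \<noteq> \<zero>} \<union> {x. p' x \<noteq> \<zero>}" and ?Q = "{x. q x \<noteq> \<zero>}"
  let ?Z = "{(g, f) \<in> ?P \<times> ?Q. src g = tgt f \<and> comp_mor g f = h}"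
  have fin: "finite ?P" "finite ?Q" using free_finite p p' q by auto
  note cl = free_coeff_closed[OF p] free_coeff_closed[OF p'] free_coeff_closed[OF q]
  have "convolution R (\<lambda>x. p x \<oplus> p' x) q h = (\<Oplus>z\<in>?Z. case z of (g, f) \<Rightarrow> (p g \<oplus> p' g) \<otimes> q f)"
    by (rule convolution_eq[OF free_add_closed[OF p p'] q fin(1) _ fin(2)]) auto
  also have "\<dots> = (\<Oplus>z\<in>?Z. (case z of (g, f) \<Rightarrow> p g \<otimes> q f) \<oplus> (case z of (g, f) \<Rightarrow> p' g \<otimes> q f))"
    by (rule finsum_cong') (use cl in \<open>auto simp: l_distr\<close>)
  also have "\<dots> = (\<Oplus>z\<in>?Z. (case z of (g, f) \<Rightarrow> p g \<otimes> q f)) \<oplus> (\<Oplus>z\<in>?Z. (case z of (g, f) \<Rightarrow> p' g \<otimes> q f))"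
    by (rule finsum_addf) (use cl in auto)
  also have "\<dots> = convolution R p q h \<oplus> convolution R p' q h"
    using convolution_eq[OF p q fin(1) _ fin(2)] convolution_eq[OF p' q fin(1) _ fin(2)] by simp
  finally show "convolution R (\<lambda>x. p x \<oplus> p' x) q h = convolution R p q h \<oplus> convolution R p' q h" .
qed

lemma convolution_add_right:
  assumes p: "p \<in> carrier (free_module R S)"
    and q: "q \<in> carrier (free_module R S')" and q': "q' \<in> carrier (free_module R S')"
  shows "convolution R p (\<lambda>x. q x \<oplus> q' x) = (\<lambda>h. convolution R p q h \<oplus> convolution R p q' h)"
proof
  fix h
  let ?Q = "{x. q x \<noteq> \<zero>} \<union> {x. q' x \<noteq> \<zero>}" and ?P = "{x. p x \<noteq> \<zero>}"
  let ?Z = "{(g, f) \<in> ?P \<times> ?Q. src g = tgt f \<and> comp_mor g f = h}"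
  have fin: "finite ?P" "finite ?Q" using free_finite p q' q by auto
  note cl = free_coeff_closed[OF p] free_coeff_closed[OF q'] free_coeff_closed[OF q]
  have "convolution R p (\<lambda>x. q x \<oplus> q' x) h = (\<Oplus>z\<in>?Z. case z of (g, f) \<Rightarrow> p g \<otimes> (q f \<oplus> q' f))"
    by (rule convolution_eq[OF p free_add_closed[OF q q'] fin(1) _ fin(2)]) auto
  also have "\<dots> = (\<Oplus>z\<in>?Z. (case z of (g, f) \<Rightarrow> p g \<otimes> q f) \<oplus> (case z of (g, f) \<Rightarrow> p g \<otimes> q' f))"
    by (rule finsum_cong') (use cl in \<open>auto simp: r_distr\<close>)
  also have "\<dots> = (\<Oplus>z\<in>?Z. (case z of (g, f) \<Rightarrow> p g \<otimes> q f)) \<oplus> (\<Oplus>z\<in>?Z. (case z of (g, f) \<Rightarrow> p g \<otimes> q' f))"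
    by (rule finsum_addf) (use cl in auto)
  also have "\<dots> = convolution R p q h \<oplus> convolution R p q' h"
    using convolution_eq[OF p q fin(1) _ fin(2)] convolution_eq[OF p q' fin(1) _ fin(2)] by simp
  finally show "convolution R p (\<lambda>x. q x \<oplus> q' x) h = convolution R p q h \<oplus> convolution R p q' h" .
qed

lemma convolution_sing:
  assumes "a \<in> carrier R" "b \<in> carrier R"
  shows "convolution R (sing R g a) (sing R f b)
    = (if src g = tgt f then sing R (comp_mor g f) (a \<otimes> b) else (\<lambda>h. \<zero>))"
proof
  fix h
  have "convolution R (sing R g a) (sing R f b) h
      = (\<Oplus>z\<in>{(g', f') \<in> {g} \<times> {f}. src g' = tgt f' \<and> comp_mor g' f' = h}. case z of (g', f') \<Rightarrow> sing R g a g' \<otimes> sing R f b f')"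
    by (rule convolution_eq[OF sing_in_free[OF UNIV_I assms(1)] sing_in_free[OF UNIV_I assms(2)]]) (auto simp: sing_def)
  moreover have "{(g', f') \<in> {g} \<times> {f}. src g' = tgt f' \<and> comp_mor g' f' = h}
      = (if src g = tgt f \<and> comp_mor g f = h then {(g, f)} else {})" by auto
  ultimately show "convolution R (sing R g a) (sing R f b) h
      = (if src g = tgt f then sing R (comp_mor g f) (a \<otimes> b) else (\<lambda>h. \<zero>)) h"
    using assms by (simp add: sing_def)
qed

lemma convolution_closed:
  assumes p: "p \<in> carrier (free_module R S)" and q: "q \<in> carrier (free_module R S')"
    and S: "\<And>g f. \<lbrakk>g \<in> S; f \<in> S'; src g = tgt f\<rbrakk> \<Longrightarrow> comp_mor g f \<in> S''"
  shows "convolution R p q \<in> carrier (free_module R S'')"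
  using p
proof (induction rule: free_induct)
  case zero thus ?case by (simp add: convolution_zero_left free_zero_closed)
next
  case (add g a p)
  have "convolution R (sing R g a) q \<in> carrier (free_module R S'')"
    using q
  proof (induction rule: free_induct)
    case zero thus ?case by (simp add: convolution_zero_right free_zero_closed)
  next
    case (add f b q)
    have "convolution R (sing R g a) (sing R f b) \<in> carrier (free_module R S'')"
      using \<open>g \<in> S\<close> \<open>f \<in> S'\<close> S \<open>a \<in> carrier R\<close> \<open>b \<in> carrier R\<close>
      by (auto simp: convolution_sing free_zero_closed intro: sing_in_free)
    thus ?case using convolution_add_right[OF sing_in_free[OF \<open>g \<in> S\<close> \<open>a \<in> carrier R\<close>] sing_in_free[OF add(1,2)] add(3)]
        free_add_closed add.IH by simp
  qed
  thus ?case using convolution_add_left[OF sing_in_free[OF add(1,2)] add(3) q] free_add_closed add.IH by simp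
qed

lemma convolution_closed_Mors:
  "\<lbrakk>p \<in> carrier (free_module R Mors); q \<in> carrier (free_module R Mors)\<rbrakk>
    \<Longrightarrow> convolution R p q \<in> carrier (free_module R Mors)"
  by (erule (1) convolution_closed) (rule comp_in_Mors)

lemma convolution_closed_Hom:
  "\<lbrakk>p \<in> carrier (free_module R (Hom n t)); q \<in> carrier (free_module R (Hom l n))\<rbrakk>
    \<Longrightarrow> convolution R p q \<in> carrier (free_module R (Hom l t))"
  by (erule (1) convolution_closed) (rule comp_in_Hom)

lemma Hom_free_Mors: "p \<in> carrier (free_module R (Hom n t)) \<Longrightarrow> p \<in> carrier (free_module R Mors)"
  by (erule free_mono) (auto intro: Hom_Mors)

text \<open>
  By additivity it suffices to compare both sides on single morphisms, where they agree by associativity of composition.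
\<close>

lemma convolution_assoc:
  assumes p: "p \<in> carrier (free_module R Mors)" and q: "q \<in> carrier (free_module R Mors)"
    and r: "r \<in> carrier (free_module R Mors)"
  shows "convolution R p (convolution R q r) = convolution R (convolution R p q) r"
  using p
proof (induction rule: free_induct)
  case zero show ?case by (simp add: convolution_zero_left)
next
  case (add g a p)
  note sg = sing_in_free[OF add(1,2)]
  have 1: "convolution R (sing R g a) (convolution R q r) = convolution R (convolution R (sing R g a) q) r"
    using q
  proof (induction rule: free_induct)
    case zero show ?case by (simp add: convolution_zero_left convolution_zero_right)
  next
    case (add f b q)
    note sf = sing_in_free[OF add(1,2)]
    have 2: "convolution R (sing R g a) (convolution R (sing R f b) r)
        = convolution R (convolution R (sing R g a) (sing R f b)) r"
      using r
    proof (induction rule: free_induct)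
      case zero show ?case by (simp add: convolution_zero_right)
    next
      case (add e c r)
      note se = sing_in_free[OF add(1,2)]
      have assoc: "comp_mor g (comp_mor f e) = comp_mor (comp_mor g f) e" if "src g = tgt f" "src f = tgt e"
        by (rule comp_assoc_Mors[OF \<open>g \<in> Mors\<close> \<open>f \<in> Mors\<close> \<open>e \<in> Mors\<close> that])
      have 3: "convolution R (sing R g a) (convolution R (sing R f b) (sing R e c))
          = convolution R (convolution R (sing R g a) (sing R f b)) (sing R e c)"
        using \<open>a \<in> carrier R\<close> \<open>b \<in> carrier R\<close> \<open>c \<in> carrier R\<close> assoc
        by (auto simp: convolution_sing convolution_zero_left convolution_zero_right m_assoc)
      have "convolution R (sing R g a) (convolution R (sing R f b) (\<lambda>x. sing R e c x \<oplus> r x))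
          = convolution R (sing R g a) (\<lambda>h. convolution R (sing R f b) (sing R e c) h \<oplus> convolution R (sing R f b) r h)"
        by (simp only: convolution_add_right[OF sf se add(3)])
      also have "\<dots> = (\<lambda>h. convolution R (sing R g a) (convolution R (sing R f b) (sing R e c)) h
          \<oplus> convolution R (sing R g a) (convolution R (sing R f b) r) h)"
        by (rule convolution_add_right[OF sg convolution_closed_Mors[OF sf se] convolution_closed_Mors[OF sf add(3)]])
      also have "\<dots> = convolution R (convolution R (sing R g a) (sing R f b)) (\<lambda>x. sing R e c x \<oplus> r x)"
        unfolding 3 add.IH by (rule convolution_add_right[OF convolution_closed_Mors[OF sg sf] se add(3), symmetric])
      finally show ?case .
    qed
    have "convolution R (sing R g a) (convolution R (\<lambda>x. sing R f b x \<oplus> q x) r)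
        = convolution R (sing R g a) (\<lambda>h. convolution R (sing R f b) r h \<oplus> convolution R q r h)"
      by (simp only: convolution_add_left[OF sf add(3) r])
    also have "\<dots> = (\<lambda>h. convolution R (sing R g a) (convolution R (sing R f b) r) h
        \<oplus> convolution R (sing R g a) (convolution R q r) h)"
      by (rule convolution_add_right[OF sg convolution_closed_Mors[OF sf r] convolution_closed_Mors[OF add(3) r]])
    also have "\<dots> = convolution R (\<lambda>h. convolution R (sing R g a) (sing R f b) h \<oplus> convolution R (sing R g a) q h) r"
      unfolding 2 add.IH
      by (rule convolution_add_left[OF convolution_closed_Mors[OF sg sf] convolution_closed_Mors[OF sg add(3)] r, symmetric])
    also have "\<dots> = convolution R (convolution R (sing R g a) (\<lambda>x. sing R f b x \<oplus> q x)) r"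
      by (simp only: convolution_add_right[OF sg sf add(3)])
    finally show ?case .
  qed
  have "convolution R (\<lambda>x. sing R g a x \<oplus> p x) (convolution R q r)
      = (\<lambda>h. convolution R (sing R g a) (convolution R q r) h \<oplus> convolution R p (convolution R q r) h)"
    by (rule convolution_add_left[OF sg add(3) convolution_closed_Mors[OF q r]])
  also have "\<dots> = convolution R (\<lambda>h. convolution R (sing R g a) q h \<oplus> convolution R p q h) r"
    unfolding 1 add.IH
    by (rule convolution_add_left[OF convolution_closed_Mors[OF sg q] convolution_closed_Mors[OF add(3) q] r, symmetric])
  also have "\<dots> = convolution R (convolution R (\<lambda>x. sing R g a x \<oplus> p x) q) r"
    by (simp only: convolution_add_left[OF sg add(3) q])
  finally show ?case .
qed

lemma delta_in_free: "f \<in> S \<Longrightarrow> delta R f \<in> carrier (free_module R S)"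
  unfolding delta_sing by (rule sing_in_free) auto

lemma convolution_id_left:
  assumes "p \<in> carrier (free_module R (Hom n t))"
  shows "convolution R (delta R (id_mor t)) p = p"
  using assms
proof (induction rule: free_induct)
  case zero show ?case by (simp add: convolution_zero_right)
next
  case (add f a p)
  have "src (id_mor t) = tgt f" using add(1) Hom_src[OF id_in_Hom] by simp
  thus ?case using convolution_add_right[OF delta_in_free[OF UNIV_I] sing_in_free[OF add(1,2)] add(3)] add
    by (simp add: delta_sing convolution_sing)
qed

lemma convolution_id_right:
  assumes "p \<in> carrier (free_module R (Hom n t))"
  shows "convolution R p (delta R (id_mor n)) = p"
  using assms
proof (induction rule: free_induct)
  case zero show ?case by (simp add: convolution_zero_left)
next
  case (add f a p)
  have "src f = tgt (id_mor n)" using add(1) Hom_src[OF add(1)] Hom_tgt[OF id_in_Hom, of n] by simp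
  thus ?case using convolution_add_left[OF sing_in_free[OF add(1,2)] add(3) delta_in_free[OF UNIV_I]] add
    by (simp add: delta_sing convolution_sing)
qed

lemma group_algebra_simps [simp]:
  "carrier (group_algebra R n) = carrier (free_module R (Hom n n))"
  "\<zero>\<^bsub>group_algebra R n\<^esub> = (\<lambda>s. \<zero>)"
  "\<one>\<^bsub>group_algebra R n\<^esub> = delta R (id_mor n)"
  "p \<oplus>\<^bsub>group_algebra R n\<^esub> q = (\<lambda>s. p s \<oplus> q s)"
  "p \<otimes>\<^bsub>group_algebra R n\<^esub> q = convolution R p q"
  by (simp_all add: group_algebra_def free_module_def)

lemma group_algebra_ring: "ring (group_algebra R n)"
proof (rule ringI)
  show "abelian_group (group_algebra R n)"
  proof (rule abelian_groupI)
    fix p assume p: "p \<in> carrier (group_algebra R n)"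
    thus "\<exists>q\<in>carrier (group_algebra R n). q \<oplus>\<^bsub>group_algebra R n\<^esub> p = \<zero>\<^bsub>group_algebra R n\<^esub>"
      by (intro bexI[of _ "\<lambda>s. \<ominus> p s"]) (auto simp: l_neg free_minus_closed free_coeff_closed)
  qed (auto simp: free_add_closed free_zero_closed free_coeff_closed a_ac)
  show "Group.monoid (group_algebra R n)"
    by (rule monoidI) (auto simp: convolution_closed_Hom delta_in_free convolution_assoc[OF Hom_free_Mors Hom_free_Mors Hom_free_Mors]
        convolution_id_left convolution_id_right)
qed (auto simp: convolution_add_left convolution_add_right)

end

context fcmodule
begin

text \<open>
  A combination \<open>p\<close> of morphisms \<open>n \<rightarrow> t\<close> acts as a map from the value at \<open>n\<close> to the value at \<open>t\<close>.
\<close>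

definition lin :: "'m obj \<Rightarrow> 'm obj \<Rightarrow> ('m mor \<Rightarrow> 'k) \<Rightarrow> 'v \<Rightarrow> 'v" where
  "lin n t p u = finsum (val V t) (\<lambda>f. p f \<odot>\<^bsub>val V t\<^esub> act V f u) (Hom n t)"

lemma lin_closed: "\<lbrakk>p \<in> carrier (free_module R (Hom n t)); u \<in> carrier (val V n)\<rbrakk> \<Longrightarrow> lin n t p u \<in> carrier (val V t)"
  unfolding lin_def by (rule grp.finsum_closed) (auto intro: act_closed coeff.free_coeff_closed)

lemma lin_add_left:
  assumes p: "p \<in> carrier (free_module R (Hom n t))" and q: "q \<in> carrier (free_module R (Hom n t))" and u: "u \<in> carrier (val V n)"
  shows "lin n t (\<lambda>f. p f \<oplus>\<^bsub>R\<^esub> q f) u = lin n t p u \<oplus>\<^bsub>val V t\<^esub> lin n t q u"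
proof -
  have "lin n t (\<lambda>f. p f \<oplus>\<^bsub>R\<^esub> q f) u
      = finsum (val V t) (\<lambda>f. p f \<odot>\<^bsub>val V t\<^esub> act V f u \<oplus>\<^bsub>val V t\<^esub> q f \<odot>\<^bsub>val V t\<^esub> act V f u) (Hom n t)"
    unfolding lin_def by (rule grp.finsum_cong')
      (use coeff.free_coeff_closed[OF p] coeff.free_coeff_closed[OF q] u in \<open>auto simp: val.smult_l_distr act_closed\<close>)
  also have "\<dots> = lin n t p u \<oplus>\<^bsub>val V t\<^esub> lin n t q u"
    unfolding lin_def by (rule grp.finsum_addf)
      (use coeff.free_coeff_closed[OF p] coeff.free_coeff_closed[OF q] u in \<open>auto simp: act_closed\<close>)
  finally show ?thesis .
qed

lemma lin_add_right:
  assumes p: "p \<in> carrier (free_module R (Hom n t))" and u: "u \<in> carrier (val V n)" and w: "w \<in> carrier (val V n)"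
  shows "lin n t p (u \<oplus>\<^bsub>val V n\<^esub> w) = lin n t p u \<oplus>\<^bsub>val V t\<^esub> lin n t p w"
proof -
  have "lin n t p (u \<oplus>\<^bsub>val V n\<^esub> w)
      = finsum (val V t) (\<lambda>f. p f \<odot>\<^bsub>val V t\<^esub> act V f u \<oplus>\<^bsub>val V t\<^esub> p f \<odot>\<^bsub>val V t\<^esub> act V f w) (Hom n t)"
    unfolding lin_def by (rule grp.finsum_cong')
      (use coeff.free_coeff_closed[OF p] u w in \<open>auto simp: act_add val.smult_r_distr act_closed\<close>)
  also have "\<dots> = lin n t p u \<oplus>\<^bsub>val V t\<^esub> lin n t p w"
    unfolding lin_def by (rule grp.finsum_addf)
      (use coeff.free_coeff_closed[OF p] u w in \<open>auto simp: act_closed\<close>)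
  finally show ?thesis .
qed

lemma lin_zero_left: "u \<in> carrier (val V n) \<Longrightarrow> lin n t (\<lambda>f. \<zero>\<^bsub>R\<^esub>) u = \<zero>\<^bsub>val V t\<^esub>"
proof -
  assume u: "u \<in> carrier (val V n)"
  have "lin n t (\<lambda>f. \<zero>\<^bsub>R\<^esub>) u = finsum (val V t) (\<lambda>f. \<zero>\<^bsub>val V t\<^esub>) (Hom n t)"
    unfolding lin_def by (rule grp.finsum_cong') (use u in \<open>auto simp: act_closed\<close>)
  thus ?thesis by (simp add: grp.finsum_zero)
qed

lemma lin_sing:
  assumes f: "f \<in> Hom n t" and a: "a \<in> carrier R" and u: "u \<in> carrier (val V n)"
  shows "lin n t (sing R f a) u = a \<odot>\<^bsub>val V t\<^esub> act V f u"
proof -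
  have "lin n t (sing R f a) u = finsum (val V t) (\<lambda>g. if f = g then a \<odot>\<^bsub>val V t\<^esub> act V g u else \<zero>\<^bsub>val V t\<^esub>) (Hom n t)"
    unfolding lin_def by (rule grp.finsum_cong') (use a u in \<open>auto simp: sing_def act_closed\<close>)
  also have "\<dots> = a \<odot>\<^bsub>val V t\<^esub> act V f u"
    by (rule grp.add.finprod_singleton[OF f]) (use a u in \<open>auto simp: act_closed\<close>)
  finally show ?thesis .
qed

lemma lin_delta: "\<lbrakk>f \<in> Hom n t; u \<in> carrier (val V n)\<rbrakk> \<Longrightarrow> lin n t (delta R f) u = act V f u"
  unfolding delta_sing by (simp add: lin_sing act_closed)

lemma lin_smult:
  assumes a: "a \<in> carrier R" and p: "p \<in> carrier (free_module R (Hom n t))" and u: "u \<in> carrier (val V n)"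
  shows "lin n t (\<lambda>f. a \<otimes>\<^bsub>R\<^esub> p f) u = a \<odot>\<^bsub>val V t\<^esub> lin n t p u"
  using p
proof (induction rule: coeff.free_induct)
  case zero thus ?case using a by (simp add: lin_zero_left u)
next
  case (add f b p)
  have s: "(\<lambda>x. a \<otimes>\<^bsub>R\<^esub> sing R f b x) = sing R f (a \<otimes>\<^bsub>R\<^esub> b)" using a by (auto simp: sing_def)
  note sf = coeff.sing_in_free[OF add(1,2)]
  have "(\<lambda>x. a \<otimes>\<^bsub>R\<^esub> (sing R f b x \<oplus>\<^bsub>R\<^esub> p x)) = (\<lambda>x. sing R f (a \<otimes>\<^bsub>R\<^esub> b) x \<oplus>\<^bsub>R\<^esub> a \<otimes>\<^bsub>R\<^esub> p x)"
    unfolding s[symmetric] using a coeff.free_coeff_closed[OF sf] coeff.free_coeff_closed[OF add(3)]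
    by (auto simp: val.R.r_distr)
  hence "lin n t (\<lambda>x. a \<otimes>\<^bsub>R\<^esub> (sing R f b x \<oplus>\<^bsub>R\<^esub> p x)) u
      = lin n t (sing R f (a \<otimes>\<^bsub>R\<^esub> b)) u \<oplus>\<^bsub>val V t\<^esub> lin n t (\<lambda>x. a \<otimes>\<^bsub>R\<^esub> p x) u"
    using lin_add_left[OF coeff.sing_in_free[OF add(1)] coeff.free_smult_closed[OF add(3) a] u, of "a \<otimes>\<^bsub>R\<^esub> b"] a add(2) by simp
  also have "\<dots> = a \<odot>\<^bsub>val V t\<^esub> lin n t (sing R f b) u \<oplus>\<^bsub>val V t\<^esub> a \<odot>\<^bsub>val V t\<^esub> lin n t p u"
    using add a u by (simp add: lin_sing val.smult_assoc1 act_closed)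
  also have "\<dots> = a \<odot>\<^bsub>val V t\<^esub> lin n t (\<lambda>x. sing R f b x \<oplus>\<^bsub>R\<^esub> p x) u"
    unfolding lin_add_left[OF sf add(3) u]
    by (rule val.smult_r_distr[symmetric]) (use a lin_closed[OF sf u] lin_closed[OF add(3) u] in auto)
  finally show ?case .
qed

lemma lin_act:
  assumes g: "g \<in> Hom t s" and p: "p \<in> carrier (free_module R (Hom n t))" and u: "u \<in> carrier (val V n)"
  shows "lin n s (convolution R (delta R g) p) u = act V g (lin n t p u)"
  using p
proof (induction rule: coeff.free_induct)
  case zero thus ?case by (simp add: lin_zero_left u coeff.convolution_zero_right act_zero[OF g])
next
  case (add f b p)
  note sf = coeff.sing_in_free[OF add(1,2)]
  have dg: "delta R g \<in> carrier (free_module R (Hom t s))" by (rule coeff.delta_in_free[OF g])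
  have 1: "lin n s (convolution R (delta R g) (sing R f b)) u = act V g (lin n t (sing R f b) u)"
    using add g u by (simp add: delta_sing coeff.convolution_sing Hom_src[OF g] lin_sing[OF comp_in_Hom[OF add(1) g]]
        lin_sing act_comp[OF add(1) g] act_smult[OF g] act_closed)
  have "lin n s (convolution R (delta R g) (\<lambda>x. sing R f b x \<oplus>\<^bsub>R\<^esub> p x)) u
      = lin n s (convolution R (delta R g) (sing R f b)) u \<oplus>\<^bsub>val V s\<^esub> lin n s (convolution R (delta R g) p) u"
    unfolding coeff.convolution_add_right[OF dg sf add(3)]
    by (rule lin_add_left[OF coeff.convolution_closed_Hom[OF dg sf] coeff.convolution_closed_Hom[OF dg add(3)] u])
  also have "\<dots> = act V g (lin n t (\<lambda>x. sing R f b x \<oplus>\<^bsub>R\<^esub> p x) u)"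
    unfolding 1 add.IH lin_add_left[OF sf add(3) u]
    by (rule act_add[OF g lin_closed[OF sf u] lin_closed[OF add(3) u], symmetric])
  finally show ?case .
qed

lemma act_lin_scalar:
  assumes "a \<in> carrier R" "f \<in> Hom n t" "q \<in> carrier (free_module R (Hom l n))" "u \<in> carrier (val V l)"
  shows "lin l t (convolution R (sing R f a) q) u = a \<odot>\<^bsub>val V t\<^esub> act V f (lin l n q u)"
proof -
  have "convolution R (sing R f a) q = (\<lambda>h. a \<otimes>\<^bsub>R\<^esub> convolution R (delta R f) q h)"
    using assms(3)
  proof (induction rule: coeff.free_induct)
    case zero thus ?case using assms by (simp add: coeff.convolution_zero_right)
  next
    case (add e b q)
    have "convolution R (sing R f a) (sing R e b) = (\<lambda>h. a \<otimes>\<^bsub>R\<^esub> convolution R (delta R f) (sing R e b) h)"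
      using assms(1) add by (auto simp: delta_sing coeff.convolution_sing) (auto simp: sing_def)
    thus ?case
      using coeff.convolution_add_right[OF coeff.sing_in_free[OF assms(2,1)] coeff.sing_in_free[OF add(1,2)] add(3)]
        coeff.convolution_add_right[OF coeff.delta_in_free[OF assms(2)] coeff.sing_in_free[OF add(1,2)] add(3)] add.IH
        coeff.convolution_coeff_closed[OF coeff.delta_in_free[OF assms(2)] coeff.sing_in_free[OF add(1,2)]]
        coeff.convolution_coeff_closed[OF coeff.delta_in_free[OF assms(2)] add(3)] assms(1)
      by (simp add: val.R.r_distr)
  qed
  thus ?thesis using assms
    by (simp add: lin_smult[OF assms(1) coeff.convolution_closed_Hom[OF coeff.delta_in_free[OF assms(2)] assms(3)] assms(4)] lin_act)
qed

lemma lin_assoc: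
  assumes p: "p \<in> carrier (free_module R (Hom n t))" and q: "q \<in> carrier (free_module R (Hom l n))" and u: "u \<in> carrier (val V l)"
  shows "lin l t (convolution R p q) u = lin n t p (lin l n q u)"
  using p
proof (induction rule: coeff.free_induct)
  case zero thus ?case by (simp add: coeff.convolution_zero_left lin_zero_left u lin_closed[OF q u])
next
  case (add f a p)
  note sf = coeff.sing_in_free[OF add(1,2)]
  have "lin l t (convolution R (\<lambda>x. sing R f a x \<oplus>\<^bsub>R\<^esub> p x) q) u
      = lin l t (convolution R (sing R f a) q) u \<oplus>\<^bsub>val V t\<^esub> lin l t (convolution R p q) u"
    unfolding coeff.convolution_add_left[OF sf add(3) q]
    by (rule lin_add_left[OF coeff.convolution_closed_Hom[OF sf q] coeff.convolution_closed_Hom[OF add(3) q] u])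
  also have "\<dots> = lin n t (sing R f a) (lin l n q u) \<oplus>\<^bsub>val V t\<^esub> lin n t p (lin l n q u)"
    unfolding add.IH act_lin_scalar[OF add(2,1) q u] lin_sing[OF add(1,2) lin_closed[OF q u]] ..
  also have "\<dots> = lin n t (\<lambda>x. sing R f a x \<oplus>\<^bsub>R\<^esub> p x) (lin l n q u)"
    by (rule lin_add_left[OF sf add(3) lin_closed[OF q u], symmetric])
  finally show ?case .
qed

end

section \<open>Relative projective modules are saturated\<close>

lemma M_bimodule_simps [simp]:
  "carrier (M_bimodule R n t) = carrier (free_module R (Hom n t))"
  "\<zero>\<^bsub>M_bimodule R n t\<^esub> = (\<lambda>s. \<zero>\<^bsub>R\<^esub>)"
  "p \<oplus>\<^bsub>M_bimodule R n t\<^esub> q = (\<lambda>s. p s \<oplus>\<^bsub>R\<^esub> q s)"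
  "a \<odot>\<^bsub>M_bimodule R n t\<^esub> p = (\<lambda>s. a \<otimes>\<^bsub>R\<^esub> p s)"
  "rsmult (M_bimodule R n t) p q = convolution R p q"
  by (simp_all add: M_bimodule_def module.defs bimodule.defs free_module_def)

context coeff_ring
begin

text \<open>
  The retraction of left composition with \<open>h\<close>: the basis element \<open>h f\<close> goes to \<open>f\<close>, and the morphisms that do not factor
  through \<open>h\<close> go to zero.
\<close>

definition restr :: "'m obj \<Rightarrow> 'm mor \<Rightarrow> ('m mor \<Rightarrow> 'k) \<Rightarrow> 'm mor \<Rightarrow> 'k" where
  "restr n h p = (\<lambda>f. if f \<in> Hom n (src h) then p (comp_mor h f) else \<zero>)"

lemma restr_closed:
  fixes h :: "'m::finite mor"
  assumes p: "p \<in> carrier (free_module R S)"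
  shows "restr n h p \<in> carrier (free_module R {f \<in> Hom n (src h). comp_mor h f \<in> S})"
proof (rule free_moduleI)
  show "restr n h p f \<in> carrier R" for f using free_coeff_closed[OF p] by (simp add: restr_def)
  show "f \<in> {f \<in> Hom n (src h). comp_mor h f \<in> S}" if "restr n h p f \<noteq> \<zero>" for f
    using that free_supp[OF p] by (auto simp: restr_def split: if_splits)
  show "finite {s. restr n h p s \<noteq> \<zero>}"
    by (rule finite_subset[OF _ finite_Hom[of n "src h"]]) (auto simp: restr_def)
qed

lemma restr_closed_Hom:
  fixes h :: "'m::finite mor"
  assumes "h \<in> Hom s t" "p \<in> carrier (free_module R (Hom n t))"
  shows "restr n h p \<in> carrier (free_module R (Hom n s))"
  using free_mono[OF restr_closed[OF assms(2), of n h]] Hom_src[OF assms(1)] by blast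

lemma restr_add:
  assumes "p \<in> carrier (free_module R S)" "q \<in> carrier (free_module R S)"
  shows "restr n h (\<lambda>f. p f \<oplus> q f) = (\<lambda>f. restr n h p f \<oplus> restr n h q f)"
  by (auto simp: restr_def)

lemma restr_zero: "restr n h (\<lambda>f. \<zero>) = (\<lambda>f. \<zero>)"
  by (auto simp: restr_def)

lemma restr_sing_comp:
  assumes "h \<in> Hom s t" "f \<in> Hom n s"
  shows "restr n h (sing R (comp_mor h f) a) = sing R f a"
proof
  fix f'
  show "restr n h (sing R (comp_mor h f) a) f' = sing R f a f'"
    using comp_left_cancel[of f' n s f h t] assms Hom_src[OF assms(1)] by (auto simp: restr_def sing_def)
qed

lemma restr_sing_other:
  assumes "h \<in> Hom s t" "\<And>f. f \<in> Hom n s \<Longrightarrow> g \<noteq> comp_mor h f"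
  shows "restr n h (sing R g a) = (\<lambda>f. \<zero>)"
  using assms(2) Hom_src[OF assms(1)] by (fastforce simp: restr_def sing_def)

text \<open>
  Precomposition with a permutation does not change whether a morphism factors through \<open>h\<close>; the retraction is therefore
  right linear, and it induces a retraction on \<open>M(n) \<otimes> U\<close>.
\<close>

lemma restr_convolution:
  fixes h :: "'m::finite mor"
  assumes h: "h \<in> Hom s t" and p: "p \<in> carrier (free_module R (Hom n t))"
    and q: "q \<in> carrier (free_module R (Hom n n))"
  shows "restr n h (convolution R p q) = convolution R (restr n h p) q"
  using p
proof (induction rule: free_induct)
  case zero show ?case by (simp add: convolution_zero_left restr_zero)
next
  case (add g a p)
  note sg = sing_in_free[OF add(1,2)]
  have 1: "restr n h (convolution R (sing R g a) q) = convolution R (restr n h (sing R g a)) q"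
    using q
  proof (induction rule: free_induct)
    case zero show ?case by (simp add: convolution_zero_right restr_zero)
  next
    case (add x b q)
    note sx = sing_in_free[OF add(1,2)]
    have st: "src g = tgt x" using Hom_src[OF \<open>g \<in> Hom n t\<close>] add(1) by simp
    have 2: "restr n h (convolution R (sing R g a) (sing R x b)) = convolution R (restr n h (sing R g a)) (sing R x b)"
    proof (cases "\<exists>f\<in>Hom n s. g = comp_mor h f")
      case True
      then obtain f where f: "f \<in> Hom n s" "g = comp_mor h f" by blast
      have "comp_mor g x = comp_mor h (comp_mor f x)" unfolding f(2) by (rule comp_assoc[OF add(1) f(1) h, symmetric])
      moreover have "src f = tgt x" using Hom_src[OF f(1)] add(1) by simp
      ultimately show ?thesis
        using restr_sing_comp[OF h f(1)] restr_sing_comp[OF h comp_in_Hom[OF add(1) f(1)]] st f(2) \<open>a \<in> carrier R\<close> add(2)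
        by (simp add: convolution_sing)
    next
      case False
      have no: "comp_mor g x \<noteq> comp_mor h f" if f: "f \<in> Hom n s" for f
      proof
        assume e: "comp_mor g x = comp_mor h f"
        obtain x' where x': "x' \<in> Hom n n" "comp_mor x x' = id_mor n" using Hom_inverse[OF add(1)] by blast
        have "g = comp_mor g (comp_mor x x')" using x' \<open>g \<in> Hom n t\<close> by simp
        also have "\<dots> = comp_mor h (comp_mor f x')"
          using comp_assoc[OF x'(1) add(1) \<open>g \<in> Hom n t\<close>] comp_assoc[OF x'(1) f h] e by simp
        finally show False using False comp_in_Hom[OF x'(1) f] by blast
      qed
      have "restr n h (sing R g a) = (\<lambda>f. \<zero>)" by (rule restr_sing_other[OF h]) (use False in blast)
      moreover have "restr n h (sing R (comp_mor g x) (a \<otimes> b)) = (\<lambda>f. \<zero>)" by (rule restr_sing_other[OF h no])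
      ultimately show ?thesis using st \<open>a \<in> carrier R\<close> add(2) by (simp add: convolution_sing convolution_zero_left)
    qed
    have "restr n h (convolution R (sing R g a) (\<lambda>y. sing R x b y \<oplus> q y))
        = (\<lambda>f. restr n h (convolution R (sing R g a) (sing R x b)) f \<oplus> restr n h (convolution R (sing R g a) q) f)"
      unfolding convolution_add_right[OF sg sx add(3)]
      by (rule restr_add[OF convolution_closed_Hom[OF sg sx] convolution_closed_Hom[OF sg add(3)]])
    also have "\<dots> = convolution R (restr n h (sing R g a)) (\<lambda>y. sing R x b y \<oplus> q y)"
      unfolding 2 add.IH by (rule convolution_add_right[OF restr_closed_Hom[OF h sg] sx add(3), symmetric])
    finally show ?case .
  qed
  have "restr n h (convolution R (\<lambda>y. sing R g a y \<oplus> p y) q)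
      = (\<lambda>f. restr n h (convolution R (sing R g a) q) f \<oplus> restr n h (convolution R p q) f)"
    unfolding convolution_add_left[OF sg add(3) q]
    by (rule restr_add[OF convolution_closed_Hom[OF sg q] convolution_closed_Hom[OF add(3) q]])
  also have "\<dots> = convolution R (restr n h (\<lambda>y. sing R g a y \<oplus> p y)) q"
    unfolding 1 add.IH restr_add[OF sg add(3)]
    by (rule convolution_add_left[OF restr_closed_Hom[OF h sg] restr_closed_Hom[OF h add(3)] q, symmetric])
  finally show ?case .
qed

lemma restr_delta:
  assumes h: "h \<in> Hom s t" and p: "p \<in> carrier (free_module R (Hom n s))"
  shows "restr n h (convolution R (delta R h) p) = p"
  using p
proof (induction rule: free_induct)
  case zero show ?case by (simp add: convolution_zero_right restr_zero)
next
  case (add f a p)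
  note sf = sing_in_free[OF add(1,2)] and dh = delta_in_free[OF h]
  have "restr n h (convolution R (delta R h) (sing R f a)) = sing R f a"
    using restr_sing_comp[OF h add(1)] Hom_src[OF h] add(1,2) by (simp add: delta_sing convolution_sing)
  thus ?case using add.IH
    by (simp add: convolution_add_right[OF dh sf add(3)]
        restr_add[OF convolution_closed_Hom[OF dh sf] convolution_closed_Hom[OF dh add(3)]])
qed

end

locale induced = coeff_ring R for R :: "'k ring" (structure) +
  fixes n :: "'m::finite obj" and U :: "('m mor \<Rightarrow> 'k, 'u) module"
  assumes U: "left_module (group_algebra R n) U"
begin

sublocale U: left_module "group_algebra R n" U by (rule U)

abbreviation "MU \<equiv> M_tensor R n U"

sublocale P: tensor_pair "group_algebra R n" "M_bimodule R n t" U for t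
proof (rule tensor_pair.intro)
  show "abelian_group (M_bimodule R n t)"
  proof (rule abelian_groupI)
    fix p assume p: "p \<in> carrier (M_bimodule R n t)"
    thus "\<exists>q\<in>carrier (M_bimodule R n t). q \<oplus>\<^bsub>M_bimodule R n t\<^esub> p = \<zero>\<^bsub>M_bimodule R n t\<^esub>"
      by (intro bexI[of _ "\<lambda>s. \<ominus> p s"]) (auto simp: l_neg free_minus_closed free_coeff_closed)
  qed (auto simp: free_add_closed free_zero_closed free_coeff_closed a_ac)
qed (auto simp: convolution_closed_Hom U.smult_closed U.M.abelian_group_axioms)

lemma val_MU: "val MU t = P.T t"
  by (simp add: M_tensor_def)

lemma act_MU: "act MU f = tensor_map (group_algebra R n) (M_bimodule R n (tgt f)) U (convolution R (delta R f)) id"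
  by (simp add: M_tensor_def)

lemma map_pair:
  assumes f: "f \<in> Hom s t"
  shows "tensor_pair_map (group_algebra R n) (M_bimodule R n s) U (M_bimodule R n t) U (convolution R (delta R f)) id"
proof (unfold_locales, goal_cases)
  case (1 x) thus ?case using convolution_closed_Hom[OF delta_in_free[OF f]] by simp
next
  case (3 x x') thus ?case using convolution_add_right[OF delta_in_free[OF f]] by simp
next
  case (5 x a) thus ?case
    using convolution_assoc[OF delta_in_free[OF Hom_Mors[OF f]] Hom_free_Mors Hom_free_Mors] by simp
qed auto

lemma restr_pair:
  assumes h: "h \<in> Hom s t"
  shows "tensor_pair_map (group_algebra R n) (M_bimodule R n t) U (M_bimodule R n s) U (restr n h) id"
proof (unfold_locales, goal_cases)
  case (1 x) thus ?case using restr_closed_Hom[OF h] by simp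
next
  case (3 x x') thus ?case using restr_add by simp
next
  case (5 x a) thus ?case using restr_convolution[OF h] by simp
qed auto

lemma act_cls:
  assumes "f \<in> Hom s t" "p \<in> carrier (free_module R (Hom n s))" "u \<in> carrier U"
  shows "act MU f (P.cls s p u) = P.cls t (convolution R (delta R f) p) u"
  using tensor_pair_map.tmap_cls[OF map_pair[OF assms(1)], of p u] assms by (simp add: act_MU)

lemma act_MU_closed: "\<lbrakk>f \<in> Hom s t; x \<in> carrier (P.T s)\<rbrakk> \<Longrightarrow> act MU f x \<in> carrier (P.T t)"
  using tensor_pair_map.tmap_closed[OF map_pair, of f s t x] by (simp add: act_MU)

lemma act_MU_add: "\<lbrakk>f \<in> Hom s t; x \<in> carrier (P.T s); y \<in> carrier (P.T s)\<rbrakk>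
    \<Longrightarrow> act MU f (x \<oplus>\<^bsub>P.T s\<^esub> y) = act MU f x \<oplus>\<^bsub>P.T t\<^esub> act MU f y"
  using tensor_pair_map.tmap_add[OF map_pair, of f s t x y] by (simp add: act_MU)

lemma act_MU_zero: "f \<in> Hom s t \<Longrightarrow> act MU f \<zero>\<^bsub>P.T s\<^esub> = \<zero>\<^bsub>P.T t\<^esub>"
  using tensor_pair_map.tmap_zero[OF map_pair, of f s t] by (simp add: act_MU)

lemma afun_MU: "afun MU"
proof (rule afun.intro)
  show "abelian_group (val MU t)" for t unfolding val_MU by (rule P.grpT)
  show "act MU f x \<in> carrier (val MU t)" if "f \<in> Hom s t" "x \<in> carrier (val MU s)" for f s t x
    using act_MU_closed that by (simp add: val_MU)
  show "act MU f (x \<oplus>\<^bsub>val MU s\<^esub> y) = act MU f x \<oplus>\<^bsub>val MU t\<^esub> act MU f y"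
    if "f \<in> Hom s t" "x \<in> carrier (val MU s)" "y \<in> carrier (val MU s)" for f s t x y
    using act_MU_add that by (simp add: val_MU)
next
  fix x t assume "x \<in> carrier (val MU t)"
  hence "x \<in> carrier (P.T t)" by (simp add: val_MU)
  thus "act MU (id_mor t) x = x"
  proof (induction rule: P.tensor_induct)
    case zero show ?case by (rule act_MU_zero[OF id_in_Hom])
  next
    case (add p u y)
    have "act MU (id_mor t) (P.cls t p u) = P.cls t p u"
      using add act_cls[OF id_in_Hom, of p t u] convolution_id_left[of p n t] by simp
    thus ?case using act_MU_add[OF id_in_Hom P.cls_closed[OF add(1,2)] add(3)] add.IH by simp
  qed
next
  fix f g l s t x assume f: "f \<in> Hom l s" and g: "g \<in> Hom s t" and "x \<in> carrier (val MU l)"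
  hence "x \<in> carrier (P.T l)" by (simp add: val_MU)
  thus "act MU (comp_mor g f) x = act MU g (act MU f x)"
  proof (induction rule: P.tensor_induct)
    case zero show ?case by (simp only: act_MU_zero[OF f] act_MU_zero[OF g] act_MU_zero[OF comp_in_Hom[OF f g]])
  next
    case (add p u y)
    have p: "p \<in> carrier (free_module R (Hom n l))" using add by simp
    have "delta R (comp_mor g f) = convolution R (delta R g) (delta R f)"
      using f Hom_src[OF g] by (simp add: delta_sing convolution_sing)
    hence "convolution R (delta R (comp_mor g f)) p = convolution R (delta R g) (convolution R (delta R f) p)"
      using convolution_assoc[OF delta_in_free[OF Hom_Mors[OF g]] delta_in_free[OF Hom_Mors[OF f]] Hom_free_Mors[OF p]] by simp
    hence 1: "act MU (comp_mor g f) (P.cls l p u) = act MU g (act MU f (P.cls l p u))"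
      using act_cls[OF f p add(2)] act_cls[OF comp_in_Hom[OF f g] p add(2)]
        act_cls[OF g convolution_closed_Hom[OF delta_in_free[OF f] p] add(2)] by simp
    have "act MU (comp_mor g f) (P.cls l p u \<oplus>\<^bsub>P.T l\<^esub> y) = act MU (comp_mor g f) (P.cls l p u) \<oplus>\<^bsub>P.T t\<^esub> act MU (comp_mor g f) y"
      by (rule act_MU_add[OF comp_in_Hom[OF f g] P.cls_closed[OF add(1,2)] add(3)])
    also have "\<dots> = act MU g (act MU f (P.cls l p u) \<oplus>\<^bsub>P.T s\<^esub> act MU f y)"
      unfolding 1 add.IH
      by (rule act_MU_add[OF g act_MU_closed[OF f P.cls_closed[OF add(1,2)]] act_MU_closed[OF f add(3)], symmetric])
    also have "\<dots> = act MU g (act MU f (P.cls l p u \<oplus>\<^bsub>P.T l\<^esub> y))"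
      by (simp only: act_MU_add[OF f P.cls_closed[OF add(1,2)] add(3)])
    finally show ?case .
  qed
qed

sublocale MU: afun MU by (rule afun_MU)

lemma cls_in_miss:
  assumes q: "q \<in> carrier (free_module R {f \<in> Hom n s. \<not> A \<subseteq> img f})" and u: "u \<in> carrier U"
  shows "P.cls s q u \<in> miss MU A s"
  using q
proof (induction rule: free_induct)
  case zero
  show ?case using P.cls_zero_left[of u s] u miss.zero[of MU s A] by (simp add: val_MU)
next
  case (add f a q)
  have f: "f \<in> Hom n s" "\<not> A \<subseteq> img f" using add(1) by auto
  have i: "sing R (id_mor n) a \<in> carrier (free_module R (Hom n n))" using add(2) by (intro sing_in_free) auto
  have "convolution R (delta R f) (sing R (id_mor n) a) = sing R f a"
    using f Hom_src[OF f(1)] Hom_tgt[OF id_in_Hom, of n] add(2) by (simp add: delta_sing convolution_sing)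
  hence "P.cls s (sing R f a) u = act MU f (P.cls n (sing R (id_mor n) a) u)"
    using act_cls[OF f(1) i u] by simp
  moreover have "P.cls n (sing R (id_mor n) a) u \<in> carrier (val MU n)"
    unfolding val_MU by (rule P.cls_closed) (use i u in auto)
  ultimately have 1: "P.cls s (sing R f a) u \<in> miss MU A s"
    using MU.act_in_miss[OF f] by simp
  have "P.cls s (\<lambda>x. sing R f a x \<oplus> q x) u = P.cls s (sing R f a) u \<oplus>\<^bsub>val MU s\<^esub> P.cls s q u"
    using P.cls_add_left[of "sing R f a" s q u] sing_in_free[OF f(1) add(2)] free_mono[OF add(3), of "Hom n s"] u
    by (auto simp: val_MU)
  thus ?case using MU.miss_add[OF 1 add.IH] by simp
qed

text \<open>
  The retractions induced by \<open>restr\<close> satisfy the hypotheses of \<open>saturated_of_retractions\<close>: if \<open>g\<close> misses a point of \<open>h A\<close> and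
  \<open>h f = g f'\<close>, then \<open>f\<close> misses a point of \<open>A\<close>.
\<close>

lemma saturated_MU: "saturated MU"
proof (rule MU.saturated_of_retractions)
  define r where "r h = tensor_map (group_algebra R n) (M_bimodule R n (src h)) U (restr n h) id" for h
  fix s t :: "'m obj" and h assume h: "h \<in> Hom s t"
  interpret rp: tensor_pair_map "group_algebra R n" "M_bimodule R n t" U "M_bimodule R n s" U "restr n h" id
    by (rule restr_pair[OF h])
  have rh: "r h = rp.tmap" by (simp add: r_def Hom_src[OF h])
  have r_zero: "r h \<zero>\<^bsub>P.T t\<^esub> = \<zero>\<^bsub>P.T s\<^esub>" unfolding rh by (rule rp.tmap_zero)
  have r_add: "r h (x \<oplus>\<^bsub>P.T t\<^esub> y) = r h x \<oplus>\<^bsub>P.T s\<^esub> r h y" if "x \<in> carrier (P.T t)" "y \<in> carrier (P.T t)" for x y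
    unfolding rh using that by (rule rp.tmap_add)
  have r_cls: "r h (P.cls t p u) = P.cls s (restr n h p) u" if "p \<in> carrier (free_module R (Hom n t))" "u \<in> carrier U" for p u
    unfolding rh using rp.tmap_cls[of p u] that by simp
  show "r h \<zero>\<^bsub>val MU t\<^esub> = \<zero>\<^bsub>val MU s\<^esub>" using r_zero by (simp add: val_MU)
  show "r h (x \<oplus>\<^bsub>val MU t\<^esub> y) = r h x \<oplus>\<^bsub>val MU s\<^esub> r h y"
    if "x \<in> carrier (val MU t)" "y \<in> carrier (val MU t)" for x y
    using r_add that by (simp add: val_MU)
  show "r h (act MU h v) = v" if "v \<in> carrier (val MU s)" for v
    using that unfolding val_MU
  proof (induction rule: P.tensor_induct)
    case zero show ?case using act_MU_zero[OF h] r_zero by simp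
  next
    case (add p u y)
    have 1: "r h (act MU h (P.cls s p u)) = P.cls s p u"
      using act_cls[OF h, of p u] r_cls[of "convolution R (delta R h) p" u] add restr_delta[OF h, of p n]
        convolution_closed_Hom[OF delta_in_free[OF h], of p n]
      by simp
    show ?case
      using act_MU_add[OF h P.cls_closed[OF add(1,2)] add(3)]
        r_add[OF act_MU_closed[OF h P.cls_closed[OF add(1,2)]] act_MU_closed[OF h add(3)]] 1 add.IH
      by simp
  qed
  show "r h (act MU g y) \<in> miss MU A s"
    if A: "A \<subseteq> full s" and g: "g \<in> Hom p t" "\<not> app h ` A \<subseteq> img g" and y: "y \<in> carrier (val MU p)" for A p g y
    using y unfolding val_MU
  proof (induction rule: P.tensor_induct)
    case zero
    have "r h (act MU g \<zero>\<^bsub>P.T p\<^esub>) = \<zero>\<^bsub>val MU s\<^esub>" using act_MU_zero[OF g(1)] r_zero by (simp add: val_MU)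
    thus ?case using miss.zero by metis
  next
    case (add q u y)
    have q: "q \<in> carrier (free_module R (Hom n p))" using add by simp
    have gq: "convolution R (delta R g) q \<in> carrier (free_module R (Hom n t))"
      by (rule convolution_closed_Hom[OF delta_in_free[OF g(1)] q])
    have "delta R g \<in> carrier (free_module R {g})" by (rule delta_in_free) simp
    hence "convolution R (delta R g) q \<in> carrier (free_module R {comp_mor g f | f. f \<in> Hom n p})"
      by (rule convolution_closed[OF _ q]) auto
    from restr_closed[OF this, of n h]
    have "restr n h (convolution R (delta R g) q) \<in> carrier (free_module R {f \<in> Hom n s. \<not> A \<subseteq> img f})"
    proof (rule free_mono)
      show "{f \<in> Hom n (src h). comp_mor h f \<in> {comp_mor g f |f. f \<in> Hom n p}} \<subseteq> {f \<in> Hom n s. \<not> A \<subseteq> img f}"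
      proof (clarify, intro conjI notI)
        fix f f' assume f: "f \<in> Hom n (src h)" and f': "f' \<in> Hom n p" and e: "comp_mor h f = comp_mor g f'"
        show "f \<in> Hom n s" using f by (simp add: Hom_src[OF h])
        assume "A \<subseteq> img f"
        hence "app h ` A \<subseteq> img (comp_mor h f)" using img_comp[OF f] by blast
        also have "\<dots> \<subseteq> img g" unfolding e img_comp[OF f'] img_Hom[OF g(1)] using img_subset_full[OF f'] by blast
        finally show False using g(2) by blast
      qed
    qed
    hence "P.cls s (restr n h (convolution R (delta R g) q)) u \<in> miss MU A s" by (rule cls_in_miss[OF _ add(2)])
    moreover have "r h (act MU g (P.cls p q u)) = P.cls s (restr n h (convolution R (delta R g) q)) u"
      using act_cls[OF g(1) q add(2)] r_cls[of "convolution R (delta R g) q" u] gq add(2) by simp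
    moreover have "r h (act MU g (P.cls p q u \<oplus>\<^bsub>P.T p\<^esub> y))
        = r h (act MU g (P.cls p q u)) \<oplus>\<^bsub>val MU s\<^esub> r h (act MU g y)"
      using act_MU_add[OF g(1) P.cls_closed[OF add(1,2)] add(3)]
        r_add[OF act_MU_closed[OF g(1) P.cls_closed[OF add(1,2)]] act_MU_closed[OF g(1) add(3)]]
      by (simp add: val_MU)
    ultimately show ?case using MU.miss_add[OF _ add.IH] by simp
  qed
qed

end

lemma cmodule_restrict:
  assumes V: "cmodule R V" and W: "subcmod R V W"
  shows "cmodule R (restrict_cmod V W)"
proof -
  interpret V: cmodule R V by (rule V)
  have sub: "W n \<subseteq> carrier (val V n)" for n
    using W subgroup.subset[OF submodule.axioms(1), of "W n" R "val V n"] by (simp add: subcmod_def)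
  show ?thesis
  proof (rule cmodule.intro)
    show "Module.module R (val (restrict_cmod V W) n)" for n
      using W submodule.submodule_is_module[OF _ V.module] by (simp add: restrict_cmod_def subcmod_def)
  qed (use W sub[THEN subsetD] in \<open>auto simp: restrict_cmod_def subcmod_def V.act_add V.act_smult V.act_id V.act_comp\<close>)
qed

locale plain_module = Module.module R M for R :: "'k ring" (structure) and M :: "('k, 'x) module" (structure)
begin

text \<open>
  The union that defines the induced maps on quotients in the definitions is the coset of the image of any representative.
\<close>

lemma coset_map:
  assumes N: "N \<subseteq> carrier M" and M': "abelian_group M'" "additive_subgroup N' M'"
    and closed: "\<And>x. x \<in> carrier M \<Longrightarrow> f x \<in> carrier M'"
    and add: "\<And>x y. x \<in> carrier M \<Longrightarrow> y \<in> carrier M \<Longrightarrow> f (x \<oplus>\<^bsub>M\<^esub> y) = f x \<oplus>\<^bsub>M'\<^esub> f y"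
    and sub: "\<And>x. x \<in> N \<Longrightarrow> f x \<in> N'" and zero: "\<zero>\<^bsub>M\<^esub> \<in> N" and c: "c \<in> carrier M"
  shows "(\<Union>x\<in>N +>\<^bsub>M\<^esub> c. N' +>\<^bsub>M'\<^esub> f x) = N' +>\<^bsub>M'\<^esub> f c"
proof -
  interpret M': abelian_group M' by (rule M')
  interpret N': additive_subgroup N' M' by (rule M')
  have "N' +>\<^bsub>M'\<^esub> f x = N' +>\<^bsub>M'\<^esub> f c" if xN: "x \<in> N +>\<^bsub>M\<^esub> c" for x
  proof -
    obtain y where y: "y \<in> N" "x = y \<oplus>\<^bsub>M\<^esub> c" using xN by (auto simp: a_r_coset_def' )
    hence "f x = f y \<oplus>\<^bsub>M'\<^esub> f c" using N c add by blast
    moreover have "N' +>\<^bsub>M'\<^esub> (f y \<oplus>\<^bsub>M'\<^esub> f c) = N' +>\<^bsub>M'\<^esub> f y +>\<^bsub>M'\<^esub> f c"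
      using M'.a_coset_add_assoc[OF N'.a_subset] closed N c y by blast
    moreover have "N' +>\<^bsub>M'\<^esub> f y = N'"
      using M'.a_coset_join2[OF _ N'.a_subgroup sub] closed N y by blast
    ultimately show ?thesis by simp
  qed
  moreover have "c \<in> N +>\<^bsub>M\<^esub> c" using zero c M.l_zero unfolding a_r_coset_def' by force
  ultimately show ?thesis by blast
qed

lemma quotient_is_module:
  assumes N: "submodule N R M"
  shows "Module.module R (quotient_module M N)"
    and "a \<in> carrier R \<Longrightarrow> x \<in> carrier M \<Longrightarrow> a \<odot>\<^bsub>quotient_module M N\<^esub> (N +>\<^bsub>M\<^esub> x) = N +>\<^bsub>M\<^esub> (a \<odot>\<^bsub>M\<^esub> x)"
    and "x \<in> carrier M \<Longrightarrow> y \<in> carrier M \<Longrightarrow> (N +>\<^bsub>M\<^esub> x) \<oplus>\<^bsub>quotient_module M N\<^esub> (N +>\<^bsub>M\<^esub> y) = N +>\<^bsub>M\<^esub> (x \<oplus>\<^bsub>M\<^esub> y)"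
proof -
  interpret N: submodule N R M by (rule N)
  have asub: "additive_subgroup N M" by (rule additive_subgroup.intro) (rule N.subgroup_axioms)
  interpret S: abelian_subgroup N M by (rule abelian_subgroupI3[OF asub M.abelian_group_axioms])
  have zN: "\<zero>\<^bsub>M\<^esub> \<in> N" by (rule S.zero_closed)
  show sm: "a \<odot>\<^bsub>quotient_module M N\<^esub> (N +>\<^bsub>M\<^esub> x) = N +>\<^bsub>M\<^esub> (a \<odot>\<^bsub>M\<^esub> x)" if "a \<in> carrier R" "x \<in> carrier M" for a x
  proof -
    have "(\<Union>y\<in>N +>\<^bsub>M\<^esub> x. N +>\<^bsub>M\<^esub> (a \<odot>\<^bsub>M\<^esub> y)) = N +>\<^bsub>M\<^esub> (a \<odot>\<^bsub>M\<^esub> x)"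
      by (rule coset_map[OF S.a_subset M.abelian_group_axioms asub])
        (use that zN N.smult_closed in \<open>auto simp: smult_r_distr\<close>)
    thus ?thesis by (simp add: quotient_module_def)
  qed
  show ad: "(N +>\<^bsub>M\<^esub> x) \<oplus>\<^bsub>quotient_module M N\<^esub> (N +>\<^bsub>M\<^esub> y) = N +>\<^bsub>M\<^esub> (x \<oplus>\<^bsub>M\<^esub> y)" if "x \<in> carrier M" "y \<in> carrier M" for x y
    using S.a_rcos_sum[OF that] by (simp add: quotient_module_def)
  have z: "\<zero>\<^bsub>quotient_module M N\<^esub> = N +>\<^bsub>M\<^esub> \<zero>\<^bsub>M\<^esub>"
    using S.a_subset by (simp add: quotient_module_def M.a_coset_add_zero)
  have cc: "\<And>x. x \<in> carrier M \<Longrightarrow> N +>\<^bsub>M\<^esub> x \<in> carrier (quotient_module M N)"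
    using M.a_rcosetsI[OF S.a_subset] by (simp add: quotient_module_def)
  have cE: "\<exists>x\<in>carrier M. X = N +>\<^bsub>M\<^esub> x" if "X \<in> carrier (quotient_module M N)" for X
    using that by (auto simp: quotient_module_def A_RCOSETS_def' )
  show "Module.module R (quotient_module M N)"
  proof (rule moduleI)
    show "cring R" by (rule is_cring)
    show "abelian_group (quotient_module M N)"
    proof (rule abelian_groupI)
      fix X assume "X \<in> carrier (quotient_module M N)"
      then obtain x where x: "x \<in> carrier M" "X = N +>\<^bsub>M\<^esub> x" using cE by blast
      show "\<exists>Y\<in>carrier (quotient_module M N). Y \<oplus>\<^bsub>quotient_module M N\<^esub> X = \<zero>\<^bsub>quotient_module M N\<^esub>"
        using x by (intro bexI[OF _ cc[of "\<ominus>\<^bsub>M\<^esub> x"]]) (auto simp: ad z M.l_neg)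
      show "\<zero>\<^bsub>quotient_module M N\<^esub> \<oplus>\<^bsub>quotient_module M N\<^esub> X = X" using x by (simp add: z ad)
      fix Y assume "Y \<in> carrier (quotient_module M N)"
      then obtain y where y: "y \<in> carrier M" "Y = N +>\<^bsub>M\<^esub> y" using cE by blast
      show "X \<oplus>\<^bsub>quotient_module M N\<^esub> Y \<in> carrier (quotient_module M N)" using x y by (simp add: ad cc)
      show "X \<oplus>\<^bsub>quotient_module M N\<^esub> Y = Y \<oplus>\<^bsub>quotient_module M N\<^esub> X" using x y by (simp add: ad M.a_comm)
      fix Z assume "Z \<in> carrier (quotient_module M N)"
      then obtain z where "z \<in> carrier M" "Z = N +>\<^bsub>M\<^esub> z" using cE by blast
      thus "X \<oplus>\<^bsub>quotient_module M N\<^esub> Y \<oplus>\<^bsub>quotient_module M N\<^esub> Z = X \<oplus>\<^bsub>quotient_module M N\<^esub> (Y \<oplus>\<^bsub>quotient_module M N\<^esub> Z)"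
        using x y by (simp add: ad M.a_assoc)
    qed (simp add: z cc)
    fix X assume "X \<in> carrier (quotient_module M N)"
    then obtain x where x: "x \<in> carrier M" "X = N +>\<^bsub>M\<^esub> x" using cE by blast
    show "\<one> \<odot>\<^bsub>quotient_module M N\<^esub> X = X" using x by (simp add: sm)
    fix a assume a: "a \<in> carrier R"
    show "a \<odot>\<^bsub>quotient_module M N\<^esub> X \<in> carrier (quotient_module M N)" using a x by (simp add: sm cc)
    show "a \<odot>\<^bsub>quotient_module M N\<^esub> (X \<oplus>\<^bsub>quotient_module M N\<^esub> Y) = a \<odot>\<^bsub>quotient_module M N\<^esub> X \<oplus>\<^bsub>quotient_module M N\<^esub> a \<odot>\<^bsub>quotient_module M N\<^esub> Y"
      if "Y \<in> carrier (quotient_module M N)" for Y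
    proof -
      obtain y where "y \<in> carrier M" "Y = N +>\<^bsub>M\<^esub> y" using cE \<open>Y \<in> _\<close> by blast
      thus ?thesis using a x by (simp add: sm ad smult_r_distr)
    qed
    fix b assume b: "b \<in> carrier R"
    show "(a \<oplus> b) \<odot>\<^bsub>quotient_module M N\<^esub> X = a \<odot>\<^bsub>quotient_module M N\<^esub> X \<oplus>\<^bsub>quotient_module M N\<^esub> b \<odot>\<^bsub>quotient_module M N\<^esub> X"
      using a b x by (simp add: sm ad smult_l_distr)
    show "(a \<otimes> b) \<odot>\<^bsub>quotient_module M N\<^esub> X = a \<odot>\<^bsub>quotient_module M N\<^esub> (b \<odot>\<^bsub>quotient_module M N\<^esub> X)"
      using a b x by (simp add: sm smult_assoc1)
  qed
qed

end

text \<open>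
  A submodule \<open>W\<close> of \<open>F\<close>; the quotient map is an epimorphism with kernel \<open>W\<close>.
\<close>

locale sub_pair = fcmodule R F for R :: "'k ring" and F :: "('m::finite, 'k, 'v) cmod" +
  fixes W :: "'m obj \<Rightarrow> 'v set"
  assumes sub: "subcmod R F W"
begin

lemma plain: "plain_module R (val F n)"
  by (rule plain_module.intro[OF val.module_axioms])

abbreviation "Q \<equiv> quotient_cmod F W"
abbreviation "proj \<equiv> (\<lambda>n x. W n +>\<^bsub>val F n\<^esub> x)"

lemma W_submodule: "submodule (W n) R (val F n)"
  using sub by (simp add: subcmod_def)

lemma W_additive: "additive_subgroup (W n) (val F n)"
  by (rule additive_subgroup.intro) (rule submodule.axioms[OF W_submodule])

lemma W_closed: "x \<in> W n \<Longrightarrow> x \<in> carrier (val F n)"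
  using additive_subgroup.a_subset[OF W_additive] by blast

lemma val_Q: "val Q n = quotient_module (val F n) (W n)"
  by (simp add: quotient_cmod_def)

lemma proj_closed: "x \<in> carrier (val F n) \<Longrightarrow> proj n x \<in> carrier (val Q n)"
  using grp.a_rcosetsI[OF additive_subgroup.a_subset[OF W_additive]] by (simp add: val_Q quotient_module_def)

lemma proj_cases: assumes "X \<in> carrier (val Q n)" obtains x where "x \<in> carrier (val F n)" "X = proj n x"
  using assms by (auto simp: val_Q quotient_module_def A_RCOSETS_def')

lemma proj_add: "\<lbrakk>x \<in> carrier (val F n); y \<in> carrier (val F n)\<rbrakk>
    \<Longrightarrow> proj n (x \<oplus>\<^bsub>val F n\<^esub> y) = proj n x \<oplus>\<^bsub>val Q n\<^esub> proj n y"
  using plain_module.quotient_is_module(3)[OF plain W_submodule] by (simp add: val_Q)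

lemma proj_smult: "\<lbrakk>a \<in> carrier R; x \<in> carrier (val F n)\<rbrakk>
    \<Longrightarrow> proj n (a \<odot>\<^bsub>val F n\<^esub> x) = a \<odot>\<^bsub>val Q n\<^esub> proj n x"
  using plain_module.quotient_is_module(2)[OF plain W_submodule] by (simp add: val_Q)

lemma proj_act:
  assumes f: "f \<in> Hom n t" and x: "x \<in> carrier (val F n)"
  shows "act Q f (proj n x) = proj t (act F f x)"
proof -
  have "(\<Union>y\<in>W n +>\<^bsub>val F n\<^esub> x. W t +>\<^bsub>val F t\<^esub> act F f y) = W t +>\<^bsub>val F t\<^esub> act F f x"
    by (rule plain_module.coset_map[OF plain additive_subgroup.a_subset[OF W_additive] grp W_additive])
      (use f x sub additive_subgroup.zero_closed[OF W_additive] in \<open>auto simp: act_closed act_add subcmod_def\<close>)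
  thus ?thesis using f by (simp add: quotient_cmod_def)
qed

lemma zero_Q: "\<zero>\<^bsub>val Q n\<^esub> = W n"
  by (simp add: val_Q quotient_module_def)

lemma proj_zero_iff: "x \<in> carrier (val F n) \<Longrightarrow> proj n x = \<zero>\<^bsub>val Q n\<^esub> \<longleftrightarrow> x \<in> W n"
  unfolding zero_Q
  using grp.a_coset_join1[OF _ _ additive_subgroup.a_subgroup[OF W_additive]]
    grp.a_coset_join2[OF _ additive_subgroup.a_subgroup[OF W_additive]] by blast

lemma cmodule_Q: "cmodule R Q"
proof (rule cmodule.intro)
  show "Module.module R (val Q n)" for n unfolding val_Q by (rule plain_module.quotient_is_module(1)[OF plain W_submodule])
next
  fix f n t X assume f: "f \<in> Hom n t" and "X \<in> carrier (val Q n)"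
  then obtain x where x: "x \<in> carrier (val F n)" "X = proj n x" by (elim proj_cases)
  show "act Q f X \<in> carrier (val Q t)" using f x by (simp add: proj_act proj_closed act_closed)
  show "act Q f (X \<oplus>\<^bsub>val Q n\<^esub> Y) = act Q f X \<oplus>\<^bsub>val Q t\<^esub> act Q f Y" if "Y \<in> carrier (val Q n)" for Y
  proof -
    obtain y where y: "y \<in> carrier (val F n)" "Y = proj n y" using \<open>Y \<in> _\<close> by (elim proj_cases)
    show ?thesis using f x y by (simp add: proj_add[symmetric] proj_act act_add act_closed)
  qed
  show "act Q f (a \<odot>\<^bsub>val Q n\<^esub> X) = a \<odot>\<^bsub>val Q t\<^esub> act Q f X" if "a \<in> carrier R" for a
    using f x that by (simp add: proj_smult[symmetric] proj_act act_smult act_closed)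
next
  fix n X assume "X \<in> carrier (val Q n)"
  then obtain x where x: "x \<in> carrier (val F n)" "X = proj n x" by (elim proj_cases)
  thus "act Q (id_mor n) X = X" by (simp add: proj_act[OF id_in_Hom] act_id)
next
  fix f g l n t X assume fg: "f \<in> Hom l n" "g \<in> Hom n t" and "X \<in> carrier (val Q l)"
  then obtain x where x: "x \<in> carrier (val F l)" "X = proj l x" by (elim proj_cases)
  show "act Q (comp_mor g f) X = act Q g (act Q f X)"
    using fg x by (simp add: proj_act[OF comp_in_Hom[OF fg]] proj_act act_comp act_closed)
qed

sublocale Q: fcmodule R Q by (rule fcmodule.intro[OF cmodule_Q])

sublocale epi F Q proj
proof unfold_locales
  show "\<exists>x\<in>carrier (val F n). proj n x = X" if "X \<in> carrier (val Q n)" for X n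
    using that by (elim proj_cases) blast
qed (auto simp: proj_closed proj_add proj_act)

lemma ker_eq: "ker = W"
proof
  show "ker n = W n" for n
    using proj_zero_iff[of _ n] W_closed[of _ n] unfolding ker_def by blast
qed

end

text \<open>
  An isomorphism is an epimorphism with zero kernel, and a zero kernel is pure.
\<close>

lemma saturated_iso:
  assumes "afun W" "afun V" "cmod_isomorphic R W V" "saturated W"
  shows "saturated V"
proof -
  obtain \<phi> where iso: "\<And>n. \<phi> n \<in> module_iso R (val W n) (val V n)"
    and nat: "\<And>n t f x. f \<in> Hom n t \<Longrightarrow> x \<in> carrier (val W n) \<Longrightarrow> \<phi> t (act W f x) = act V f (\<phi> n x)"
    using assms(3) unfolding cmod_isomorphic_def by blast
  interpret epi W V \<phi>
  proof (rule epi.intro[OF assms(1,2)], unfold_locales)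
    fix n
    have b: "bij_betw (\<phi> n) (carrier (val W n)) (carrier (val V n))" using iso by (auto simp: module_iso_def)
    show "\<phi> n x \<in> carrier (val V n)" if "x \<in> carrier (val W n)" for x using b that by (rule bij_betwE[THEN bspec])
    show "\<exists>x\<in>carrier (val W n). \<phi> n x = w" if "w \<in> carrier (val V n)" for w
    proof -
      have "w \<in> \<phi> n ` carrier (val W n)" using that unfolding bij_betw_imp_surj_on[OF b] .
      thus ?thesis by (elim imageE) (auto intro!: bexI)
    qed
  qed (use iso nat in \<open>auto simp: module_iso_def\<close>)
  have "z = \<zero>\<^bsub>val W t\<^esub>" if "z \<in> ker t" for z t
  proof -
    have "inj_on (\<phi> t) (carrier (val W t))" using iso by (auto simp: module_iso_def bij_betw_def)
    thus ?thesis using inj_onD[of "\<phi> t" _ z "\<zero>\<^bsub>val W t\<^esub>"] that pi_zero by (auto simp: ker_def)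
  qed
  hence "pure (full t) t" for t unfolding pure_def using miss.zero[of K t "full t"] by fastforce
  thus ?thesis by (rule saturated_of_pure[OF assms(4)])
qed

context fcmodule
begin

lemma saturated_of_relative_projective:
  assumes "relative_projective R V"
  shows "saturated V"
proof -
  obtain l W where W: "\<And>j. j \<le> l \<Longrightarrow> subcmod R V (W j)"
    and W0: "\<And>n. W 0 n = {\<zero>\<^bsub>val V n\<^esub>}" and Wl: "\<And>n. W l n = carrier (val V n)"
    and step: "\<And>j. j < l \<Longrightarrow> (\<forall>n. W j n \<subseteq> W (Suc j) n) \<and>
               basic_relative_projective R (quotient_cmod (restrict_cmod V (W (Suc j))) (W j))"
    using assms unfolding relative_projective_def by blast
  have "j \<le> l \<Longrightarrow> saturated (restrict_cmod V (W j))" for j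
  proof (induction j)
    case 0
    interpret Z: fcmodule R "restrict_cmod V (W 0)"
      by (rule fcmodule.intro[OF cmodule_restrict[OF cmodule_axioms W[OF 0]]])
    have "v \<in> miss (restrict_cmod V (W 0)) A n" if "v \<in> carrier (val (restrict_cmod V (W 0)) n)" for v n A
      using that W0 miss.zero[of "restrict_cmod V (W 0)" n A] by (simp add: restrict_cmod_def)
    thus ?case unfolding saturated_def saturated_at_def by blast
  next
    case (Suc j)
    hence j: "j < l" by simp
    let ?F = "restrict_cmod V (W (Suc j))"
    interpret F: fcmodule R ?F
      by (rule fcmodule.intro[OF cmodule_restrict[OF cmodule_axioms W[OF Suc.prems]]])
    have le: "W j n \<subseteq> W (Suc j) n" for n using step[OF j] by blast
    interpret S: sub_pair R ?F "W j"
    proof unfold_locales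
      have "submodule (W j n) R (val ?F n)" for n
      proof -
        have sm: "submodule (W j n) R (val V n)" using W[of j] j by (simp add: subcmod_def)
        show ?thesis
        proof (rule F.val.module_incl_imp_submodule)
          show "W j n \<subseteq> carrier (val ?F n)" using le by (simp add: restrict_cmod_def)
          show "Module.module R ((val ?F n)\<lparr>carrier := W j n\<rparr>)"
            using submodule.submodule_is_module[OF sm val.module_axioms] by (simp add: restrict_cmod_def)
        qed
      qed
      thus "subcmod R ?F (W j)" using W[of j] j by (simp add: subcmod_def restrict_cmod_def)
    qed
    obtain n and U :: "('m mor \<Rightarrow> 'k, 'v set) module" where U: "left_module (group_algebra R n) U"
      and iso: "cmod_isomorphic R (M_tensor R n U) S.Q"
      using step[OF j] unfolding basic_relative_projective_def by blast
    interpret I: induced R n U 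
      by (rule induced.intro[OF coeff.coeff_ring_axioms]) (unfold induced_axioms_def, rule U)
    have sQ: "saturated S.Q" by (rule saturated_iso[OF I.afun_MU S.Q.afun_axioms iso I.saturated_MU])
    have "S.K = restrict_cmod V (W j)" unfolding S.ker_eq by (simp add: restrict_cmod_def)
    hence "saturated S.K" using Suc.IH j by simp
    thus ?case using S.saturated_extension sQ by blast
  qed
  hence "saturated (restrict_cmod V (W l))" by simp
  moreover have "restrict_cmod V (W l) = V"
    using Wl by (simp add: restrict_cmod_def cmod.equality)
  ultimately show ?thesis by simp
qed

end

section \<open>Saturated modules are relative projective\<close>

inductive_set generated :: "('m, 'k, 'v) cmod \<Rightarrow> 'm obj set \<Rightarrow> 'm obj \<Rightarrow> 'v set" for V S t where
  zero: "\<zero>\<^bsub>val V t\<^esub> \<in> generated V S t"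
| step: "\<lbrakk>p \<in> S; g \<in> Hom p t; y \<in> carrier (val V p); w \<in> generated V S t\<rbrakk>
    \<Longrightarrow> act V g y \<oplus>\<^bsub>val V t\<^esub> w \<in> generated V S t"

lemma Hom_deg_less:
  assumes g: "g \<in> Hom p (n :: 'm::finite obj)" "\<not> full n \<subseteq> img g"
  shows "deg p < deg n"
proof -
  have "img g \<subset> full n" using g(2) img_subset_full[OF g(1)] by blast
  thus ?thesis using psubset_card_mono[OF finite_full] deg_img[OF g(1)] card_full by metis
qed

lemma hom_finsum:
  fixes G :: "('a, 'c) ring_scheme" and H :: "('b, 'd) ring_scheme"
  assumes G: "abelian_group G" and H: "abelian_group H"
    and zero: "h \<zero>\<^bsub>G\<^esub> = \<zero>\<^bsub>H\<^esub>"
    and closed: "\<And>x. x \<in> carrier G \<Longrightarrow> h x \<in> carrier H"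
    and add: "\<And>x y. x \<in> carrier G \<Longrightarrow> y \<in> carrier G \<Longrightarrow> h (x \<oplus>\<^bsub>G\<^esub> y) = h x \<oplus>\<^bsub>H\<^esub> h y"
    and "finite A" "f \<in> A \<rightarrow> carrier G"
  shows "h (finsum G f A) = finsum H (\<lambda>a. h (f a)) A"
proof -
  interpret G: abelian_group G by (rule G)
  interpret H: abelian_group H by (rule H)
  show ?thesis using assms(6,7)
  proof (induction A rule: finite_induct)
    case empty show ?case by (simp add: zero)
  next
    case (insert a A)
    have f: "f \<in> A \<rightarrow> carrier G" "f a \<in> carrier G" using insert by auto
    have "finsum G f A \<in> carrier G" by (rule G.finsum_closed[OF f(1)])
    moreover have "(\<lambda>a. h (f a)) \<in> A \<rightarrow> carrier H" using f closed by auto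
    ultimately show ?case using insert f add closed by (simp add: G.finsum_insert H.finsum_insert)
  qed
qed

lemma (in coeff_ring) convolution_smult_left:
  assumes a: "a \<in> carrier R" and p: "p \<in> carrier (free_module R S)" and q: "q \<in> carrier (free_module R S')"
  shows "convolution R (\<lambda>s. a \<otimes> p s) q = (\<lambda>s. a \<otimes> convolution R p q s)"
proof
  fix h
  let ?P = "{x. p x \<noteq> \<zero>}" and ?Q = "{x. q x \<noteq> \<zero>}"
  let ?Z = "{(g, f) \<in> ?P \<times> ?Q. src g = tgt f \<and> comp_mor g f = h}"
  have fin: "finite ?P" "finite ?Q" using free_finite p q by auto
  note cl = free_coeff_closed[OF p] free_coeff_closed[OF q]
  have "finite ?Z" by (rule finite_subset[of _ "?P \<times> ?Q"]) (use fin in auto)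
  have sub: "{x. a \<otimes> p x \<noteq> \<zero>} \<subseteq> ?P" using a by auto
  have "convolution R (\<lambda>s. a \<otimes> p s) q h = (\<Oplus>z\<in>?Z. case z of (g, f) \<Rightarrow> (a \<otimes> p g) \<otimes> q f)"
    by (rule convolution_eq[OF free_smult_closed[OF p a] q fin(1) sub fin(2)]) simp
  also have "\<dots> = (\<Oplus>z\<in>?Z. a \<otimes> (case z of (g, f) \<Rightarrow> p g \<otimes> q f))"
    by (rule finsum_cong') (use cl a in \<open>auto simp: m_assoc\<close>)
  also have "\<dots> = a \<otimes> (\<Oplus>z\<in>?Z. case z of (g, f) \<Rightarrow> p g \<otimes> q f)"
    by (rule finsum_rdistr[symmetric]) (use cl a \<open>finite ?Z\<close> in auto)
  also have "\<dots> = a \<otimes> convolution R p q h"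
    using convolution_eq[OF p q fin(1) _ fin(2)] by simp
  finally show "convolution R (\<lambda>s. a \<otimes> p s) q h = a \<otimes> convolution R p q h" .
qed

context fcmodule
begin

lemma generated_closed: "w \<in> generated V S t \<Longrightarrow> w \<in> carrier (val V t)"
  by (induction rule: generated.induct) (auto intro: act_closed)

lemma act_in_generated: "\<lbrakk>p \<in> S; g \<in> Hom p t; y \<in> carrier (val V p)\<rbrakk> \<Longrightarrow> act V g y \<in> generated V S t"
  using generated.step[of p S g t y V "\<zero>\<^bsub>val V t\<^esub>"] generated.zero[of V t S] by (simp add: act_closed)

lemma generated_add: "w \<in> generated V S t \<Longrightarrow> u \<in> generated V S t \<Longrightarrow> w \<oplus>\<^bsub>val V t\<^esub> u \<in> generated V S t"
proof (induction rule: generated.induct)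
  case zero thus ?case by (simp add: generated_closed)
next
  case (step p g y w)
  have "act V g y \<oplus>\<^bsub>val V t\<^esub> w \<oplus>\<^bsub>val V t\<^esub> u = act V g y \<oplus>\<^bsub>val V t\<^esub> (w \<oplus>\<^bsub>val V t\<^esub> u)"
    using step by (simp add: grp.a_assoc act_closed generated_closed)
  with step show ?case by (simp add: generated.step)
qed

lemma generated_smult: "w \<in> generated V S t \<Longrightarrow> a \<in> carrier R \<Longrightarrow> a \<odot>\<^bsub>val V t\<^esub> w \<in> generated V S t"
proof (induction rule: generated.induct)
  case zero thus ?case by (simp add: generated.zero)
next
  case (step p g y w)
  have "a \<odot>\<^bsub>val V t\<^esub> (act V g y \<oplus>\<^bsub>val V t\<^esub> w) = act V g (a \<odot>\<^bsub>val V p\<^esub> y) \<oplus>\<^bsub>val V t\<^esub> a \<odot>\<^bsub>val V t\<^esub> w"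
    using step by (simp add: val.smult_r_distr act_closed generated_closed act_smult)
  with step show ?case by (simp add: generated.step)
qed

lemma generated_minus: "w \<in> generated V S t \<Longrightarrow> \<ominus>\<^bsub>val V t\<^esub> w \<in> generated V S t"
  using generated_smult[of w S t "\<ominus>\<^bsub>R\<^esub> \<one>\<^bsub>R\<^esub>"] val.smult_l_minus[of "\<one>\<^bsub>R\<^esub>" w t] generated_closed[of w S t] by simp

lemma generated_act: "w \<in> generated V S n \<Longrightarrow> f \<in> Hom n t \<Longrightarrow> act V f w \<in> generated V S t"
proof (induction rule: generated.induct)
  case zero thus ?case by (simp add: act_zero generated.zero)
next
  case (step p g y w)
  have "act V f (act V g y \<oplus>\<^bsub>val V n\<^esub> w) = act V (comp_mor f g) y \<oplus>\<^bsub>val V t\<^esub> act V f w"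
    using step by (simp add: act_add act_closed generated_closed act_comp)
  thus ?case using generated.step[OF step(1) comp_in_Hom[OF step(2) step.prems] step(3)] step.IH step.prems by simp
qed

lemma generated_mono: "w \<in> generated V S t \<Longrightarrow> S \<subseteq> S' \<Longrightarrow> w \<in> generated V S' t"
  by (induction rule: generated.induct) (auto intro: generated.intros)

lemma generated_empty: "generated V {} t = {\<zero>\<^bsub>val V t\<^esub>}"
  by (auto elim: generated.cases intro: generated.zero)

lemma generated_self: "n \<in> S \<Longrightarrow> generated V S n = carrier (val V n)"
  using act_in_generated[OF _ id_in_Hom, of n S] generated_closed[of _ S n] act_id[of _ n] by fastforce

lemma generated_submodule: "submodule (generated V S t) R (val V t)"
  by (rule val.submoduleI) (auto intro: generated_closed generated.zero generated_minus generated_add generated_smult)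

lemma generated_subcmod: "subcmod R V (generated V S)"
  unfolding subcmod_def using generated_submodule generated_act by blast

end

text \<open>
  One step of the filtration: \<open>m\<close> is a new object, all objects of smaller degree have already been used, and no object of
  larger degree has.
\<close>

locale filtration_step = fcmodule R V for R :: "'k ring" and V :: "('m::finite, 'k, 'v) cmod" +
  fixes S :: "'m obj set" and m :: "'m obj"
  assumes saturated_at: "saturated V" and new: "m \<notin> S"
    and old: "\<And>p. p \<in> S \<Longrightarrow> deg p \<le> deg m" and below: "\<And>p. deg p < deg m \<Longrightarrow> p \<in> S"
begin

abbreviation "F \<equiv> restrict_cmod V (generated V (insert m S))"

sublocale F: fcmodule R F
  by (rule fcmodule.intro[OF cmodule_restrict[OF cmodule_axioms generated_subcmod]])

lemma F_simps [simp]: "carrier (val F n) = generated V (insert m S) n" "\<zero>\<^bsub>val F n\<^esub> = \<zero>\<^bsub>val V n\<^esub>"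
  "x \<oplus>\<^bsub>val F n\<^esub> y = x \<oplus>\<^bsub>val V n\<^esub> y" "a \<odot>\<^bsub>val F n\<^esub> x = a \<odot>\<^bsub>val V n\<^esub> x" "act F = act V"
  by (simp_all add: restrict_cmod_def)

sublocale sub_pair R F "generated V S"
proof unfold_locales
  have "submodule (generated V S n) R (val F n)" for n
  proof (rule F.val.module_incl_imp_submodule)
    show "generated V S n \<subseteq> carrier (val F n)" using generated_mono[of _ S n "insert m S"] by auto
    show "Module.module R ((val F n)\<lparr>carrier := generated V S n\<rparr>)"
      using submodule.submodule_is_module[OF generated_submodule[of S n] val.module_axioms] by (simp add: restrict_cmod_def)
  qed
  thus "subcmod R F (generated V S)" using generated_act by (simp add: subcmod_def)
qed

text \<open>
  The value of the quotient at \<open>m\<close>, which is \<open>V\<^sub>m / (\<mm>V)\<^sub>m\<close> by \<open>miss_below\<close>, as a module over the group algebra.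
\<close>

definition U :: "('m mor \<Rightarrow> 'k, 'v set) module" where
  "U = \<lparr>carrier = carrier (val Q m), mult = undefined, one = undefined, ring.zero = \<zero>\<^bsub>val Q m\<^esub>,
     ring.add = (\<lambda>x y. x \<oplus>\<^bsub>val Q m\<^esub> y), smult = Q.lin m m\<rparr>"

lemma U_simps [simp]: "carrier U = carrier (val Q m)" "\<zero>\<^bsub>U\<^esub> = \<zero>\<^bsub>val Q m\<^esub>"
  "x \<oplus>\<^bsub>U\<^esub> y = x \<oplus>\<^bsub>val Q m\<^esub> y" "a \<odot>\<^bsub>U\<^esub> x = Q.lin m m a x"
  by (simp_all add: U_def)

lemma U_left_module: "left_module (group_algebra R m) U"
proof (rule left_module.intro)
  show "ring (group_algebra R m)" by (rule coeff.group_algebra_ring)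
  show "abelian_group U"
  proof (rule abelian_groupI)
    fix x assume "x \<in> carrier U"
    thus "\<exists>y\<in>carrier U. y \<oplus>\<^bsub>U\<^esub> x = \<zero>\<^bsub>U\<^esub>"
      by (intro bexI[of _ "\<ominus>\<^bsub>val Q m\<^esub> x"]) (auto simp: Q.grp.l_neg)
  qed (auto simp: Q.grp.a_ac)
  show "left_module_axioms (group_algebra R m) U"
  proof (rule left_module_axioms.intro)
    show "\<one>\<^bsub>group_algebra R m\<^esub> \<odot>\<^bsub>U\<^esub> x = x" if "x \<in> carrier U" for x
      using that Q.lin_delta[OF id_in_Hom, of x m] by (simp add: Q.act_id)
    show "(a \<otimes>\<^bsub>group_algebra R m\<^esub> b) \<odot>\<^bsub>U\<^esub> x = a \<odot>\<^bsub>U\<^esub> (b \<odot>\<^bsub>U\<^esub> x)"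
      if "a \<in> carrier (group_algebra R m)" "b \<in> carrier (group_algebra R m)" "x \<in> carrier U" for a b x
      using that Q.lin_assoc[of a m m b m x] by simp
  qed (auto simp: Q.lin_closed Q.lin_add_left Q.lin_add_right)
qed

sublocale I: induced R m U
  by (rule induced.intro[OF coeff.coeff_ring_axioms]) (unfold induced_axioms_def, rule U_left_module)

lemma comparison_exists: "\<exists>h. (\<forall>x\<in>carrier (I.P.T t). h x \<in> carrier (val Q t)) \<and>
   (\<forall>x\<in>carrier (I.P.T t). \<forall>y\<in>carrier (I.P.T t). h (x \<oplus>\<^bsub>I.P.T t\<^esub> y) = h x \<oplus>\<^bsub>val Q t\<^esub> h y) \<and>
   (\<forall>p\<in>carrier (free_module R (Hom m t)). \<forall>u\<in>carrier (val Q m). h (I.P.cls t p u) = Q.lin m t p u)"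
proof -
  obtain h where "\<And>x. x \<in> carrier (I.P.T t) \<Longrightarrow> h x \<in> carrier (val Q t)"
    "\<And>x y. x \<in> carrier (I.P.T t) \<Longrightarrow> y \<in> carrier (I.P.T t) \<Longrightarrow> h (x \<oplus>\<^bsub>I.P.T t\<^esub> y) = h x \<oplus>\<^bsub>val Q t\<^esub> h y"
    "\<And>p u. p \<in> carrier (M_bimodule R m t) \<Longrightarrow> u \<in> carrier U \<Longrightarrow> h (I.P.cls t p u) = Q.lin m t p u"
    by (rule I.P.tensor_universal[where H = "val Q t" and \<beta> = "Q.lin m t" and t = t])
      (auto simp: Q.grp Q.lin_closed Q.lin_add_left Q.lin_add_right Q.lin_assoc)
  thus ?thesis by (intro exI[of _ h]) simp
qed

text \<open>
  The natural map from \<open>M(m) \<otimes> U\<close> to the quotient, \<open>f \<otimes> u \<mapsto> f u\<close>.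
\<close>

definition comparison :: "'m obj \<Rightarrow> (('m mor \<Rightarrow> 'k) \<times> 'v set \<Rightarrow>\<^sub>0 int) set \<Rightarrow> 'v set" where
  "comparison t = (SOME h. (\<forall>x\<in>carrier (I.P.T t). h x \<in> carrier (val Q t)) \<and>
   (\<forall>x\<in>carrier (I.P.T t). \<forall>y\<in>carrier (I.P.T t). h (x \<oplus>\<^bsub>I.P.T t\<^esub> y) = h x \<oplus>\<^bsub>val Q t\<^esub> h y) \<and>
   (\<forall>p\<in>carrier (free_module R (Hom m t)). \<forall>u\<in>carrier (val Q m). h (I.P.cls t p u) = Q.lin m t p u))"

lemma comparison:
  "x \<in> carrier (I.P.T t) \<Longrightarrow> comparison t x \<in> carrier (val Q t)"
  "\<lbrakk>x \<in> carrier (I.P.T t); y \<in> carrier (I.P.T t)\<rbrakk>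
    \<Longrightarrow> comparison t (x \<oplus>\<^bsub>I.P.T t\<^esub> y) = comparison t x \<oplus>\<^bsub>val Q t\<^esub> comparison t y"
  "\<lbrakk>p \<in> carrier (free_module R (Hom m t)); u \<in> carrier (val Q m)\<rbrakk>
    \<Longrightarrow> comparison t (I.P.cls t p u) = Q.lin m t p u"
  using someI_ex[OF comparison_exists[of t]] unfolding comparison_def[symmetric] by blast+

lemma comparison_hom: "abelian_group_hom (I.P.T t) (val Q t) (comparison t)"
  by (rule abelian_group_homI) (auto simp: I.P.grpT Q.grp group_hom_def group_hom_axioms_def hom_def comparison
      intro: I.P.T.a_group Q.grp.a_group)

lemma comparison_zero: "comparison t \<zero>\<^bsub>I.P.T t\<^esub> = \<zero>\<^bsub>val Q t\<^esub>"
  by (rule abelian_group_hom.hom_zero[OF comparison_hom])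

lemma comparison_act:
  assumes g: "g \<in> Hom t s" and x: "x \<in> carrier (I.P.T t)"
  shows "comparison s (act I.MU g x) = act Q g (comparison t x)"
  using x
proof (induction rule: I.P.tensor_induct)
  case zero
  show ?case by (simp only: I.act_MU_zero[OF g] comparison_zero Q.act_zero[OF g])
next
  case (add p u y)
  have p: "p \<in> carrier (free_module R (Hom m t))" and u: "u \<in> carrier (val Q m)" using add by auto
  have gp: "convolution R (delta R g) p \<in> carrier (free_module R (Hom m s))"
    by (rule coeff.convolution_closed_Hom[OF coeff.delta_in_free[OF g] p])
  have 1: "comparison s (act I.MU g (I.P.cls t p u)) = act Q g (comparison t (I.P.cls t p u))"
    using I.act_cls[OF g p, of u] u comparison(3)[OF p u] comparison(3)[OF gp u] Q.lin_act[OF g p u] by simp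
  have c: "I.P.cls t p u \<in> carrier (I.P.T t)" by (rule I.P.cls_closed[OF add(1,2)])
  have "comparison s (act I.MU g (I.P.cls t p u \<oplus>\<^bsub>I.P.T t\<^esub> y))
      = comparison s (act I.MU g (I.P.cls t p u)) \<oplus>\<^bsub>val Q s\<^esub> comparison s (act I.MU g y)"
    by (simp only: I.act_MU_add[OF g c add(3)] comparison(2)[OF I.act_MU_closed[OF g c] I.act_MU_closed[OF g add(3)]])
  also have "\<dots> = act Q g (comparison t (I.P.cls t p u) \<oplus>\<^bsub>val Q t\<^esub> comparison t y)"
    unfolding 1 add.IH by (rule Q.act_add[OF g comparison(1)[OF c] comparison(1)[OF add(3)], symmetric])
  also have "\<dots> = act Q g (comparison t (I.P.cls t p u \<oplus>\<^bsub>I.P.T t\<^esub> y))"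
    by (simp only: comparison(2)[OF c add(3)])
  finally show ?case .
qed

lemma smult_pair:
  assumes a: "a \<in> carrier R"
  shows "tensor_pair_map (group_algebra R m) (M_bimodule R m t) U (M_bimodule R m t) U (\<lambda>x. a \<odot>\<^bsub>M_bimodule R m t\<^esub> x) id"
proof (unfold_locales, goal_cases)
  case (1 x) thus ?case using coeff.free_smult_closed[OF _ a] by simp
next
  case (3 x x') thus ?case
    using a coeff.free_coeff_closed[of x "Hom m t"] coeff.free_coeff_closed[of x' "Hom m t"] by (simp add: val.R.r_distr)
next
  case (5 x b) thus ?case using coeff.convolution_smult_left[OF a, of x "Hom m t" b "Hom m m"] by simp
qed auto

lemma comparison_smult:
  assumes a: "a \<in> carrier R" and x: "x \<in> carrier (I.P.T t)"
  shows "comparison t (a \<odot>\<^bsub>I.P.T t\<^esub> x) = a \<odot>\<^bsub>val Q t\<^esub> comparison t x"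
proof -
  interpret s: tensor_pair_map "group_algebra R m" "M_bimodule R m t" U "M_bimodule R m t" U
    "\<lambda>x. a \<odot>\<^bsub>M_bimodule R m t\<^esub> x" id by (rule smult_pair[OF a])
  have eq: "a \<odot>\<^bsub>I.P.T t\<^esub> x = s.tmap x" for x by (rule I.P.smult_T)
  show ?thesis using x
  proof (induction rule: I.P.tensor_induct)
    case zero
    show ?case using a by (simp only: eq s.tmap_zero comparison_zero Q.val.smult_r_null)
  next
    case (add p u y)
    have p: "p \<in> carrier (free_module R (Hom m t))" and u: "u \<in> carrier (val Q m)" using add by auto
    have ap: "(\<lambda>s. a \<otimes>\<^bsub>R\<^esub> p s) \<in> carrier (free_module R (Hom m t))" by (rule coeff.free_smult_closed[OF p a])
    have "s.tmap (I.P.cls t p u) = I.P.cls t (\<lambda>s. a \<otimes>\<^bsub>R\<^esub> p s) u"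
      using s.tmap_cls[OF add(1,2)] by simp
    hence 1: "comparison t (s.tmap (I.P.cls t p u)) = a \<odot>\<^bsub>val Q t\<^esub> comparison t (I.P.cls t p u)"
      using comparison(3)[OF p u] comparison(3)[OF ap u] Q.lin_smult[OF a p u] by simp
    have c: "I.P.cls t p u \<in> carrier (I.P.T t)" by (rule I.P.cls_closed[OF add(1,2)])
    have "comparison t (s.tmap (I.P.cls t p u \<oplus>\<^bsub>I.P.T t\<^esub> y))
        = comparison t (s.tmap (I.P.cls t p u)) \<oplus>\<^bsub>val Q t\<^esub> comparison t (s.tmap y)"
      by (simp only: s.tmap_add[OF c add(3)] comparison(2)[OF s.tmap_closed[OF c] s.tmap_closed[OF add(3)]])
    also have "\<dots> = a \<odot>\<^bsub>val Q t\<^esub> (comparison t (I.P.cls t p u) \<oplus>\<^bsub>val Q t\<^esub> comparison t y)"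
      unfolding 1 add.IH[unfolded eq]
      by (rule Q.val.smult_r_distr[OF a comparison(1)[OF c] comparison(1)[OF add(3)], symmetric])
    also have "\<dots> = a \<odot>\<^bsub>val Q t\<^esub> comparison t (I.P.cls t p u \<oplus>\<^bsub>I.P.T t\<^esub> y)"
      by (simp only: comparison(2)[OF c add(3)])
    finally show ?case unfolding eq .
  qed
qed

lemma F_at_m: "carrier (val F m) = carrier (val V m)"
  using generated_self[of m "insert m S"] by simp

lemma comparison_surj:
  assumes "X \<in> carrier (val Q t)"
  shows "\<exists>x\<in>carrier (I.P.T t). comparison t x = X"
proof -
  obtain x where x: "x \<in> generated V (insert m S) t" "X = proj t x" using proj_cases[OF assms] F_simps(1) by metis
  have "\<exists>z\<in>carrier (I.P.T t). comparison t z = proj t x"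
    using x(1)
  proof (induction rule: generated.induct)
    case zero
    have "proj t \<zero>\<^bsub>val V t\<^esub> = \<zero>\<^bsub>val Q t\<^esub>" using pi_zero[of t] by simp
    thus ?case using comparison_zero[of t] I.P.T.zero_closed[of t] by metis
  next
    case (step p g y w)
    then obtain z where z: "z \<in> carrier (I.P.T t)" "comparison t z = proj t w" by blast
    have gy: "act V g y \<in> carrier (val F t)" using act_in_generated[OF step(1-3)] by simp
    have w: "w \<in> carrier (val F t)" using step by simp
    have pr: "proj t (act V g y \<oplus>\<^bsub>val V t\<^esub> w) = proj t (act V g y) \<oplus>\<^bsub>val Q t\<^esub> proj t w"
      using proj_add[OF gy w] by simp
    show ?case
    proof (cases "p = m")
      case True
      hence g: "g \<in> Hom m t" and y: "y \<in> carrier (val F m)" using step F_at_m by auto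
      have c: "I.P.cls t (delta R g) (proj m y) \<in> carrier (I.P.T t)"
        by (rule I.P.cls_closed) (use coeff.delta_in_free[OF g] proj_closed[OF y] in auto)
      have "comparison t (I.P.cls t (delta R g) (proj m y)) = proj t (act V g y)"
        using comparison(3)[OF coeff.delta_in_free[OF g] proj_closed[OF y]] Q.lin_delta[OF g proj_closed[OF y]]
          proj_act[OF g y] by simp
      hence "comparison t (I.P.cls t (delta R g) (proj m y) \<oplus>\<^bsub>I.P.T t\<^esub> z) = proj t (act V g y \<oplus>\<^bsub>val V t\<^esub> w)"
        using comparison(2)[OF c z(1)] z(2) pr by simp
      thus ?thesis using I.P.T.a_closed[OF c z(1)] by blast
    next
      case False
      hence "act V g y \<in> generated V S t" using step act_in_generated by blast
      hence "proj t (act V g y) = \<zero>\<^bsub>val Q t\<^esub>" using proj_zero_iff[OF gy] by blast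
      hence "proj t (act V g y \<oplus>\<^bsub>val V t\<^esub> w) = proj t w" using pr Q.grp.l_zero[OF proj_closed[OF w]] by simp
      thus ?thesis using z by blast
    qed
  qed
  thus ?thesis using x by simp
qed

text \<open>
  One representative for each orbit of the symmetric group of \<open>m\<close> on the morphisms \<open>m \<rightarrow> t\<close>, that is for each range.
\<close>

definition rep :: "'m obj \<Rightarrow> 'm mor \<Rightarrow> 'm mor" where
  "rep t f = (SOME g. g \<in> Hom m t \<and> img g = img f)"

definition Reps :: "'m obj \<Rightarrow> 'm mor set" where
  "Reps t = rep t ` Hom m t"

lemma rep: "f \<in> Hom m t \<Longrightarrow> rep t f \<in> Hom m t \<and> img (rep t f) = img f"
  unfolding rep_def by (rule someI[of "\<lambda>g. g \<in> Hom m t \<and> img g = img f" f]) simp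

lemma Reps_Hom: "f \<in> Reps t \<Longrightarrow> f \<in> Hom m t"
  unfolding Reps_def using rep by blast

lemma finite_Reps: "finite (Reps t)"
  unfolding Reps_def by simp

lemma Reps_img_inj: "f \<in> Reps t \<Longrightarrow> g \<in> Reps t \<Longrightarrow> img f = img g \<Longrightarrow> f = g"
proof -
  assume "f \<in> Reps t" "g \<in> Reps t" and e: "img f = img g"
  then obtain f' g' where fg: "f = rep t f'" "f' \<in> Hom m t" "g = rep t g'" "g' \<in> Hom m t"
    unfolding Reps_def by blast
  hence "img f' = img g'" using rep[of f' t] rep[of g' t] e by metis
  thus "f = g" unfolding fg rep_def by simp
qed

text \<open>
  The normal form of the elements of \<open>M(m) \<otimes> U\<close>: \<open>M(m)\<^sub>t\<close> is free as a right module on the representatives.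
\<close>

definition combo :: "'m obj \<Rightarrow> ('m mor \<Rightarrow> 'v set) \<Rightarrow> (('m mor \<Rightarrow> 'k) \<times> 'v set \<Rightarrow>\<^sub>0 int) set" where
  "combo t u = finsum (I.P.T t) (\<lambda>f. I.P.cls t (delta R f) (u f)) (Reps t)"

lemma cls_delta_closed: "\<lbrakk>f \<in> Hom m t; w \<in> carrier (val Q m)\<rbrakk> \<Longrightarrow> I.P.cls t (delta R f) w \<in> carrier (I.P.T t)"
  by (rule I.P.cls_closed) (use coeff.delta_in_free in auto)

lemma combo_add:
  assumes u: "u \<in> Reps t \<rightarrow> carrier (val Q m)" and w: "w \<in> Reps t \<rightarrow> carrier (val Q m)"
  shows "combo t u \<oplus>\<^bsub>I.P.T t\<^esub> combo t w = combo t (\<lambda>f. u f \<oplus>\<^bsub>val Q m\<^esub> w f)"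
proof -
  have "combo t (\<lambda>f. u f \<oplus>\<^bsub>val Q m\<^esub> w f)
      = finsum (I.P.T t) (\<lambda>f. I.P.cls t (delta R f) (u f) \<oplus>\<^bsub>I.P.T t\<^esub> I.P.cls t (delta R f) (w f)) (Reps t)"
    unfolding combo_def
  proof (rule I.P.T.finsum_cong')
    fix f assume f: "f \<in> Reps t"
    hence "u f \<in> carrier U" "w f \<in> carrier U" "delta R f \<in> carrier (M_bimodule R m t)"
      using u w coeff.delta_in_free[OF Reps_Hom[OF f]] by auto
    thus "I.P.cls t (delta R f) (u f \<oplus>\<^bsub>val Q m\<^esub> w f) = I.P.cls t (delta R f) (u f) \<oplus>\<^bsub>I.P.T t\<^esub> I.P.cls t (delta R f) (w f)"
      using I.P.cls_add_right[of "delta R f" t "u f" "w f"] by simp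
  next
    show "(\<lambda>f. I.P.cls t (delta R f) (u f) \<oplus>\<^bsub>I.P.T t\<^esub> I.P.cls t (delta R f) (w f)) \<in> Reps t \<rightarrow> carrier (I.P.T t)"
      using cls_delta_closed[OF Reps_Hom] funcset_mem[OF u] funcset_mem[OF w] by (auto intro!: I.P.T.a_closed)
  qed simp
  also have "\<dots> = combo t u \<oplus>\<^bsub>I.P.T t\<^esub> combo t w"
    unfolding combo_def by (rule I.P.T.finsum_addf)
      (use cls_delta_closed[OF Reps_Hom] funcset_mem[OF u] funcset_mem[OF w] in auto)
  finally show ?thesis ..
qed

lemma combo_single:
  assumes f: "f \<in> Reps t" and w: "w \<in> carrier (val Q m)"
  shows "combo t (\<lambda>g. if f = g then w else \<zero>\<^bsub>val Q m\<^esub>) = I.P.cls t (delta R f) w"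
proof -
  have "combo t (\<lambda>g. if f = g then w else \<zero>\<^bsub>val Q m\<^esub>)
      = finsum (I.P.T t) (\<lambda>g. if f = g then I.P.cls t (delta R g) w else \<zero>\<^bsub>I.P.T t\<^esub>) (Reps t)"
    unfolding combo_def
  proof (rule I.P.T.finsum_cong')
    fix g assume g: "g \<in> Reps t"
    have "I.P.cls t (delta R g) \<zero>\<^bsub>val Q m\<^esub> = \<zero>\<^bsub>I.P.T t\<^esub>"
      using I.P.cls_zero_right[of "delta R g" t] coeff.delta_in_free[OF Reps_Hom[OF g]] by simp
    thus "I.P.cls t (delta R g) (if f = g then w else \<zero>\<^bsub>val Q m\<^esub>)
        = (if f = g then I.P.cls t (delta R g) w else \<zero>\<^bsub>I.P.T t\<^esub>)" by simp
  qed (use w cls_delta_closed Reps_Hom I.P.T.zero_closed in auto)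
  also have "\<dots> = I.P.cls t (delta R f) w"
    by (rule I.P.T.add.finprod_singleton[OF f finite_Reps]) (use w cls_delta_closed Reps_Hom in auto)
  finally show ?thesis .
qed

lemma combo_sing:
  assumes f: "f \<in> Hom m t" and a: "a \<in> carrier R" and w: "w \<in> carrier (val Q m)"
  shows "\<exists>u. u \<in> Reps t \<rightarrow> carrier (val Q m) \<and> combo t u = I.P.cls t (sing R f a) w"
proof -
  obtain s where s: "s \<in> Hom m m" "f = comp_mor (rep t f) s"
    using factor_through[OF f, of "rep t f" m] rep[OF f] by blast
  have ss: "sing R s a \<in> carrier (free_module R (Hom m m))" by (rule coeff.sing_in_free[OF s(1) a])
  have d: "delta R (rep t f) \<in> carrier (free_module R (Hom m t))" using coeff.delta_in_free rep[OF f] by blast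
  have "convolution R (delta R (rep t f)) (sing R s a) = sing R f a"
    using a Hom_src[OF conjunct1[OF rep[OF f]]] Hom_tgt[OF s(1)] by (simp add: delta_sing coeff.convolution_sing s(2)[symmetric])
  hence "I.P.cls t (sing R f a) w = I.P.cls t (delta R (rep t f)) (Q.lin m m (sing R s a) w)"
    using I.P.cls_balanced[of "delta R (rep t f)" t "sing R s a" w] d ss w by simp
  moreover have "Q.lin m m (sing R s a) w \<in> carrier (val Q m)" by (rule Q.lin_closed[OF ss w])
  moreover have "rep t f \<in> Reps t" using f by (simp add: Reps_def)
  ultimately show ?thesis using combo_single[of "rep t f" t "Q.lin m m (sing R s a) w"]
    by (intro exI[of _ "\<lambda>g. if rep t f = g then Q.lin m m (sing R s a) w else \<zero>\<^bsub>val Q m\<^esub>"]) auto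
qed

lemma combo_zero: "combo t (\<lambda>f. \<zero>\<^bsub>val Q m\<^esub>) = \<zero>\<^bsub>I.P.T t\<^esub>"
proof -
  have "combo t (\<lambda>f. \<zero>\<^bsub>val Q m\<^esub>) = finsum (I.P.T t) (\<lambda>f. \<zero>\<^bsub>I.P.T t\<^esub>) (Reps t)"
    unfolding combo_def
  proof (rule I.P.T.finsum_cong')
    fix f assume "f \<in> Reps t"
    thus "I.P.cls t (delta R f) \<zero>\<^bsub>val Q m\<^esub> = \<zero>\<^bsub>I.P.T t\<^esub>"
      using I.P.cls_zero_right[of "delta R f" t] coeff.delta_in_free[OF Reps_Hom] by simp
  qed (use I.P.T.zero_closed in auto)
  thus ?thesis by (simp only: I.P.T.finsum_zero)
qed

lemma combo_exists:
  assumes "x \<in> carrier (I.P.T t)"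
  shows "\<exists>u. u \<in> Reps t \<rightarrow> carrier (val Q m) \<and> combo t u = x"
  using assms
proof (induction rule: I.P.tensor_induct)
  case zero
  show ?case using combo_zero[of t] by (intro exI[of _ "\<lambda>f. \<zero>\<^bsub>val Q m\<^esub>"]) auto
next
  case (add p w y)
  then obtain uy where uy: "uy \<in> Reps t \<rightarrow> carrier (val Q m)" "combo t uy = y" by blast
  have p: "p \<in> carrier (free_module R (Hom m t))" and w: "w \<in> carrier (val Q m)" using add by auto
  have "\<exists>u. u \<in> Reps t \<rightarrow> carrier (val Q m) \<and> combo t u = I.P.cls t p w"
    using p
  proof (induction rule: coeff.free_induct)
    case zero
    have "I.P.cls t (\<lambda>s. \<zero>\<^bsub>R\<^esub>) w = \<zero>\<^bsub>I.P.T t\<^esub>" using I.P.cls_zero_left[of w t] w by simp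
    thus ?case using combo_zero[of t] by (intro exI[of _ "\<lambda>f. \<zero>\<^bsub>val Q m\<^esub>"]) auto
  next
    case (add f a p)
    then obtain u where u: "u \<in> Reps t \<rightarrow> carrier (val Q m)" "combo t u = I.P.cls t p w" by blast
    obtain u' where u': "u' \<in> Reps t \<rightarrow> carrier (val Q m)" "combo t u' = I.P.cls t (sing R f a) w"
      using combo_sing[OF add(1,2) w] by blast
    have "I.P.cls t (\<lambda>x. sing R f a x \<oplus>\<^bsub>R\<^esub> p x) w = I.P.cls t (sing R f a) w \<oplus>\<^bsub>I.P.T t\<^esub> I.P.cls t p w"
      using I.P.cls_add_left[of "sing R f a" t p w] coeff.sing_in_free[OF add(1,2)] add(3) w by simp
    hence "combo t (\<lambda>f. u' f \<oplus>\<^bsub>val Q m\<^esub> u f) = I.P.cls t (\<lambda>x. sing R f a x \<oplus>\<^bsub>R\<^esub> p x) w"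
      using combo_add[OF u'(1) u(1)] u u' by simp
    thus ?case using u(1) u'(1) by (intro exI[of _ "\<lambda>f. u' f \<oplus>\<^bsub>val Q m\<^esub> u f"]) auto
  qed
  then obtain u where u: "u \<in> Reps t \<rightarrow> carrier (val Q m)" "combo t u = I.P.cls t p w" by blast
  show ?case using combo_add[OF u(1) uy(1)] u uy by (intro exI[of _ "\<lambda>f. u f \<oplus>\<^bsub>val Q m\<^esub> uy f"]) auto
qed

lemma miss_below: "v \<in> miss V (full m) m \<Longrightarrow> v \<in> generated V S m"
proof (induction rule: miss.induct)
  case zero show ?case by (rule generated.zero)
next
  case (step g p y w)
  show ?case by (rule generated.step[OF below[OF Hom_deg_less[OF step(1,2)]] step(1,3) step.IH])
qed

text \<open>
  The range of a morphism from an old object cannot contain the range of \<open>f\<close>: its cardinality is at most that of the range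
  of \<open>f\<close>, and equal ranges would make the object equal to \<open>m\<close>.
\<close>

lemma generated_in_miss:
  assumes f: "f \<in> Hom m t" and "w \<in> generated V S t"
  shows "w \<in> miss V (img f) t"
  using assms(2)
proof (induction rule: generated.induct)
  case zero show ?case by (rule miss.zero)
next
  case (step p g y w)
  have "\<not> img f \<subseteq> img g"
  proof
    assume a: "img f \<subseteq> img g"
    have "deg p \<le> deg m" by (rule old[OF step(1)])
    hence "card (img g) \<le> card (img f)" using deg_img[OF f] deg_img[OF step(2)] by simp
    moreover have "finite (img g)" using img_subset_full[OF step(2)] finite_subset finite_full by blast
    ultimately have "img f = img g" using card_seteq[OF _ a] by blast
    hence "m = p" using Hom_same_img[OF f step(2)] by simp
    thus False using new step(1) by simp
  qed
  thus ?case by (intro miss.step[OF step(2) _ step(3)] step.IH)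
qed

text \<open>
  Write \<open>x = \<Sum> f \<otimes> u\<^sub>f\<close> in normal form and lift \<open>u\<^sub>f\<close> to \<open>v\<^sub>f \<in> V\<^sub>m\<close>.  As \<open>x\<close> maps to zero, \<open>\<Sum> f v\<^sub>f\<close> comes from old objects.
  Fix one of the \<open>f\<close> and let \<open>v = v\<^sub>f\<close>.  The elements from old objects and the other terms of the sum lie in
  \<open>miss V (img f) t\<close>, hence so does \<open>f v\<close>.  By saturation \<open>v\<close> lies in \<open>miss V (full m) m\<close>, which consists of elements
  from old objects, so that its class \<open>u\<^sub>f\<close> is zero.
\<close>

lemma comparison_inj:
  assumes x: "x \<in> carrier (I.P.T t)" and cx: "comparison t x = \<zero>\<^bsub>val Q t\<^esub>"
  shows "x = \<zero>\<^bsub>I.P.T t\<^esub>"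
proof -
  obtain u where u: "u \<in> Reps t \<rightarrow> carrier (val Q m)" "combo t u = x" using combo_exists[OF x] by blast
  have "\<exists>v. v \<in> carrier (val F m) \<and> u f = proj m v" if "f \<in> Reps t" for f
    using u(1) that proj_cases[of "u f" m] by (metis PiE funcset_mem)
  then obtain v where v: "\<And>f. f \<in> Reps t \<Longrightarrow> v f \<in> carrier (val F m) \<and> u f = proj m (v f)" by metis
  have av: "act V f (v f) \<in> carrier (val F t)" if "f \<in> Reps t" for f
    using F.act_closed[OF Reps_Hom[OF that]] v[OF that] by simp
  let ?s = "\<lambda>A. finsum (val F t) (\<lambda>f. act V f (v f)) A"
  have "comparison t x = finsum (val Q t) (\<lambda>f. comparison t (I.P.cls t (delta R f) (u f))) (Reps t)"
    unfolding u(2)[symmetric] combo_def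
    by (rule hom_finsum[OF I.P.grpT Q.grp comparison_zero comparison(1) comparison(2) finite_Reps])
      (use cls_delta_closed[OF Reps_Hom] funcset_mem[OF u(1)] in auto)
  also have "\<dots> = finsum (val Q t) (\<lambda>f. proj t (act V f (v f))) (Reps t)"
  proof (rule Q.grp.finsum_cong')
    fix f assume f: "f \<in> Reps t"
    have uf: "u f \<in> carrier (val Q m)" using u(1) f by blast
    show "comparison t (I.P.cls t (delta R f) (u f)) = proj t (act V f (v f))"
      using comparison(3)[OF coeff.delta_in_free[OF Reps_Hom[OF f]] uf] Q.lin_delta[OF Reps_Hom[OF f] uf]
        proj_act[OF Reps_Hom[OF f], of "v f"] v[OF f] by simp
  qed (use av proj_closed in auto)
  also have "\<dots> = proj t (?s (Reps t))"
    by (rule hom_finsum[OF F.grp Q.grp pi_zero pi_closed pi_add finite_Reps, symmetric]) (use av in auto)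
  finally have "proj t (?s (Reps t)) = \<zero>\<^bsub>val Q t\<^esub>" using cx by simp
  moreover have scl: "?s A \<in> carrier (val F t)" if "A \<subseteq> Reps t" for A
    by (rule F.grp.finsum_closed) (use av that in auto)
  ultimately have inS: "?s (Reps t) \<in> generated V S t" using proj_zero_iff scl by blast
  have u0: "u f0 = \<zero>\<^bsub>val Q m\<^esub>" if f0: "f0 \<in> Reps t" for f0
  proof -
    have f0H: "f0 \<in> Hom m t" by (rule Reps_Hom[OF f0])
    have rest: "?s A \<in> miss V (img f0) t" if "A \<subseteq> Reps t - {f0}" for A
    proof -
      have "finite A" using that finite_Reps finite_subset by blast
      thus ?thesis using that
      proof (induction A rule: finite_induct)
        case empty show ?case using miss.zero[of V t "img f0"] by simp
      next
        case (insert f A)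
        have fR: "f \<in> Reps t" "f \<noteq> f0" using insert by auto
        have "?s (insert f A) = act V f (v f) \<oplus>\<^bsub>val V t\<^esub> ?s A"
          using insert av by (subst F.grp.finsum_insert) auto
        moreover have "\<not> img f0 \<subseteq> img f"
        proof
          assume "img f0 \<subseteq> img f"
          moreover have "card (img f0) = card (img f)" using deg_img[OF f0H] deg_img[OF Reps_Hom[OF fR(1)]] by simp
          moreover have "finite (img f)"
            using img_subset_full[OF Reps_Hom[OF fR(1)]] finite_subset finite_full by blast
          ultimately have "img f0 = img f" by (metis card_subset_eq)
          thus False using Reps_img_inj[OF f0 fR(1)] fR(2) by blast
        qed
        moreover have "v f \<in> carrier (val V m)" using v[OF fR(1)] F_at_m by blast
        ultimately show ?case using miss.step[OF Reps_Hom[OF fR(1)]] insert by simp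
      qed
    qed
    have cl: "act V f0 (v f0) \<in> carrier (val V t)" "?s (Reps t - {f0}) \<in> carrier (val V t)"
      using av[OF f0] scl[of "Reps t - {f0}"] generated_closed[of _ "insert m S" t] by auto
    have "?s (Reps t) = ?s (insert f0 (Reps t - {f0}))" using f0 by (simp add: insert_absorb)
    also have "\<dots> = act V f0 (v f0) \<oplus>\<^bsub>val V t\<^esub> ?s (Reps t - {f0})"
      using av f0 finite_Reps[of t] by (subst F.grp.finsum_insert) auto
    finally have "act V f0 (v f0) = ?s (Reps t) \<ominus>\<^bsub>val V t\<^esub> ?s (Reps t - {f0})"
      using cl by (simp add: grp.sum_diff_right)
    hence "act V f0 (v f0) \<in> miss V (img f0) t"
      using miss_diff[OF generated_in_miss[OF f0H inS] rest[OF subset_refl]] by simp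
    hence "v f0 \<in> miss V (full m) m"
      using saturatedD[OF saturated_at subset_refl f0H, of "v f0"] v[OF f0] F_at_m unfolding img_Hom[OF f0H] by blast
    hence "v f0 \<in> generated V S m" by (rule miss_below)
    thus ?thesis using proj_zero_iff[of "v f0" m] v[OF f0] by simp
  qed
  have "x = combo t (\<lambda>f. \<zero>\<^bsub>val Q m\<^esub>)"
    unfolding u(2)[symmetric] combo_def
  proof (rule I.P.T.finsum_cong')
    show "(\<lambda>f. I.P.cls t (delta R f) \<zero>\<^bsub>val Q m\<^esub>) \<in> Reps t \<rightarrow> carrier (I.P.T t)"
      using cls_delta_closed Reps_Hom by auto
  qed (use u0 in auto)
  thus ?thesis by (simp add: combo_zero)
qed

lemma comparison_iso: "comparison t \<in> module_iso R (val I.MU t) (val Q t)"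
proof -
  have "inj_on (comparison t) (carrier (I.P.T t))"
  proof (rule inj_onI)
    fix x y assume xy: "x \<in> carrier (I.P.T t)" "y \<in> carrier (I.P.T t)" "comparison t x = comparison t y"
    have "comparison t (x \<ominus>\<^bsub>I.P.T t\<^esub> y) = comparison t x \<ominus>\<^bsub>val Q t\<^esub> comparison t y"
      using xy(1,2) comparison(2)[OF xy(1) I.P.T.a_inv_closed[OF xy(2)]] abelian_group_hom.hom_a_inv[OF comparison_hom xy(2)]
      by (simp add: a_minus_def)
    also have "\<dots> = \<zero>\<^bsub>val Q t\<^esub>" unfolding xy(3) by (rule Q.grp.diff_self[OF comparison(1)[OF xy(2)]])
    finally have "x \<ominus>\<^bsub>I.P.T t\<^esub> y = \<zero>\<^bsub>I.P.T t\<^esub>" by (rule comparison_inj[OF I.P.T.minus_closed[OF xy(1,2)]])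
    thus "x = y" using I.P.T.split_summand[OF xy(1,2)] I.P.T.l_zero[OF xy(2)] by metis
  qed
  moreover have "comparison t ` carrier (I.P.T t) = carrier (val Q t)"
    using comparison(1) comparison_surj by blast
  ultimately show ?thesis
    unfolding module_iso_def I.val_MU using comparison_smult comparison(2) by (simp add: bij_betw_def)
qed

lemma step_basic: "basic_relative_projective R Q"
  unfolding basic_relative_projective_def
proof (intro exI conjI)
  show "left_module (group_algebra R m) U" by (rule U_left_module)
  show "cmod_isomorphic R I.MU Q"
    unfolding cmod_isomorphic_def using comparison_iso comparison_act by (intro exI[of _ comparison]) (simp add: I.val_MU)
qed

end

context fcmodule
begin

lemma generated_all:
  assumes d: "\<And>n. d \<le> deg n \<Longrightarrow> carrier (val V n) \<subseteq> miss V (full n) n"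
    and S: "\<And>n. deg n < d \<Longrightarrow> n \<in> S"
  shows "generated V S n = carrier (val V n)"
proof (induction "deg n" arbitrary: n rule: less_induct)
  case less
  show ?case
  proof (cases "deg n < d")
    case True
    thus ?thesis using generated_self[OF S] by blast
  next
    case False
    have "v \<in> generated V S n" if "v \<in> miss V (full n) n" for v
      using that
    proof (induction rule: miss.induct)
      case zero show ?case by (rule generated.zero)
    next
      case (step g p y w)
      have "y \<in> generated V S p" using less[OF Hom_deg_less[OF step(1,2)]] step(3) by simp
      thus ?case by (intro generated_add generated_act[OF _ step(1)] step.IH)
    qed
    thus ?thesis using d[of n] False generated_closed[of _ S n] by auto
  qed
qed

lemma finite_objects: "finite {n :: 'm obj. deg n < d}"
proof -
  have "{n :: 'm obj. deg n < d} \<subseteq> PiE UNIV (\<lambda>i. {..d})"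
  proof
    fix n :: "'m obj" assume "n \<in> {n. deg n < d}"
    hence "n i < d" for i using member_le_sum[of i UNIV n] by (simp add: deg_def)
    thus "n \<in> PiE UNIV (\<lambda>i. {..d})" by (auto simp: PiE_iff less_imp_le)
  qed
  thus ?thesis by (rule finite_subset) (auto intro!: finite_PiE)
qed

text \<open>
  The assumption on \<open>d\<close> says \<open>V\<^sub>n = (\<mm>V)\<^sub>n\<close> in degrees at least \<open>d\<close>; the objects of degree less than \<open>d\<close>, sorted by
  degree, give the filtration.
\<close>

lemma relative_projective_of_saturated:
  assumes saturated_at: "saturated V" and d: "\<And>n. d \<le> deg n \<Longrightarrow> carrier (val V n) \<subseteq> miss V (full n) n"
  shows "relative_projective R V"
proof -
  obtain xs where xs: "set xs = {n :: 'm obj. deg n < d}" "distinct xs"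
    using finite_distinct_list[OF finite_objects] by blast
  define ns where "ns = sort_key deg xs"
  have ns: "set ns = {n. deg n < d}" "distinct ns" "sorted (map deg ns)"
    using xs by (simp_all add: ns_def)
  let ?W = "\<lambda>j. generated V (set (take j ns))"
  have "basic_relative_projective R (quotient_cmod (restrict_cmod V (?W (Suc j))) (?W j))" if j: "j < length ns" for j
  proof -
    interpret filtration_step R V "set (take j ns)" "ns ! j"
    proof unfold_locales
      show "saturated V" by (rule saturated_at)
      show "ns ! j \<notin> set (take j ns)"
        using ns(2) j by (metis distinct_take id_take_nth_drop not_distinct_conv_prefix in_set_conv_decomp distinct_append disjoint_insert(1) list.simps(15))
      show "deg p \<le> deg (ns ! j)" if pS: "p \<in> set (take j ns)" for p
      proof -
        obtain i where i: "i < j" "p = ns ! i" using pS j by (auto simp: in_set_conv_nth)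
        thus ?thesis using sorted_nth_mono[OF ns(3), of i j] j by simp
      qed
      show "p \<in> set (take j ns)" if p: "deg p < deg (ns ! j)" for p
      proof -
        have "ns ! j \<in> set ns" using j by simp
        hence "p \<in> set ns" using p ns(1) by simp
        then obtain i where i: "i < length ns" "p = ns ! i" by (auto simp: in_set_conv_nth)
        have "i < j"
        proof (rule ccontr)
          assume "\<not> i < j"
          hence "deg (ns ! j) \<le> deg (ns ! i)" using sorted_nth_mono[OF ns(3), of j i] i by simp
          thus False using p i by simp
        qed
        thus ?thesis using i by (auto simp: in_set_conv_nth intro!: exI[of _ i])
      qed
    qed
    have "set (take (Suc j) ns) = insert (ns ! j) (set (take j ns))" using j by (simp add: take_Suc_conv_app_nth)
    thus ?thesis using step_basic by simp
  qed
  moreover have "?W (length ns) n = carrier (val V n)" for n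
    by (rule generated_all[OF d]) (use ns(1) in auto)
  moreover have "?W j n \<subseteq> ?W (Suc j) n" for j n
    using generated_mono[of _ "set (take j ns)" n "set (take (Suc j) ns)"] set_take_subset_set_take[of j "Suc j" ns] by auto
  moreover have "?W 0 n = {\<zero>\<^bsub>val V n\<^esub>}" for n by (simp add: generated_empty)
  ultimately show ?thesis unfolding relative_projective_def
    using generated_subcmod by (intro exI[of _ "length ns"] exI[of _ ?W]) simp
qed

end

section \<open>Tensoring with the quotient by the up-ideal\<close>

text \<open>
  As a rewrite rule, \<open>Hom_tgt\<close> loops on assumptions of the form \<open>f \<in> Hom (src f) (tgt f)\<close>.
\<close>

declare Hom_tgt [simp del]

lemma abelian_group_cong:
  fixes M :: "('a, 'c) ring_scheme" and N :: "('a, 'd) ring_scheme"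
  assumes "abelian_group M" "carrier N = carrier M" "\<zero>\<^bsub>N\<^esub> = \<zero>\<^bsub>M\<^esub>"
    "\<And>x y. x \<oplus>\<^bsub>N\<^esub> y = x \<oplus>\<^bsub>M\<^esub> y"
  shows "abelian_group N"
proof -
  interpret M: abelian_group M by (rule assms)
  show ?thesis
  proof (rule abelian_groupI)
    show "\<exists>y\<in>carrier N. y \<oplus>\<^bsub>N\<^esub> x = \<zero>\<^bsub>N\<^esub>" if "x \<in> carrier N" for x
      using that by (intro bexI[of _ "\<ominus>\<^bsub>M\<^esub> x"]) (auto simp: assms(2-4) M.l_neg)
  qed (auto simp: assms(2-4) M.a_ac)
qed

text \<open>
  The morphisms that span the ideal \<open>\<mm>\<close>.
\<close>

definition Raising :: "'m mor set" where
  "Raising = {f \<in> Mors. src f < tgt f}"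

lemma Raising_Hom: "f \<in> Raising \<Longrightarrow> f \<in> Hom (src f) (tgt f) \<and> src f < tgt f"
  by (simp add: Raising_def mem_Mors)

lemma Mors_le: "f \<in> Mors \<Longrightarrow> src f \<le> tgt f"
  using Hom_le[of f "src f" "tgt f"] by (simp add: mem_Mors)

lemma id_Mors [simp]: "id_mor n \<in> Mors"
  by (rule Hom_Mors[OF id_in_Hom])

lemma src_tgt_id [simp]: "src (id_mor n) = n" "tgt (id_mor n) = n"
  using Hom_src[OF id_in_Hom[of n]] Hom_tgt[OF id_in_Hom[of n]] by simp_all

context coeff_ring
begin

abbreviation alg :: "('k, 'm mor \<Rightarrow> 'k) module" where "alg \<equiv> cat_algebra R"
abbreviation up :: "('m mor \<Rightarrow> 'k) set" where "up \<equiv> up_ideal R"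
abbreviation bar :: "('m mor \<Rightarrow> 'k) \<Rightarrow> ('m mor \<Rightarrow> 'k) set" where "bar p \<equiv> up +>\<^bsub>alg\<^esub> p"
abbreviation top_mod :: "('m mor \<Rightarrow> 'k, 'm mor \<Rightarrow> 'k, ('m mor \<Rightarrow> 'k) set) bimodule" where
  "top_mod \<equiv> cat_algebra_mod_up R"

lemma alg_simps [simp]: "carrier alg = carrier (free_module R Mors)" "\<zero>\<^bsub>alg\<^esub> = (\<lambda>s. \<zero>)"
  "p \<oplus>\<^bsub>alg\<^esub> q = (\<lambda>s. p s \<oplus> q s)" "p \<otimes>\<^bsub>alg\<^esub> q = convolution R p q"
  "a \<odot>\<^bsub>alg\<^esub> p = (\<lambda>s. a \<otimes> p s)"
  by (simp_all add: cat_algebra_def free_module_def)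

lemma alg_module: "Module.module R (alg :: ('k, 'm mor \<Rightarrow> 'k) module)"
proof (rule moduleI)
  show "abelian_group (alg :: ('k, 'm mor \<Rightarrow> 'k) module)"
    by (rule abelian_group_cong[OF free_abelian_group[of Mors]]) auto
qed (auto simp: is_cring free_smult_closed free_coeff_closed l_distr r_distr m_assoc)

lemma up_eq: "(up :: ('m mor \<Rightarrow> 'k) set) = carrier (free_module R Raising)"
proof (intro subset_antisym subsetI)
  fix p :: "'m mor \<Rightarrow> 'k"
  assume "p \<in> up"
  hence p: "p \<in> carrier (free_module R Mors)" "\<And>f. p f \<noteq> \<zero> \<Longrightarrow> src f < tgt f" by (auto simp: up_ideal_def)
  show "p \<in> carrier (free_module R Raising)"
    by (rule free_moduleI) (use p free_coeff_closed[OF p(1)] free_supp[OF p(1)] free_finite[OF p(1)] in \<open>auto simp: Raising_def\<close>)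
next
  fix p :: "'m mor \<Rightarrow> 'k"
  assume p: "p \<in> carrier (free_module R Raising)"
  have "p \<in> carrier (free_module R Mors)" by (rule free_mono[OF p]) (auto simp: Raising_def)
  thus "p \<in> up" using free_supp[OF p] by (auto simp: up_ideal_def Raising_def)
qed

lemma up_closed: "p \<in> up \<Longrightarrow> p \<in> carrier (free_module R Mors)"
  unfolding up_eq by (erule free_mono) (auto simp: Raising_def)

lemma up_submodule: "submodule up R (alg :: ('k, 'm mor \<Rightarrow> 'k) module)"
proof -
  interpret A: Module.module R "alg :: ('k, 'm mor \<Rightarrow> 'k) module" by (rule alg_module)
  show ?thesis
  proof (rule A.submoduleI)
    fix p :: "'m mor \<Rightarrow> 'k" assume p: "p \<in> up"
    have "\<ominus>\<^bsub>alg\<^esub> p = (\<lambda>s. \<ominus> p s)"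
      by (rule A.M.minus_equality) (use p up_closed[OF p] free_minus_closed[OF up_closed[OF p]]
        free_coeff_closed[OF up_closed[OF p]] in \<open>auto simp: l_neg\<close>)
    thus "\<ominus>\<^bsub>alg\<^esub> p \<in> up" using p free_minus_closed unfolding up_eq by simp
  next
    show "(up :: ('m mor \<Rightarrow> 'k) set) \<subseteq> carrier alg" using up_closed by auto
  qed (auto simp: up_eq free_zero_closed free_add_closed free_smult_closed)
qed

lemma plain_alg: "plain_module R (alg :: ('k, 'm mor \<Rightarrow> 'k) module)"
  by (rule plain_module.intro[OF alg_module])

lemma up_additive: "additive_subgroup up (alg :: ('k, 'm mor \<Rightarrow> 'k) module)"
  by (rule additive_subgroup.intro) (rule submodule.axioms[OF up_submodule])

lemma convolution_up_left: "\<lbrakk>p \<in> up; q \<in> carrier (free_module R Mors)\<rbrakk> \<Longrightarrow> convolution R p q \<in> up"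
  unfolding up_eq
proof (erule (1) convolution_closed)
  fix g f :: "'m mor" assume g: "g \<in> Raising" and f: "f \<in> Mors" and e: "src g = tgt f"
  have "src f \<le> tgt f" "tgt f < tgt g" using Mors_le[OF f] Raising_Hom[OF g] e by auto
  thus "comp_mor g f \<in> Raising" using g f e comp_in_Mors[of g f] by (auto simp: Raising_def)
qed

lemma convolution_up_right: "\<lbrakk>p \<in> carrier (free_module R Mors); q \<in> up\<rbrakk> \<Longrightarrow> convolution R p q \<in> up"
  unfolding up_eq
proof (erule (1) convolution_closed)
  fix g f :: "'m mor" assume f: "f \<in> Raising" and g: "g \<in> Mors" and e: "src g = tgt f"
  have "src f < tgt f" "tgt f \<le> tgt g" using Mors_le[OF g] Raising_Hom[OF f] e by auto
  thus "comp_mor g f \<in> Raising" using g f e comp_in_Mors[of g f] by (auto simp: Raising_def)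
qed

lemma bar_closed: "p \<in> carrier (free_module R Mors) \<Longrightarrow> bar p \<in> carrier top_mod"
  using abelian_group.a_rcosetsI[OF module.axioms(2)[OF alg_module] additive_subgroup.a_subset[OF up_additive]]
  by (simp add: cat_algebra_mod_up_def Let_def FactRing_def)

lemma bar_cases:
  assumes "x \<in> carrier top_mod" obtains p where "p \<in> carrier (free_module R Mors)" "x = bar p"
  using assms by (auto simp: cat_algebra_mod_up_def Let_def FactRing_def A_RCOSETS_def')

lemma bar_add: "\<lbrakk>p \<in> carrier (free_module R Mors); q \<in> carrier (free_module R Mors)\<rbrakk>
    \<Longrightarrow> bar p \<oplus>\<^bsub>top_mod\<^esub> bar q = bar (\<lambda>s. p s \<oplus> q s)"
  using plain_module.quotient_is_module(3)[OF plain_alg up_submodule, of p q]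
  by (simp add: cat_algebra_mod_up_def Let_def FactRing_def quotient_module_def)

lemma top_mod_zero: "\<zero>\<^bsub>top_mod\<^esub> = up"
  by (simp add: cat_algebra_mod_up_def Let_def FactRing_def)

lemma top_mod_group: "abelian_group (top_mod :: ('m mor \<Rightarrow> 'k, 'm mor \<Rightarrow> 'k, ('m mor \<Rightarrow> 'k) set) bimodule)"
  by (rule abelian_group_cong[OF module.axioms(2)[OF plain_module.quotient_is_module(1)[OF plain_alg up_submodule]]])
    (simp_all add: cat_algebra_mod_up_def Let_def FactRing_def quotient_module_def)

lemma bar_up: "p \<in> up \<Longrightarrow> bar p = \<zero>\<^bsub>top_mod\<^esub>"
  unfolding top_mod_zero
  by (rule abelian_group.a_coset_join2[OF module.axioms(2)[OF alg_module] _ additive_subgroup.a_subgroup[OF up_additive]])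
    (simp_all add: up_closed)

lemma bar_shift: "\<lbrakk>k \<in> up; p \<in> carrier (free_module R Mors)\<rbrakk> \<Longrightarrow> bar (\<lambda>s. k s \<oplus> p s) = bar p"
  using bar_add[OF up_closed, of k p] bar_up[of k] abelian_monoid.l_zero[OF abelian_group.axioms(1)[OF top_mod_group] bar_closed, of p]
  by simp

lemma bar_mem: "a \<in> bar p \<longleftrightarrow> (\<exists>k\<in>up. a = (\<lambda>s. k s \<oplus> p s))"
  by (auto simp: a_r_coset_def')

lemma bar_self: "p \<in> carrier (free_module R Mors) \<Longrightarrow> p \<in> bar p"
proof -
  assume p: "p \<in> carrier (free_module R Mors)"
  show ?thesis unfolding bar_mem
    by (rule bexI[of _ "\<lambda>s. \<zero>"]) (use free_coeff_closed[OF p] in \<open>simp_all add: up_eq free_zero_closed\<close>)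
qed

text \<open>
  In the product of \<open>i + p\<close> and \<open>j + q\<close> with \<open>i\<close> and \<open>j\<close> in \<open>\<mm>\<close>, all terms except \<open>p q\<close> lie in the two-sided ideal \<open>\<mm>\<close>.
\<close>

lemma bar_mult:
  assumes p: "p \<in> carrier (free_module R Mors)" and q: "q \<in> carrier (free_module R Mors)"
  shows "rcoset_mult alg up (bar p) (bar q) = bar (convolution R p q)"
proof -
  have *: "bar (convolution R a b) = bar (convolution R p q)" if ab: "a \<in> bar p" "b \<in> bar q" for a b
  proof -
    obtain i j where ij: "i \<in> up" "a = (\<lambda>s. i s \<oplus> p s)" "j \<in> up" "b = (\<lambda>s. j s \<oplus> q s)"
      using ab bar_mem by blast
    have b: "b \<in> carrier (free_module R Mors)" unfolding ij(4) by (rule free_add_closed[OF up_closed[OF ij(3)] q])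
    have "convolution R a b = (\<lambda>s. convolution R i b s \<oplus> convolution R p b s)"
      unfolding ij(2) by (rule convolution_add_left[OF up_closed[OF ij(1)] p b])
    hence "bar (convolution R a b) = bar (convolution R p b)"
      using bar_shift[OF convolution_up_left[OF ij(1) b] convolution_closed_Mors[OF p b]] by simp
    moreover have "convolution R p b = (\<lambda>s. convolution R p j s \<oplus> convolution R p q s)"
      unfolding ij(4) by (rule convolution_add_right[OF p up_closed[OF ij(3)] q])
    hence "bar (convolution R p b) = bar (convolution R p q)"
      using bar_shift[OF convolution_up_right[OF p ij(3)] convolution_closed_Mors[OF p q]] by simp
    ultimately show ?thesis by simp
  qed
  have "rcoset_mult alg up (bar p) (bar q) = (\<Union>a\<in>bar p. \<Union>b\<in>bar q. bar (convolution R a b))"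
    by (simp add: rcoset_mult_def)
  also have "\<dots> = (\<Union>a\<in>bar p. \<Union>b\<in>bar q. bar (convolution R p q))"
    by (intro SUP_cong refl *)
  also have "\<dots> = bar (convolution R p q)" using bar_self[OF p] bar_self[OF q] by auto
  finally show ?thesis .
qed

lemma rsmult_bar: "\<lbrakk>p \<in> carrier (free_module R Mors); q \<in> carrier (free_module R Mors)\<rbrakk>
    \<Longrightarrow> rsmult top_mod (bar p) q = bar (convolution R p q)"
  by (simp add: cat_algebra_mod_up_def Let_def FactRing_def bar_mult)

lemma smult_bar: "\<lbrakk>p \<in> carrier (free_module R Mors); q \<in> carrier (free_module R Mors)\<rbrakk>
    \<Longrightarrow> p \<odot>\<^bsub>top_mod\<^esub> bar q = bar (convolution R p q)"
  by (simp add: cat_algebra_mod_up_def Let_def FactRing_def bar_mult)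

text \<open>
  Local units: the category algebra is not unital, but the sum of the identities of finitely many objects acts as a unit on
  everything supported there.
\<close>

definition unit :: "'m obj set \<Rightarrow> 'm mor \<Rightarrow> 'k" where
  "unit N = (\<lambda>f. if f \<in> id_mor ` N then \<one> else \<zero>)"

lemma id_mor_inj: "id_mor n = id_mor n' \<longleftrightarrow> n = n'"
  by (metis src_tgt_id(1))

lemma unit_empty: "unit {} = (\<lambda>f. \<zero>)"
  by (simp add: unit_def)

lemma unit_insert: "n \<notin> N \<Longrightarrow> unit (insert n N) = (\<lambda>f. sing R (id_mor n) \<one> f \<oplus> unit N f)"
  by (rule ext) (auto simp: unit_def sing_def id_mor_inj)

lemma unit_closed: "finite N \<Longrightarrow> unit N \<in> carrier (free_module R Mors)"
  by (rule free_moduleI) (auto simp: unit_def split: if_splits)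

lemma unit_convolution_sing:
  assumes p: "p \<in> carrier (free_module R Mors)"
  shows "convolution R (sing R (id_mor n) \<one>) p = (\<lambda>f. if tgt f = n then p f else \<zero>)"
  using p
proof (induction rule: free_induct)
  case zero show ?case by (simp add: convolution_zero_right)
next
  case (add f a p)
  have "comp_mor (id_mor (tgt f)) f = f" using add(1) comp_id_left by (simp add: mem_Mors)
  hence "convolution R (sing R (id_mor n) \<one>) (sing R f a) = (\<lambda>g. if tgt g = n then sing R f a g else \<zero>)"
    using add(2) by (auto simp: convolution_sing) (auto simp: sing_def)
  thus ?case using convolution_add_right[OF sing_in_free[OF id_Mors one_closed] sing_in_free[OF add(1,2)] add(3)] add.IH
    by auto
qed

lemma unit_convolution:
  assumes p: "p \<in> carrier (free_module R Mors)" and N: "finite N"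
  shows "convolution R (unit N) p = (\<lambda>f. if tgt f \<in> N then p f else \<zero>)"
  using N
proof (induction N rule: finite_induct)
  case empty
  show ?case by (simp add: unit_empty convolution_zero_left)
next
  case (insert n N)
  show ?case
    unfolding unit_insert[OF insert(2)]
      convolution_add_left[OF sing_in_free[OF id_Mors one_closed] unit_closed[OF insert(1)] p]
      insert.IH unit_convolution_sing[OF p]
    using free_coeff_closed[OF p] insert(2) by (intro ext) auto
qed

lemma unit_convolution_id:
  assumes "p \<in> carrier (free_module R Mors)" "finite N" "\<And>f. p f \<noteq> \<zero> \<Longrightarrow> tgt f \<in> N"
  shows "convolution R (unit N) p = p"
  unfolding unit_convolution[OF assms(1,2)] using assms(3) by (intro ext) metis

end

context fcmodule
begin

abbreviation "tot \<equiv> total R V"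
abbreviation "supp x \<equiv> {n. x n \<noteq> \<zero>\<^bsub>val V n\<^esub>}"

lemma tot_carrier: "x \<in> carrier tot \<longleftrightarrow> (\<forall>n. x n \<in> carrier (val V n)) \<and> finite (supp x)"
  by (simp add: total_def)

lemma tot_simps [simp]: "\<zero>\<^bsub>tot\<^esub> = (\<lambda>n. \<zero>\<^bsub>val V n\<^esub>)" "x \<oplus>\<^bsub>tot\<^esub> y = (\<lambda>n. x n \<oplus>\<^bsub>val V n\<^esub> y n)"
  by (simp_all add: total_def)

lemma tot_zero_closed: "(\<lambda>n. \<zero>\<^bsub>val V n\<^esub>) \<in> carrier tot"
  by (simp add: tot_carrier)

lemma tot_add_closed: "x \<in> carrier tot \<Longrightarrow> y \<in> carrier tot \<Longrightarrow> (\<lambda>n. x n \<oplus>\<^bsub>val V n\<^esub> y n) \<in> carrier tot"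
  unfolding tot_carrier by (auto intro: finite_subset[of _ "supp x \<union> supp y"])

lemma tot_minus_closed: "x \<in> carrier tot \<Longrightarrow> (\<lambda>n. \<ominus>\<^bsub>val V n\<^esub> x n) \<in> carrier tot"
  unfolding tot_carrier by (auto elim!: finite_subset[rotated])

lemma tot_group: "abelian_group tot"
proof (rule abelian_groupI)
  show "\<exists>y\<in>carrier tot. y \<oplus>\<^bsub>tot\<^esub> x = \<zero>\<^bsub>tot\<^esub>" if "x \<in> carrier tot" for x
    by (rule bexI[OF _ tot_minus_closed[OF that]]) (use that in \<open>simp add: grp.l_neg tot_carrier\<close>)
qed (auto simp: tot_zero_closed tot_add_closed, auto simp: tot_carrier grp.a_ac)

lemma tot_minus:
  assumes "x \<in> carrier tot" shows "\<ominus>\<^bsub>tot\<^esub> x = (\<lambda>n. \<ominus>\<^bsub>val V n\<^esub> x n)"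
  by (rule abelian_group.minus_equality[OF tot_group _ assms tot_minus_closed[OF assms]])
    (use assms in \<open>simp add: grp.l_neg tot_carrier\<close>)

lemma tot_diff: "x \<in> carrier tot \<Longrightarrow> y \<in> carrier tot \<Longrightarrow> x \<ominus>\<^bsub>tot\<^esub> y = (\<lambda>n. x n \<ominus>\<^bsub>val V n\<^esub> y n)"
  by (simp add: a_minus_def tot_minus)

definition single :: "'m obj \<Rightarrow> 'v \<Rightarrow> 'm obj \<Rightarrow> 'v" where
  "single n v = (\<lambda>t. if t = n then v else \<zero>\<^bsub>val V t\<^esub>)"

lemma single_closed: "v \<in> carrier (val V n) \<Longrightarrow> single n v \<in> carrier tot"
  unfolding tot_carrier single_def by (auto intro: finite_subset[of _ "{n}"])

text \<open>
  Adding one component at a time; \<open>y\<close> is a copy of the element at which the induction starts, to which the step can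
  refer.
\<close>

lemma tot_induct [consumes 1, case_names zero add]:
  assumes x: "x \<in> carrier tot" and zero: "P (\<lambda>n. \<zero>\<^bsub>val V n\<^esub>)"
    and add: "\<And>n v x. \<lbrakk>v \<in> carrier (val V n); x \<in> carrier tot; P x; x n = \<zero>\<^bsub>val V n\<^esub>; v = y n\<rbrakk>
      \<Longrightarrow> P (\<lambda>t. single n v t \<oplus>\<^bsub>val V t\<^esub> x t)" and y: "\<And>n. x n \<noteq> \<zero>\<^bsub>val V n\<^esub> \<Longrightarrow> x n = y n"
  shows "P x"
  using x y
proof (induction "card (supp x)" arbitrary: x)
  case 0
  hence "x = (\<lambda>n. \<zero>\<^bsub>val V n\<^esub>)" by (auto simp: tot_carrier)
  thus ?case using zero by simp
next
  case (Suc c)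
  have fin: "finite (supp x)" using Suc.prems by (simp add: tot_carrier)
  have "supp x \<noteq> {}" using Suc.hyps(2) by force
  then obtain n where n: "x n \<noteq> \<zero>\<^bsub>val V n\<^esub>" by blast
  define z where "z = (\<lambda>t. if t = n then \<zero>\<^bsub>val V t\<^esub> else x t)"
  have supp: "supp z = supp x - {n}" by (auto simp: z_def)
  have z: "z \<in> carrier tot" using Suc.prems fin supp by (auto simp: tot_carrier z_def)
  have "P z" by (rule Suc.hyps(1)[OF _ z]) (use supp fin n Suc.hyps(2) Suc.prems(2) in \<open>auto simp: z_def split: if_splits\<close>)
  hence "P (\<lambda>t. single n (x n) t \<oplus>\<^bsub>val V t\<^esub> z t)"
    by (intro add[OF _ z]) (use Suc.prems n in \<open>auto simp: tot_carrier z_def\<close>)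
  moreover have "(\<lambda>t. single n (x n) t \<oplus>\<^bsub>val V t\<^esub> z t) = x"
    using Suc.prems by (auto simp: tot_carrier z_def single_def)
  ultimately show ?case by simp
qed

abbreviation "tm p x \<equiv> p \<odot>\<^bsub>tot\<^esub> x"

lemma act_Mors: "\<lbrakk>f \<in> Mors; x \<in> carrier tot\<rbrakk> \<Longrightarrow> act V f (x (src f)) \<in> carrier (val V (tgt f))"
  using act_closed[of f "src f" "tgt f"] by (simp add: mem_Mors tot_carrier)

lemma tm_eq:
  assumes p: "p \<in> carrier (free_module R Mors)" and x: "x \<in> carrier tot"
    and P: "finite P" "{f. p f \<noteq> \<zero>\<^bsub>R\<^esub>} \<subseteq> P" "P \<subseteq> Mors"
  shows "tm p x t = finsum (val V t) (\<lambda>f. p f \<odot>\<^bsub>val V t\<^esub> act V f (x (src f))) {f \<in> P. tgt f = t}"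
proof -
  have cl: "act V f (x (src f)) \<in> carrier (val V t)" if "f \<in> P" "tgt f = t" for f
    using act_Mors[OF _ x, of f] that P by blast
  have "tm p x t = finsum (val V t) (\<lambda>f. p f \<odot>\<^bsub>val V t\<^esub> act V f (x (src f))) {f. p f \<noteq> \<zero>\<^bsub>R\<^esub> \<and> tgt f = t}"
    by (simp add: total_def)
  also have "\<dots> = finsum (val V t) (\<lambda>f. p f \<odot>\<^bsub>val V t\<^esub> act V f (x (src f))) {f \<in> P. tgt f = t}"
    by (rule grp.add.finprod_mono_neutral_cong_left) (use P cl coeff.free_coeff_closed[OF p] in auto)
  finally show ?thesis .
qed

lemma tm_val_closed:
  assumes p: "p \<in> carrier (free_module R Mors)" and x: "x \<in> carrier tot"
  shows "tm p x t \<in> carrier (val V t)"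
proof -
  have S: "{f. p f \<noteq> \<zero>\<^bsub>R\<^esub>} \<subseteq> Mors" using coeff.free_supp[OF p] by blast
  have "act V f (x (src f)) \<in> carrier (val V t)" if "p f \<noteq> \<zero>\<^bsub>R\<^esub>" "tgt f = t" for f
    using act_Mors[OF _ x, of f] that S by blast
  thus ?thesis
    unfolding tm_eq[OF p x coeff.free_finite[OF p] subset_refl S]
    by (intro grp.finsum_closed) (use coeff.free_coeff_closed[OF p] in auto)
qed

lemma tm_closed:
  assumes p: "p \<in> carrier (free_module R Mors)" and x: "x \<in> carrier tot"
  shows "tm p x \<in> carrier tot"
proof -
  have "tm p x t = \<zero>\<^bsub>val V t\<^esub>" if "t \<notin> tgt ` {f. p f \<noteq> \<zero>\<^bsub>R\<^esub>}" for t
  proof -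
    have e: "{f. p f \<noteq> \<zero>\<^bsub>R\<^esub> \<and> tgt f = t} = {}" using that by blast
    have "tm p x t = finsum (val V t) (\<lambda>f. p f \<odot>\<^bsub>val V t\<^esub> act V f (x (src f))) {f. p f \<noteq> \<zero>\<^bsub>R\<^esub> \<and> tgt f = t}"
      by (simp add: total_def)
    thus ?thesis unfolding e by simp
  qed
  hence "supp (tm p x) \<subseteq> tgt ` {f. p f \<noteq> \<zero>\<^bsub>R\<^esub>}" by blast
  thus ?thesis using tm_val_closed[OF p x] coeff.free_finite[OF p] unfolding tot_carrier
    by (meson finite_imageI finite_subset)
qed

lemma tm_zero_left: "tm (\<lambda>f. \<zero>\<^bsub>R\<^esub>) x = (\<lambda>t. \<zero>\<^bsub>val V t\<^esub>)"
  by (simp add: total_def)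

lemma tm_add_left:
  assumes p: "p \<in> carrier (free_module R Mors)" and q: "q \<in> carrier (free_module R Mors)" and x: "x \<in> carrier tot"
  shows "tm (\<lambda>f. p f \<oplus>\<^bsub>R\<^esub> q f) x = (\<lambda>t. tm p x t \<oplus>\<^bsub>val V t\<^esub> tm q x t)"
proof
  fix t
  let ?P = "{f. p f \<noteq> \<zero>\<^bsub>R\<^esub>} \<union> {f. q f \<noteq> \<zero>\<^bsub>R\<^esub>}"
  have P: "finite ?P" "?P \<subseteq> Mors" using coeff.free_finite p q coeff.free_supp[OF p] coeff.free_supp[OF q] by auto
  have cl: "act V f (x (src f)) \<in> carrier (val V t)" if "f \<in> ?P" "tgt f = t" for f
    using act_Mors[OF _ x, of f] that P by blast
  note cc = coeff.free_coeff_closed[OF p] coeff.free_coeff_closed[OF q]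
  let ?a = "\<lambda>f. act V f (x (src f))" and ?Z = "{f \<in> ?P. tgt f = t}"
  have "tm (\<lambda>f. p f \<oplus>\<^bsub>R\<^esub> q f) x t = finsum (val V t) (\<lambda>f. (p f \<oplus>\<^bsub>R\<^esub> q f) \<odot>\<^bsub>val V t\<^esub> ?a f) ?Z"
    by (rule tm_eq[OF coeff.free_add_closed[OF p q] x P(1) _ P(2)]) auto
  also have "\<dots> = finsum (val V t) (\<lambda>f. p f \<odot>\<^bsub>val V t\<^esub> ?a f \<oplus>\<^bsub>val V t\<^esub> q f \<odot>\<^bsub>val V t\<^esub> ?a f) ?Z"
    by (rule grp.finsum_cong') (use cl cc in \<open>auto simp: val.smult_l_distr\<close>)
  also have "\<dots> = finsum (val V t) (\<lambda>f. p f \<odot>\<^bsub>val V t\<^esub> ?a f) ?Z \<oplus>\<^bsub>val V t\<^esub> finsum (val V t) (\<lambda>f. q f \<odot>\<^bsub>val V t\<^esub> ?a f) ?Z"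
    by (rule grp.finsum_addf) (use cl cc in auto)
  also have "\<dots> = tm p x t \<oplus>\<^bsub>val V t\<^esub> tm q x t"
    using tm_eq[OF p x P(1) _ P(2)] tm_eq[OF q x P(1) _ P(2)] by simp
  finally show "tm (\<lambda>f. p f \<oplus>\<^bsub>R\<^esub> q f) x t = tm p x t \<oplus>\<^bsub>val V t\<^esub> tm q x t" .
qed

lemma tm_add_right:
  assumes p: "p \<in> carrier (free_module R Mors)" and x: "x \<in> carrier tot" and y: "y \<in> carrier tot"
  shows "tm p (\<lambda>n. x n \<oplus>\<^bsub>val V n\<^esub> y n) = (\<lambda>t. tm p x t \<oplus>\<^bsub>val V t\<^esub> tm p y t)"
proof
  fix t
  let ?P = "{f. p f \<noteq> \<zero>\<^bsub>R\<^esub>}"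
  have P: "finite ?P" "?P \<subseteq> Mors" using coeff.free_finite[OF p] coeff.free_supp[OF p] by auto
  have cl: "act V f (x (src f)) \<in> carrier (val V t)" "act V f (y (src f)) \<in> carrier (val V t)" if "f \<in> ?P" "tgt f = t" for f
    using act_Mors[OF _ x, of f] act_Mors[OF _ y, of f] that P by blast+
  have aa: "act V f (x (src f) \<oplus>\<^bsub>val V (src f)\<^esub> y (src f)) = act V f (x (src f)) \<oplus>\<^bsub>val V t\<^esub> act V f (y (src f))"
    if "f \<in> ?P" "tgt f = t" for f
  proof -
    have "f \<in> Hom (src f) t" using that P mem_Mors by blast
    thus ?thesis using x y act_add unfolding tot_carrier by blast
  qed
  note cc = coeff.free_coeff_closed[OF p]
  let ?Z = "{f \<in> ?P. tgt f = t}"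
  have "tm p (\<lambda>n. x n \<oplus>\<^bsub>val V n\<^esub> y n) t
      = finsum (val V t) (\<lambda>f. p f \<odot>\<^bsub>val V t\<^esub> act V f (x (src f) \<oplus>\<^bsub>val V (src f)\<^esub> y (src f))) ?Z"
    by (rule tm_eq[OF p tot_add_closed[OF x y] P(1) _ P(2)]) auto
  also have "\<dots> = finsum (val V t) (\<lambda>f. p f \<odot>\<^bsub>val V t\<^esub> act V f (x (src f)) \<oplus>\<^bsub>val V t\<^esub> p f \<odot>\<^bsub>val V t\<^esub> act V f (y (src f))) ?Z"
    by (rule grp.finsum_cong') (use cl cc aa in \<open>auto simp: val.smult_r_distr\<close>)
  also have "\<dots> = finsum (val V t) (\<lambda>f. p f \<odot>\<^bsub>val V t\<^esub> act V f (x (src f))) ?Z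
      \<oplus>\<^bsub>val V t\<^esub> finsum (val V t) (\<lambda>f. p f \<odot>\<^bsub>val V t\<^esub> act V f (y (src f))) ?Z"
    by (rule grp.finsum_addf) (use cl cc in auto)
  also have "\<dots> = tm p x t \<oplus>\<^bsub>val V t\<^esub> tm p y t"
    using tm_eq[OF p x P(1) _ P(2)] tm_eq[OF p y P(1) _ P(2)] by simp
  finally show "tm p (\<lambda>n. x n \<oplus>\<^bsub>val V n\<^esub> y n) t = tm p x t \<oplus>\<^bsub>val V t\<^esub> tm p y t" .
qed

lemma tm_sing:
  assumes f: "f \<in> Mors" and a: "a \<in> carrier R" and x: "x \<in> carrier tot"
  shows "tm (sing R f a) x = single (tgt f) (a \<odot>\<^bsub>val V (tgt f)\<^esub> act V f (x (src f)))"
proof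
  fix t
  have "tm (sing R f a) x t
      = finsum (val V t) (\<lambda>g. sing R f a g \<odot>\<^bsub>val V t\<^esub> act V g (x (src g))) {g \<in> {f}. tgt g = t}"
    by (rule tm_eq[OF coeff.sing_in_free[OF f a] x]) (use f in \<open>auto simp: sing_def\<close>)
  moreover have "{g \<in> {f}. tgt g = t} = (if tgt f = t then {f} else {})" by auto
  ultimately show "tm (sing R f a) x t = single (tgt f) (a \<odot>\<^bsub>val V (tgt f)\<^esub> act V f (x (src f))) t"
    using act_Mors[OF f x] a by (auto simp: single_def sing_def)
qed

lemma single_at: "single n v n = v" and single_off: "t \<noteq> n \<Longrightarrow> single n v t = \<zero>\<^bsub>val V t\<^esub>"
  by (simp_all add: single_def)

text \<open>
  \<open>\<Oplus>\<^sub>n V\<^sub>n\<close> is a module over the category algebra; checked on single morphisms.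
\<close>

lemma tm_assoc:
  assumes p: "p \<in> carrier (free_module R Mors)" and q: "q \<in> carrier (free_module R Mors)" and x: "x \<in> carrier tot"
  shows "tm (convolution R p q) x = tm p (tm q x)"
  using p
proof (induction rule: coeff.free_induct)
  case zero show ?case by (simp add: coeff.convolution_zero_left tm_zero_left)
next
  case (add g a p)
  note sg = coeff.sing_in_free[OF add(1,2)]
  have 1: "tm (convolution R (sing R g a) q) x = tm (sing R g a) (tm q x)"
    using q
  proof (induction rule: coeff.free_induct)
    case zero
    have "tm (sing R g a) (\<lambda>t. \<zero>\<^bsub>val V t\<^esub>) = (\<lambda>t. \<zero>\<^bsub>val V t\<^esub>)"
      using tm_sing[OF \<open>g \<in> Mors\<close> \<open>a \<in> carrier R\<close> tot_zero_closed] act_zero[of g "src g" "tgt g"] \<open>g \<in> Mors\<close> \<open>a \<in> carrier R\<close>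
      by (auto simp: single_def mem_Mors)
    thus ?case by (simp add: coeff.convolution_zero_right tm_zero_left)
  next
    case (add f b q)
    note sf = coeff.sing_in_free[OF add(1,2)]
    have fx: "act V f (x (src f)) \<in> carrier (val V (tgt f))" by (rule act_Mors[OF add(1) x])
    have gH: "g \<in> Hom (src g) (tgt g)" and fH: "f \<in> Hom (src f) (tgt f)"
      using \<open>g \<in> Mors\<close> add(1) by (simp_all only: mem_Mors)
    have 2: "tm (convolution R (sing R g a) (sing R f b)) x = tm (sing R g a) (tm (sing R f b) x)"
    proof (cases "src g = tgt f")
      case True
      have "comp_mor g f \<in> Mors" by (rule comp_in_Mors[OF \<open>g \<in> Mors\<close> add(1) True])
      hence "tm (convolution R (sing R g a) (sing R f b)) x
          = single (tgt g) ((a \<otimes>\<^bsub>R\<^esub> b) \<odot>\<^bsub>val V (tgt g)\<^esub> act V (comp_mor g f) (x (src f)))"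
        using tm_sing[of "comp_mor g f" "a \<otimes>\<^bsub>R\<^esub> b" x] \<open>a \<in> carrier R\<close> add(2) x True by (simp add: coeff.convolution_sing)
      also have "act V (comp_mor g f) (x (src f)) = act V g (act V f (x (src f)))"
        by (rule act_comp[OF fH]) (use gH True x in \<open>auto simp: tot_carrier\<close>)
      also have "(a \<otimes>\<^bsub>R\<^esub> b) \<odot>\<^bsub>val V (tgt g)\<^esub> act V g (act V f (x (src f)))
          = a \<odot>\<^bsub>val V (tgt g)\<^esub> act V g (b \<odot>\<^bsub>val V (src g)\<^esub> act V f (x (src f)))"
        using \<open>a \<in> carrier R\<close> add(2) act_smult[OF gH add(2), of "act V f (x (src f))"]
          act_closed[OF gH, of "act V f (x (src f))"] fx True by (simp add: val.smult_assoc1)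
      also have "b \<odot>\<^bsub>val V (src g)\<^esub> act V f (x (src f)) = tm (sing R f b) x (src g)"
        unfolding tm_sing[OF add(1,2) x] True single_at ..
      also have "single (tgt g) (a \<odot>\<^bsub>val V (tgt g)\<^esub> act V g (tm (sing R f b) x (src g))) = tm (sing R g a) (tm (sing R f b) x)"
        by (rule tm_sing[OF \<open>g \<in> Mors\<close> \<open>a \<in> carrier R\<close> tm_closed[OF sf x], symmetric])
      finally show ?thesis .
    next
      case False
      have "tm (sing R g a) (tm (sing R f b) x) = single (tgt g) (a \<odot>\<^bsub>val V (tgt g)\<^esub> act V g \<zero>\<^bsub>val V (src g)\<^esub>)"
        unfolding tm_sing[OF \<open>g \<in> Mors\<close> \<open>a \<in> carrier R\<close> tm_closed[OF sf x]]
        unfolding tm_sing[OF add(1,2) x] single_off[OF False] ..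
      also have "\<dots> = (\<lambda>t. \<zero>\<^bsub>val V t\<^esub>)"
        using act_zero[OF gH] \<open>a \<in> carrier R\<close> by (auto simp: single_def)
      finally show ?thesis
        using \<open>a \<in> carrier R\<close> add(2) False by (simp add: coeff.convolution_sing tm_zero_left)
    qed
    have "tm (convolution R (sing R g a) (\<lambda>h. sing R f b h \<oplus>\<^bsub>R\<^esub> q h)) x
        = (\<lambda>t. tm (convolution R (sing R g a) (sing R f b)) x t \<oplus>\<^bsub>val V t\<^esub> tm (convolution R (sing R g a) q) x t)"
      unfolding coeff.convolution_add_right[OF sg sf add(3)]
      by (rule tm_add_left[OF coeff.convolution_closed_Mors[OF sg sf] coeff.convolution_closed_Mors[OF sg add(3)] x])
    also have "\<dots> = tm (sing R g a) (tm (\<lambda>h. sing R f b h \<oplus>\<^bsub>R\<^esub> q h) x)"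
      unfolding 2 add.IH tm_add_left[OF sf add(3) x]
      by (rule tm_add_right[OF sg tm_closed[OF sf x] tm_closed[OF add(3) x], symmetric])
    finally show ?case .
  qed
  have "tm (convolution R (\<lambda>h. sing R g a h \<oplus>\<^bsub>R\<^esub> p h) q) x
      = (\<lambda>t. tm (convolution R (sing R g a) q) x t \<oplus>\<^bsub>val V t\<^esub> tm (convolution R p q) x t)"
    unfolding coeff.convolution_add_left[OF sg add(3) q]
    by (rule tm_add_left[OF coeff.convolution_closed_Mors[OF sg q] coeff.convolution_closed_Mors[OF add(3) q] x])
  also have "\<dots> = tm (\<lambda>h. sing R g a h \<oplus>\<^bsub>R\<^esub> p h) (tm q x)"
    unfolding 1 add.IH by (rule tm_add_left[OF sg add(3) tm_closed[OF q x], symmetric])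
  finally show ?case .
qed

lemma tm_unit:
  assumes x: "x \<in> carrier tot" and N: "finite N"
  shows "tm (coeff.unit N) x = (\<lambda>t. if t \<in> N then x t else \<zero>\<^bsub>val V t\<^esub>)"
  using N
proof (induction N rule: finite_induct)
  case empty
  show ?case by (simp add: coeff.unit_empty tm_zero_left)
next
  case (insert n N)
  have xn: "x t \<in> carrier (val V t)" for t using x by (simp add: tot_carrier)
  have "tm (sing R (id_mor n) \<one>\<^bsub>R\<^esub>) x = single n (x n)"
    using tm_sing[OF id_Mors val.R.one_closed x, of n] xn[of n] by (simp add: act_id)
  thus ?case
    unfolding coeff.unit_insert[OF insert(2)]
      tm_add_left[OF coeff.sing_in_free[OF id_Mors val.R.one_closed] coeff.unit_closed[OF insert(1)] x] insert.IH
    using xn insert(2) by (intro ext) (auto simp: single_def)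
qed

lemma tm_unit_id: "\<lbrakk>x \<in> carrier tot; finite N; supp x \<subseteq> N\<rbrakk> \<Longrightarrow> tm (coeff.unit N) x = x"
proof -
  assume x: "x \<in> carrier tot" "finite N" and sub: "supp x \<subseteq> N"
  have "x t = \<zero>\<^bsub>val V t\<^esub>" if "t \<notin> N" for t using sub that by blast
  thus ?thesis unfolding tm_unit[OF x] by (intro ext) simp
qed

abbreviation TX :: "('m mor \<Rightarrow> 'k, 'm mor \<Rightarrow> 'k, ('m mor \<Rightarrow> 'k) set) bimodule" where
  "TX \<equiv> cat_algebra_mod_up R"

sublocale C: tensor_pair "cat_algebra R" TX tot
proof (rule tensor_pair.intro)
  show "abelian_group TX" by (rule coeff.top_mod_group)
  show "abelian_group tot" by (rule tot_group)
  show "rsmult TX x a \<in> carrier TX" if xX: "x \<in> carrier TX" and aA: "a \<in> carrier (cat_algebra R)"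
    for x :: "('m mor \<Rightarrow> 'k) set" and a
  proof -
    obtain p where p: "p \<in> carrier (free_module R Mors)" "x = coeff.bar p" using coeff.bar_cases[OF xX] .
    have a: "a \<in> carrier (free_module R Mors)" using aA by simp
    show ?thesis unfolding p(2) coeff.rsmult_bar[OF p(1) a]
      by (rule coeff.bar_closed[OF coeff.convolution_closed_Mors[OF p(1) a]])
  qed
qed (simp add: tm_closed)

text \<open>
  The map \<open>y \<mapsto> 1 \<otimes> y\<close> from \<open>\<Oplus>\<^sub>n V\<^sub>n\<close> to the tensor product with \<open>k\<C> / \<mm>\<close>, with a local unit in the place of \<open>1\<close>.  It is
  onto with kernel \<open>\<Oplus>\<^sub>n (\<mm>V)\<^sub>n\<close>, by \<open>eta_surj\<close> and \<open>eta_zero_iff\<close>.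
\<close>

definition eta :: "('m obj \<Rightarrow> 'v) \<Rightarrow> (('m mor \<Rightarrow> 'k) set \<times> ('m obj \<Rightarrow> 'v) \<Rightarrow>\<^sub>0 int) set" where
  "eta y = C.cls (coeff.bar (coeff.unit (supp y))) y"

lemma eta_unit:
  assumes y: "y \<in> carrier tot" and N: "finite N" "supp y \<subseteq> N"
  shows "C.cls (coeff.bar (coeff.unit N)) y = eta y"
proof -
  let ?e = "coeff.unit (supp y)" and ?f = "coeff.unit N"
  have fin: "finite (supp y)" using y by (simp add: tot_carrier)
  note e = coeff.unit_closed[OF fin] and f = coeff.unit_closed[OF N(1)]
  have "coeff.bar ?e = rsmult TX (coeff.bar ?f) ?e"
    unfolding coeff.rsmult_bar[OF f e]
    by (subst coeff.unit_convolution_id[OF e N(1)]) (use N in \<open>auto simp: coeff.unit_def split: if_splits\<close>)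
  hence "eta y = C.cls (coeff.bar ?f) (tm ?e y)"
    unfolding eta_def using C.cls_balanced[of "coeff.bar ?f" ?e y] coeff.bar_closed[OF f] e y by simp
  thus ?thesis using tm_unit_id[OF y fin subset_refl] by simp
qed

lemma cls_eta:
  assumes p: "p \<in> carrier (free_module R Mors)" and y: "y \<in> carrier tot"
  shows "C.cls (coeff.bar p) y = eta (tm p y)"
proof -
  let ?N = "tgt ` {f. p f \<noteq> \<zero>\<^bsub>R\<^esub>} \<union> supp (tm p y)"
  have py: "tm p y \<in> carrier tot" by (rule tm_closed[OF p y])
  have N: "finite ?N" using coeff.free_finite[OF p] py by (auto simp: tot_carrier)
  note e = coeff.unit_closed[OF N]
  have "coeff.bar p = rsmult TX (coeff.bar (coeff.unit ?N)) p"
    unfolding coeff.rsmult_bar[OF e p] by (subst coeff.unit_convolution_id[OF p N]) auto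
  hence "C.cls (coeff.bar p) y = C.cls (coeff.bar (coeff.unit ?N)) (tm p y)"
    using C.cls_balanced[of "coeff.bar (coeff.unit ?N)" p y] coeff.bar_closed[OF e] p y by simp
  thus ?thesis using eta_unit[OF py N] by simp
qed

lemma eta_closed: "y \<in> carrier tot \<Longrightarrow> eta y \<in> carrier C.T"
  unfolding eta_def by (rule C.cls_closed) (auto intro: coeff.bar_closed coeff.unit_closed simp: tot_carrier)

lemma eta_add:
  assumes y: "y \<in> carrier tot" and z: "z \<in> carrier tot"
  shows "eta (\<lambda>n. y n \<oplus>\<^bsub>val V n\<^esub> z n) = eta y \<oplus>\<^bsub>C.T\<^esub> eta z"
proof -
  let ?N = "supp y \<union> supp z"
  have N: "finite ?N" using y z by (simp add: tot_carrier)
  have s: "supp (\<lambda>n. y n \<oplus>\<^bsub>val V n\<^esub> z n) \<subseteq> ?N" by auto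
  show ?thesis
    using C.cls_add_right[of "coeff.bar (coeff.unit ?N)" y z] coeff.bar_closed[OF coeff.unit_closed[OF N]] y z
      eta_unit[OF y N] eta_unit[OF z N] eta_unit[OF tot_add_closed[OF y z] N s] by simp
qed

lemma eta_zero: "eta (\<lambda>n. \<zero>\<^bsub>val V n\<^esub>) = \<zero>\<^bsub>C.T\<^esub>"
  unfolding eta_def using C.cls_zero_right[of "coeff.bar (coeff.unit {})"] coeff.bar_closed[OF coeff.unit_closed[of "{}"]] by simp

lemma eta_minus:
  assumes y: "y \<in> carrier tot"
  shows "eta (\<lambda>n. \<ominus>\<^bsub>val V n\<^esub> y n) = \<ominus>\<^bsub>C.T\<^esub> eta y"
proof (rule C.T.eq_minus_of_sum_zero[OF eta_closed[OF y] eta_closed[OF tot_minus_closed[OF y]]])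
  have "(\<lambda>n. y n \<oplus>\<^bsub>val V n\<^esub> \<ominus>\<^bsub>val V n\<^esub> y n) = (\<lambda>n. \<zero>\<^bsub>val V n\<^esub>)" using y by (simp add: tot_carrier grp.r_neg)
  thus "eta y \<oplus>\<^bsub>C.T\<^esub> eta (\<lambda>n. \<ominus>\<^bsub>val V n\<^esub> y n) = \<zero>\<^bsub>C.T\<^esub>"
    using eta_add[OF y tot_minus_closed[OF y]] eta_zero by simp
qed

lemma eta_diff: "\<lbrakk>y \<in> carrier tot; z \<in> carrier tot\<rbrakk>
    \<Longrightarrow> eta (\<lambda>n. y n \<ominus>\<^bsub>val V n\<^esub> z n) = eta y \<ominus>\<^bsub>C.T\<^esub> eta z"
  using eta_add[OF _ tot_minus_closed, of y z] by (simp add: a_minus_def eta_minus)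

lemma eta_surj: "t \<in> carrier C.T \<Longrightarrow> \<exists>y\<in>carrier tot. t = eta y"
proof (induction rule: C.tensor_induct)
  case zero show ?case using eta_zero tot_zero_closed by metis
next
  case (add x y t)
  then obtain z where z: "z \<in> carrier tot" "t = eta z" by blast
  obtain p where p: "p \<in> carrier (free_module R Mors)" "x = coeff.bar p" using coeff.bar_cases[OF add(1)] .
  have py: "tm p y \<in> carrier tot" by (rule tm_closed[OF p(1) add(2)])
  have "C.cls x y \<oplus>\<^bsub>C.T\<^esub> t = eta (\<lambda>n. tm p y n \<oplus>\<^bsub>val V n\<^esub> z n)"
    unfolding eta_add[OF py z(1)] z(2) p(2) cls_eta[OF p(1) add(2)] ..
  thus ?case using tot_add_closed[OF py z(1)] by blast
qed

lemma miss_smult: "w \<in> miss V A t \<Longrightarrow> a \<in> carrier R \<Longrightarrow> a \<odot>\<^bsub>val V t\<^esub> w \<in> miss V A t"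
proof (induction rule: miss.induct)
  case zero thus ?case by (simp add: miss.zero)
next
  case (step g p y w)
  have "a \<odot>\<^bsub>val V t\<^esub> (act V g y \<oplus>\<^bsub>val V t\<^esub> w) = act V g (a \<odot>\<^bsub>val V p\<^esub> y) \<oplus>\<^bsub>val V t\<^esub> a \<odot>\<^bsub>val V t\<^esub> w"
    using step by (simp add: val.smult_r_distr act_closed miss_closed act_smult)
  with step show ?case by (simp add: miss.step)
qed

lemma miss_submodule: "submodule (miss V A n) R (val V n)"
  by (rule val.submoduleI) (auto intro: miss_closed miss.zero miss_minus miss_add miss_smult)

lemma tm_up:
  assumes k: "k \<in> up_ideal R" and y: "y \<in> carrier tot"
  shows "tm k y n \<in> miss V (full n) n"
  using k unfolding coeff.up_eq
proof (induction rule: coeff.free_induct)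
  case zero show ?case by (simp add: tm_zero_left miss.zero)
next
  case (add f a p)
  have f: "f \<in> Hom (src f) (tgt f)" "src f < tgt f" using Raising_Hom[OF add(1)] by auto
  have fM: "f \<in> Mors" using add(1) by (simp add: Raising_def)
  have p: "p \<in> carrier (free_module R Mors)" by (rule coeff.free_mono[OF add(3)]) (auto simp: Raising_def)
  have "act V f (y (src f)) \<in> miss V (full (tgt f)) (tgt f)"
    by (rule act_in_miss[OF f(1)]) (use f Hom_less_iff[OF f(1)] y in \<open>auto simp: tot_carrier\<close>)
  hence "tm (sing R f a) y n \<in> miss V (full n) n"
    unfolding tm_sing[OF fM add(2) y] using add(2) by (auto simp: single_def miss.zero miss_smult)
  thus ?case using miss_add[OF _ add.IH] unfolding tm_add_left[OF coeff.sing_in_free[OF fM add(2)] p y] by blast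
qed

lemma eta_single_miss:
  assumes "v \<in> miss V (full n) n"
  shows "eta (single n v) = \<zero>\<^bsub>C.T\<^esub>"
  using assms
proof (induction rule: miss.induct)
  case zero
  have "single n \<zero>\<^bsub>val V n\<^esub> = (\<lambda>t. \<zero>\<^bsub>val V t\<^esub>)" by (auto simp: single_def)
  thus ?case using eta_zero by simp
next
  case (step g p y w)
  have gM: "g \<in> Mors" by (rule Hom_Mors[OF step(1)])
  note sg = Hom_src[OF step(1)] and tg = Hom_tgt[OF step(1)]
  have "p < n" using Hom_less_iff[OF step(1)] step(2) by blast
  hence "delta R g \<in> up_ideal R" unfolding coeff.up_eq by (intro coeff.delta_in_free) (use gM sg tg in \<open>simp add: Raising_def\<close>)
  hence b: "coeff.bar (delta R g) = \<zero>\<^bsub>TX\<^esub>" by (rule coeff.bar_up)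
  have sp: "single p y \<in> carrier tot" by (rule single_closed[OF step(3)])
  have gy: "act V g y \<in> carrier (val V n)" by (rule act_closed[OF step(1,3)])
  have "tm (delta R g) (single p y) = single n (act V g y)"
    using tm_sing[OF gM val.R.one_closed sp] gy by (simp add: delta_sing sg tg single_at)
  hence "eta (single n (act V g y)) = C.cls \<zero>\<^bsub>TX\<^esub> (single p y)"
    using cls_eta[OF coeff.delta_in_free[OF gM] sp] b by simp
  hence 1: "eta (single n (act V g y)) = \<zero>\<^bsub>C.T\<^esub>" using C.cls_zero_left[OF sp] by simp
  have w: "w \<in> carrier (val V n)" by (rule miss_closed[OF step(4)])
  have "single n (act V g y \<oplus>\<^bsub>val V n\<^esub> w) = (\<lambda>t. single n (act V g y) t \<oplus>\<^bsub>val V t\<^esub> single n w t)"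
    by (auto simp: single_def)
  hence "eta (single n (act V g y \<oplus>\<^bsub>val V n\<^esub> w)) = \<zero>\<^bsub>C.T\<^esub> \<oplus>\<^bsub>C.T\<^esub> \<zero>\<^bsub>C.T\<^esub>"
    using eta_add[OF single_closed[OF gy] single_closed[OF w]] 1 step.IH by simp
  thus ?case using C.T.l_zero[OF C.T.zero_closed] by simp
qed

text \<open>
  If all components lie in \<open>\<mm>V\<close>, then \<open>y\<close> is a combination of elements \<open>g w\<close> with \<open>g \<in> \<mm>\<close>, and \<open>1 \<otimes> g w = g \<otimes> w = 0\<close>.
  Conversely, for every \<open>n\<close> the balanced map that sends the class of \<open>p\<close> and \<open>z\<close> to the class of \<open>(p z)\<^sub>n\<close> in \<open>V\<^sub>n / (\<mm>V)\<^sub>n\<close>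
  detects \<open>y\<^sub>n\<close>.
\<close>

lemma eta_zero_iff:
  assumes y: "y \<in> carrier tot"
  shows "eta y = \<zero>\<^bsub>C.T\<^esub> \<longleftrightarrow> (\<forall>n. y n \<in> miss V (full n) n)"
proof
  assume m: "\<forall>n. y n \<in> miss V (full n) n"
  show "eta y = \<zero>\<^bsub>C.T\<^esub>"
    using y
  proof (induction rule: tot_induct[where y = y])
    case zero show ?case by (rule eta_zero)
  next
    case (add n v x)
    have "eta (single n v) = \<zero>\<^bsub>C.T\<^esub>" using eta_single_miss m add by simp
    thus ?case using eta_add[OF single_closed[OF add(1)] add(2)] add.IH C.T.l_zero[OF C.T.zero_closed] by simp
  qed simp
next
  assume e: "eta y = \<zero>\<^bsub>C.T\<^esub>"
  show "\<forall>n. y n \<in> miss V (full n) n"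
  proof
    fix n
    let ?M = "miss V (full n) n" and ?H = "quotient_module (val V n) (miss V (full n) n)"
    have pl: "plain_module R (val V n)" by (rule plain_module.intro[OF val.module_axioms])
    interpret H: Module.module R ?H by (rule plain_module.quotient_is_module(1)[OF pl miss_submodule])
    have asub: "additive_subgroup ?M (val V n)"
      by (rule additive_subgroup.intro) (rule submodule.axioms[OF miss_submodule])
    let ?pr = "\<lambda>v. ?M +>\<^bsub>val V n\<^esub> v"
    have pr_add: "?pr (u \<oplus>\<^bsub>val V n\<^esub> v) = ?pr u \<oplus>\<^bsub>?H\<^esub> ?pr v" if "u \<in> carrier (val V n)" "v \<in> carrier (val V n)" for u v
      using plain_module.quotient_is_module(3)[OF pl miss_submodule that] by simp
    have pr_closed: "?pr u \<in> carrier ?H" if "u \<in> carrier (val V n)" for u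
      using grp.a_rcosetsI[OF additive_subgroup.a_subset[OF asub] that] by (simp add: quotient_module_def)
    have pr_zero: "?pr u = \<zero>\<^bsub>?H\<^esub> \<longleftrightarrow> u \<in> ?M" if "u \<in> carrier (val V n)" for u
      using grp.a_coset_join1[OF _ that additive_subgroup.a_subgroup[OF asub]]
        grp.a_coset_join2[OF that additive_subgroup.a_subgroup[OF asub]] by (auto simp: quotient_module_def)
    \<comment> \<open>The class does not depend on the chosen representative of the coset, as \<open>\<mm>\<close> acts by zero on the target.\<close>
    define \<beta> where "\<beta> x z = ?pr (tm (SOME p. p \<in> carrier (free_module R Mors) \<and> x = coeff.bar p) z n)" for x z
    have \<beta>: "\<beta> (coeff.bar p) z = ?pr (tm p z n)" if p: "p \<in> carrier (free_module R Mors)" and z: "z \<in> carrier tot" for p z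
    proof -
      define p' where "p' = (SOME q. q \<in> carrier (free_module R Mors) \<and> coeff.bar p = coeff.bar q)"
      have p': "p' \<in> carrier (free_module R Mors) \<and> coeff.bar p = coeff.bar p'"
        unfolding p'_def by (rule someI[of "\<lambda>q. q \<in> carrier (free_module R Mors) \<and> coeff.bar p = coeff.bar q" p]) (simp add: p)
      hence "p' \<in> coeff.bar p" using coeff.bar_self by blast
      then obtain k where k: "k \<in> up_ideal R" "p' = (\<lambda>s. k s \<oplus>\<^bsub>R\<^esub> p s)" unfolding coeff.bar_mem by blast
      have "tm p' z n = tm k z n \<oplus>\<^bsub>val V n\<^esub> tm p z n"
        unfolding k(2) tm_add_left[OF coeff.up_closed[OF k(1)] p z] ..
      hence "?pr (tm p' z n) = ?pr (tm k z n) \<oplus>\<^bsub>?H\<^esub> ?pr (tm p z n)"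
        using pr_add[OF tm_val_closed[OF coeff.up_closed[OF k(1)] z] tm_val_closed[OF p z]] by simp
      also have "?pr (tm k z n) = \<zero>\<^bsub>?H\<^esub>"
        using pr_zero[OF tm_val_closed[OF coeff.up_closed[OF k(1)] z]] tm_up[OF k(1) z] by blast
      also have "\<zero>\<^bsub>?H\<^esub> \<oplus>\<^bsub>?H\<^esub> ?pr (tm p z n) = ?pr (tm p z n)" by (rule H.M.l_zero[OF pr_closed[OF tm_val_closed[OF p z]]])
      finally show ?thesis unfolding \<beta>_def p'_def[symmetric] .
    qed
    obtain h where h: "\<And>s t. s \<in> carrier C.T \<Longrightarrow> t \<in> carrier C.T \<Longrightarrow> h (s \<oplus>\<^bsub>C.T\<^esub> t) = h s \<oplus>\<^bsub>?H\<^esub> h t"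
      "\<And>t. t \<in> carrier C.T \<Longrightarrow> h t \<in> carrier ?H"
      "\<And>x z. x \<in> carrier TX \<Longrightarrow> z \<in> carrier tot \<Longrightarrow> h (C.cls x z) = \<beta> x z"
    proof (rule C.tensor_universal[where H = ?H and \<beta> = \<beta>])
      show "abelian_group ?H" by (rule H.M.abelian_group_axioms)
      fix x z assume x: "x \<in> carrier TX" and z: "z \<in> carrier tot"
      obtain p where p: "p \<in> carrier (free_module R Mors)" "x = coeff.bar p" using coeff.bar_cases[OF x] .
      show "\<beta> x z \<in> carrier ?H" unfolding p(2) \<beta>[OF p(1) z] by (rule pr_closed[OF tm_val_closed[OF p(1) z]])
      show "\<beta> (x \<oplus>\<^bsub>TX\<^esub> x') z = \<beta> x z \<oplus>\<^bsub>?H\<^esub> \<beta> x' z" if x': "x' \<in> carrier TX" for x'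
      proof -
        obtain p' where p': "p' \<in> carrier (free_module R Mors)" "x' = coeff.bar p'" using coeff.bar_cases[OF x'] .
        show ?thesis
          unfolding p(2) p'(2) coeff.bar_add[OF p(1) p'(1)] \<beta>[OF p(1) z] \<beta>[OF p'(1) z]
            \<beta>[OF coeff.free_add_closed[OF p(1) p'(1)] z] tm_add_left[OF p(1) p'(1) z]
          by (rule pr_add[OF tm_val_closed[OF p(1) z] tm_val_closed[OF p'(1) z]])
      qed
      show "\<beta> x (z \<oplus>\<^bsub>tot\<^esub> z') = \<beta> x z \<oplus>\<^bsub>?H\<^esub> \<beta> x z'" if z': "z' \<in> carrier tot" for z'
        unfolding p(2) tot_simps \<beta>[OF p(1) z] \<beta>[OF p(1) z'] \<beta>[OF p(1) tot_add_closed[OF z z']] tm_add_right[OF p(1) z z']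
        by (rule pr_add[OF tm_val_closed[OF p(1) z] tm_val_closed[OF p(1) z']])
      show "\<beta> (rsmult TX x a) z = \<beta> x (tm a z)" if "a \<in> carrier (cat_algebra R)" for a
      proof -
        have a: "a \<in> carrier (free_module R Mors)" using that by simp
        show ?thesis
          unfolding p(2) coeff.rsmult_bar[OF p(1) a] \<beta>[OF coeff.convolution_closed_Mors[OF p(1) a] z]
            \<beta>[OF p(1) tm_closed[OF a z]] tm_assoc[OF p(1) a z] ..
      qed
    qed (rule that)
    let ?u = "coeff.unit (supp y)"
    have fin: "finite (supp y)" using y by (simp add: tot_carrier)
    note u = coeff.unit_closed[OF fin]
    have "h (eta y) = ?pr (y n)"
      unfolding eta_def h(3)[OF coeff.bar_closed[OF u] y] \<beta>[OF u y] tm_unit_id[OF y fin subset_refl] ..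
    moreover have "h \<zero>\<^bsub>C.T\<^esub> = \<zero>\<^bsub>?H\<^esub>"
      using h(1)[OF C.T.zero_closed C.T.zero_closed] h(2)[OF C.T.zero_closed] C.T.l_zero[OF C.T.zero_closed]
        H.M.add.r_cancel_one' by metis
    ultimately have "?pr (y n) = \<zero>\<^bsub>?H\<^esub>" using e by simp
    thus "y n \<in> ?M" using pr_zero y by (simp add: tot_carrier)
  qed
qed

lemma eta_eq_iff:
  assumes y: "y \<in> carrier tot" and z: "z \<in> carrier tot"
  shows "eta y = eta z \<longleftrightarrow> (\<forall>n. y n \<ominus>\<^bsub>val V n\<^esub> z n \<in> miss V (full n) n)"
proof -
  have yz: "(\<lambda>n. y n \<ominus>\<^bsub>val V n\<^esub> z n) \<in> carrier tot"
    using abelian_group.minus_closed[OF tot_group y z] by (simp add: tot_diff[OF y z])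
  have "eta y = eta z \<longleftrightarrow> eta y \<ominus>\<^bsub>C.T\<^esub> eta z = \<zero>\<^bsub>C.T\<^esub>"
    using C.T.diff_self[OF eta_closed[OF z]] C.T.split_summand[OF eta_closed[OF y] eta_closed[OF z]]
      C.T.l_zero[OF eta_closed[OF z]] by metis
  thus ?thesis using eta_zero_iff[OF yz] eta_diff[OF y z] by simp
qed

end

section \<open>Homology of the standard resolution\<close>

text \<open>
  A homomorphism of modules induces a map after tensoring, which is the given map on representatives (\<open>tmap_eta\<close>).
\<close>

locale fcmodule_hom = F: fcmodule R F + G: fcmodule R G
  for R :: "'k ring" and F :: "('m::finite, 'k, 'a) cmod" and G :: "('m, 'k, 'b) cmod" +
  fixes d :: "'m obj \<Rightarrow> 'a \<Rightarrow> 'b"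
  assumes d_closed: "x \<in> carrier (val F n) \<Longrightarrow> d n x \<in> carrier (val G n)"
    and d_add: "\<lbrakk>x \<in> carrier (val F n); y \<in> carrier (val F n)\<rbrakk>
      \<Longrightarrow> d n (x \<oplus>\<^bsub>val F n\<^esub> y) = d n x \<oplus>\<^bsub>val G n\<^esub> d n y"
    and d_act: "\<lbrakk>f \<in> Hom n t; x \<in> carrier (val F n)\<rbrakk> \<Longrightarrow> d t (act F f x) = act G f (d n x)"
    and d_smult: "\<lbrakk>a \<in> carrier R; x \<in> carrier (val F n)\<rbrakk> \<Longrightarrow> d n (a \<odot>\<^bsub>val F n\<^esub> x) = a \<odot>\<^bsub>val G n\<^esub> d n x"
begin

lemma d_zero: "d n \<zero>\<^bsub>val F n\<^esub> = \<zero>\<^bsub>val G n\<^esub>"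
proof -
  have "d n \<zero>\<^bsub>val F n\<^esub> \<oplus>\<^bsub>val G n\<^esub> d n \<zero>\<^bsub>val F n\<^esub> = d n \<zero>\<^bsub>val F n\<^esub>"
    using d_add[of "\<zero>\<^bsub>val F n\<^esub>" n "\<zero>\<^bsub>val F n\<^esub>"] by simp
  thus ?thesis using d_closed[of "\<zero>\<^bsub>val F n\<^esub>" n] G.grp.add.r_cancel_one' by simp
qed

abbreviation "dt \<equiv> (\<lambda>x n. d n (x n))"

lemma dt_closed: "x \<in> carrier F.tot \<Longrightarrow> dt x \<in> carrier G.tot"
  unfolding F.tot_carrier G.tot_carrier using d_closed d_zero by (auto elim!: finite_subset[rotated])

lemma dt_tm:
  assumes p: "p \<in> carrier (free_module R Mors)" and x: "x \<in> carrier F.tot"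
  shows "dt (p \<odot>\<^bsub>F.tot\<^esub> x) = p \<odot>\<^bsub>G.tot\<^esub> dt x"
proof
  fix t
  let ?P = "{f. p f \<noteq> \<zero>\<^bsub>R\<^esub>}"
  let ?Z = "{f \<in> ?P. tgt f = t}"
  have P: "finite ?P" "?P \<subseteq> Mors" using F.coeff.free_finite[OF p] F.coeff.free_supp[OF p] by auto
  have xc: "x n \<in> carrier (val F n)" for n using x by (simp add: F.tot_carrier)
  have fH: "f \<in> Hom (src f) t" if "f \<in> ?Z" for f using that P mem_Mors by blast
  note cc = F.coeff.free_coeff_closed[OF p]
  have "d t ((p \<odot>\<^bsub>F.tot\<^esub> x) t) = d t (finsum (val F t) (\<lambda>f. p f \<odot>\<^bsub>val F t\<^esub> act F f (x (src f))) ?Z)"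
    by (simp only: F.tm_eq[OF p x P(1) subset_refl P(2)])
  also have "\<dots> = finsum (val G t) (\<lambda>f. d t (p f \<odot>\<^bsub>val F t\<^esub> act F f (x (src f)))) ?Z"
    by (rule hom_finsum[OF F.grp G.grp d_zero d_closed d_add]) (use P fH F.act_closed[OF fH xc] cc in auto)
  also have "\<dots> = finsum (val G t) (\<lambda>f. p f \<odot>\<^bsub>val G t\<^esub> act G f (dt x (src f))) ?Z"
  proof (rule G.grp.finsum_cong')
    show "(\<lambda>f. p f \<odot>\<^bsub>val G t\<^esub> act G f (dt x (src f))) \<in> ?Z \<rightarrow> carrier (val G t)"
      using G.act_closed[OF fH d_closed[OF xc]] cc by auto
    show "d t (p f \<odot>\<^bsub>val F t\<^esub> act F f (x (src f))) = p f \<odot>\<^bsub>val G t\<^esub> act G f (dt x (src f))" if "f \<in> ?Z" for f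
      using d_smult[OF cc F.act_closed[OF fH[OF that] xc], of f] d_act[OF fH[OF that] xc] by simp
  qed simp
  also have "\<dots> = (p \<odot>\<^bsub>G.tot\<^esub> dt x) t"
    by (rule G.tm_eq[OF p dt_closed[OF x] P(1) subset_refl P(2), symmetric])
  finally show "d t ((p \<odot>\<^bsub>F.tot\<^esub> x) t) = (p \<odot>\<^bsub>G.tot\<^esub> dt x) t" .
qed

sublocale M: tensor_pair_map "cat_algebra R" F.TX F.tot F.TX G.tot id dt
proof (unfold_locales, goal_cases)
  case (2 y) thus ?case by (rule dt_closed)
next
  case (4 y y') thus ?case using d_add by (simp add: F.tot_carrier)
next
  case (6 a y) thus ?case using dt_tm by simp
qed auto

lemma tmap_eta:
  assumes y: "y \<in> carrier F.tot" shows "M.tmap (F.eta y) = G.eta (dt y)"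
proof -
  let ?N = "F.supp y"
  have N: "finite ?N" using y by (simp add: F.tot_carrier)
  have sub: "G.supp (dt y) \<subseteq> ?N" using d_zero by auto
  have "M.tmap (F.eta y) = G.C.cls (F.coeff.bar (F.coeff.unit ?N)) (dt y)"
    unfolding F.eta_def using M.tmap_cls[OF F.coeff.bar_closed[OF F.coeff.unit_closed[OF N]] y] by simp
  thus ?thesis using G.eta_unit[OF dt_closed[OF y] N sub] by simp
qed

lemma image_subgroup: "additive_subgroup (M.tmap ` carrier F.C.T) G.C.T"
proof -
  have "group_hom (add_monoid F.C.T) (add_monoid G.C.T) M.tmap"
    by (auto simp: group_hom_def group_hom_axioms_def hom_def F.C.T.a_group G.C.T.a_group M.tmap_closed M.tmap_add)
  from group_hom.img_is_subgroup[OF this] show ?thesis by (intro additive_subgroup.intro) simp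
qed

end

lemma is_zero_quotient:
  fixes T :: "('a, 'x) module"
  assumes T: "abelian_group T" and B: "additive_subgroup B T" and Z: "Z \<subseteq> carrier T" "Z \<noteq> {}"
  shows "is_zero (quotient_module (T\<lparr>carrier := Z\<rparr>) B) \<longleftrightarrow> Z \<subseteq> B"
proof -
  have c: "B +>\<^bsub>T\<lparr>carrier := Z\<rparr>\<^esub> a = B +>\<^bsub>T\<^esub> a" for a by (simp add: a_r_coset_def')
  have car: "carrier (quotient_module (T\<lparr>carrier := Z\<rparr>) B) = (\<lambda>a. B +>\<^bsub>T\<^esub> a) ` Z"
    by (auto simp: quotient_module_def A_RCOSETS_def' c)
  have "B +>\<^bsub>T\<^esub> a = B \<longleftrightarrow> a \<in> B" if "a \<in> Z" for a
    using abelian_group.a_coset_join1[OF T _ _ additive_subgroup.a_subgroup[OF B]]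
      abelian_group.a_coset_join2[OF T _ additive_subgroup.a_subgroup[OF B]] that Z by blast
  thus ?thesis unfolding is_zero_def car using Z(2) by (auto simp: quotient_module_def)
qed

text \<open>
  Two consecutive terms of the resolution: the differential is the cover of the kernel, viewed as a map to the free module
  that contains the kernel.
\<close>

locale two_covers = A: covered R W c + B: covered R "cover_kernel R c W" c'
  for R :: "'k ring" and W :: "('m::finite, 'k, 'v) cmod" and c :: "'v \<Rightarrow> 'x"
    and c' :: "('m mor \<times> 'x \<Rightarrow> 'k) \<Rightarrow> 'y"
begin

lemma B_pi_ker: "x \<in> carrier (val B.FC n) \<Longrightarrow> B.\<pi> n x \<in> A.ker n"
  using B.cover_closed[of x n] by (simp add: A.cover_kernel_eq)

sublocale d: fcmodule_hom R B.FC A.FC B.\<pi>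
proof unfold_locales
  fix n x assume x: "x \<in> carrier (val B.FC n)"
  show "B.\<pi> n x \<in> carrier (val A.FC n)" by (rule A.ker_closed[OF B_pi_ker[OF x]])
  show "B.\<pi> n (x \<oplus>\<^bsub>val B.FC n\<^esub> y) = B.\<pi> n x \<oplus>\<^bsub>val A.FC n\<^esub> B.\<pi> n y" if "y \<in> carrier (val B.FC n)" for y
    using B.cover_add[OF x that] by (simp add: A.cover_kernel_eq)
  show "B.\<pi> t (act B.FC f x) = act A.FC f (B.\<pi> n x)" if "f \<in> Hom n t" for f t
    using B.cover_act[OF that x] by (simp add: A.cover_kernel_eq)
  show "B.\<pi> n (a \<odot>\<^bsub>val B.FC n\<^esub> x) = a \<odot>\<^bsub>val A.FC n\<^esub> B.\<pi> n x" if "a \<in> carrier R" for a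
    using B.cover_smult[OF that x] by (simp add: A.cover_kernel_eq A.val_K)
qed

end

locale three_covers = AB: two_covers R W c c' + BC: two_covers R "cover_kernel R c W" c' c''
  for R :: "'k ring" and W :: "('m::finite, 'k, 'v) cmod" and c :: "'v \<Rightarrow> 'x"
    and c' :: "('m mor \<times> 'x \<Rightarrow> 'k) \<Rightarrow> 'y" and c'' :: "('m mor \<times> 'y \<Rightarrow> 'k) \<Rightarrow> 'z"
begin

abbreviation "F0 \<equiv> AB.A.FC"
abbreviation "F1 \<equiv> AB.B.FC"
abbreviation "F2 \<equiv> BC.B.FC"
abbreviation "d0 \<equiv> AB.B.\<pi>"
abbreviation "d1 \<equiv> BC.B.\<pi>"
abbreviation "boundaries \<equiv> BC.d.M.tmap ` carrier BC.B.FC.C.T"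

lemma d1_surj: "k \<in> AB.B.ker n \<Longrightarrow> \<exists>w\<in>carrier (val F2 n). d1 n w = k"
  using BC.B.pi_surj[of k n] by (simp add: AB.B.cover_kernel_eq)

lemma d0_d1: "w \<in> carrier (val F2 n) \<Longrightarrow> d0 n (d1 n w) = \<zero>\<^bsub>val F0 n\<^esub>"
proof -
  assume "w \<in> carrier (val F2 n)"
  hence "d1 n w \<in> AB.B.ker n" by (rule BC.B_pi_ker)
  moreover have "\<zero>\<^bsub>val (cover_kernel R c W) n\<^esub> = \<zero>\<^bsub>val F0 n\<^esub>" by (simp add: AB.A.cover_kernel_eq)
  ultimately show ?thesis unfolding AB.B.ker_def by simp
qed

lemma boundary_iff:
  assumes y: "y \<in> carrier AB.B.FC.tot"
  shows "AB.B.FC.eta y \<in> boundaries \<longleftrightarrow>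
    (\<exists>w\<in>carrier BC.B.FC.tot. \<forall>n. y n \<ominus>\<^bsub>val F1 n\<^esub> d1 n (w n) \<in> miss F1 (full n) n)"
proof
  assume "AB.B.FC.eta y \<in> boundaries"
  then obtain t where t: "t \<in> carrier BC.B.FC.C.T" "AB.B.FC.eta y = BC.d.M.tmap t" by blast
  obtain w where w: "w \<in> carrier BC.B.FC.tot" "t = BC.B.FC.eta w" using BC.B.FC.eta_surj[OF t(1)] by blast
  have "AB.B.FC.eta y = AB.B.FC.eta (BC.d.dt w)" unfolding t(2) w(2) by (rule BC.d.tmap_eta[OF w(1)])
  hence "\<forall>n. y n \<ominus>\<^bsub>val F1 n\<^esub> d1 n (w n) \<in> miss F1 (full n) n"
    using AB.B.FC.eta_eq_iff[OF y BC.d.dt_closed[OF w(1)]] by simp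
  thus "\<exists>w\<in>carrier BC.B.FC.tot. \<forall>n. y n \<ominus>\<^bsub>val F1 n\<^esub> d1 n (w n) \<in> miss F1 (full n) n" using w(1) by blast
next
  assume "\<exists>w\<in>carrier BC.B.FC.tot. \<forall>n. y n \<ominus>\<^bsub>val F1 n\<^esub> d1 n (w n) \<in> miss F1 (full n) n"
  then obtain w where w: "w \<in> carrier BC.B.FC.tot" "\<forall>n. y n \<ominus>\<^bsub>val F1 n\<^esub> d1 n (w n) \<in> miss F1 (full n) n" by blast
  have "AB.B.FC.eta y = AB.B.FC.eta (BC.d.dt w)"
    using AB.B.FC.eta_eq_iff[OF y BC.d.dt_closed[OF w(1)]] w(2) by simp
  also have "\<dots> = BC.d.M.tmap (BC.B.FC.eta w)" by (rule BC.d.tmap_eta[OF w(1), symmetric])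
  finally show "AB.B.FC.eta y \<in> boundaries" using BC.B.FC.eta_closed[OF w(1)] by blast
qed

lemma cycle_iff:
  assumes y: "y \<in> carrier AB.B.FC.tot"
  shows "AB.d.M.tmap (AB.B.FC.eta y) = \<zero>\<^bsub>AB.A.FC.C.T\<^esub> \<longleftrightarrow> (\<forall>n. d0 n (y n) \<in> miss F0 (full n) n)"
  using AB.d.tmap_eta[OF y] AB.A.FC.eta_zero_iff[OF AB.d.dt_closed[OF y]] by simp

text \<open>
  Let \<open>F\<^sub>2 \<rightarrow> F\<^sub>1 \<rightarrow> F\<^sub>0\<close> be consecutive terms and \<open>K\<close> the image of \<open>F\<^sub>1\<close> in \<open>F\<^sub>0\<close>.  After reduction modulo \<open>\<mm>\<close>, a cycle is
  an element \<open>y\<close> of \<open>F\<^sub>1\<close> with image in \<open>K \<inter> \<mm>F\<^sub>0\<close>.  It is a boundary if and only if it lies in \<open>\<mm>F\<^sub>1\<close> up to an element of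
  the kernel of \<open>F\<^sub>1 \<rightarrow> K\<close>, that is, if and only if its image lies in \<open>\<mm>K\<close>.
\<close>

lemma exact_iff:
  "(\<forall>y\<in>carrier AB.B.FC.tot. AB.d.M.tmap (AB.B.FC.eta y) = \<zero>\<^bsub>AB.A.FC.C.T\<^esub> \<longrightarrow> AB.B.FC.eta y \<in> boundaries)
    \<longleftrightarrow> (\<forall>t. AB.A.pure (full t) t)" (is "?L \<longleftrightarrow> ?R")
proof
  assume L: ?L
  show ?R unfolding AB.A.pure_def
  proof (intro allI ballI impI)
    fix t z assume z: "z \<in> AB.A.ker t" "z \<in> miss F0 (full t) t"
    obtain p where p: "p \<in> carrier (val F1 t)" "d0 t p = z"
      using AB.B.pi_surj[of z t] z(1) by (auto simp: AB.A.cover_kernel_eq)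
    let ?y = "AB.B.FC.single t p"
    have y: "?y \<in> carrier AB.B.FC.tot" by (rule AB.B.FC.single_closed[OF p(1)])
    have "d0 n (?y n) \<in> miss F0 (full n) n" for n
    proof (cases "n = t")
      case True thus ?thesis using p z by (simp add: AB.B.FC.single_at)
    next
      case False thus ?thesis using AB.d.d_zero miss.zero[of F0 n "full n"] by (simp add: AB.B.FC.single_off)
    qed
    hence "AB.B.FC.eta ?y \<in> boundaries" using L y cycle_iff[OF y] by blast
    then obtain w where w: "w \<in> carrier BC.B.FC.tot" "?y t \<ominus>\<^bsub>val F1 t\<^esub> d1 t (w t) \<in> miss F1 (full t) t"
      using boundary_iff[OF y] by blast
    have wt: "w t \<in> carrier (val F2 t)" using w(1) by (simp add: BC.B.FC.tot_carrier)
    have d1w: "d1 t (w t) \<in> AB.B.ker t" by (rule BC.B_pi_ker[OF wt])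
    have p': "p = (p \<ominus>\<^bsub>val F1 t\<^esub> d1 t (w t)) \<oplus>\<^bsub>val F1 t\<^esub> d1 t (w t)"
      by (rule AB.B.FC.grp.split_summand[OF p(1) AB.B.ker_closed[OF d1w]])
    let ?m = "p \<ominus>\<^bsub>val F1 t\<^esub> d1 t (w t)"
    have m: "?m \<in> miss F1 (full t) t" using w(2) by (simp add: AB.B.FC.single_at)
    have "d0 t ?m \<in> miss (cover_kernel R c W) (full t) t" by (rule AB.B.pi_miss[OF m])
    moreover have "d0 t ?m = z"
    proof -
      have mc: "?m \<in> carrier (val F1 t)" by (rule AB.B.FC.miss_closed[OF m])
      have "z = d0 t ?m \<oplus>\<^bsub>val F0 t\<^esub> d0 t (d1 t (w t))"
        using AB.d.d_add[OF mc AB.B.ker_closed[OF d1w]] p' p(2) by simp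
      thus ?thesis using d0_d1[OF wt] AB.d.d_closed[OF mc] by simp
    qed
    ultimately show "z \<in> miss AB.A.K (full t) t" by (simp add: AB.A.cover_kernel_eq)
  qed
next
  assume Rt: ?R
  show ?L
  proof (intro ballI impI)
    fix y assume y: "y \<in> carrier AB.B.FC.tot" and "AB.d.M.tmap (AB.B.FC.eta y) = \<zero>\<^bsub>AB.A.FC.C.T\<^esub>"
    hence m: "\<And>n. d0 n (y n) \<in> miss F0 (full n) n" using cycle_iff[OF y] by blast
    have yn: "y n \<in> carrier (val F1 n)" for n using y by (simp add: AB.B.FC.tot_carrier)
    have ex: "\<exists>w. w \<in> carrier (val F2 n) \<and> y n \<ominus>\<^bsub>val F1 n\<^esub> d1 n w \<in> miss F1 (full n) n
        \<and> (y n = \<zero>\<^bsub>val F1 n\<^esub> \<longrightarrow> w = \<zero>\<^bsub>val F2 n\<^esub>)" for n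
    proof (cases "y n = \<zero>\<^bsub>val F1 n\<^esub>")
      case True
      have "y n \<ominus>\<^bsub>val F1 n\<^esub> d1 n \<zero>\<^bsub>val F2 n\<^esub> = \<zero>\<^bsub>val F1 n\<^esub>"
        using True BC.d.d_zero[of n] AB.B.FC.grp.diff_self[of "\<zero>\<^bsub>val F1 n\<^esub>" n] by simp
      thus ?thesis using miss.zero[of F1 n "full n"] by (intro exI[of _ "\<zero>\<^bsub>val F2 n\<^esub>"]) simp
    next
      case False
      have "d0 n (y n) \<in> miss (cover_kernel R c W) (full n) n"
        using Rt m[of n] AB.B_pi_ker[OF yn] unfolding AB.A.pure_def AB.A.cover_kernel_eq by blast
      then obtain k u where ku: "k \<in> AB.B.ker n" "u \<in> miss F1 (full n) n" "y n = k \<oplus>\<^bsub>val F1 n\<^esub> u"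
        using AB.B.lift_mod_ker[OF yn] by metis
      obtain w where w: "w \<in> carrier (val F2 n)" "d1 n w = k" using d1_surj[OF ku(1)] by blast
      have "y n \<ominus>\<^bsub>val F1 n\<^esub> d1 n w = u"
        unfolding w(2) ku(3) by (rule AB.B.FC.grp.sum_diff_left[OF AB.B.ker_closed[OF ku(1)] AB.B.FC.miss_closed[OF ku(2)]])
      thus ?thesis using w ku False by blast
    qed
    then obtain w where w: "\<And>n. w n \<in> carrier (val F2 n)" "\<And>n. y n \<ominus>\<^bsub>val F1 n\<^esub> d1 n (w n) \<in> miss F1 (full n) n"
      "\<And>n. y n = \<zero>\<^bsub>val F1 n\<^esub> \<Longrightarrow> w n = \<zero>\<^bsub>val F2 n\<^esub>" by metis
    have "BC.B.FC.supp w \<subseteq> AB.B.FC.supp y" using w(3) by blast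
    hence "w \<in> carrier BC.B.FC.tot" using w(1) y finite_subset by (auto simp: BC.B.FC.tot_carrier AB.B.FC.tot_carrier)
    thus "AB.B.FC.eta y \<in> boundaries" using boundary_iff[OF y] w(2) by blast
  qed
qed

lemma homology_zero_iff:
  "is_zero (quotient_module (AB.B.FC.C.T\<lparr>carrier := a_kernel AB.B.FC.C.T AB.A.FC.C.T AB.d.M.tmap\<rparr>) boundaries)
    \<longleftrightarrow> saturated W"
proof -
  let ?Z = "a_kernel AB.B.FC.C.T AB.A.FC.C.T AB.d.M.tmap"
  have Z: "x \<in> ?Z \<longleftrightarrow> x \<in> carrier AB.B.FC.C.T \<and> AB.d.M.tmap x = \<zero>\<^bsub>AB.A.FC.C.T\<^esub>" for x
    by (simp add: a_kernel_def kernel_def)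
  have "is_zero (quotient_module (AB.B.FC.C.T\<lparr>carrier := ?Z\<rparr>) boundaries) \<longleftrightarrow> ?Z \<subseteq> boundaries"
  proof (rule is_zero_quotient[OF AB.B.FC.C.grpT BC.d.image_subgroup])
    show "?Z \<subseteq> carrier AB.B.FC.C.T" using Z by blast
    show "?Z \<noteq> {}" using Z[of "\<zero>\<^bsub>AB.B.FC.C.T\<^esub>"] AB.d.M.tmap_zero AB.B.FC.C.T.zero_closed by blast
  qed
  also have "\<dots> \<longleftrightarrow> (\<forall>y\<in>carrier AB.B.FC.tot. AB.d.M.tmap (AB.B.FC.eta y) = \<zero>\<^bsub>AB.A.FC.C.T\<^esub>
      \<longrightarrow> AB.B.FC.eta y \<in> boundaries)"
  proof
    assume "?Z \<subseteq> boundaries"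
    thus "\<forall>y\<in>carrier AB.B.FC.tot. AB.d.M.tmap (AB.B.FC.eta y) = \<zero>\<^bsub>AB.A.FC.C.T\<^esub> \<longrightarrow> AB.B.FC.eta y \<in> boundaries"
      using Z AB.B.FC.eta_closed by blast
  next
    assume a: "\<forall>y\<in>carrier AB.B.FC.tot. AB.d.M.tmap (AB.B.FC.eta y) = \<zero>\<^bsub>AB.A.FC.C.T\<^esub> \<longrightarrow> AB.B.FC.eta y \<in> boundaries"
    show "?Z \<subseteq> boundaries"
    proof
      fix x assume "x \<in> ?Z"
      hence x: "x \<in> carrier AB.B.FC.C.T" "AB.d.M.tmap x = \<zero>\<^bsub>AB.A.FC.C.T\<^esub>" using Z by blast+
      obtain y where "y \<in> carrier AB.B.FC.tot" "x = AB.B.FC.eta y" using AB.B.FC.eta_surj[OF x(1)] by blast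
      thus "x \<in> boundaries" using a x(2) by blast
    qed
  qed
  also have "\<dots> \<longleftrightarrow> saturated W" unfolding exact_iff by (rule AB.A.saturated_iff_pure_cover[symmetric])
  finally show ?thesis .
qed

end

context fcmodule
begin

text \<open>
  Homology in degree \<open>s + 1\<close> involves three terms of the resolution, the first of which covers \<open>V\<close> if \<open>s = 0\<close> and a
  syzygy of \<open>V\<close> otherwise; either of them is saturated exactly when \<open>V\<close> is.
\<close>

lemma homology_Suc_zero_iff: "is_zero (homology R V (Suc s)) \<longleftrightarrow> saturated V"
proof (cases s)
  case 0
  interpret B: covered R "syzygy R V 0" "syz_label R" by (rule covered_syzygy)
  interpret C: covered R "syzygy R V (Suc 0)" "syz_label R" by (rule covered_syzygy)
  interpret A: covered R V Elem by (rule covered_Elem)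
  interpret T: three_covers R V Elem "syz_label R" "syz_label R"
    by (intro three_covers.intro two_covers.intro)
      (use A.covered_axioms B.covered_axioms C.covered_axioms in simp_all)
  show ?thesis
    using T.homology_zero_iff unfolding 0
    by (simp add: tor_def tor_cycles_def tor_chains_def tor_boundary_def differential_def)
next
  case (Suc r)
  interpret A: covered R "syzygy R V r" "syz_label R" by (rule covered_syzygy)
  interpret B: covered R "syzygy R V (Suc r)" "syz_label R" by (rule covered_syzygy)
  interpret C: covered R "syzygy R V (Suc (Suc r))" "syz_label R" by (rule covered_syzygy)
  interpret T: three_covers R "syzygy R V r" "syz_label R" "syz_label R" "syz_label R"
    by (intro three_covers.intro two_covers.intro)
      (use A.covered_axioms B.covered_axioms C.covered_axioms in simp_all)
  show ?thesis
    using T.homology_zero_iff saturated_syzygy[of r] unfolding Suc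
    by (simp add: tor_def tor_cycles_def tor_chains_def tor_boundary_def differential_def)
qed

lemma smult_top_pair:
  assumes a: "a \<in> carrier (free_module R Mors)"
  shows "tensor_pair_map (cat_algebra R) TX tot TX tot (\<lambda>x. a \<odot>\<^bsub>TX\<^esub> x) id"
proof (unfold_locales, goal_cases)
  case (1 x)
  then obtain p where p: "p \<in> carrier (free_module R Mors)" "x = coeff.bar p" by (elim coeff.bar_cases)
  show ?case unfolding p(2) coeff.smult_bar[OF a p(1)] by (rule coeff.bar_closed[OF coeff.convolution_closed_Mors[OF a p(1)]])
next
  case (3 x x')
  obtain p where p: "p \<in> carrier (free_module R Mors)" "x = coeff.bar p" using 3(1) by (elim coeff.bar_cases)
  obtain q where q: "q \<in> carrier (free_module R Mors)" "x' = coeff.bar q" using 3(2) by (elim coeff.bar_cases)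
  show ?case
    unfolding p(2) q(2) coeff.bar_add[OF p(1) q(1)] coeff.smult_bar[OF a p(1)] coeff.smult_bar[OF a q(1)]
      coeff.smult_bar[OF a coeff.free_add_closed[OF p(1) q(1)]] coeff.convolution_add_right[OF a p(1) q(1)]
    by (rule coeff.bar_add[OF coeff.convolution_closed_Mors[OF a p(1)] coeff.convolution_closed_Mors[OF a q(1)], symmetric])
next
  case (5 x b)
  obtain p where p: "p \<in> carrier (free_module R Mors)" "x = coeff.bar p" using 5(1) by (elim coeff.bar_cases)
  have b: "b \<in> carrier (free_module R Mors)" using 5(2) by simp
  show ?case
    unfolding p(2) coeff.rsmult_bar[OF p(1) b] coeff.smult_bar[OF a p(1)] coeff.smult_bar[OF a coeff.convolution_closed_Mors[OF p(1) b]]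
      coeff.rsmult_bar[OF coeff.convolution_closed_Mors[OF a p(1)] b] coeff.convolution_assoc[OF a p(1) b] ..
qed auto

lemma smult_eta:
  assumes a: "a \<in> carrier (free_module R Mors)" and y: "y \<in> carrier tot"
  shows "a \<odot>\<^bsub>C.T\<^esub> eta y = eta (tm a y)"
proof -
  interpret s: tensor_pair_map "cat_algebra R" TX tot TX tot "\<lambda>x. a \<odot>\<^bsub>TX\<^esub> x" id by (rule smult_top_pair[OF a])
  have fin: "finite (supp y)" using y by (simp add: tot_carrier)
  note u = coeff.unit_closed[OF fin]
  have "a \<odot>\<^bsub>C.T\<^esub> eta y = s.tmap (eta y)" by (rule C.smult_T)
  also have "\<dots> = C.cls (coeff.bar (convolution R a (coeff.unit (supp y)))) y"
    unfolding eta_def s.tmap_cls[OF coeff.bar_closed[OF u] y] coeff.smult_bar[OF a u] by simp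
  also have "\<dots> = eta (tm (convolution R a (coeff.unit (supp y))) y)"
    by (rule cls_eta[OF coeff.convolution_closed_Mors[OF a u] y])
  also have "tm (convolution R a (coeff.unit (supp y))) y = tm a y"
    unfolding tm_assoc[OF a u y] tm_unit_id[OF y fin subset_refl] ..
  finally show ?thesis .
qed

text \<open>
  Lift \<open>v\<close> to the first term of the resolution.  The class of the lift is fixed by the identity of \<open>n\<close>, so that it lies in
  the component at \<open>n\<close> and is a boundary.  Up to \<open>\<mm>F\<^sub>0\<close> the lift is thus an element of the kernel, which maps to zero.
\<close>

lemma generated_of_component_zero:
  assumes "component R (homology R V 0) n = {\<zero>\<^bsub>homology R V 0\<^esub>}"
  shows "carrier (val V n) \<subseteq> miss V (full n) n"
proof
  fix v assume v: "v \<in> carrier (val V n)"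
  interpret two_covers R V Elem "syz_label R"
    by (intro two_covers.intro) (use covered_Elem covered_syzygy[of 0] in simp_all)
  let ?B = "d.M.tmap ` carrier B.FC.C.T" and ?T = "A.FC.C.T"
  have H: "homology R V 0 = quotient_module (?T\<lparr>carrier := carrier ?T\<rparr>) ?B"
    by (simp add: tor_def tor_cycles_def tor_chains_def tor_boundary_def differential_def)
  have H': "homology R V 0 = quotient_module ?T ?B" unfolding H by simp
  obtain p where p: "p \<in> carrier (val A.FC n)" "A.\<pi> n p = v" using A.pi_surj v by blast
  let ?y = "A.FC.single n p" and ?e = "delta R (id_mor n)"
  have y: "?y \<in> carrier A.FC.tot" by (rule A.FC.single_closed[OF p(1)])
  have c: "A.FC.eta ?y \<in> carrier ?T" by (rule A.FC.eta_closed[OF y])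
  let ?X = "?B +>\<^bsub>?T\<^esub> A.FC.eta ?y"
  have sub: "additive_subgroup ?B ?T" by (rule d.image_subgroup)
  have "?X \<in> carrier (homology R V 0)"
    unfolding H' using A.FC.C.T.a_rcosetsI[OF additive_subgroup.a_subset[OF sub] c] by (simp add: quotient_module_def)
  hence "?e \<odot>\<^bsub>homology R V 0\<^esub> ?X \<in> component R (homology R V 0) n" unfolding component_def by blast
  hence eX: "?e \<odot>\<^bsub>homology R V 0\<^esub> ?X = ?B" unfolding assms unfolding H' by (simp add: quotient_module_def)
  have cX: "A.FC.eta ?y \<in> ?X"
    by (rule abelian_subgroup.a_rcos_self[OF abelian_subgroupI3[OF sub A.FC.C.grpT] c])
  have e: "?e \<in> carrier (free_module R Mors)" by (rule coeff.delta_in_free[OF id_Mors])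
  have "?e \<odot>\<^bsub>?T\<^esub> A.FC.eta ?y = A.FC.eta (A.FC.tm ?e ?y)" by (rule A.FC.smult_eta[OF e y])
  also have "A.FC.tm ?e ?y = ?y"
    using A.FC.tm_sing[OF id_Mors val.R.one_closed y, of n] p(1)
    by (simp add: delta_sing A.FC.single_at A.FC.act_id)
  finally have ec: "?e \<odot>\<^bsub>?T\<^esub> A.FC.eta ?y = A.FC.eta ?y" .
  have "?B +>\<^bsub>?T\<^esub> (?e \<odot>\<^bsub>?T\<^esub> A.FC.eta ?y) \<subseteq> ?e \<odot>\<^bsub>homology R V 0\<^esub> ?X"
    unfolding H' using cX by (auto simp: quotient_module_def)
  hence "?X \<subseteq> ?B" unfolding ec eX .
  hence "A.FC.eta ?y \<in> ?B" using cX by blast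
  then obtain t where t: "t \<in> carrier B.FC.C.T" "A.FC.eta ?y = d.M.tmap t" by blast
  obtain w where w: "w \<in> carrier B.FC.tot" "t = B.FC.eta w" using B.FC.eta_surj[OF t(1)] by blast
  have "A.FC.eta ?y = A.FC.eta (d.dt w)" unfolding t(2) w(2) by (rule d.tmap_eta[OF w(1)])
  hence "?y n \<ominus>\<^bsub>val A.FC n\<^esub> d.dt w n \<in> miss A.FC (full n) n"
    unfolding A.FC.eta_eq_iff[OF y d.dt_closed[OF w(1)]] by (rule spec)
  hence m: "p \<ominus>\<^bsub>val A.FC n\<^esub> B.\<pi> n (w n) \<in> miss A.FC (full n) n"
    by (simp only: A.FC.single_at)
  have k: "B.\<pi> n (w n) \<in> A.ker n" by (rule B_pi_ker) (use w(1) in \<open>simp add: B.FC.tot_carrier\<close>)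
  have "A.\<pi> n (p \<ominus>\<^bsub>val A.FC n\<^esub> B.\<pi> n (w n)) = v"
    using A.pi_diff[OF p(1) A.ker_closed[OF k]] k v p(2) by (simp add: A.ker_def grp.diff_zero)
  thus "v \<in> miss V (full n) n" using A.pi_miss[OF m] by simp
qed

lemma generated_of_generating_degree:
  assumes "generating_degree R V < \<infinity>"
  shows "\<exists>d. \<forall>n. d \<le> deg n \<longrightarrow> carrier (val V n) \<subseteq> miss V (full n) n"
proof -
  let ?D = "{n. component R (homology R V 0) n \<noteq> {\<zero>\<^bsub>homology R V 0\<^esub>}}"
  have "\<exists>d. \<forall>n\<in>?D. deg n < d"
  proof (cases "?D = {}")
    case False
    hence "(SUP n\<in>?D. ereal (real (deg n))) < \<infinity>" using assms by (simp add: generating_degree_def Let_def split: if_splits)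
    then obtain b where b: "(SUP n\<in>?D. ereal (real (deg n))) \<le> ereal b" using less_PInf_Ex_of_nat less_imp_le by (metis less_irrefl)
    have "deg n < Suc (nat \<lceil>b\<rceil>)" if "n \<in> ?D" for n
    proof -
      have "ereal (real (deg n)) \<le> ereal b" using b SUP_upper[OF that, of "\<lambda>n. ereal (real (deg n))"] order_trans by blast
      hence "real (deg n) \<le> b" by simp
      thus ?thesis by linarith
    qed
    thus ?thesis by blast
  qed blast
  then obtain d where d: "\<And>n. n \<in> ?D \<Longrightarrow> deg n < d" by blast
  have "carrier (val V n) \<subseteq> miss V (full n) n" if "d \<le> deg n" for n
  proof (rule generated_of_component_zero)
    show "component R (homology R V 0) n = {\<zero>\<^bsub>homology R V 0\<^esub>}" using d[of n] that by fastforce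
  qed
  thus ?thesis by blast
qed

end

theorem theorem1p3:
  fixes R :: "'k ring" and V :: "('m::finite, 'k, 'v) cmod"
  assumes "cring R"
    and "cmodule R V"
    and "generating_degree R V < \<infinity>"
  shows "(relative_projective R V \<longleftrightarrow> (\<forall>s\<ge>1. is_zero (homology R V s)))
       \<and> (relative_projective R V \<longleftrightarrow> is_zero (homology R V 1))
       \<and> (relative_projective R V \<longleftrightarrow> (\<exists>s\<ge>1. is_zero (homology R V s)))"
proof -
  interpret V: fcmodule R V by (rule fcmodule.intro[OF assms(2)])
  have "relative_projective R V \<longleftrightarrow> saturated V"
    using V.saturated_of_relative_projective V.generated_of_generating_degree[OF assms(3)]
      V.relative_projective_of_saturated by blast
  moreover have "is_zero (homology R V s) \<longleftrightarrow> saturated V" if "s \<ge> 1" for s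
    using V.homology_Suc_zero_iff[of "s - 1"] that by simp
  ultimately show ?thesis by auto
qed

end
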